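(* Let $X$ be an analytic vector field in the reduced form described in the context, i.e. $$X(x,y,\theta,t,\lambda)=\begin{pmatrix} c(\theta,t,\lambda)y\\ a_k(\theta,t,\lambda)x^k+A(x,y,\theta,t,\lambda)\\ \omega+d_p(\theta,t,\lambda)x^p+B(x,y,\theta,t,\lambda)\end{pmatrix},\qquad (x,y,\theta,t,\lambda)\in U\times\mathbb T^d\times\mathbb R\times\Lambda,$$ depending quasiperiodically on $t$ with time frequencies $\nu\in\mathbb R^{d'}$. Assume that $2p>k-1$, that $(\omega,\nu)$ is Diophantine (in the vector field setting), and that $\bar a_k(\lambda)>0$ for $\lambda\in\Lambda$. Then, for all $n\ge2$, there exist two maps $\mathcal K_n:\mathbb R\times\mathbb T^d\times\mathbb R\times\Lambda\to\mathbb R^2\times\mathbb T^d$ of the form $$\mathcal K_n(u,\theta,t,\lambda)=\begin{pmatrix}u^2+\sum_{i=3}^{n}\bar K^x_i(\lambda)u^i+\sum_{i=k+1}^{n+k-1}\tilde K^x_i(\theta,t,\lambda)u^i\\ \sum_{i=k+1}^{n+k-1}\bar K^y_i(\lambda)u^i+\sum_{i=2k}^{n+2k-2}\tilde K^y_i(\theta,t,\lambda)u^i\\ \theta+\sum_{i=2p-k+1}^{n+2p-k-1}\bar K^\theta_i(\lambda)u^i+\sum_{i=2p}^{n+2p-2}\tilde K^\theta_i(\theta,t,\lambda)u^i\end{pmatrix},$$ depending quasiperiodically on time with the same frequencies as $X$, and two corresponding vector fields $\mathcal Y_n:\mathbb R\times\mathbb T^d\times\mathbb R\times\Lambda\to\mathbb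 R\times\mathbb T^d$ of the form $$\mathcal Y_n(u,\theta,t,\lambda)=\mathcal Y_n(u,\lambda)=\begin{cases}\begin{pmatrix}\bar Y^x_k(\lambda)u^k\\ \omega\end{pmatrix}&\text{if }2\le n\le k,\\[2ex] \begin{pmatrix}\bar Y^x_k(\lambda)u^k+\bar Y^x_{2k-1}(\lambda)u^{2k-1}\\ \omega\end{pmatrix}&\text{if }n\ge k+1,\end{cases}$$ such that $$\mathcal G_n(u,\theta,t,\lambda):=X(\mathcal K_n(u,\theta,t,\lambda),t,\lambda)-\partial_{(u,\theta)}\mathcal K_n(u,\theta,t,\lambda)\cdot\mathcal Y_n(u,\theta,t,\lambda)-\partial_t\mathcal K_n(u,\theta,t,\lambda)$$ satisfies $\mathcal G_n=\big(O(u^{n+k}),O(u^{n+2k-1}),O(u^{n+2p-1})\big)$. Moreover, for the lowest order coefficients we obtain (with the same choice of sign, $+$ or $-$, in all formulas, each choice giving one of the two pairs) $$\bar K^y_{k+1}(\lambda)=\pm\sqrt{\frac{2\,\bar a_k(\lambda)}{\bar c(\lambda)(k+1)}},\quad \bar K^\theta_{2p-k+1}(\lambda)=\pm\frac{\bar d_p(\lambda)}{2p-k+1}\sqrt{\frac{2(k+1)}{\bar c(\lambda)\,\bar a_k(\lambda)}},\quad \bar Y^x_k(\lambda)=\pm\sqrt{\frac{\bar c(\lambda)\,\bar a_k(\lambda)}{2(k+1)}},$$ $$\tilde K^x_{k+1}(\theta,t,\lambda)=\mathcal{SD}(\tilde c(\theta,t,\lambda))\,\bar K^y_{k+1}(\lambda),\quad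 \tilde K^y_{2k}(\theta,t,\lambda)=\mathcal{SD}(\tilde a_k(\theta,t,\lambda)),\quad \tilde K^\theta_{2p}(\theta,t,\lambda)=\mathcal{SD}(\tilde d_p(\theta,t,\lambda)).$$
   Context: $\mathbb T^d=(\mathbb R/\mathbb Z)^d$; $U\subset\mathbb R^2$ is a neighbourhood of $(0,0)$; $\Lambda\subset\mathbb R^m$ is a parameter set; $\omega\in\mathbb R^d$. (As in the paper, the target of a vector field on $\mathbb R\times\mathbb T^d$ is written $\mathbb R\times\mathbb T^d$; its values are tangent vectors in $\mathbb R\times\mathbb R^d$.) A function $h(z,t)$ depends quasiperiodically on $t$ with time frequencies $\nu\in\mathbb R^{d'}$ if $h(z,t)=\check h(z,\nu t)$ for some function $\check h(z,\tau)$, $\tau\in\mathbb T^{d'}$ (the hull function; analytic here). For $h$ depending on $\theta\in\mathbb T^d$ and quasiperiodically on $t$, the average is $\bar h=\frac1{\mathrm{vol}(\mathbb T^d\times\mathbb T^{d'})}\int_{\mathbb T^d\times\mathbb T^{d'}}\check h(\theta,\theta')\,d\theta\,d\theta'$, and $\tilde h=h-\bar h$ is the oscillatory part. In the coefficients of $\mathcal K_n,\mathcal Y_n$, a bar indicates independence of $(\theta,t)$ and a tilde indicates dependence on $(\theta,t)$ (zero average). Reduced form: $k\ge2$, $p\ge1$ are integers, $X$ is as displayed with analytic ingredients, $\bar c(\lambda)>0$, and $$A=y\,O(\|(x,y)\|^{k-1})+O(\|(x,y)\|^{k+1}),\qquad B=y\,O(\|(x,y)\|^{p-1})+O(\|(x,y)\|^{p+1}).$$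 It is assumed throughout that $\bar d_p(\lambda)\neq0$. The estimate of $\mathcal G_n$ is understood as $u\to0$; $\mathcal K_n$, $\mathcal Y_n$ are polynomial in $u$ and considered for $u\ge0$. A vector $v\in\mathbb R^N$ is Diophantine (vector field setting) if there exist $C>0$ and $\tau\ge N-1$ with $|v\cdot q|\ge C|q|^{-\tau}$ for all $q\in\mathbb Z^N\setminus\{0\}$, where $|q|=|q_1|+\dots+|q_N|$; here $N=d+d'$, $v=(\omega,\nu)$. For an analytic $h(\theta,t,\lambda)$, quasiperiodic in $t$ with frequencies $\nu$ and with zero average, $\mathcal{SD}(h)$ denotes the unique analytic solution $\varphi(\theta,t,\lambda)$, quasiperiodic in $t$ with frequencies $\nu$ and with zero average, of $\partial_\theta\varphi\cdot\omega+\partial_t\varphi=h$. *)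

theory Defs
  imports "HOL-Analysis.Analysis" "HOL-Library.Landau_Symbols"
begin

text \<open>Real analyticity at each point of a set. As for the complex \<open>analytic_on\<close>, the power series
  represents the function on a full ball of the ambient space, so \<open>S\<close> need not be open. The index
  \<open>\<alpha>\<close> is a multi-index, with one exponent for each element of the standard basis.\<close>

definition real_analytic_on ::
    "('a::euclidean_space \<Rightarrow> 'b::real_normed_vector) \<Rightarrow> 'a set \<Rightarrow> bool" where
  "real_analytic_on f S \<longleftrightarrow>
     (\<forall>p\<in>S. \<exists>r>0. \<exists>a. \<forall>x\<in>ball p r.
        ((\<lambda>\<alpha>. (\<Prod>b\<in>Basis. ((x - p) \<bullet> b) ^ \<alpha> b) *\<^sub>R a \<alpha>) has_sum f x) (Basis \<rightarrow>\<^sub>E UNIV))"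

text \<open>Functions on a torus are represented by functions on the universal cover that are periodic
  with respect to the integer lattice. Below, \<open>'d\<close> indexes the angles \<open>\<theta>\<close> of the phase space and
  \<open>'e\<close> the time frequencies.\<close>

definition torus_periodic :: "(real^'d \<Rightarrow> real^'e \<Rightarrow> 'b) \<Rightarrow> bool" where
  "torus_periodic H \<longleftrightarrow>
     (\<forall>\<theta> \<tau> q r. (\<forall>i. q $ i \<in> \<int>) \<longrightarrow> (\<forall>i. r $ i \<in> \<int>) \<longrightarrow> H (\<theta> + q) (\<tau> + r) = H \<theta> \<tau>)"

definition analytic_hull ::
    "real^'e \<Rightarrow> (real^'d \<Rightarrow> real \<Rightarrow> 'b::real_normed_vector) \<Rightarrow> (real^'d \<Rightarrow> real^'e \<Rightarrow> 'b) \<Rightarrow> bool" where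
  "analytic_hull \<nu> h H \<longleftrightarrow> torus_periodic H \<and> real_analytic_on (\<lambda>(\<theta>, \<tau>). H \<theta> \<tau>) UNIV \<and>
     (\<forall>\<theta> t. h \<theta> t = H \<theta> (t *\<^sub>R \<nu>))"

text \<open>Quasiperiodicity with a hull that is jointly analytic in the angles and in further variables
  \<open>p \<in> S\<close>. The hull is a function on the torus for every \<open>p\<close>, also for those near \<open>S\<close>; on \<open>S\<close> it
  represents \<open>h\<close>.\<close>

definition quasiperiodic_on ::
    "real^'e \<Rightarrow> 'p::euclidean_space set \<Rightarrow> (real^'d \<Rightarrow> real \<Rightarrow> 'p \<Rightarrow> 'b::real_normed_vector) \<Rightarrow> bool" where
  "quasiperiodic_on \<nu> S h \<longleftrightarrow>
     (\<exists>H. (\<forall>p. torus_periodic (\<lambda>\<theta> \<tau>. H \<theta> \<tau> p)) \<and>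
          (\<forall>p\<in>S. \<forall>\<theta> t. h \<theta> t p = H \<theta> (t *\<^sub>R \<nu>) p) \<and>
          real_analytic_on (\<lambda>(\<theta>, \<tau>, p). H \<theta> \<tau> p) (UNIV \<times> UNIV \<times> S))"

text \<open>The average and the oscillatory part. The hull is unique when the entries of \<open>\<nu>\<close> are rationally
  independent; the unit cube, a fundamental domain of the torus, has volume one.\<close>

definition average :: "real^'e \<Rightarrow> (real^'d \<Rightarrow> real \<Rightarrow> 'b::euclidean_space) \<Rightarrow> 'b" where
  "average \<nu> h = integral (cbox 0 One) (\<lambda>(\<theta>, \<tau>). (THE H. analytic_hull \<nu> h H) \<theta> \<tau>)"

definition oscillatory ::
    "real^'e \<Rightarrow> (real^'d \<Rightarrow> real \<Rightarrow> 'b::euclidean_space) \<Rightarrow> real^'d \<Rightarrow> real \<Rightarrow> 'b" where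
  "oscillatory \<nu> h \<theta> t = h \<theta> t - average \<nu> h"

abbreviation average_at ::
    "real^'e \<Rightarrow> (real^'d \<Rightarrow> real \<Rightarrow> 'p \<Rightarrow> 'b::euclidean_space) \<Rightarrow> 'p \<Rightarrow> 'b" where
  "average_at \<nu> h p \<equiv> average \<nu> (\<lambda>\<theta> t. h \<theta> t p)"

abbreviation oscillatory_at ::
    "real^'e \<Rightarrow> (real^'d \<Rightarrow> real \<Rightarrow> 'p \<Rightarrow> 'b::euclidean_space) \<Rightarrow> 'p \<Rightarrow> real^'d \<Rightarrow> real \<Rightarrow> 'b" where
  "oscillatory_at \<nu> h p \<equiv> oscillatory \<nu> (\<lambda>\<theta> t. h \<theta> t p)"

definition join_vec :: "real^'d \<Rightarrow> real^'e \<Rightarrow> real^('d + 'e)" where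
  "join_vec \<omega> \<nu> = (\<chi> i. case i of Inl j \<Rightarrow> \<omega> $ j | Inr j \<Rightarrow> \<nu> $ j)"

definition diophantine :: "real^'n \<Rightarrow> bool" where
  "diophantine v \<longleftrightarrow>
     (\<exists>C>0. \<exists>\<tau>\<ge>real CARD('n) - 1. \<forall>q::int^'n. q \<noteq> 0 \<longrightarrow>
        \<bar>\<Sum>i\<in>UNIV. v $ i * of_int (q $ i)\<bar> \<ge> C * (\<Sum>i\<in>UNIV. \<bar>of_int (q $ i)\<bar>) powr (- \<tau>))"

text \<open>The solution of the small divisors equation, taken for each value of the parameters
  separately; it is unique when \<open>join_vec \<omega> \<nu>\<close> is Diophantine.\<close>

definition SD ::
    "real^'d \<Rightarrow> real^'e \<Rightarrow> (real^'d \<Rightarrow> real \<Rightarrow> 'b::euclidean_space) \<Rightarrow> real^'d \<Rightarrow> real \<Rightarrow> 'b" where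
  "SD \<omega> \<nu> h = (THE \<phi>. (\<exists>H. analytic_hull \<nu> \<phi> H) \<and> average \<nu> \<phi> = 0 \<and>
     (\<forall>\<theta> t. frechet_derivative (\<lambda>\<theta>. \<phi> \<theta> t) (at \<theta>) \<omega> + vector_derivative (\<lambda>t. \<phi> \<theta> t) (at t) = h \<theta> t))"

text \<open>\<open>F(x,y) = y O(\<parallel>(x,y)\<parallel>\<^sup>j\<^sup>-\<^sup>1) + O(\<parallel>(x,y)\<parallel>\<^sup>j\<^sup>+\<^sup>1)\<close> as \<open>(x,y) \<rightarrow> (0,0)\<close>, for \<open>j \<ge> 1\<close>.\<close>

definition remainder_form ::
    "(real \<times> real) set \<Rightarrow> nat \<Rightarrow> (real \<Rightarrow> real \<Rightarrow> 'b::real_normed_vector) \<Rightarrow> bool" where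
  "remainder_form U j F \<longleftrightarrow>
     (\<exists>F1 F2. (\<forall>(x, y)\<in>U. F x y = y *\<^sub>R F1 (x, y) + F2 (x, y)) \<and>
        (\<lambda>z. norm (F1 z)) \<in> O[at (0, 0)](\<lambda>z. norm z ^ (j - 1)) \<and>
        (\<lambda>z. norm (F2 z)) \<in> O[at (0, 0)](\<lambda>z. norm z ^ (j + 1)))"

definition X_field ::
    "nat \<Rightarrow> nat \<Rightarrow> real^'d
      \<Rightarrow> (real^'d \<Rightarrow> real \<Rightarrow> real^'m \<Rightarrow> real)
      \<Rightarrow> (real^'d \<Rightarrow> real \<Rightarrow> real^'m \<Rightarrow> real)
      \<Rightarrow> (real^'d \<Rightarrow> real \<Rightarrow> real^'m \<Rightarrow> real^'d)
      \<Rightarrow> (real \<Rightarrow> real \<Rightarrow> real^'d \<Rightarrow> real \<Rightarrow> real^'m \<Rightarrow> real)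
      \<Rightarrow> (real \<Rightarrow> real \<Rightarrow> real^'d \<Rightarrow> real \<Rightarrow> real^'m \<Rightarrow> real^'d)
      \<Rightarrow> real \<times> real \<times> (real^'d) \<Rightarrow> real \<Rightarrow> real^'m \<Rightarrow> real \<times> real \<times> (real^'d)" where
  "X_field k p \<omega> c a d A B = (\<lambda>(x, y, \<theta>) t \<mu>.
     (c \<theta> t \<mu> * y,
      a \<theta> t \<mu> * x ^ k + A x y \<theta> t \<mu>,
      \<omega> + x ^ p *\<^sub>R d \<theta> t \<mu> + B x y \<theta> t \<mu>))"

text \<open>The last component of \<open>K_map\<close> is a lift to the universal cover of the torus-valued component.
  Where \<open>2 * p > k - 1\<close>, the truncated subtractions in the summation bounds are exact.\<close>

definition K_map ::
    "nat \<Rightarrow> nat \<Rightarrow> nat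
      \<Rightarrow> (nat \<Rightarrow> real^'m \<Rightarrow> real) \<Rightarrow> (nat \<Rightarrow> real^'d \<Rightarrow> real \<Rightarrow> real^'m \<Rightarrow> real)
      \<Rightarrow> (nat \<Rightarrow> real^'m \<Rightarrow> real) \<Rightarrow> (nat \<Rightarrow> real^'d \<Rightarrow> real \<Rightarrow> real^'m \<Rightarrow> real)
      \<Rightarrow> (nat \<Rightarrow> real^'m \<Rightarrow> real^'d) \<Rightarrow> (nat \<Rightarrow> real^'d \<Rightarrow> real \<Rightarrow> real^'m \<Rightarrow> real^'d)
      \<Rightarrow> real \<Rightarrow> real^'d \<Rightarrow> real \<Rightarrow> real^'m \<Rightarrow> real \<times> real \<times> (real^'d)" where
  "K_map k p n Kx Kx' Ky Ky' K\<theta> K\<theta>' u \<theta> t \<mu> =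
     (u\<^sup>2 + (\<Sum>i=3..n. Kx i \<mu> * u ^ i) + (\<Sum>i=k+1..n+k-1. Kx' i \<theta> t \<mu> * u ^ i),
      (\<Sum>i=k+1..n+k-1. Ky i \<mu> * u ^ i) + (\<Sum>i=2*k..n+2*k-2. Ky' i \<theta> t \<mu> * u ^ i),
      \<theta> + (\<Sum>i=2*p+1-k..n+2*p-k-1. u ^ i *\<^sub>R K\<theta> i \<mu>)
        + (\<Sum>i=2*p..n+2*p-2. u ^ i *\<^sub>R K\<theta>' i \<theta> t \<mu>))"

definition Y_field ::
    "nat \<Rightarrow> nat \<Rightarrow> real^'d \<Rightarrow> (nat \<Rightarrow> real^'m \<Rightarrow> real) \<Rightarrow> real \<Rightarrow> real^'m \<Rightarrow> real \<times> (real^'d)" where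
  "Y_field k n \<omega> Y u \<mu> =
     (if n \<le> k then Y k \<mu> * u ^ k else Y k \<mu> * u ^ k + Y (2*k-1) \<mu> * u ^ (2*k-1), \<omega>)"

definition invariance_error ::
    "(real \<times> real \<times> (real^'d) \<Rightarrow> real \<Rightarrow> real^'m \<Rightarrow> real \<times> real \<times> (real^'d))
      \<Rightarrow> (real \<Rightarrow> real^'d \<Rightarrow> real \<Rightarrow> real^'m \<Rightarrow> real \<times> real \<times> (real^'d))
      \<Rightarrow> (real \<Rightarrow> real^'m \<Rightarrow> real \<times> (real^'d))
      \<Rightarrow> real \<Rightarrow> real^'d \<Rightarrow> real \<Rightarrow> real^'m \<Rightarrow> real \<times> real \<times> (real^'d)" where
  "invariance_error X K Y u \<theta> t \<mu> =
     X (K u \<theta> t \<mu>) t \<mu>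
     - frechet_derivative (\<lambda>(u, \<theta>). K u \<theta> t \<mu>) (at (u, \<theta>)) (Y u \<mu>)
     - vector_derivative (\<lambda>t. K u \<theta> t \<mu>) (at t)"

text \<open>\<open>g = O(u\<^sup>m)\<close> as \<open>u \<rightarrow> 0\<close>, \<open>u \<ge> 0\<close>, uniformly in the angles and time, and uniformly
  on compact sets of parameters.\<close>

definition bigO_zero ::
    "(real^'m) set \<Rightarrow> nat \<Rightarrow> (real \<Rightarrow> real^'d \<Rightarrow> real \<Rightarrow> real^'m \<Rightarrow> 'b::real_normed_vector) \<Rightarrow> bool" where
  "bigO_zero \<Lambda> m g \<longleftrightarrow>
     (\<forall>L. compact L \<longrightarrow> L \<subseteq> \<Lambda> \<longrightarrow>
        (\<exists>C. \<exists>\<delta>>0. \<forall>\<mu>\<in>L. \<forall>\<theta> t u. 0 \<le> u \<longrightarrow> u < \<delta> \<longrightarrow> norm (g u \<theta> t \<mu>) \<le> C * u ^ m))"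

end

theory Submission
  imports Defs "HOL-Analysis.Kronecker_Approximation_Theorem"
begin

text \<open>
The theorem asks for approximate parameterizations \<open>K\<close> of invariant manifolds of a parabolic torus, together
with a vector field \<open>Y\<close> on the line times the torus such that \<open>X \<circ> K = DK \<cdot> Y + \<partial>\<^sub>t K\<close> up to high order
in \<open>u\<close>. The natural scales are \<open>x = u\<^sup>2 \<xi>\<close>, \<open>y = u ^ (k + 1) \<eta>\<close> and \<open>\<theta> + u ^ m \<vartheta>\<close> with \<open>m = 2 p - k + 1\<close>. In these
variables the leading terms \<open>c y\<close>, \<open>a x ^ k\<close> and \<open>d x ^ p\<close> of \<open>X\<close> have the orders \<open>u ^ (k + 1)\<close>, \<open>u ^ (2 k)\<close> and
\<open>u ^ (2 p)\<close>, and the remainders \<open>A\<close> and \<open>B\<close> are of higher order by a factor \<open>u\<close> (\<open>weighted_remainder\<close>).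
Dividing by these powers leaves an equation that is analytic at \<open>u = 0\<close>, and it is solved order by order.

At each order \<open>N \<ge> 1\<close> the unknown coefficients enter linearly, and the equation splits into its average over
the torus and its oscillatory part. The line moves with speed \<open>O(u ^ k)\<close> and the torus with the speed \<open>(\<omega>, \<nu>)\<close>,
so the oscillatory coefficients of index \<open>N\<close> enter at order \<open>N\<close> only through their derivatives along
\<open>(\<omega>, \<nu>)\<close>, if they are placed at powers of \<open>u\<close> higher by \<open>k - 1\<close> than the averaged ones. The average of the
equation is a linear system for the averaged coefficients (\<open>linear_system\<close>). Its determinant is proportional to
\<open>(2 + N) (k + 1 + N) - 2 k (k + 1)\<close> and vanishes only at \<open>N = k - 1\<close>, where the coefficient of \<open>u ^ (2 k - 1)\<close> in the vector
field \<open>Y\<close> resolves the resonance. The oscillatory part is then a small divisors equation. For \<open>N = 0\<close> the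
averaged equations are quadratic with two real solutions, by positivity of the averages of \<open>c\<close> and \<open>a\<close>; they
give the two signs and the formulas for the lowest coefficients (\<open>leading_relations\<close>, \<open>solution_base\<close>,
\<open>solution_step\<close>).

The small divisors equation is solved by Fourier series (\<open>small_divisor_equation_real\<close>): the coefficients of
an analytic function decay exponentially, which outweighs the Diophantine loss, jointly analytically in the parameters.
The analytic background is the algebra of power series with absolutely summable coefficients on cubes,
whose norm bounds are recorded by \<open>ps_bound\<close>. The decay of the coefficients follows from expanding
translates of the function in powers of the translation (\<open>fourier_decay_coordinate\<close>), and completeness of the
characters from the Stone-Weierstrass theorem (\<open>fourier_zero_imp_zero\<close>).

Averages and the operator \<open>\<S>\<D>\<close> are defined by unique choice. Uniqueness of hulls and of solutions rests on
the density of a line with nonresonant direction in the torus (\<open>periodic_zero_on_line_imp_zero\<close>), a consequence of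
Kronecker's theorem.
\<close>

section \<open>Absolutely convergent power series on cubes\<close>

abbreviation multi_indices :: "('a::euclidean_space \<Rightarrow> nat) set" where
  "multi_indices \<equiv> Basis \<rightarrow>\<^sub>E UNIV"

definition mpow :: "'a::euclidean_space \<Rightarrow> ('a \<Rightarrow> nat) \<Rightarrow> real" where
  "mpow y \<alpha> = (\<Prod>b\<in>Basis. (y \<bullet> b) ^ \<alpha> b)"

definition mdeg :: "('a::euclidean_space \<Rightarrow> nat) \<Rightarrow> nat" where
  "mdeg \<alpha> = (\<Sum>b\<in>Basis. \<alpha> b)"

definition cube :: "real \<Rightarrow> 'a::euclidean_space set" where
  "cube r = {y. \<forall>b\<in>Basis. \<bar>y \<bullet> b\<bar> \<le> r}"

text \<open>The analytic functions on a polydisc with absolutely summable coefficients form a Banach algebra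
under the weighted \<open>\<ell>\<^sup>1\<close> norm of the coefficients. Writing \<open>ps_bound p r f M\<close> for \<open>norm \<le> M\<close> keeps all
estimates on real power series free of complex extensions: sums, products and compositions are
controlled by the bounds alone. The cube is the natural domain for such series, since a monomial
is largest at its corners.\<close>

definition ps_bound ::
    "'a::euclidean_space \<Rightarrow> real \<Rightarrow> ('a \<Rightarrow> 'b::banach) \<Rightarrow> real \<Rightarrow> bool" where
  "ps_bound p r f M \<longleftrightarrow> (\<exists>a. (\<lambda>\<alpha>. norm (a \<alpha>) * r ^ mdeg \<alpha>) summable_on multi_indices \<and>
     (\<Sum>\<^sub>\<infinity>\<alpha>\<in>multi_indices. norm (a \<alpha>) * r ^ mdeg \<alpha>) \<le> M \<and>
     (\<forall>y\<in>cube r. ((\<lambda>\<alpha>. mpow y \<alpha> *\<^sub>R a \<alpha>) has_sum f (p + y)) multi_indices))"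

lemma abs_mpow_le:
  assumes "y \<in> cube r" shows "\<bar>mpow y \<alpha>\<bar> \<le> r ^ mdeg \<alpha>"
proof -
  have "\<bar>mpow y \<alpha>\<bar> = (\<Prod>b\<in>Basis. \<bar>y \<bullet> b\<bar> ^ \<alpha> b)"
    by (simp add: mpow_def abs_prod power_abs)
  also have "\<dots> \<le> (\<Prod>b\<in>Basis. r ^ \<alpha> b)"
    using assms by (intro prod_mono) (auto simp: cube_def intro: power_mono)
  finally show ?thesis by (simp add: mdeg_def power_sum)
qed

lemma cube_mono: "r \<le> R \<Longrightarrow> cube r \<subseteq> cube R"
  by (force simp: cube_def)

lemma zero_in_cube [simp]: "0 \<le> r \<Longrightarrow> 0 \<in> cube r"
  by (simp add: cube_def)

lemma summable_on_prod_PiE: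
  fixes g :: "'i \<Rightarrow> 'j \<Rightarrow> real"
  assumes fin: "finite A" and cnt: "\<And>x. x \<in> A \<Longrightarrow> countable (B x)"
    and sm: "\<And>x. x \<in> A \<Longrightarrow> g x summable_on B x"
  shows "(\<lambda>\<alpha>. \<Prod>x\<in>A. g x (\<alpha> x)) summable_on PiE A B"
proof -
  have "Infinite_Set_Sum.abs_summable_on (\<lambda>\<alpha>. \<Prod>x\<in>A. g x (\<alpha> x)) (PiE A B)"
  proof (rule abs_summable_on_prod_PiE[OF fin cnt])
    fix x assume "x \<in> A"
    with sm have "(\<lambda>y. norm (g x y)) summable_on B x"
      using summable_on_iff_abs_summable_on_real by blast
    then show "Infinite_Set_Sum.abs_summable_on (g x) (B x)"
      using abs_summable_equivalent by blast
  qed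
  then show ?thesis
    using abs_summable_equivalent abs_summable_summable by blast
qed

lemma summable_on_geometric_mdeg:
  fixes t :: real
  assumes "0 \<le> t" "t < 1"
  shows "(\<lambda>\<alpha>::'a::euclidean_space \<Rightarrow> nat. t ^ mdeg \<alpha>) summable_on multi_indices"
proof -
  have "(\<lambda>n. t ^ n) summable_on (UNIV :: nat set)"
    using assms summable_geometric[of t] by (simp add: summable_on_UNIV_nonneg_real_iff)
  then have "(\<lambda>\<alpha>::'a \<Rightarrow> nat. \<Prod>b\<in>Basis. t ^ \<alpha> b) summable_on multi_indices"
    by (intro summable_on_prod_PiE) auto
  then show ?thesis by (simp add: mdeg_def power_sum)
qed

lemma ps_bound_normE:
  assumes "ps_bound p r f M" "0 \<le> r" "y \<in> cube r"
  shows "norm (f (p + y)) \<le> M"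
proof -
  obtain a where a: "(\<lambda>\<alpha>. norm (a \<alpha>) * r ^ mdeg \<alpha>) summable_on multi_indices"
     "(\<Sum>\<^sub>\<infinity>\<alpha>\<in>multi_indices. norm (a \<alpha>) * r ^ mdeg \<alpha>) \<le> M"
     "((\<lambda>\<alpha>. mpow y \<alpha> *\<^sub>R a \<alpha>) has_sum f (p + y)) multi_indices"
    using assms unfolding ps_bound_def by blast
  have "norm (f (p + y)) \<le> (\<Sum>\<^sub>\<infinity>\<alpha>\<in>multi_indices. norm (a \<alpha>) * r ^ mdeg \<alpha>)"
  proof (rule norm_infsum_le[OF a(3)])
    show "norm (mpow y \<alpha> *\<^sub>R a \<alpha>) \<le> norm (a \<alpha>) * r ^ mdeg \<alpha>" for \<alpha>
      using mult_right_mono[OF abs_mpow_le[OF assms(3), of \<alpha>], of "norm (a \<alpha>)"] by (simp add: mult.commute)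
  qed (use a in auto)
  with a(2) show ?thesis by simp
qed

lemma ps_bound_nonneg:
  assumes "ps_bound p r f M" "0 \<le> r" shows "0 \<le> M"
  by (rule order_trans[OF norm_ge_zero ps_bound_normE[OF assms zero_in_cube[OF assms(2)]]])

lemma ps_bound_mono: "ps_bound p r f M \<Longrightarrow> M \<le> M' \<Longrightarrow> ps_bound p r f M'"
  unfolding ps_bound_def by (meson order_trans)

lemma ps_bound_cong:
  assumes "ps_bound p r f M" "\<And>y. y \<in> cube r \<Longrightarrow> f (p + y) = g (p + y)"
  shows "ps_bound p r g M"
proof -
  have "((\<lambda>\<alpha>. mpow y \<alpha> *\<^sub>R a \<alpha>) has_sum f (p + y)) multi_indices
      \<longleftrightarrow> ((\<lambda>\<alpha>. mpow y \<alpha> *\<^sub>R a \<alpha>) has_sum g (p + y)) multi_indices" if "y \<in> cube r" for a y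
    using assms(2)[OF that] by simp
  with assms(1) show ?thesis by (simp add: ps_bound_def cong: ball_cong)
qed

lemma summable_on_scaled_mono:
  fixes a :: "('a::euclidean_space \<Rightarrow> nat) \<Rightarrow> 'b::real_normed_vector"
  assumes "(\<lambda>\<alpha>. norm (a \<alpha>) * R ^ mdeg \<alpha>) summable_on A" "0 \<le> r" "r \<le> R"
  shows "(\<lambda>\<alpha>. norm (a \<alpha>) * r ^ mdeg \<alpha>) summable_on A"
  by (rule summable_on_comparison_test[OF assms(1)])
     (use assms in \<open>auto intro!: mult_left_mono power_mono\<close>)

lemma ps_bound_shrink:
  assumes "ps_bound p R f M" "0 \<le> r" "r \<le> R"
  shows "ps_bound p r f M"
proof -
  obtain a where a: "(\<lambda>\<alpha>. norm (a \<alpha>) * R ^ mdeg \<alpha>) summable_on multi_indices"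
     "(\<Sum>\<^sub>\<infinity>\<alpha>\<in>multi_indices. norm (a \<alpha>) * R ^ mdeg \<alpha>) \<le> M"
     "\<forall>y\<in>cube R. ((\<lambda>\<alpha>. mpow y \<alpha> *\<^sub>R a \<alpha>) has_sum f (p + y)) multi_indices"
    using assms unfolding ps_bound_def by blast
  have sm: "(\<lambda>\<alpha>. norm (a \<alpha>) * r ^ mdeg \<alpha>) summable_on multi_indices"
    using summable_on_scaled_mono a(1) assms by blast
  have "(\<Sum>\<^sub>\<infinity>\<alpha>\<in>multi_indices. norm (a \<alpha>) * r ^ mdeg \<alpha>) \<le> (\<Sum>\<^sub>\<infinity>\<alpha>\<in>multi_indices. norm (a \<alpha>) * R ^ mdeg \<alpha>)"
    using assms by (intro infsum_mono sm a(1)) (auto intro!: mult_left_mono power_mono)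
  with a sm show ?thesis
    unfolding ps_bound_def using cube_mono[OF assms(3)] by (intro exI[of _ a]) force
qed

text \<open>Completeness of the algebra: this is the double series theorem, rearranging the series of series by
multi-indices. The other closure properties reduce to it.\<close>

lemma ps_bound_sum:
  fixes F :: "'j \<Rightarrow> 'a::euclidean_space \<Rightarrow> 'b::banach"
  assumes r: "0 \<le> r" and F: "\<And>j. j \<in> J \<Longrightarrow> ps_bound p r (F j) (m j)"
    and sm: "m summable_on J" and M: "infsum m J \<le> M"
    and f: "\<And>y. y \<in> cube r \<Longrightarrow> ((\<lambda>j. F j (p + y)) has_sum f (p + y)) J"
  shows "ps_bound p r f M"
proof -
  let ?I = "multi_indices :: ('a \<Rightarrow> nat) set"
  have "\<forall>j\<in>J. \<exists>a. (\<lambda>\<alpha>. norm (a \<alpha>) * r ^ mdeg \<alpha>) summable_on ?I \<and>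
     (\<Sum>\<^sub>\<infinity>\<alpha>\<in>?I. norm (a \<alpha>) * r ^ mdeg \<alpha>) \<le> m j \<and>
     (\<forall>y\<in>cube r. ((\<lambda>\<alpha>. mpow y \<alpha> *\<^sub>R a \<alpha>) has_sum F j (p + y)) ?I)"
    using F unfolding ps_bound_def by blast
  from bchoice[OF this] obtain a where "\<forall>j\<in>J. (\<lambda>\<alpha>. norm (a j \<alpha>) * r ^ mdeg \<alpha>) summable_on ?I \<and>
     (\<Sum>\<^sub>\<infinity>\<alpha>\<in>?I. norm (a j \<alpha>) * r ^ mdeg \<alpha>) \<le> m j \<and>
     (\<forall>y\<in>cube r. ((\<lambda>\<alpha>. mpow y \<alpha> *\<^sub>R a j \<alpha>) has_sum F j (p + y)) ?I)" ..
  then have a: "\<And>j. j \<in> J \<Longrightarrow> (\<lambda>\<alpha>. norm (a j \<alpha>) * r ^ mdeg \<alpha>) summable_on ?I"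
     "\<And>j. j \<in> J \<Longrightarrow> (\<Sum>\<^sub>\<infinity>\<alpha>\<in>?I. norm (a j \<alpha>) * r ^ mdeg \<alpha>) \<le> m j"
     "\<And>j y. j \<in> J \<Longrightarrow> y \<in> cube r \<Longrightarrow> ((\<lambda>\<alpha>. mpow y \<alpha> *\<^sub>R a j \<alpha>) has_sum F j (p + y)) ?I"
    by blast+
  define S where "S j = (\<Sum>\<^sub>\<infinity>\<alpha>\<in>?I. norm (a j \<alpha>) * r ^ mdeg \<alpha>)" for j
  have S0: "S j \<ge> 0" for j unfolding S_def using r by (intro infsum_nonneg) auto
  have Ssm: "S summable_on J"
    by (rule summable_on_comparison_test[OF sm]) (use a(2) S0 in \<open>auto simp: S_def\<close>)
  have big: "(\<lambda>(j, \<alpha>). norm (a j \<alpha>) * r ^ mdeg \<alpha>) summable_on J \<times> ?I"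
  proof (rule summable_on_SigmaI[where g = S])
    show "((\<lambda>y. case (j, y) of (j, \<alpha>) \<Rightarrow> norm (a j \<alpha>) * r ^ mdeg \<alpha>) has_sum S j) ?I" if "j \<in> J" for j
      using a(1)[OF that] by (simp add: S_def)
  qed (use Ssm r in auto)
  have big': "(\<lambda>(\<alpha>, j). norm (a j \<alpha>) * r ^ mdeg \<alpha>) summable_on ?I \<times> J"
    using big by (subst summable_on_swap) simp
  have col: "(\<lambda>j. norm (a j \<alpha>) * r ^ mdeg \<alpha>) summable_on J" if "\<alpha> \<in> ?I" for \<alpha>
    using summable_on_SigmaD1[OF big' that] .
  \<comment> \<open>For \<open>r = 0\<close> the bounds do not control the coefficients of positive degree; \<open>cube 0\<close> is a point, and zero serves.\<close>
  define b where "b \<alpha> = (if r = 0 \<and> mdeg \<alpha> \<noteq> 0 then 0 else \<Sum>\<^sub>\<infinity>j\<in>J. a j \<alpha>)" for \<alpha>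
  have acol: "(\<lambda>j. a j \<alpha>) abs_summable_on J" if "\<alpha> \<in> ?I" "r ^ mdeg \<alpha> \<noteq> 0" for \<alpha>
    using col[OF that(1)] that(2) by (metis summable_on_cmult_left')
  have bn: "norm (b \<alpha>) * r ^ mdeg \<alpha> \<le> (\<Sum>\<^sub>\<infinity>j\<in>J. norm (a j \<alpha>) * r ^ mdeg \<alpha>)" if "\<alpha> \<in> ?I" for \<alpha>
  proof (cases "r ^ mdeg \<alpha> = 0")
    case True
    then show ?thesis unfolding True by simp
  next
    case False
    then have "\<not> (r = 0 \<and> mdeg \<alpha> \<noteq> 0)" by auto
    then have "b \<alpha> = (\<Sum>\<^sub>\<infinity>j\<in>J. a j \<alpha>)" unfolding b_def by (rule if_not_P)
    then have "norm (b \<alpha>) \<le> (\<Sum>\<^sub>\<infinity>j\<in>J. norm (a j \<alpha>))"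
      using norm_infsum_bound[OF acol[OF that False]] by simp
    then show ?thesis using r by (simp add: infsum_cmult_left' mult_right_mono)
  qed
  have sm2: "(\<lambda>\<alpha>. \<Sum>\<^sub>\<infinity>j\<in>J. norm (a j \<alpha>) * r ^ mdeg \<alpha>) summable_on ?I"
    using summable_on_Sigma_banach[OF big'] by simp
  have bsm: "(\<lambda>\<alpha>. norm (b \<alpha>) * r ^ mdeg \<alpha>) summable_on ?I"
    by (rule summable_on_comparison_test[OF sm2]) (use bn r in auto)
  have "(\<Sum>\<^sub>\<infinity>\<alpha>\<in>?I. norm (b \<alpha>) * r ^ mdeg \<alpha>) \<le> (\<Sum>\<^sub>\<infinity>\<alpha>\<in>?I. \<Sum>\<^sub>\<infinity>j\<in>J. norm (a j \<alpha>) * r ^ mdeg \<alpha>)"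
    by (intro infsum_mono bsm sm2 bn)
  also have "\<dots> = (\<Sum>\<^sub>\<infinity>j\<in>J. S j)"
    unfolding S_def by (rule infsum_swap_banach[OF big'])
  also have "\<dots> \<le> infsum m J"
    using a(2) by (intro infsum_mono Ssm sm) (auto simp: S_def)
  finally have bM: "(\<Sum>\<^sub>\<infinity>\<alpha>\<in>?I. norm (b \<alpha>) * r ^ mdeg \<alpha>) \<le> M" using M by linarith
  have "((\<lambda>\<alpha>. mpow y \<alpha> *\<^sub>R b \<alpha>) has_sum f (p + y)) ?I" if y: "y \<in> cube r" for y
  proof -
    let ?g = "\<lambda>(j, \<alpha>). mpow y \<alpha> *\<^sub>R a j \<alpha>"
    have "(\<lambda>x. norm (?g x)) summable_on J \<times> ?I"
    proof (rule Infinite_Sum.abs_summable_on_comparison_test'[OF big])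
      show "norm (?g x) \<le> (case x of (j, \<alpha>) \<Rightarrow> norm (a j \<alpha>) * r ^ mdeg \<alpha>)" for x
        using mult_right_mono[OF abs_mpow_le[OF y, of "snd x"], of "norm (a (fst x) (snd x))"]
        by (simp add: split_beta mult.commute)
    qed
    then have gs: "?g summable_on J \<times> ?I" by (rule abs_summable_summable)
    have "(?g has_sum f (p + y)) (J \<times> ?I)"
      by (rule has_sum_SigmaI[OF _ f[OF y] gs]) (use a(3) y in auto)
    then have *: "((\<lambda>(\<alpha>, j). mpow y \<alpha> *\<^sub>R a j \<alpha>) has_sum f (p + y)) (?I \<times> J)"
      by (subst has_sum_swap) simp
    show ?thesis
    proof (rule has_sum_SigmaD[OF *])
      fix \<alpha> assume al: "\<alpha> \<in> ?I"
      show "((\<lambda>j. case (\<alpha>, j) of (\<alpha>, j) \<Rightarrow> mpow y \<alpha> *\<^sub>R a j \<alpha>) has_sum mpow y \<alpha> *\<^sub>R b \<alpha>) J"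
      proof (cases "r ^ mdeg \<alpha> = 0")
        case True
        with abs_mpow_le[OF y, of \<alpha>] have "mpow y \<alpha> = 0" by simp
        then show ?thesis by simp
      next
        case False
        then have "b \<alpha> = (\<Sum>\<^sub>\<infinity>j\<in>J. a j \<alpha>)" by (auto simp: b_def)
        with abs_summable_summable[OF acol[OF al False]]
        have "((\<lambda>j. a j \<alpha>) has_sum b \<alpha>) J" by simp
        then show ?thesis by (simp add: has_sum_scaleR)
      qed
    qed
  qed
  with bsm bM show ?thesis unfolding ps_bound_def by blast
qed

lemma has_sum_single:
  fixes f :: "'i \<Rightarrow> 'b::real_normed_vector"
  assumes "x \<in> A" "\<And>y. y \<in> A \<Longrightarrow> y \<noteq> x \<Longrightarrow> f y = 0"
  shows "(f has_sum f x) A"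
proof -
  have "(f has_sum f x) A \<longleftrightarrow> (f has_sum f x) {x}"
    by (rule has_sum_cong_neutral) (use assms in auto)
  then show ?thesis by (simp add: has_sum_finiteI)
qed

lemma mpow_restrict [simp]: "mpow y (restrict \<alpha> Basis) = mpow y \<alpha>"
  by (simp add: mpow_def)

lemma mdeg_restrict [simp]: "mdeg (restrict \<alpha> Basis) = mdeg \<alpha>"
  by (simp add: mdeg_def)

lemma mpow_add: "mpow y (\<lambda>b. \<alpha> b + \<beta> b) = mpow y \<alpha> * mpow y \<beta>"
  by (simp add: mpow_def power_add prod.distrib)

lemma mdeg_add: "mdeg (\<lambda>b. \<alpha> b + \<beta> b) = mdeg \<alpha> + mdeg \<beta>"
  by (simp add: mdeg_def sum.distrib)

lemma ps_bound_monomial: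
  assumes "0 \<le> r"
  shows "ps_bound p r (\<lambda>x. mpow (x - p) \<alpha> *\<^sub>R c) (norm c * r ^ mdeg \<alpha>)"
proof -
  let ?\<alpha> = "restrict \<alpha> Basis"
  let ?a = "\<lambda>\<beta>. if \<beta> = ?\<alpha> then c else 0"
  have "((\<lambda>\<beta>. norm (?a \<beta>) * r ^ mdeg \<beta>) has_sum norm (?a ?\<alpha>) * r ^ mdeg ?\<alpha>) multi_indices"
    by (rule has_sum_single) auto
  then have 1: "((\<lambda>\<beta>. norm (?a \<beta>) * r ^ mdeg \<beta>) has_sum norm c * r ^ mdeg \<alpha>) multi_indices"
    by simp
  have "((\<lambda>\<beta>. mpow y \<beta> *\<^sub>R ?a \<beta>) has_sum mpow y ?\<alpha> *\<^sub>R ?a ?\<alpha>) multi_indices" for y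
    by (rule has_sum_single) auto
  then have 2: "((\<lambda>\<beta>. mpow y \<beta> *\<^sub>R ?a \<beta>) has_sum mpow (p + y - p) \<alpha> *\<^sub>R c) multi_indices" for y
    by simp
  show ?thesis
    unfolding ps_bound_def using 1 2 by (intro exI[of _ ?a]) (auto simp: has_sum_iff)
qed

lemma ps_bound_const: "0 \<le> r \<Longrightarrow> ps_bound p r (\<lambda>x. c) (norm c)"
  using ps_bound_monomial[of r p "\<lambda>_. 0" c] by (simp add: mpow_def mdeg_def)

lemma ps_bound_coordinate:
  assumes "0 \<le> r" "b \<in> Basis" shows "ps_bound p r (\<lambda>x. (x - p) \<bullet> b) r"
proof -
  have "mpow y (\<lambda>b'. if b' = b then 1 else 0) = y \<bullet> b" for y
    using assms(2) by (simp add: mpow_def if_distrib[of "\<lambda>n. _ ^ n"] cong: if_cong)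
  moreover have "mdeg (\<lambda>b'. if b' = b then 1 else 0) = 1"
    using assms(2) by (simp add: mdeg_def)
  ultimately show ?thesis
    using ps_bound_monomial[OF assms(1), of p "\<lambda>b'. if b' = b then 1 else 0" "1::real"] by simp
qed

lemma ps_bound_finite_sum:
  assumes "0 \<le> r" "finite J" "\<And>j. j \<in> J \<Longrightarrow> ps_bound p r (F j) (m j)"
  shows "ps_bound p r (\<lambda>x. \<Sum>j\<in>J. F j x) (\<Sum>j\<in>J. m j)"
  by (rule ps_bound_sum[OF assms(1), of J p F m]) (use assms in auto)

lemma ps_bound_add:
  assumes "0 \<le> r" "ps_bound p r f M" "ps_bound p r g N"
  shows "ps_bound p r (\<lambda>x. f x + g x) (M + N)"
  using ps_bound_finite_sum[of r "UNIV :: bool set" p "\<lambda>j. if j then f else g" "\<lambda>j. if j then M else N"] assms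
  by (simp add: UNIV_bool add.commute)

text \<open>Linear maps act on the coefficients; the factor \<open>K\<close> bounds the operator norm.\<close>

lemma ps_bound_linear:
  assumes L: "bounded_linear L" and K: "\<And>x. norm (L x) \<le> K * norm x" and K0: "0 \<le> K"
    and r: "0 \<le> r" and f: "ps_bound p r f M"
  shows "ps_bound p r (\<lambda>x. L (f x)) (K * M)"
proof -
  interpret bounded_linear L by fact
  obtain a where a: "(\<lambda>\<alpha>. norm (a \<alpha>) * r ^ mdeg \<alpha>) summable_on multi_indices"
     "(\<Sum>\<^sub>\<infinity>\<alpha>\<in>multi_indices. norm (a \<alpha>) * r ^ mdeg \<alpha>) \<le> M"
     "\<forall>y\<in>cube r. ((\<lambda>\<alpha>. mpow y \<alpha> *\<^sub>R a \<alpha>) has_sum f (p + y)) multi_indices"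
    using f unfolding ps_bound_def by blast
  have le: "norm (L (a \<alpha>)) * r ^ mdeg \<alpha> \<le> K * (norm (a \<alpha>) * r ^ mdeg \<alpha>)" for \<alpha>
    using mult_right_mono[OF K[of "a \<alpha>"], of "r ^ mdeg \<alpha>"] r by (simp add: mult.assoc)
  have sm: "(\<lambda>\<alpha>. K * (norm (a \<alpha>) * r ^ mdeg \<alpha>)) summable_on multi_indices"
    by (rule summable_on_cmult_right[OF a(1)])
  have sL: "(\<lambda>\<alpha>. norm (L (a \<alpha>)) * r ^ mdeg \<alpha>) summable_on multi_indices"
    by (rule summable_on_comparison_test[OF sm]) (use le r in auto)
  have "(\<Sum>\<^sub>\<infinity>\<alpha>\<in>multi_indices. norm (L (a \<alpha>)) * r ^ mdeg \<alpha>) \<le> (\<Sum>\<^sub>\<infinity>\<alpha>\<in>multi_indices. K * (norm (a \<alpha>) * r ^ mdeg \<alpha>))"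
    by (intro infsum_mono sL sm le)
  also have "\<dots> = K * (\<Sum>\<^sub>\<infinity>\<alpha>\<in>multi_indices. norm (a \<alpha>) * r ^ mdeg \<alpha>)"
    by (rule infsum_cmult_right')
  also have "\<dots> \<le> K * M" using a(2) K0 by (rule mult_left_mono)
  finally have b: "(\<Sum>\<^sub>\<infinity>\<alpha>\<in>multi_indices. norm (L (a \<alpha>)) * r ^ mdeg \<alpha>) \<le> K * M" .
  have "((\<lambda>\<alpha>. mpow y \<alpha> *\<^sub>R L (a \<alpha>)) has_sum L (f (p + y))) multi_indices" if "y \<in> cube r" for y
    using has_sum_bounded_linear[OF L a(3)[rule_format, OF that]] by (simp add: scaleR)
  with sL b show ?thesis unfolding ps_bound_def by (intro exI[of _ "\<lambda>\<alpha>. L (a \<alpha>)"]) blast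
qed

text \<open>Cauchy product of two multivariate series. It covers scalar multiplication and multiplication in an
algebra at once.\<close>

lemma ps_bound_bilinear:
  fixes f :: "'a::euclidean_space \<Rightarrow> 'b::banach" and g :: "'a \<Rightarrow> 'c::banach"
    and pr :: "'b \<Rightarrow> 'c \<Rightarrow> 'd::banach"
  assumes pr: "bounded_bilinear pr" and le: "\<And>x y. norm (pr x y) \<le> norm x * norm y"
    and r: "0 \<le> r" and f: "ps_bound p r f M" and g: "ps_bound p r g N"
  shows "ps_bound p r (\<lambda>x. pr (f x) (g x)) (M * N)"
proof -
  interpret bounded_bilinear pr by fact
  let ?I = multi_indices
  obtain a where a: "(\<lambda>\<alpha>. norm (a \<alpha>) * r ^ mdeg \<alpha>) summable_on ?I"
     "(\<Sum>\<^sub>\<infinity>\<alpha>\<in>?I. norm (a \<alpha>) * r ^ mdeg \<alpha>) \<le> M"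
     "\<forall>y\<in>cube r. ((\<lambda>\<alpha>. mpow y \<alpha> *\<^sub>R a \<alpha>) has_sum f (p + y)) ?I"
    using f unfolding ps_bound_def by blast
  obtain b where b: "(\<lambda>\<alpha>. norm (b \<alpha>) * r ^ mdeg \<alpha>) summable_on ?I"
     "(\<Sum>\<^sub>\<infinity>\<alpha>\<in>?I. norm (b \<alpha>) * r ^ mdeg \<alpha>) \<le> N"
     "\<forall>y\<in>cube r. ((\<lambda>\<alpha>. mpow y \<alpha> *\<^sub>R b \<alpha>) has_sum g (p + y)) ?I"
    using g unfolding ps_bound_def by blast
  define A B where "A = (\<Sum>\<^sub>\<infinity>\<alpha>\<in>?I. norm (a \<alpha>) * r ^ mdeg \<alpha>)"
    and "B = (\<Sum>\<^sub>\<infinity>\<alpha>\<in>?I. norm (b \<alpha>) * r ^ mdeg \<alpha>)"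
  have A0: "0 \<le> A" and B0: "0 \<le> B" unfolding A_def B_def using r by (auto intro!: infsum_nonneg)
  define m where "m = (\<lambda>(\<alpha>, \<beta>). (norm (a \<alpha>) * r ^ mdeg \<alpha>) * (norm (b \<beta>) * r ^ mdeg \<beta>))"
  have in1: "((\<lambda>\<beta>. m (\<alpha>, \<beta>)) has_sum (norm (a \<alpha>) * r ^ mdeg \<alpha>) * B) ?I" for \<alpha>
    unfolding m_def B_def using has_sum_cmult_right[OF has_sum_infsum[OF b(1)]] by simp
  have out1: "((\<lambda>\<alpha>. (norm (a \<alpha>) * r ^ mdeg \<alpha>) * B) has_sum A * B) ?I"
    unfolding A_def using has_sum_cmult_left[OF has_sum_infsum[OF a(1)]] by simp
  have msm: "m summable_on ?I \<times> ?I"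
    by (rule summable_on_SigmaI[OF in1]) (use out1 r in \<open>auto simp: m_def has_sum_iff\<close>)
  have mM: "infsum m (?I \<times> ?I) \<le> M * N"
  proof -
    have "(m has_sum A * B) (?I \<times> ?I)"
      by (rule has_sum_SigmaI[OF in1 out1 msm])
    then have "infsum m (?I \<times> ?I) = A * B" by (simp add: has_sum_iff)
    also have "\<dots> \<le> M * N" using a(2) b(2) A0 B0 by (intro mult_mono) (auto simp: A_def B_def)
    finally show ?thesis .
  qed
  show ?thesis
  proof (rule ps_bound_sum[OF r _ msm mM])
    show "ps_bound p r ((\<lambda>(\<alpha>, \<beta>) x. mpow (x - p) (\<lambda>b. \<alpha> b + \<beta> b) *\<^sub>R pr (a \<alpha>) (b \<beta>)) j) (m j)" for j
    proof -
      obtain \<alpha> \<beta> where j: "j = (\<alpha>, \<beta>)" by force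
      have "norm (pr (a \<alpha>) (b \<beta>)) * r ^ mdeg (\<lambda>b. \<alpha> b + \<beta> b) \<le> m j"
        using mult_right_mono[OF le[of "a \<alpha>" "b \<beta>"], of "r ^ (mdeg \<alpha> + mdeg \<beta>)"] r
        by (simp add: j m_def mdeg_add power_add mult_ac)
      then show ?thesis unfolding j prod.case
        by (rule ps_bound_mono[OF ps_bound_monomial[OF r]])
    qed
    fix y :: 'a assume y: "y \<in> cube r"
    let ?G = "\<lambda>(\<alpha>, \<beta>). pr (mpow y \<alpha> *\<^sub>R a \<alpha>) (mpow y \<beta> *\<^sub>R b \<beta>)"
    have "(\<lambda>j. norm (?G j)) summable_on ?I \<times> ?I"
    proof (rule Infinite_Sum.abs_summable_on_comparison_test'[OF msm])
      fix j show "norm (?G j) \<le> m j"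
      proof (cases j)
        case (Pair \<alpha> \<beta>)
        have "norm (?G j) \<le> (\<bar>mpow y \<alpha>\<bar> * norm (a \<alpha>)) * (\<bar>mpow y \<beta>\<bar> * norm (b \<beta>))"
          using le[of "mpow y \<alpha> *\<^sub>R a \<alpha>" "mpow y \<beta> *\<^sub>R b \<beta>"] by (simp add: Pair)
        also have "\<dots> \<le> (r ^ mdeg \<alpha> * norm (a \<alpha>)) * (r ^ mdeg \<beta> * norm (b \<beta>))"
          using abs_mpow_le[OF y] r by (intro mult_mono) auto
        finally show ?thesis by (simp add: m_def Pair mult_ac)
      qed
    qed
    then have sm: "?G summable_on ?I \<times> ?I" by (rule abs_summable_summable)
    have "(?G has_sum pr (f (p + y)) (g (p + y))) (?I \<times> ?I)"
    proof (rule has_sum_SigmaI[OF _ _ sm])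
      show "((\<lambda>\<beta>. ?G (\<alpha>, \<beta>)) has_sum pr (mpow y \<alpha> *\<^sub>R a \<alpha>) (g (p + y))) ?I" for \<alpha>
        using has_sum_bounded_linear[OF bounded_linear_right b(3)[rule_format, OF y]] by simp
      show "((\<lambda>\<alpha>. pr (mpow y \<alpha> *\<^sub>R a \<alpha>) (g (p + y))) has_sum pr (f (p + y)) (g (p + y))) ?I"
        using has_sum_bounded_linear[OF bounded_linear_left a(3)[rule_format, OF y]] by simp
    qed
    moreover have "?G = (\<lambda>j. (\<lambda>(\<alpha>, \<beta>) x. mpow (x - p) (\<lambda>b. \<alpha> b + \<beta> b) *\<^sub>R pr (a \<alpha>) (b \<beta>)) j (p + y))"
      by (auto simp: mpow_add scaleR_left scaleR_right)
    ultimately show "((\<lambda>j. (\<lambda>(\<alpha>, \<beta>) x. mpow (x - p) (\<lambda>b. \<alpha> b + \<beta> b) *\<^sub>R pr (a \<alpha>) (b \<beta>)) j (p + y))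
        has_sum pr (f (p + y)) (g (p + y))) (?I \<times> ?I)" by simp
  qed
qed

lemma ps_bound_scaleR:
  assumes "0 \<le> r" "ps_bound p r f M" "ps_bound p r g N"
  shows "ps_bound p r (\<lambda>x. f x *\<^sub>R g x) (M * N)"
  by (rule ps_bound_bilinear[OF bounded_bilinear_scaleR _ assms]) simp

lemma ps_bound_mult:
  fixes f g :: "'a::euclidean_space \<Rightarrow> 'b::{real_normed_algebra, banach}"
  assumes "0 \<le> r" "ps_bound p r f M" "ps_bound p r g N"
  shows "ps_bound p r (\<lambda>x. f x * g x) (M * N)"
  by (rule ps_bound_bilinear[OF bounded_bilinear_mult _ assms]) (rule norm_mult_ineq)

lemma ps_bound_power:
  fixes f :: "'a::euclidean_space \<Rightarrow> 'b::{real_normed_algebra_1, banach}"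
  assumes "0 \<le> r" "ps_bound p r f M"
  shows "ps_bound p r (\<lambda>x. f x ^ n) (M ^ n)"
proof (induction n)
  case 0
  then show ?case using ps_bound_const[OF assms(1), of p "1 :: 'b"] by simp
next
  case (Suc n)
  show ?case using ps_bound_mult[OF assms Suc] by simp
qed

lemma ps_bound_prod:
  fixes f :: "'i \<Rightarrow> 'a::euclidean_space \<Rightarrow> real"
  assumes "finite A" "0 \<le> r" "\<And>i. i \<in> A \<Longrightarrow> ps_bound p r (f i) (M i)"
  shows "ps_bound p r (\<lambda>x. \<Prod>i\<in>A. f i x) (\<Prod>i\<in>A. M i)"
  using assms(1,3)
proof (induction A rule: finite_induct)
  case empty
  then show ?case using ps_bound_const[OF assms(2), of p "1 :: real"] by simp
next
  case (insert i A)
  then show ?case using ps_bound_mult[OF assms(2), of p "f i" "M i" "\<lambda>x. \<Prod>i\<in>A. f i x" "\<Prod>i\<in>A. M i"] by simp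
qed

text \<open>Substitution: \<open>f \<circ> g\<close> is the series of the monomials of \<open>g - q\<close>, and the monomial with index \<open>\<alpha>\<close> has
bound \<open>R ^ mdeg \<alpha>\<close> by the product rule, which is what the summability of \<open>f\<close> is calibrated for.\<close>

lemma ps_bound_compose:
  fixes f :: "'b::euclidean_space \<Rightarrow> 'c::banach" and g :: "'a::euclidean_space \<Rightarrow> 'b"
  assumes r: "0 \<le> r" and R: "0 \<le> R" and f: "ps_bound q R f M"
    and g: "\<And>b. b \<in> Basis \<Longrightarrow> ps_bound p r (\<lambda>x. (g x - q) \<bullet> b) R"
  shows "ps_bound p r (\<lambda>x. f (g x)) M"
proof -
  let ?I = "multi_indices :: ('b \<Rightarrow> nat) set"
  obtain a where a: "(\<lambda>\<alpha>. norm (a \<alpha>) * R ^ mdeg \<alpha>) summable_on ?I"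
     "(\<Sum>\<^sub>\<infinity>\<alpha>\<in>?I. norm (a \<alpha>) * R ^ mdeg \<alpha>) \<le> M"
     "\<forall>y\<in>cube R. ((\<lambda>\<alpha>. mpow y \<alpha> *\<^sub>R a \<alpha>) has_sum f (q + y)) ?I"
    using f unfolding ps_bound_def by blast
  show ?thesis
  proof (rule ps_bound_sum[OF r _ a(1) a(2), where F = "\<lambda>\<alpha> x. mpow (g x - q) \<alpha> *\<^sub>R a \<alpha>"])
    fix \<alpha>
    have "ps_bound p r (\<lambda>x. mpow (g x - q) \<alpha>) (R ^ mdeg \<alpha>)"
      unfolding mpow_def mdeg_def power_sum
      by (intro ps_bound_prod ps_bound_power r g) auto
    from ps_bound_scaleR[OF r this ps_bound_const[OF r, of p "a \<alpha>"]]
    show "ps_bound p r (\<lambda>x. mpow (g x - q) \<alpha> *\<^sub>R a \<alpha>) (norm (a \<alpha>) * R ^ mdeg \<alpha>)"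
      by (simp add: mult.commute)
  next
    fix y :: 'a assume y: "y \<in> cube r"
    have "g (p + y) - q \<in> cube R"
      using ps_bound_normE[OF g r y] by (auto simp: cube_def)
    from a(3)[rule_format, OF this]
    show "((\<lambda>\<alpha>. mpow (g (p + y) - q) \<alpha> *\<^sub>R a \<alpha>) has_sum f (g (p + y))) ?I" by simp
  qed
qed

lemma mpow_zero: "mpow 0 \<alpha> = (if mdeg \<alpha> = 0 then 1 else 0)"
  by (auto simp: mpow_def mdeg_def)

text \<open>Removing the constant term leaves only monomials of degree at least one, each of which gains a
factor \<open>t\<close> when the cube shrinks by \<open>t\<close>. This makes an analytic inner function fit into the domain of
the outer one.\<close>

lemma ps_bound_increment:
  fixes f :: "'a::euclidean_space \<Rightarrow> 'b::banach"
  assumes r: "0 \<le> r" and t: "0 \<le> t" "t \<le> 1" and f: "ps_bound p r f M"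
  shows "ps_bound p (t * r) (\<lambda>x. f x - f p) (t * M)"
proof -
  let ?I = "multi_indices :: ('a \<Rightarrow> nat) set"
  obtain a where a: "(\<lambda>\<alpha>. norm (a \<alpha>) * r ^ mdeg \<alpha>) summable_on ?I"
     "(\<Sum>\<^sub>\<infinity>\<alpha>\<in>?I. norm (a \<alpha>) * r ^ mdeg \<alpha>) \<le> M"
     "\<forall>y\<in>cube r. ((\<lambda>\<alpha>. mpow y \<alpha> *\<^sub>R a \<alpha>) has_sum f (p + y)) ?I"
    using f unfolding ps_bound_def by blast
  define b where "b \<alpha> = (if mdeg \<alpha> = 0 then 0 else a \<alpha>)" for \<alpha>
  have le: "norm (b \<alpha>) * (t * r) ^ mdeg \<alpha> \<le> t * (norm (a \<alpha>) * r ^ mdeg \<alpha>)" for \<alpha>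
  proof (cases "mdeg \<alpha>")
    case (Suc n)
    have "t ^ Suc n \<le> t" using t power_le_one[of t n] mult_left_mono[of "t ^ n" 1 t] by simp
    then have "t ^ mdeg \<alpha> * (norm (a \<alpha>) * r ^ mdeg \<alpha>) \<le> t * (norm (a \<alpha>) * r ^ mdeg \<alpha>)"
      unfolding Suc using r by (intro mult_right_mono) auto
    then show ?thesis by (simp add: b_def Suc power_mult_distrib mult_ac)
  qed (use r t in \<open>simp add: b_def\<close>)
  have sm: "(\<lambda>\<alpha>. t * (norm (a \<alpha>) * r ^ mdeg \<alpha>)) summable_on ?I"
    by (rule summable_on_cmult_right[OF a(1)])
  have sb: "(\<lambda>\<alpha>. norm (b \<alpha>) * (t * r) ^ mdeg \<alpha>) summable_on ?I"
    by (rule summable_on_comparison_test[OF sm]) (use le r t in auto)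
  have "(\<Sum>\<^sub>\<infinity>\<alpha>\<in>?I. norm (b \<alpha>) * (t * r) ^ mdeg \<alpha>) \<le> (\<Sum>\<^sub>\<infinity>\<alpha>\<in>?I. t * (norm (a \<alpha>) * r ^ mdeg \<alpha>))"
    by (intro infsum_mono sb sm le)
  also have "\<dots> = t * (\<Sum>\<^sub>\<infinity>\<alpha>\<in>?I. norm (a \<alpha>) * r ^ mdeg \<alpha>)"
    by (rule infsum_cmult_right')
  also have "\<dots> \<le> t * M" using a(2) t(1) by (rule mult_left_mono)
  finally have bM: "(\<Sum>\<^sub>\<infinity>\<alpha>\<in>?I. norm (b \<alpha>) * (t * r) ^ mdeg \<alpha>) \<le> t * M" .
  have "((\<lambda>\<alpha>. mpow y \<alpha> *\<^sub>R b \<alpha>) has_sum f (p + y) - f p) ?I" if y: "y \<in> cube (t * r)" for y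
  proof -
    let ?z = "\<lambda>\<alpha>. mpow 0 \<alpha> *\<^sub>R a \<alpha>"
    have "y \<in> cube r" using y cube_mono[of "t * r" r] mult_right_mono[OF t(2) r] by auto
    then have 1: "((\<lambda>\<alpha>. mpow y \<alpha> *\<^sub>R a \<alpha>) has_sum f (p + y)) ?I" using a(3) by blast
    have "(?z has_sum f p) ?I" using a(3)[rule_format, of 0] r by simp
    from has_sum_scaleR[OF this, of "-1"] have 2: "((\<lambda>\<alpha>. - ?z \<alpha>) has_sum - f p) ?I" by simp
    have "mpow y \<alpha> *\<^sub>R b \<alpha> = mpow y \<alpha> *\<^sub>R a \<alpha> + - ?z \<alpha>" for \<alpha>
      by (auto simp: b_def mpow_zero) (simp add: mpow_def mdeg_def)
    then show ?thesis using has_sum_add[OF 1 2] by simp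
  qed
  with sb bM show ?thesis unfolding ps_bound_def by (intro exI[of _ b]) auto
qed

section \<open>Real analytic functions\<close>

lemma summable_on_imp_bounded_terms:
  fixes f :: "'i \<Rightarrow> 'b::real_normed_vector"
  assumes "f summable_on A"
  obtains C where "\<And>x. x \<in> A \<Longrightarrow> norm (f x) \<le> C"
proof -
  obtain S where "(sum f \<longlongrightarrow> S) (finite_subsets_at_top A)"
    using assms by (auto simp: summable_on_def has_sum_def)
  from tendstoD[OF this, of 1] obtain F where F: "finite F" "F \<subseteq> A"
    "\<And>G. finite G \<Longrightarrow> F \<subseteq> G \<Longrightarrow> G \<subseteq> A \<Longrightarrow> dist (sum f G) S < 1"
    by (auto simp: eventually_finite_subsets_at_top)
  have "norm (f x) \<le> 2 + (\<Sum>z\<in>F. norm (f z))" if x: "x \<in> A" for x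
  proof (cases "x \<in> F")
    case True
    then show ?thesis using F(1) member_le_sum[of x F "\<lambda>z. norm (f z)"] by auto
  next
    case False
    have "norm (sum f (insert x F) - sum f F) \<le> dist (sum f (insert x F)) S + dist (sum f F) S"
      unfolding dist_norm[symmetric] by (rule dist_triangle2)
    also have "\<dots> \<le> 2"
      using F(3)[OF _ subset_insertI, of x] F(3)[OF F(1) order_refl F(2)] F(1,2) x by simp
    finally have "norm (f x) \<le> 2" using False F(1) by simp
    then show ?thesis using sum_nonneg[of F "\<lambda>z. norm (f z)"] by simp
  qed
  then show ?thesis using that by blast
qed

lemma norm_le_cube:
  assumes "y \<in> cube s" shows "norm (y :: 'a::euclidean_space) \<le> real DIM('a) * s"
proof -
  have "norm y \<le> (\<Sum>b\<in>Basis. \<bar>y \<bullet> b\<bar>)" by (rule norm_le_l1)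
  also have "\<dots> \<le> (\<Sum>b\<in>(Basis :: 'a set). s)" using assms by (intro sum_mono) (auto simp: cube_def)
  finally show ?thesis by simp
qed

lemma norm_imp_cube: "norm y \<le> s \<Longrightarrow> y \<in> cube s"
  unfolding cube_def by (blast intro: Basis_le_norm order_trans)

text \<open>A power series that converges on a ball has an absolute bound on a smaller cube: the terms at the
corner of a cube inside the ball are bounded, hence geometrically small on the cube of half the size.\<close>

lemma real_analytic_on_iff:
  fixes f :: "'a::euclidean_space \<Rightarrow> 'b::banach"
  shows "real_analytic_on f S \<longleftrightarrow> (\<forall>p\<in>S. \<exists>r>0. \<exists>M. ps_bound p r f M)"
proof (intro iffI ballI)
  fix p assume "real_analytic_on f S" "p \<in> S"
  then obtain r a where r: "r > 0" and a: "\<And>x. x \<in> ball p r \<Longrightarrow>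
      ((\<lambda>\<alpha>. mpow (x - p) \<alpha> *\<^sub>R a \<alpha>) has_sum f x) multi_indices"
    unfolding real_analytic_on_def mpow_def by blast
  define s where "s = r / (2 * real DIM('a))"
  have s: "0 < s" using r by (simp add: s_def)
  have ball: "p + y \<in> ball p r" if "y \<in> cube s" for y
    using norm_le_cube[OF that] r by (simp add: s_def dist_norm)
  \<comment> \<open>at the corner \<open>?y\<close> of the cube, the monomial with index \<open>\<alpha>\<close> is exactly \<open>s ^ mdeg \<alpha>\<close>\<close>
  let ?y = "(\<Sum>b\<in>Basis. s *\<^sub>R b) :: 'a"
  have yb: "?y \<bullet> b = s" if "b \<in> Basis" for b
    using that by (simp add: inner_sum_left inner_Basis if_distrib cong: if_cong)
  have "?y \<in> cube s" using yb s by (simp add: cube_def)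
  from a[OF ball[OF this]] have "(\<lambda>\<alpha>. mpow ?y \<alpha> *\<^sub>R a \<alpha>) summable_on multi_indices"
    by (auto simp: has_sum_iff)
  moreover have "mpow ?y \<alpha> = s ^ mdeg \<alpha>" for \<alpha>
    using yb by (simp add: mpow_def mdeg_def power_sum)
  ultimately have "(\<lambda>\<alpha>. s ^ mdeg \<alpha> *\<^sub>R a \<alpha>) summable_on multi_indices" by simp
  then obtain C where C: "\<And>\<alpha>. \<alpha> \<in> multi_indices \<Longrightarrow> norm (s ^ mdeg \<alpha> *\<^sub>R a \<alpha>) \<le> C"
    using summable_on_imp_bounded_terms by blast
  have sm: "(\<lambda>\<alpha>. C * (1/2) ^ mdeg \<alpha>) summable_on (multi_indices :: ('a \<Rightarrow> nat) set)"
    by (intro summable_on_cmult_right summable_on_geometric_mdeg) auto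
  have "(\<lambda>\<alpha>. norm (a \<alpha>) * (s/2) ^ mdeg \<alpha>) summable_on multi_indices"
  proof (rule summable_on_comparison_test[OF sm])
    show "norm (a \<alpha>) * (s/2) ^ mdeg \<alpha> \<le> C * (1/2) ^ mdeg \<alpha>" if "\<alpha> \<in> multi_indices" for \<alpha>
      using mult_right_mono[OF C[OF that], of "(1/2) ^ mdeg \<alpha>"] s
      by (simp add: power_divide mult.commute field_simps)
  qed (use s in auto)
  moreover have "((\<lambda>\<alpha>. mpow y \<alpha> *\<^sub>R a \<alpha>) has_sum f (p + y)) multi_indices" if "y \<in> cube (s/2)" for y
  proof -
    have "y \<in> cube s" using that s cube_mono[of "s/2" s] by auto
    from a[OF ball[OF this]] show ?thesis by simp
  qed
  ultimately have "ps_bound p (s/2) f (\<Sum>\<^sub>\<infinity>\<alpha>\<in>multi_indices. norm (a \<alpha>) * (s/2) ^ mdeg \<alpha>)"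
    unfolding ps_bound_def by blast
  then show "\<exists>r>0. \<exists>M. ps_bound p r f M" using s by (intro exI[of _ "s/2"]) auto
next
  assume R: "\<forall>p\<in>S. \<exists>r>0. \<exists>M. ps_bound p r f M"
  show "real_analytic_on f S"
    unfolding real_analytic_on_def
  proof
    fix p assume "p \<in> S"
    then obtain r M a where r: "r > 0" and
      a: "\<And>y. y \<in> cube r \<Longrightarrow> ((\<lambda>\<alpha>. mpow y \<alpha> *\<^sub>R a \<alpha>) has_sum f (p + y)) multi_indices"
      using R unfolding ps_bound_def by blast
    have "((\<lambda>\<alpha>. mpow (x - p) \<alpha> *\<^sub>R a \<alpha>) has_sum f x) multi_indices" if "x \<in> ball p r" for x
    proof -
      have "x - p \<in> cube r" using that by (intro norm_imp_cube) (simp add: dist_norm norm_minus_commute)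
      from a[OF this] show ?thesis by simp
    qed
    then show "\<exists>r>0. \<exists>a. \<forall>x\<in>ball p r.
        ((\<lambda>\<alpha>. (\<Prod>b\<in>Basis. ((x - p) \<bullet> b) ^ \<alpha> b) *\<^sub>R a \<alpha>) has_sum f x) multi_indices"
      unfolding mpow_def using r by blast
  qed
qed

lemma real_analytic_onI: "(\<And>p. p \<in> S \<Longrightarrow> \<exists>r>0. \<exists>M. ps_bound p r f M) \<Longrightarrow> real_analytic_on f S"
  by (simp add: real_analytic_on_iff)

lemma real_analytic_onE:
  fixes f :: "'a::euclidean_space \<Rightarrow> 'b::banach"
  assumes "real_analytic_on f S" "p \<in> S"
  obtains r M where "r > 0" "ps_bound p r f M"
  using assms by (auto simp: real_analytic_on_iff)

lemma real_analytic_on_subset: "real_analytic_on f S \<Longrightarrow> T \<subseteq> S \<Longrightarrow> real_analytic_on f T"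
  by (auto simp: real_analytic_on_def)

lemma real_analytic_on_compose:
  fixes f :: "'b::euclidean_space \<Rightarrow> 'c::banach" and g :: "'a::euclidean_space \<Rightarrow> 'b"
  assumes f: "real_analytic_on f T" and g: "real_analytic_on g S" and "g ` S \<subseteq> T"
  shows "real_analytic_on (\<lambda>x. f (g x)) S"
proof (rule real_analytic_onI)
  fix p assume p: "p \<in> S"
  obtain R M where R: "R > 0" "ps_bound (g p) R f M"
    using f assms(3) p by (blast elim: real_analytic_onE)
  obtain r N where r: "r > 0" "ps_bound p r g N" using g p by (blast elim: real_analytic_onE)
  have N: "0 \<le> N" using r by (auto intro: ps_bound_nonneg)
  \<comment> \<open>the factor by which to shrink the cube so that the increments of \<open>g\<close> stay within \<open>R\<close>\<close>
  define t where "t = min 1 (R / (N + 1))"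
  have t: "0 < t" "t \<le> 1" using R N by (auto simp: t_def)
  have "t * N \<le> R / (N + 1) * N" using N by (intro mult_right_mono) (auto simp: t_def)
  also have "\<dots> \<le> R" using N R by (simp add: field_simps)
  finally have tN: "t * N \<le> R" .
  have "ps_bound p (t * r) (\<lambda>x. f (g x)) M"
  proof (rule ps_bound_compose[OF _ _ R(2)])
    fix b :: 'b assume "b \<in> Basis"
    then have "ps_bound p (t * r) (\<lambda>x. (g x - g p) \<bullet> b) (1 * (t * N))"
      using r t by (intro ps_bound_linear[OF bounded_linear_inner_left] ps_bound_increment)
        (auto simp: Basis_le_norm)
    then show "ps_bound p (t * r) (\<lambda>x. (g x - g p) \<bullet> b) R"
      using tN by (auto intro: ps_bound_mono)
  qed (use r t R in auto)
  then show "\<exists>r>0. \<exists>M. ps_bound p r (\<lambda>x. f (g x)) M" using r t by (intro exI[of _ "t * r"]) auto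
qed

lemma real_analytic_on_const [simp]:
  fixes c :: "'b::banach"
  shows "real_analytic_on (\<lambda>x. c) S"
  by (rule real_analytic_onI) (intro exI[of _ "1::real"] exI[of _ "norm c"] conjI ps_bound_const; simp)

lemma real_analytic_on_bounded_linear:
  fixes f :: "'a::euclidean_space \<Rightarrow> 'b::banach" and L :: "'b \<Rightarrow> 'c::banach"
  assumes L: "bounded_linear L" and f: "real_analytic_on f S"
  shows "real_analytic_on (\<lambda>x. L (f x)) S"
proof (rule real_analytic_onI)
  fix p assume "p \<in> S"
  then obtain r N where r: "r > 0" "ps_bound p r f N" using f by (blast elim: real_analytic_onE)
  obtain K where "\<And>x. norm (L x) \<le> norm x * K" "K > 0"
    using bounded_linear.pos_bounded[OF L] by blast
  then have "ps_bound p r (\<lambda>x. L (f x)) (K * N)"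
    using r by (intro ps_bound_linear[OF L]) (auto simp: mult.commute)
  then show "\<exists>r>0. \<exists>M. ps_bound p r (\<lambda>x. L (f x)) M" using r by blast
qed

lemma real_analytic_on_bilinear:
  fixes f :: "'a::euclidean_space \<Rightarrow> 'b::banach" and g :: "'a \<Rightarrow> 'c::banach"
    and pr :: "'b \<Rightarrow> 'c \<Rightarrow> 'd::banach"
  assumes pr: "bounded_bilinear pr" and le: "\<And>x y. norm (pr x y) \<le> norm x * norm y"
    and f: "real_analytic_on f S" and g: "real_analytic_on g S"
  shows "real_analytic_on (\<lambda>x. pr (f x) (g x)) S"
proof (rule real_analytic_onI)
  fix p assume p: "p \<in> S"
  obtain r M where r: "r > 0" "ps_bound p r f M" using f p by (blast elim: real_analytic_onE)
  obtain R N where R: "R > 0" "ps_bound p R g N" using g p by (blast elim: real_analytic_onE)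
  have "ps_bound p (min r R) (\<lambda>x. pr (f x) (g x)) (M * N)"
    using r R by (intro ps_bound_bilinear[OF pr le]) (auto intro: ps_bound_shrink)
  then show "\<exists>r>0. \<exists>M. ps_bound p r (\<lambda>x. pr (f x) (g x)) M" using r R by (intro exI[of _ "min r R"]) auto
qed

lemma real_analytic_on_scaleR:
  fixes g :: "'a::euclidean_space \<Rightarrow> 'b::banach"
  assumes "real_analytic_on f S" "real_analytic_on g S"
  shows "real_analytic_on (\<lambda>x. f x *\<^sub>R g x) S"
  by (rule real_analytic_on_bilinear[OF bounded_bilinear_scaleR _ assms]) simp

lemma real_analytic_on_mult:
  fixes f g :: "'a::euclidean_space \<Rightarrow> 'b::{real_normed_algebra, banach}"
  assumes "real_analytic_on f S" "real_analytic_on g S"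
  shows "real_analytic_on (\<lambda>x. f x * g x) S"
  by (rule real_analytic_on_bilinear[OF bounded_bilinear_mult _ assms]) (rule norm_mult_ineq)

lemma real_analytic_on_add:
  fixes f g :: "'a::euclidean_space \<Rightarrow> 'b::banach"
  assumes f: "real_analytic_on f S" and g: "real_analytic_on g S"
  shows "real_analytic_on (\<lambda>x. f x + g x) S"
proof (rule real_analytic_onI)
  fix p assume p: "p \<in> S"
  obtain r M where r: "r > 0" "ps_bound p r f M" using f p by (blast elim: real_analytic_onE)
  obtain R N where R: "R > 0" "ps_bound p R g N" using g p by (blast elim: real_analytic_onE)
  have "ps_bound p (min r R) (\<lambda>x. f x + g x) (M + N)"
    using r R by (intro ps_bound_add) (auto intro: ps_bound_shrink)
  then show "\<exists>r>0. \<exists>M. ps_bound p r (\<lambda>x. f x + g x) M" using r R by (intro exI[of _ "min r R"]) auto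
qed

lemma real_analytic_on_minus:
  fixes f :: "'a::euclidean_space \<Rightarrow> 'b::banach"
  shows "real_analytic_on f S \<Longrightarrow> real_analytic_on (\<lambda>x. - f x) S"
  by (rule real_analytic_on_bounded_linear) (simp add: bounded_linear_minus bounded_linear_ident)

lemma real_analytic_on_diff:
  fixes f g :: "'a::euclidean_space \<Rightarrow> 'b::banach"
  assumes "real_analytic_on f S" "real_analytic_on g S"
  shows "real_analytic_on (\<lambda>x. f x - g x) S"
  using real_analytic_on_add[OF assms(1) real_analytic_on_minus[OF assms(2)]] by simp

lemma real_analytic_on_sum:
  fixes f :: "'i \<Rightarrow> 'a::euclidean_space \<Rightarrow> 'b::banach"
  assumes "\<And>i. i \<in> I \<Longrightarrow> real_analytic_on (f i) S"
  shows "real_analytic_on (\<lambda>x. \<Sum>i\<in>I. f i x) S"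
  using assms by (induction I rule: infinite_finite_induct) (auto intro: real_analytic_on_add)

lemma real_analytic_on_power:
  fixes f :: "'a::euclidean_space \<Rightarrow> 'b::{real_normed_algebra_1, banach}"
  assumes "real_analytic_on f S" shows "real_analytic_on (\<lambda>x. f x ^ n) S"
  using assms by (induction n) (auto intro: real_analytic_on_mult)

lemma real_analytic_on_ident: "real_analytic_on (\<lambda>x :: 'a::euclidean_space. x) S"
proof (rule real_analytic_onI)
  fix p :: 'a
  have "ps_bound p 1 (\<lambda>x. p + (\<Sum>b\<in>Basis. ((x - p) \<bullet> b) *\<^sub>R b)) (norm p + (\<Sum>b\<in>(Basis :: 'a set). 1 * norm b))"
    by (intro ps_bound_add ps_bound_finite_sum ps_bound_const ps_bound_scaleR ps_bound_coordinate) auto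
  then have "ps_bound p 1 (\<lambda>x. x) (norm p + (\<Sum>b\<in>(Basis :: 'a set). 1 * norm b))"
    by (simp add: euclidean_representation)
  then show "\<exists>r>0. \<exists>M. ps_bound p r (\<lambda>x. x) M" by (intro exI[of _ "1::real"]) auto
qed

lemma real_analytic_on_Pair:
  fixes f :: "'a::euclidean_space \<Rightarrow> 'b::euclidean_space" and g :: "'a \<Rightarrow> 'c::euclidean_space"
  assumes "real_analytic_on f S" "real_analytic_on g S"
  shows "real_analytic_on (\<lambda>x. (f x, g x)) S"
proof -
  have "bounded_linear (\<lambda>x::'b. (x, 0::'c))" "bounded_linear (\<lambda>x::'c. (0::'b, x))"
    by (auto intro: bounded_linear_Pair bounded_linear_ident bounded_linear_zero)
  from real_analytic_on_add[OF real_analytic_on_bounded_linear[OF this(1) assms(1)]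
      real_analytic_on_bounded_linear[OF this(2) assms(2)]]
  show ?thesis by simp
qed

lemma real_analytic_on_fst:
  fixes f :: "'a::euclidean_space \<Rightarrow> 'b::euclidean_space \<times> 'c::euclidean_space"
  shows "real_analytic_on f S \<Longrightarrow> real_analytic_on (\<lambda>x. fst (f x)) S"
  by (rule real_analytic_on_bounded_linear) (rule bounded_linear_fst)

lemma real_analytic_on_snd:
  fixes f :: "'a::euclidean_space \<Rightarrow> 'b::euclidean_space \<times> 'c::euclidean_space"
  shows "real_analytic_on f S \<Longrightarrow> real_analytic_on (\<lambda>x. snd (f x)) S"
  by (rule real_analytic_on_bounded_linear) (rule bounded_linear_snd)

lemmas real_analytic_intros =
  real_analytic_on_const real_analytic_on_ident real_analytic_on_add real_analytic_on_diff
  real_analytic_on_minus real_analytic_on_mult real_analytic_on_scaleR real_analytic_on_power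
  real_analytic_on_sum real_analytic_on_Pair real_analytic_on_fst real_analytic_on_snd

text \<open>Bridge from one-dimensional series given by \<open>sums\<close>; it yields the analyticity of the inverse (geometric
series) and of the square root (binomial series).\<close>

lemma real_analytic_on_power_series:
  fixes f :: "real \<Rightarrow> real"
  assumes K: "0 < K" and f: "\<And>z. \<bar>z\<bar> < K \<Longrightarrow> (\<lambda>n. c n * z ^ n) sums f (p + z)"
  shows "real_analytic_on f {p}"
proof (rule real_analytic_onI)
  fix p' assume "p' \<in> {p}"
  then have p': "p' = p" by simp
  define r where "r = K / 3"
  have r: "0 < r" "r < 2 * K / 3" using K by (auto simp: r_def)
  have "summable (\<lambda>n. c n * (2 * K / 3) ^ n)" using f[of "2 * K / 3"] K by (auto simp: sums_iff)
  then have "summable (\<lambda>n. norm (c n * r ^ n))"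
    by (rule powser_insidea) (use r K in auto)
  then have sm: "(\<lambda>n. \<bar>c n\<bar> * r ^ n) summable_on UNIV"
    using r by (simp add: summable_on_UNIV_nonneg_real_iff abs_mult)
  have "ps_bound p r f (\<Sum>\<^sub>\<infinity>n. \<bar>c n\<bar> * r ^ n)"
  proof (rule ps_bound_sum[OF _ _ sm order_refl, where F = "\<lambda>n x. c n * ((x - p) \<bullet> 1) ^ n"])
    show "ps_bound p r (\<lambda>x. c n * ((x - p) \<bullet> 1) ^ n) (\<bar>c n\<bar> * r ^ n)" for n
    proof -
      have "ps_bound p r (\<lambda>x. (x - p) \<bullet> 1) r" using r by (intro ps_bound_coordinate) auto
      from ps_bound_mult[OF _ ps_bound_const ps_bound_power[OF _ this], of "c n" n] r
      show ?thesis by simp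
    qed
  next
    fix y :: real assume "y \<in> cube r"
    then have y: "\<bar>y\<bar> \<le> r" by (simp add: cube_def)
    have "(\<lambda>n. norm (c n * y ^ n)) summable_on UNIV"
      by (rule Infinite_Sum.abs_summable_on_comparison_test'[OF sm])
         (use y in \<open>auto simp: abs_mult power_abs intro!: mult_left_mono power_mono\<close>)
    then have "(\<lambda>n. c n * y ^ n) summable_on UNIV" by (rule abs_summable_summable)
    then have "((\<lambda>n. c n * y ^ n) has_sum (\<Sum>\<^sub>\<infinity>n. c n * y ^ n)) UNIV" by simp
    moreover from has_sum_imp_sums[OF this] f[of y] y r have "(\<Sum>\<^sub>\<infinity>n. c n * y ^ n) = f (p + y)"
      by (auto simp: sums_iff)
    ultimately show "((\<lambda>n. c n * ((p + y - p) \<bullet> 1) ^ n) has_sum f (p + y)) UNIV" by simp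
  qed (use r in auto)
  then show "\<exists>r>0. \<exists>M. ps_bound p' r f M" unfolding p' using r by blast
qed

lemma real_analytic_on_inverse:
  fixes f :: "'a::euclidean_space \<Rightarrow> real"
  assumes "real_analytic_on f S" "\<And>x. x \<in> S \<Longrightarrow> f x \<noteq> 0"
  shows "real_analytic_on (\<lambda>x. inverse (f x)) S"
proof (rule real_analytic_on_compose[OF _ assms(1)])
  show "real_analytic_on inverse (- {0::real})"
    unfolding real_analytic_on_def
  proof
    fix p :: real assume "p \<in> - {0}"
    then have p: "p \<noteq> 0" by simp
    have "real_analytic_on inverse {p}"
    proof (rule real_analytic_on_power_series[where K = "\<bar>p\<bar>" and c = "\<lambda>n. inverse p * (- inverse p) ^ n"])
      fix z assume z: "\<bar>z\<bar> < \<bar>p\<bar>"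
      have "(\<lambda>n. (- z / p) ^ n) sums (1 / (1 - (- z / p)))"
        by (rule geometric_sums) (use z p in \<open>simp add: field_simps\<close>)
      from sums_mult[OF this, of "inverse p"] z p
      show "(\<lambda>n. inverse p * (- inverse p) ^ n * z ^ n) sums inverse (p + z)"
        by (simp add: field_simps power_mult_distrib[symmetric])
    qed (use p in simp)
    then show "\<exists>r>0. \<exists>a. \<forall>x\<in>ball p r.
        ((\<lambda>\<alpha>. (\<Prod>b\<in>Basis. ((x - p) \<bullet> b) ^ \<alpha> b) *\<^sub>R a \<alpha>) has_sum inverse x) multi_indices"
      by (auto simp: real_analytic_on_def)
  qed
qed (use assms(2) in auto)

lemma real_analytic_on_divide:
  fixes f g :: "'a::euclidean_space \<Rightarrow> real"
  assumes "real_analytic_on f S" "real_analytic_on g S" "\<And>x. x \<in> S \<Longrightarrow> g x \<noteq> 0"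
  shows "real_analytic_on (\<lambda>x. f x / g x) S"
  unfolding divide_inverse
  by (intro real_analytic_on_mult real_analytic_on_inverse assms)

lemma real_analytic_on_sqrt:
  fixes f :: "'a::euclidean_space \<Rightarrow> real"
  assumes "real_analytic_on f S" "\<And>x. x \<in> S \<Longrightarrow> f x > 0"
  shows "real_analytic_on (\<lambda>x. sqrt (f x)) S"
proof (rule real_analytic_on_compose[OF _ assms(1)])
  show "real_analytic_on sqrt {0<..}"
    unfolding real_analytic_on_def
  proof
    fix p :: real assume "p \<in> {0<..}"
    then have p: "p > 0" by simp
    have "real_analytic_on sqrt {p}"
    proof (rule real_analytic_on_power_series[where K = p and c = "\<lambda>n. sqrt p * ((1/2) gchoose n) * inverse p ^ n"])
      fix z assume z: "\<bar>z\<bar> < p"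
      have "(\<lambda>n. ((1/2) gchoose n) * (z / p) ^ n) sums (1 + z / p) powr (1/2)"
        by (rule gen_binomial_real) (use z p in \<open>simp add: field_simps\<close>)
      moreover have "1 + z / p = (p + z) / p" using p by (simp add: field_simps)
      ultimately have "(\<lambda>n. ((1/2) gchoose n) * (z / p) ^ n) sums (sqrt (p + z) / sqrt p)"
        using z p by (simp add: powr_half_sqrt real_sqrt_divide)
      from sums_mult[OF this, of "sqrt p"] p
      show "(\<lambda>n. sqrt p * ((1/2) gchoose n) * inverse p ^ n * z ^ n) sums sqrt (p + z)"
        by (simp add: field_simps)
    qed (use p in simp)
    then show "\<exists>r>0. \<exists>a. \<forall>x\<in>ball p r.
        ((\<lambda>\<alpha>. (\<Prod>b\<in>Basis. ((x - p) \<bullet> b) ^ \<alpha> b) *\<^sub>R a \<alpha>) has_sum sqrt x) multi_indices"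
      by (auto simp: real_analytic_on_def)
  qed
qed (use assms(2) in auto)

section \<open>Derivatives, division by a variable and slices\<close>

text \<open>Re-expansion at a nearby point, as a composition with the translation.\<close>

lemma ps_bound_nearby:
  fixes f :: "'a::euclidean_space \<Rightarrow> 'b::banach"
  assumes r: "0 \<le> r" and f: "ps_bound p r f M" and q: "q - p \<in> cube (r / 2)"
  shows "ps_bound q (r / 2) f M"
proof (rule ps_bound_compose[OF _ r f])
  fix b :: 'a assume b: "b \<in> Basis"
  have "ps_bound q (r / 2) (\<lambda>x. (x - q) \<bullet> b + (q - p) \<bullet> b) (r / 2 + norm ((q - p) \<bullet> b))"
    using r b by (intro ps_bound_add ps_bound_coordinate ps_bound_const) auto
  moreover have "r / 2 + norm ((q - p) \<bullet> b) \<le> r" using q b by (auto simp: cube_def)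
  ultimately show "ps_bound q (r / 2) (\<lambda>x. (x - p) \<bullet> b) r"
    by (auto simp: inner_diff_left intro: ps_bound_mono)
qed (use r in simp)

lemma differentiable_prod:
  fixes f :: "'i \<Rightarrow> 'a::real_normed_vector \<Rightarrow> real"
  assumes "finite I" "\<And>i. i \<in> I \<Longrightarrow> f i differentiable (at x)"
  shows "(\<lambda>x. \<Prod>i\<in>I. f i x) differentiable (at x)"
  using assms by (induction I rule: finite_induct) auto

text \<open>The part of degree at most one is a polynomial, and the rest is \<open>O(norm y ^ 2)\<close>, again because each of
its monomials gains \<open>t\<^sup>2\<close> on a cube shrunk by \<open>t\<close>.\<close>

lemma ps_bound_differentiable:
  fixes f :: "'a::euclidean_space \<Rightarrow> 'b::banach"
  assumes r: "0 < r" and f: "ps_bound p r f M"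
  shows "f differentiable (at p)"
proof -
  let ?I = "multi_indices :: ('a \<Rightarrow> nat) set"
  obtain a where a: "(\<lambda>\<alpha>. norm (a \<alpha>) * r ^ mdeg \<alpha>) summable_on ?I"
     "(\<Sum>\<^sub>\<infinity>\<alpha>\<in>?I. norm (a \<alpha>) * r ^ mdeg \<alpha>) \<le> M"
     "\<forall>y\<in>cube r. ((\<lambda>\<alpha>. mpow y \<alpha> *\<^sub>R a \<alpha>) has_sum f (p + y)) ?I"
    using f unfolding ps_bound_def by blast
  define lo where "lo = {\<alpha> \<in> ?I. mdeg \<alpha> \<le> 1}"
  have "lo \<subseteq> Basis \<rightarrow>\<^sub>E {..1}"
  proof
    fix \<alpha> assume al: "\<alpha> \<in> lo"
    have "\<alpha> b \<le> 1" if "b \<in> Basis" for b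
    proof -
      have "\<alpha> b \<le> mdeg \<alpha>" unfolding mdeg_def using that by (intro member_le_sum) auto
      then show ?thesis using al by (auto simp: lo_def)
    qed
    then show "\<alpha> \<in> Basis \<rightarrow>\<^sub>E {..1}" using al by (auto simp: lo_def PiE_iff)
  qed
  then have lo: "finite lo" by (rule finite_subset) (simp add: finite_PiE)
  define P where "P y = (\<Sum>\<alpha>\<in>lo. mpow y \<alpha> *\<^sub>R a \<alpha>)" for y
  define R where "R y = f (p + y) - P y" for y
  have Rle: "norm (R y) \<le> (t ^ 2) * M" if y: "y \<in> cube (t * r)" and t: "0 \<le> t" "t \<le> 1" for y t
  proof -
    define b where "b \<alpha> = (if mdeg \<alpha> \<le> 1 then 0 else a \<alpha>)" for \<alpha>
    have yr: "y \<in> cube r" using y cube_mono[of "t * r" r] mult_right_mono[OF t(2), of r] r by auto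
    have 1: "((\<lambda>\<alpha>. mpow y \<alpha> *\<^sub>R a \<alpha>) has_sum f (p + y)) ?I" using a(3) yr by blast
    have "((\<lambda>\<alpha>. if \<alpha> \<in> lo then - (mpow y \<alpha> *\<^sub>R a \<alpha>) else 0) has_sum - P y) ?I"
    proof -
      have "((\<lambda>\<alpha>. if \<alpha> \<in> lo then - (mpow y \<alpha> *\<^sub>R a \<alpha>) else 0) has_sum - P y) ?I
        \<longleftrightarrow> ((\<lambda>\<alpha>. - (mpow y \<alpha> *\<^sub>R a \<alpha>)) has_sum - P y) lo"
        by (rule has_sum_cong_neutral) (auto simp: lo_def)
      also have "\<dots>" using lo by (auto intro!: has_sum_finiteI simp: P_def sum_negf)
      finally show ?thesis .
    qed
    from has_sum_add[OF 1 this]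
    have "((\<lambda>\<alpha>. mpow y \<alpha> *\<^sub>R a \<alpha> + (if \<alpha> \<in> lo then - (mpow y \<alpha> *\<^sub>R a \<alpha>) else 0)) has_sum R y) ?I"
      by (simp add: R_def)
    also have "?this \<longleftrightarrow> ((\<lambda>\<alpha>. mpow y \<alpha> *\<^sub>R b \<alpha>) has_sum R y) ?I"
      by (rule has_sum_cong) (auto simp: b_def lo_def)
    finally have hs: "((\<lambda>\<alpha>. mpow y \<alpha> *\<^sub>R b \<alpha>) has_sum R y) ?I" .
    have "norm (R y) \<le> t ^ 2 * (\<Sum>\<^sub>\<infinity>\<alpha>\<in>?I. norm (a \<alpha>) * r ^ mdeg \<alpha>)"
    proof (rule norm_infsum_le[OF hs has_sum_cmult_right[OF has_sum_infsum[OF a(1)]]])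
      fix \<alpha>
      show "norm (mpow y \<alpha> *\<^sub>R b \<alpha>) \<le> t ^ 2 * (norm (a \<alpha>) * r ^ mdeg \<alpha>)"
      proof (cases "mdeg \<alpha> \<le> 1")
        case False
        then have "t ^ mdeg \<alpha> \<le> t ^ 2" using t by (intro power_decreasing) auto
        then have "(t * r) ^ mdeg \<alpha> \<le> t ^ 2 * r ^ mdeg \<alpha>"
          using r by (simp add: power_mult_distrib)
        with abs_mpow_le[OF y, of \<alpha>] have "\<bar>mpow y \<alpha>\<bar> \<le> t ^ 2 * r ^ mdeg \<alpha>" by linarith
        from mult_right_mono[OF this, of "norm (a \<alpha>)"] False show ?thesis
          by (simp add: b_def mult_ac)
      qed (use r in \<open>simp add: b_def\<close>)
    qed
    also have "\<dots> \<le> t ^ 2 * M" using a(2) by (rule mult_left_mono) simp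
    finally show ?thesis .
  qed
  have Rn: "norm (R y) \<le> M / r ^ 2 * norm y * norm y" if "norm y \<le> r" for y
    using Rle[of y "norm y / r"] r that norm_imp_cube[of y "norm y"]
    by (simp add: power2_eq_square field_simps)
  have R0: "R 0 = 0" using Rn[of 0] r by simp
  have "(R has_derivative (\<lambda>_. 0)) (at 0)"
    unfolding has_derivative_iff_norm
  proof
    have "((\<lambda>y::'a. M / r ^ 2 * norm y) \<longlongrightarrow> M / r ^ 2 * norm (0::'a)) (at 0)"
      by (intro tendsto_mult_left tendsto_norm tendsto_ident_at)
    then have *: "((\<lambda>y::'a. M / r ^ 2 * norm y) \<longlongrightarrow> 0) (at 0)" by simp
    have "\<forall>\<^sub>F y in at 0. norm (norm (R y - R 0 - 0) / norm (y - 0)) \<le> M / r ^ 2 * norm y"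
      unfolding eventually_at
    proof (intro exI[of _ r] conjI r ballI impI)
      fix y :: 'a assume "y \<noteq> 0 \<and> dist y 0 < r"
      then show "norm (norm (R y - R 0 - 0) / norm (y - 0)) \<le> M / r ^ 2 * norm y"
        using Rn[of y] R0 by (simp add: field_simps)
    qed
    then show "((\<lambda>y. norm (R y - R 0 - 0) / norm (y - 0)) \<longlongrightarrow> 0) (at 0)"
      using * by (rule Lim_null_comparison)
  qed (rule bounded_linear_zero)
  then have dR: "R differentiable (at 0)" by (rule differentiableI)
  have "(\<lambda>y. mpow y \<alpha> *\<^sub>R a \<alpha>) differentiable (at 0)" for \<alpha>
  proof -
    have "(\<lambda>y. mpow y \<alpha>) differentiable (at 0)"
      unfolding mpow_def by (intro differentiable_prod differentiable_power differentiable_inner) auto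
    then obtain D where "((\<lambda>y. mpow y \<alpha>) has_derivative D) (at 0)" by (auto simp: differentiable_def)
    from has_derivative_scaleR_left[OF this] show ?thesis by (rule differentiableI)
  qed
  then have "P differentiable (at 0)"
    unfolding P_def[abs_def] using lo by (intro differentiable_sum) auto
  from differentiable_add[OF this dR] have "(\<lambda>y. f (p + y)) differentiable (at (p - p))"
    by (simp add: R_def)
  moreover have "(\<lambda>x. x - p) differentiable (at p)" by simp
  ultimately have "((\<lambda>y. f (p + y)) \<circ> (\<lambda>x. x - p)) differentiable (at p)"
    by (intro differentiable_chain_at)
  then show ?thesis by (simp add: o_def)
qed

lemma real_analytic_on_differentiable:
  fixes f :: "'a::euclidean_space \<Rightarrow> 'b::banach"
  assumes "real_analytic_on f S" "p \<in> S" shows "f differentiable (at p)"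
  using assms ps_bound_differentiable by (blast elim: real_analytic_onE)

lemma real_analytic_on_isCont:
  fixes f :: "'a::euclidean_space \<Rightarrow> 'b::banach"
  assumes "real_analytic_on f S" "p \<in> S" shows "isCont f p"
  using real_analytic_on_differentiable[OF assms] by (rule differentiable_imp_continuous_within)

lemma real_analytic_on_continuous_on:
  fixes f :: "'a::euclidean_space \<Rightarrow> 'b::banach"
  assumes "real_analytic_on f S" shows "continuous_on S f"
  using assms by (intro continuous_at_imp_continuous_on ballI real_analytic_on_isCont)

text \<open>The value at \<open>u = 0\<close> is the one that makes the quotient analytic. Iterating the operation produces the
Taylor coefficients in \<open>u\<close> and their remainders.\<close>

definition difference_quotient ::
    "(real \<times> 'z::euclidean_space \<Rightarrow> 'b::banach) \<Rightarrow> real \<times> 'z \<Rightarrow> 'b" where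
  "difference_quotient f = (\<lambda>(u, z). if u = 0 then vector_derivative (\<lambda>s. f (s, z)) (at 0)
     else (f (u, z) - f (0, z)) /\<^sub>R u)"

lemma difference_quotient_identity:
  "f (u, z) = f (0, z) + u *\<^sub>R difference_quotient f (u, z)"
  by (simp add: difference_quotient_def)

text \<open>Split the series of \<open>f\<close> into the monomials without \<open>u\<close>, which give \<open>f (0, z)\<close>, and those with \<open>u\<close>, from which
one factor \<open>u\<close> is taken out; the latter costs \<open>1 / r\<close> in the bound.\<close>

lemma ps_bound_divide_variable:
  fixes f :: "real \<times> 'z::euclidean_space \<Rightarrow> 'b::banach"
  assumes r: "0 < r" and f: "ps_bound (0, z0) r f M"
  obtains R where "ps_bound (0, z0) r R (M / r)"
    "\<And>u z. (u, z - z0) \<in> cube r \<Longrightarrow> f (u, z) = f (0, z) + u *\<^sub>R R (u, z)"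
proof -
  let ?I = "multi_indices :: (real \<times> 'z \<Rightarrow> nat) set"
  let ?e = "(1, 0) :: real \<times> 'z"
  have e: "?e \<in> Basis" by (simp add: Basis_prod_def)
  obtain a where a: "(\<lambda>\<alpha>. norm (a \<alpha>) * r ^ mdeg \<alpha>) summable_on ?I"
     "(\<Sum>\<^sub>\<infinity>\<alpha>\<in>?I. norm (a \<alpha>) * r ^ mdeg \<alpha>) \<le> M"
     "\<forall>y\<in>cube r. ((\<lambda>\<alpha>. mpow y \<alpha> *\<^sub>R a \<alpha>) has_sum f ((0, z0) + y)) ?I"
    using f unfolding ps_bound_def by blast
  \<comment> \<open>indices of the monomials that contain \<open>u\<close>; \<open>dn\<close> lowers their exponent of \<open>u\<close> by one\<close>
  define J where "J = {\<alpha> \<in> ?I. \<alpha> ?e \<noteq> 0}"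
  define dn where "dn \<alpha> = \<alpha>(?e := \<alpha> ?e - 1)" for \<alpha> :: "real \<times> 'z \<Rightarrow> nat"
  have split: "mpow y \<alpha> = (y \<bullet> ?e) ^ \<alpha> ?e * (\<Prod>b\<in>Basis - {?e}. (y \<bullet> b) ^ \<alpha> b)" for y \<alpha>
    unfolding mpow_def using e by (simp add: prod.remove)
  have dn_pow: "mpow y \<alpha> = (y \<bullet> ?e) * mpow y (dn \<alpha>)" if "\<alpha> \<in> J" for \<alpha> y
    using that by (simp add: split dn_def J_def power_eq_if)
  have dn_deg: "mdeg \<alpha> = Suc (mdeg (dn \<alpha>))" if "\<alpha> \<in> J" for \<alpha>
    using that e by (simp add: mdeg_def dn_def J_def sum.remove[of _ ?e])
  define m where "m \<alpha> = norm (a \<alpha>) * r ^ mdeg \<alpha> / r" for \<alpha>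
  have sJ: "(\<lambda>\<alpha>. norm (a \<alpha>) * r ^ mdeg \<alpha>) summable_on J"
    by (rule summable_on_subset_banach[OF a(1)]) (auto simp: J_def)
  then have sm: "m summable_on J"
    unfolding m_def by (simp add: divide_inverse summable_on_cmult_left)
  have "(\<Sum>\<^sub>\<infinity>\<alpha>\<in>J. norm (a \<alpha>) * r ^ mdeg \<alpha>) \<le> M"
    using infsum_mono_neutral[OF sJ a(1)] a(2) r by (force simp: J_def)
  then have mM: "infsum m J \<le> M / r"
    using r by (simp add: m_def[abs_def] divide_inverse infsum_cmult_left' mult_right_mono)
  define R where "R x = (\<Sum>\<^sub>\<infinity>\<alpha>\<in>J. mpow (x - (0, z0)) (dn \<alpha>) *\<^sub>R a \<alpha>)" for x
  have Rs: "((\<lambda>\<alpha>. mpow y (dn \<alpha>) *\<^sub>R a \<alpha>) has_sum R ((0, z0) + y)) J" if y: "y \<in> cube r" for y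
  proof -
    have "(\<lambda>\<alpha>. norm (mpow y (dn \<alpha>) *\<^sub>R a \<alpha>)) summable_on J"
    proof (rule Infinite_Sum.abs_summable_on_comparison_test'[OF sm])
      show "norm (mpow y (dn \<alpha>) *\<^sub>R a \<alpha>) \<le> m \<alpha>" if "\<alpha> \<in> J" for \<alpha>
        using mult_right_mono[OF abs_mpow_le[OF y, of "dn \<alpha>"], of "norm (a \<alpha>)"] r
        by (simp add: m_def dn_deg[OF that] mult_ac)
    qed
    then have "(\<lambda>\<alpha>. mpow y (dn \<alpha>) *\<^sub>R a \<alpha>) summable_on J" by (rule abs_summable_summable)
    then show ?thesis by (simp add: R_def)
  qed
  have "ps_bound (0, z0) r R (M / r)"
  proof (rule ps_bound_sum[OF _ _ sm mM, where F = "\<lambda>\<alpha> x. mpow (x - (0, z0)) (dn \<alpha>) *\<^sub>R a \<alpha>"])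
    show "ps_bound (0, z0) r (\<lambda>x. mpow (x - (0, z0)) (dn \<alpha>) *\<^sub>R a \<alpha>) (m \<alpha>)" if "\<alpha> \<in> J" for \<alpha>
      using ps_bound_monomial[of r "(0, z0)" "dn \<alpha>" "a \<alpha>"] r by (simp add: m_def dn_deg[OF that])
  qed (use r Rs in auto)
  moreover have "f (u, z) = f (0, z) + u *\<^sub>R R (u, z)" if uz: "(u, z - z0) \<in> cube r" for u z
  proof -
    let ?y = "(u, z - z0)" and ?w = "(0, z - z0)"
    have y0: "?w \<in> cube r" using uz r by (auto simp: cube_def Basis_prod_def)
    have 1: "((\<lambda>\<alpha>. mpow ?y \<alpha> *\<^sub>R a \<alpha>) has_sum f (u, z)) ?I" using a(3)[rule_format, OF uz] by simp
    have 2: "((\<lambda>\<alpha>. mpow ?w \<alpha> *\<^sub>R a \<alpha>) has_sum f (0, z)) ?I" using a(3)[rule_format, OF y0] by simp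
    have "((\<lambda>\<alpha>. u *\<^sub>R (mpow ?y (dn \<alpha>) *\<^sub>R a \<alpha>)) has_sum u *\<^sub>R R (u, z)) J"
      using has_sum_scaleR[OF Rs[OF uz]] by simp
    also have "?this \<longleftrightarrow> ((\<lambda>\<alpha>. if \<alpha> \<in> J then mpow ?y \<alpha> *\<^sub>R a \<alpha> else 0) has_sum u *\<^sub>R R (u, z)) ?I"
      by (rule has_sum_cong_neutral) (auto simp: dn_pow, auto simp: J_def)
    finally have "((\<lambda>\<alpha>. mpow ?w \<alpha> *\<^sub>R a \<alpha> + (if \<alpha> \<in> J then mpow ?y \<alpha> *\<^sub>R a \<alpha> else 0))
        has_sum f (0, z) + u *\<^sub>R R (u, z)) ?I"
      by (rule has_sum_add[OF 2])
    also have "?this \<longleftrightarrow> ((\<lambda>\<alpha>. mpow ?y \<alpha> *\<^sub>R a \<alpha>) has_sum f (0, z) + u *\<^sub>R R (u, z)) ?I"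
    proof (rule has_sum_cong)
      fix \<alpha> assume "\<alpha> \<in> ?I"
      have "(\<Prod>b\<in>Basis - {?e}. (?w \<bullet> b) ^ \<alpha> b) = (\<Prod>b\<in>Basis - {?e}. (?y \<bullet> b) ^ \<alpha> b)"
        by (rule prod.cong) (auto simp: Basis_prod_def)
      then show "mpow ?w \<alpha> *\<^sub>R a \<alpha> + (if \<alpha> \<in> J then mpow ?y \<alpha> *\<^sub>R a \<alpha> else 0) = mpow ?y \<alpha> *\<^sub>R a \<alpha>"
        using \<open>\<alpha> \<in> ?I\<close> by (auto simp: split J_def)
    qed
    finally show ?thesis using 1 has_sum_unique by blast
  qed
  ultimately show ?thesis by (rule that)
qed

lemma real_analytic_on_difference_quotient:
  fixes f :: "real \<times> 'z::euclidean_space \<Rightarrow> 'b::banach"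
  assumes f: "real_analytic_on f ({0} \<times> Z)"
  shows "real_analytic_on (difference_quotient f) ({0} \<times> Z)"
proof (rule real_analytic_onI)
  fix p :: "real \<times> 'z" assume "p \<in> {0} \<times> Z"
  then obtain z0 where p: "p = (0, z0)" and z0: "z0 \<in> Z" by auto
  then obtain r M where r: "r > 0" "ps_bound (0, z0) r f M"
    using f by (blast elim: real_analytic_onE)
  obtain R where R: "ps_bound (0, z0) r R (M / r)"
    "\<And>u z. (u, z - z0) \<in> cube r \<Longrightarrow> f (u, z) = f (0, z) + u *\<^sub>R R (u, z)"
    using ps_bound_divide_variable[OF r] by blast
  have "difference_quotient f (u, z) = R (u, z)" if uz: "(u, z - z0) \<in> cube (r / 2)" for u z
  proof (cases "u = 0")
    case False
    have "(u, z - z0) \<in> cube r" using uz r cube_mono[of "r / 2" r] by auto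
    from R(2)[OF this] False show ?thesis by (simp add: difference_quotient_def)
  next
    case True
    have "ps_bound (0, z) (r / 2) R (M / r)"
      using uz r R(1) by (intro ps_bound_nearby[of r "(0, z0)"]) (auto simp: True)
    then have "R differentiable (at (0, z))" using r by (intro ps_bound_differentiable[of "r / 2"]) auto
    then have "(R \<circ> (\<lambda>s. (s, z))) differentiable (at 0)"
      by (intro differentiable_chain_at differentiable_Pair) auto
    then obtain D where D: "((\<lambda>s. R (s, z)) has_vector_derivative D) (at 0)"
      using vector_derivative_works by (auto simp: o_def)
    have "((\<lambda>s. f (0, z) + s *\<^sub>R R (s, z)) has_vector_derivative R (0, z)) (at 0)"
      by (rule derivative_eq_intros D refl | simp)+
    then have "((\<lambda>s. f (s, z)) has_vector_derivative R (0, z)) (at 0)"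
    proof (rule has_vector_derivative_transform_within_open[where S = "ball 0 r"])
      fix s :: real assume "s \<in> ball 0 r"
      then have "(s, z - z0) \<in> cube r" using uz r by (auto simp: cube_def Basis_prod_def)
      from R(2)[OF this] show "f (0, z) + s *\<^sub>R R (s, z) = f (s, z)" by simp
    qed (use r in auto)
    then show ?thesis by (simp add: difference_quotient_def True vector_derivative_at)
  qed
  moreover have "ps_bound (0, z0) (r / 2) R (M / r)"
    using R(1) r by (auto intro: ps_bound_shrink)
  ultimately have "ps_bound p (r / 2) (difference_quotient f) (M / r)"
    unfolding p by (elim ps_bound_cong) auto
  then show "\<exists>r>0. \<exists>M. ps_bound p r (difference_quotient f) M"
    using r by (intro exI[of _ "r / 2"]) auto
qed

lemma power_series_coefficients_zero:
  fixes c :: "nat \<Rightarrow> real"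
  assumes r: "0 < r" and c: "\<And>t. \<bar>t\<bar> \<le> r \<Longrightarrow> ((\<lambda>n. t ^ n * c n) has_sum 0) UNIV"
  shows "c n = 0"
proof (rule ccontr)
  assume nz: "c n \<noteq> 0"
  define m where "m = (LEAST n. c n \<noteq> 0)"
  have m: "c m \<noteq> 0" using nz unfolding m_def by (rule LeastI)
  have lt: "c i = 0" if "i < m" for i using not_less_Least[of i "\<lambda>n. c n \<noteq> 0"] that by (auto simp: m_def)
  define d where "d i = (if i = 0 then 0 else c (i + m))" for i
  have s: "(\<lambda>i. c (i + m) * t ^ i) sums (if t = 0 then c m else 0)" if t: "norm t < r" for t
  proof (cases "t = 0")
    case True
    have "(\<lambda>i. c (i + m) * (0::real) ^ i) sums c (0 + m)" using powser_sums_zero[of "\<lambda>i. c (i + m)"] by simp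
    then show ?thesis by (simp add: True)
  next
    case False
    have "(\<lambda>n. t ^ n * c n) sums 0" using t by (intro has_sum_imp_sums c) auto
    then have "(\<lambda>n. t ^ (n + m) * c (n + m)) sums 0"
      by (subst sums_zero_iff_shift) (auto simp: lt)
    from sums_mult[OF this, of "inverse t ^ m"] False
    show ?thesis by (simp add: power_add field_simps)
  qed
  have s': "(\<lambda>i. c (i + m) * t ^ i) sums (c m + (if t = 0 then 0 else - c m))" if "norm t < r" for t
    using s[OF that] by (cases "t = 0") auto
  have "((\<lambda>t::real. c m + (if t = 0 then 0 else - c m)) \<longlongrightarrow> c (0 + m)) (at 0)"
    using powser_limit_0[OF r s'] by simp
  moreover have "((\<lambda>t. c m + (if t = 0 then 0 else - c m)) \<longlongrightarrow> 0) (at (0::real))"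
    by (rule tendsto_eventually) (auto simp: eventually_at intro!: exI[of _ 1])
  ultimately have "c (0 + m) = 0" by (rule LIM_unique)
  with m show False by simp
qed

text \<open>Induction on the number of variables: the series in the first variable has coefficients that are
series in the others, and they vanish by the one-dimensional case.\<close>

lemma multi_power_series_coefficients_zero:
  fixes a :: "('i \<Rightarrow> nat) \<Rightarrow> real"
  assumes "finite B" and r: "0 < r"
    and "\<And>y. (\<And>b. b \<in> B \<Longrightarrow> \<bar>y b\<bar> \<le> r) \<Longrightarrow> ((\<lambda>\<alpha>. (\<Prod>b\<in>B. y b ^ \<alpha> b) * a \<alpha>) has_sum 0) (B \<rightarrow>\<^sub>E UNIV)"
    and "\<alpha> \<in> B \<rightarrow>\<^sub>E UNIV"
  shows "a \<alpha> = 0"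
  using assms(1,3,4)
proof (induction B arbitrary: a \<alpha> rule: finite_induct)
  case empty
  from empty(1)[of "\<lambda>_. 0"] have "(a has_sum 0) {\<lambda>_. undefined}" by simp
  moreover have "(a has_sum a (\<lambda>_. undefined)) {\<lambda>_. undefined}" by (rule has_sum_finiteI) auto
  ultimately show ?case using empty(2) has_sum_unique by auto
next
  case (insert x B)
  let ?P = "B \<rightarrow>\<^sub>E (UNIV :: nat set)" and ?u = "\<lambda>(g, n). g(x := n)"
  have img: "PiE (insert x B) (\<lambda>_. UNIV) = ?u ` (?P \<times> (UNIV :: nat set))"
    unfolding PiE_insert_eq by (subst swap_product [symmetric]) (simp add: image_image case_prod_unfold)
  have inj: "inj_on ?u (?P \<times> (UNIV :: nat set))" using inj_combinator'[OF insert(2), of "\<lambda>_. UNIV"] by simp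
  have 1: "((\<lambda>(g, n). (\<Prod>b\<in>B. y b ^ g b) * (t ^ n * a (g(x := n)))) has_sum 0) (?P \<times> UNIV)"
    if y: "\<And>b. b \<in> B \<Longrightarrow> \<bar>y b\<bar> \<le> r" and t: "\<bar>t\<bar> \<le> r" for y t
  proof -
    have "((\<lambda>\<alpha>. (\<Prod>b\<in>insert x B. (y(x := t)) b ^ \<alpha> b) * a \<alpha>) has_sum 0) (?u ` (?P \<times> UNIV))"
      unfolding img[symmetric] using y t by (intro insert(4)) auto
    then have "(((\<lambda>\<alpha>. (\<Prod>b\<in>insert x B. (y(x := t)) b ^ \<alpha> b) * a \<alpha>) \<circ> ?u) has_sum 0) (?P \<times> UNIV)"
      by (simp only: has_sum_reindex[OF inj])
    moreover have "((\<lambda>\<alpha>. (\<Prod>b\<in>insert x B. (y(x := t)) b ^ \<alpha> b) * a \<alpha>) \<circ> ?u)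
        = (\<lambda>(g, n). (\<Prod>b\<in>B. y b ^ g b) * (t ^ n * a (g(x := n))))"
    proof
      fix gn :: "('i \<Rightarrow> nat) \<times> nat"
      obtain g n where gn: "gn = (g, n)" by force
      have "(\<Prod>b\<in>B. (y(x := t)) b ^ (g(x := n)) b) = (\<Prod>b\<in>B. y b ^ g b)"
        using insert(2) by (intro prod.cong) auto
      then show "((\<lambda>\<alpha>. (\<Prod>b\<in>insert x B. (y(x := t)) b ^ \<alpha> b) * a \<alpha>) \<circ> ?u) gn
        = (\<lambda>(g, n). (\<Prod>b\<in>B. y b ^ g b) * (t ^ n * a (g(x := n)))) gn"
        using insert(1,2) by (simp add: gn mult_ac)
    qed
    ultimately show ?thesis by simp
  qed
  have 2: "((\<lambda>g. (\<Prod>b\<in>B. y b ^ g b) * a (g(x := n))) has_sum 0) ?P"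
    if y: "\<And>b. b \<in> B \<Longrightarrow> \<bar>y b\<bar> \<le> r" for y n
  proof -
    have row: "(\<lambda>g. (\<Prod>b\<in>B. y b ^ g b) * a (g(x := n))) summable_on ?P" for n
    proof -
      have "(\<lambda>(g, n). (\<Prod>b\<in>B. y b ^ g b) * (r ^ n * a (g(x := n)))) summable_on (?P \<times> UNIV)"
      proof (rule has_sum_imp_summable)
        show "((\<lambda>(g, n). (\<Prod>b\<in>B. y b ^ g b) * (r ^ n * a (g(x := n)))) has_sum 0) (?P \<times> UNIV)"
          by (rule 1) (use y r in auto)
      qed
      then have "(\<lambda>(n, g). (\<Prod>b\<in>B. y b ^ g b) * (r ^ n * a (g(x := n)))) summable_on (UNIV \<times> ?P)"
        by (subst summable_on_swap) simp
      from summable_on_SigmaD1[OF this UNIV_I, of n]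
      have "(\<lambda>g. r ^ n * ((\<Prod>b\<in>B. y b ^ g b) * a (g(x := n)))) summable_on ?P" by (simp add: mult_ac)
      then show ?thesis by (subst (asm) summable_on_cmult_right') (use r in auto)
    qed
    define c where "c n = (\<Sum>\<^sub>\<infinity>g\<in>?P. (\<Prod>b\<in>B. y b ^ g b) * a (g(x := n)))" for n
    have "c n = 0"
    proof (rule power_series_coefficients_zero[OF r])
      fix t assume t: "\<bar>t\<bar> \<le> r"
      have "((\<lambda>(n, g). (\<Prod>b\<in>B. y b ^ g b) * (t ^ n * a (g(x := n)))) has_sum 0) (UNIV \<times> ?P)"
        using 1[OF y t] by (subst has_sum_swap) simp
      then show "((\<lambda>n. t ^ n * c n) has_sum 0) UNIV"
      proof (rule has_sum_SigmaD)
        fix n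
        show "((\<lambda>g. case (n, g) of (n, g) \<Rightarrow> (\<Prod>b\<in>B. y b ^ g b) * (t ^ n * a (g(x := n)))) has_sum t ^ n * c n) ?P"
          using has_sum_cmult_right[OF has_sum_infsum[OF row[of n]], of "t ^ n"] by (simp add: c_def mult_ac)
      qed
    qed
    then show ?thesis using row[of n] by (simp add: c_def has_sum_iff)
  qed
  from insert(5) img obtain g n where g: "g \<in> ?P" "\<alpha> = g(x := n)" by auto
  have "a (g(x := n)) = 0"
    by (rule insert(3)[of "\<lambda>g. a (g(x := n))", OF 2 g(1)])
  then show ?case unfolding g(2) .
qed

lemma has_sum_minus:
  fixes f g :: "'i \<Rightarrow> 'b::real_normed_vector"
  assumes "(f has_sum s) A" "(g has_sum t) A"
  shows "((\<lambda>x. f x - g x) has_sum s - t) A"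
  using has_sum_add[OF assms(1) has_sum_scaleR[OF assms(2), of "-1"]] by simp

lemma ps_coefficients_unique:
  fixes a b :: "('a::euclidean_space \<Rightarrow> nat) \<Rightarrow> real"
  assumes r: "0 < r"
    and a: "\<And>y. y \<in> cube r \<Longrightarrow> ((\<lambda>\<alpha>. mpow y \<alpha> * a \<alpha>) has_sum f y) multi_indices"
    and b: "\<And>y. y \<in> cube r \<Longrightarrow> ((\<lambda>\<alpha>. mpow y \<alpha> * b \<alpha>) has_sum f y) multi_indices"
    and al: "\<alpha> \<in> multi_indices"
  shows "a \<alpha> = b \<alpha>"
proof -
  have "a \<alpha> - b \<alpha> = 0"
  proof (rule multi_power_series_coefficients_zero[OF finite_Basis r _ al, of "\<lambda>\<alpha>. a \<alpha> - b \<alpha>"])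
    fix y :: "'a \<Rightarrow> real" assume y: "\<And>b. b \<in> Basis \<Longrightarrow> \<bar>y b\<bar> \<le> r"
    let ?y = "(\<Sum>b\<in>Basis. y b *\<^sub>R b) :: 'a"
    have yb: "?y \<bullet> b = y b" if "b \<in> Basis" for b
      using that by (simp add: inner_sum_left inner_Basis if_distrib cong: if_cong)
    have Y: "?y \<in> cube r" using yb y by (simp add: cube_def)
    have "((\<lambda>\<alpha>. mpow ?y \<alpha> * a \<alpha> - mpow ?y \<alpha> * b \<alpha>) has_sum f ?y - f ?y) multi_indices"
      by (rule has_sum_minus[OF a[OF Y] b[OF Y]])
    then show "((\<lambda>\<alpha>. (\<Prod>b\<in>Basis. y b ^ \<alpha> b) * (a \<alpha> - b \<alpha>)) has_sum 0) multi_indices"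
      using yb by (simp add: mpow_def algebra_simps)
  qed
  then show ?thesis by simp
qed

text \<open>Collecting a series in \<open>(x, w)\<close> by the powers of \<open>w\<close>. The bound is a Cauchy estimate.\<close>

lemma ps_bound_slices:
  fixes f :: "'a::euclidean_space \<times> 'w::euclidean_space \<Rightarrow> real"
  assumes r: "0 < r" and f: "ps_bound (x0, w0) r f M"
  obtains g where "\<And>\<beta>. \<beta> \<in> multi_indices \<Longrightarrow> ps_bound x0 r (g \<beta>) (M / r ^ mdeg \<beta>)"
    "\<And>y w. y \<in> cube r \<Longrightarrow> w \<in> cube r \<Longrightarrow>
       ((\<lambda>\<beta>. mpow w \<beta> * g \<beta> (x0 + y)) has_sum f (x0 + y, w0 + w)) multi_indices"
proof -
  let ?I = "multi_indices :: ('a \<times> 'w \<Rightarrow> nat) set" and ?W = "multi_indices :: ('w \<Rightarrow> nat) set"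
  obtain a where a: "(\<lambda>\<alpha>. norm (a \<alpha>) * r ^ mdeg \<alpha>) summable_on ?I"
     "(\<Sum>\<^sub>\<infinity>\<alpha>\<in>?I. norm (a \<alpha>) * r ^ mdeg \<alpha>) \<le> M"
     "\<forall>y\<in>cube r. ((\<lambda>\<alpha>. mpow y \<alpha> *\<^sub>R a \<alpha>) has_sum f ((x0, w0) + y)) ?I"
    using f unfolding ps_bound_def by blast
  define L where "L \<alpha> = (\<lambda>b. \<alpha> (b, 0))" for \<alpha> :: "'a \<times> 'w \<Rightarrow> nat"
  define R where "R \<alpha> = restrict (\<lambda>b. \<alpha> (0, b)) Basis" for \<alpha> :: "'a \<times> 'w \<Rightarrow> nat"
  have disj: "(\<lambda>u::'a. (u, 0::'w)) ` Basis \<inter> (\<lambda>v::'w. (0::'a, v)) ` Basis = {}" by auto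
  have pow: "mpow (y, w) \<alpha> = mpow y (L \<alpha>) * mpow w (R \<alpha>)" for y w \<alpha>
    unfolding mpow_def Basis_prod_def
    by (subst prod.union_disjoint) (auto simp: disj L_def R_def prod.reindex inj_on_def)
  have deg: "mdeg \<alpha> = mdeg (L \<alpha>) + mdeg (R \<alpha>)" for \<alpha> :: "'a \<times> 'w \<Rightarrow> nat"
    unfolding mdeg_def Basis_prod_def
    by (subst sum.union_disjoint) (auto simp: disj L_def R_def sum.reindex inj_on_def)
  define J where "J \<beta> = {\<alpha> \<in> ?I. R \<alpha> = \<beta>}" for \<beta>
  define g where "g \<beta> x = (\<Sum>\<^sub>\<infinity>\<alpha>\<in>J \<beta>. mpow (x - x0) (L \<alpha>) *\<^sub>R a \<alpha>)" for \<beta> x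
  define m where "m \<alpha> = norm (a \<alpha>) * r ^ mdeg (L \<alpha>)" for \<alpha>
  have mJ: "m \<alpha> = norm (a \<alpha>) * r ^ mdeg \<alpha> * (1 / r ^ mdeg \<beta>)" if "\<alpha> \<in> J \<beta>" for \<alpha> \<beta>
    using that r by (auto simp: m_def J_def deg power_add)
  have sJ: "(\<lambda>\<alpha>. norm (a \<alpha>) * r ^ mdeg \<alpha>) summable_on J \<beta>" for \<beta>
    by (rule summable_on_subset_banach[OF a(1)]) (auto simp: J_def)
  have sm: "m summable_on J \<beta>" for \<beta>
    using summable_on_cmult_left[OF sJ[of \<beta>], of "1 / r ^ mdeg \<beta>"]
    by (subst summable_on_cong[OF mJ]) auto
  have mM: "infsum m (J \<beta>) \<le> M / r ^ mdeg \<beta>" for \<beta>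
  proof -
    have "infsum m (J \<beta>) = (\<Sum>\<^sub>\<infinity>\<alpha>\<in>J \<beta>. norm (a \<alpha>) * r ^ mdeg \<alpha> * (1 / r ^ mdeg \<beta>))"
      by (rule infsum_cong) (rule mJ)
    also have "\<dots> = (\<Sum>\<^sub>\<infinity>\<alpha>\<in>J \<beta>. norm (a \<alpha>) * r ^ mdeg \<alpha>) * (1 / r ^ mdeg \<beta>)"
      by (rule infsum_cmult_left')
    also have "\<dots> \<le> M * (1 / r ^ mdeg \<beta>)"
    proof (rule mult_right_mono)
      have "(\<Sum>\<^sub>\<infinity>\<alpha>\<in>J \<beta>. norm (a \<alpha>) * r ^ mdeg \<alpha>) \<le> (\<Sum>\<^sub>\<infinity>\<alpha>\<in>?I. norm (a \<alpha>) * r ^ mdeg \<alpha>)"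
        by (rule infsum_mono_neutral[OF sJ a(1)]) (use r in \<open>auto simp: J_def\<close>)
      then show "(\<Sum>\<^sub>\<infinity>\<alpha>\<in>J \<beta>. norm (a \<alpha>) * r ^ mdeg \<alpha>) \<le> M" using a(2) by linarith
    qed (use r in auto)
    finally show ?thesis by simp
  qed
  have gs: "((\<lambda>\<alpha>. mpow y (L \<alpha>) *\<^sub>R a \<alpha>) has_sum g \<beta> (x0 + y)) (J \<beta>)" if y: "y \<in> cube r" for y \<beta>
  proof -
    have "(\<lambda>\<alpha>. norm (mpow y (L \<alpha>) *\<^sub>R a \<alpha>)) summable_on J \<beta>"
    proof (rule Infinite_Sum.abs_summable_on_comparison_test'[OF sm])
      show "norm (mpow y (L \<alpha>) *\<^sub>R a \<alpha>) \<le> m \<alpha>" for \<alpha>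
        using mult_right_mono[OF abs_mpow_le[OF y, of "L \<alpha>"], of "norm (a \<alpha>)"]
        by (simp add: m_def abs_mult mult_ac)
    qed
    then have "(\<lambda>\<alpha>. mpow y (L \<alpha>) *\<^sub>R a \<alpha>) summable_on J \<beta>" by (rule abs_summable_summable)
    then show ?thesis by (simp add: g_def)
  qed
  show ?thesis
  proof (rule that)
    fix \<beta>
    show "ps_bound x0 r (g \<beta>) (M / r ^ mdeg \<beta>)"
    proof (rule ps_bound_sum[OF _ _ sm mM, where F = "\<lambda>\<alpha> x. mpow (x - x0) (L \<alpha>) *\<^sub>R a \<alpha>"])
      show "ps_bound x0 r (\<lambda>x. mpow (x - x0) (L \<alpha>) *\<^sub>R a \<alpha>) (m \<alpha>)" for \<alpha>
        unfolding m_def using r by (intro ps_bound_monomial) auto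
    qed (use r gs in auto)
  next
    fix y :: 'a and w :: 'w assume y: "y \<in> cube r" and w: "w \<in> cube r"
    then have "(y, w) \<in> cube r" using r by (auto simp: cube_def Basis_prod_def)
    with a(3) have hs: "((\<lambda>\<alpha>. mpow (y, w) \<alpha> *\<^sub>R a \<alpha>) has_sum f (x0 + y, w0 + w)) ?I" by force
    have inj: "inj_on snd (Sigma ?W J)" by (auto simp: inj_on_def J_def)
    have "snd ` Sigma ?W J = ?I" by (force simp: J_def R_def image_iff)
    with hs have "((\<lambda>\<alpha>. mpow (y, w) \<alpha> *\<^sub>R a \<alpha>) has_sum f (x0 + y, w0 + w)) (snd ` Sigma ?W J)" by simp
    then have "(((\<lambda>\<alpha>. mpow (y, w) \<alpha> *\<^sub>R a \<alpha>) \<circ> snd) has_sum f (x0 + y, w0 + w)) (Sigma ?W J)"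
      by (simp only: has_sum_reindex[OF inj])
    then show "((\<lambda>\<beta>. mpow w \<beta> * g \<beta> (x0 + y)) has_sum f (x0 + y, w0 + w)) ?W"
    proof (rule has_sum_SigmaD)
      fix \<beta>
      have "((\<lambda>\<alpha>. mpow w \<beta> *\<^sub>R (mpow y (L \<alpha>) *\<^sub>R a \<alpha>)) has_sum mpow w \<beta> * g \<beta> (x0 + y)) (J \<beta>)"
        using has_sum_scaleR[OF gs[OF y]] by simp
      also have "?this \<longleftrightarrow> ((\<lambda>\<alpha>. ((\<lambda>\<alpha>. mpow (y, w) \<alpha> *\<^sub>R a \<alpha>) \<circ> snd) (\<beta>, \<alpha>)) has_sum mpow w \<beta> * g \<beta> (x0 + y)) (J \<beta>)"
        by (rule has_sum_cong) (auto simp: J_def pow)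
      finally show "((\<lambda>\<alpha>. ((\<lambda>\<alpha>. mpow (y, w) \<alpha> *\<^sub>R a \<alpha>) \<circ> snd) (\<beta>, \<alpha>)) has_sum mpow w \<beta> * g \<beta> (x0 + y)) (J \<beta>)" .
    qed
  qed
qed

text \<open>The local slices around different points \<open>x\<close> agree on overlaps by uniqueness of coefficients, so they
patch to functions defined for all \<open>x\<close>.\<close>

lemma global_slices:
  fixes f :: "'a::euclidean_space \<times> 'w::euclidean_space \<Rightarrow> real"
  assumes r: "0 < r" and f: "\<And>x. ps_bound (x, w0) r f M"
  obtains g where "\<And>\<beta> x. \<beta> \<in> multi_indices \<Longrightarrow> ps_bound x r (g \<beta>) (M / r ^ mdeg \<beta>)"
    "\<And>x w. w \<in> cube r \<Longrightarrow> ((\<lambda>\<beta>. mpow w \<beta> * g \<beta> x) has_sum f (x, w0 + w)) multi_indices"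
proof -
  let ?Q = "\<lambda>x g. (\<forall>\<beta>\<in>multi_indices. ps_bound x r (g \<beta>) (M / r ^ mdeg \<beta>)) \<and>
    (\<forall>y\<in>cube r. \<forall>w\<in>cube r. ((\<lambda>\<beta>. mpow w \<beta> * g \<beta> (x + y)) has_sum f (x + y, w0 + w)) multi_indices)"
  have "\<forall>x. \<exists>g. ?Q x g"
  proof
    fix x
    show "\<exists>g. ?Q x g"
      by (rule ps_bound_slices[OF r f[of x]]) (rule exI, intro conjI ballI)
  qed
  from choice[OF this] obtain G where G': "\<forall>x. ?Q x (G x)" ..
  have G: "ps_bound x r (G x \<beta>) (M / r ^ mdeg \<beta>)" if "\<beta> \<in> multi_indices" for x \<beta>
    using spec[OF G', of x] that by simp
  have G2: "((\<lambda>\<beta>. mpow w \<beta> * G x \<beta> (x + y)) has_sum f (x + y, w0 + w)) multi_indices"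
    if "y \<in> cube r" "w \<in> cube r" for x y w
    using spec[OF G', of x] that by simp
  have eq: "G x \<beta> (x + y) = G (x + y) \<beta> (x + y)" if "\<beta> \<in> multi_indices" "y \<in> cube r" for x y \<beta>
  proof (rule ps_coefficients_unique[OF r _ _ that(1), of "\<lambda>\<beta>. G x \<beta> (x + y)" "\<lambda>w. f (x + y, w0 + w)" "\<lambda>\<beta>. G (x + y) \<beta> (x + y)"])
    fix w :: 'w assume w: "w \<in> cube r"
    show "((\<lambda>\<beta>. mpow w \<beta> * G x \<beta> (x + y)) has_sum f (x + y, w0 + w)) multi_indices"
      by (rule G2[OF that(2) w])
    show "((\<lambda>\<beta>. mpow w \<beta> * G (x + y) \<beta> (x + y)) has_sum f (x + y, w0 + w)) multi_indices"
      using G2[of 0 w "x + y"] r w by simp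
  qed
  show ?thesis
  proof (rule that[of "\<lambda>\<beta> x. G x \<beta> x"])
    fix \<beta> :: "'w \<Rightarrow> nat" and x assume \<beta>: "\<beta> \<in> multi_indices"
    show "ps_bound x r (\<lambda>x. G x \<beta> x) (M / r ^ mdeg \<beta>)"
      by (rule ps_bound_cong[OF G[OF \<beta>]]) (rule eq[OF \<beta>])
  next
    fix x and w :: 'w assume w: "w \<in> cube r"
    show "((\<lambda>\<beta>. mpow w \<beta> * G x \<beta> x) has_sum f (x, w0 + w)) multi_indices"
      using G2[of 0 w x] r w by simp
  qed
qed

section \<open>Periodic functions and their Fourier coefficients\<close>

text \<open>Functions on a torus are lattice-periodic functions on its universal cover. An abstract Euclidean space
with its standard basis serves both for the angles \<open>\<theta>\<close> alone and for the pairs \<open>(\<theta>, \<tau>)\<close>.\<close>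

definition lattice :: "'a::euclidean_space set" where
  "lattice = {q. \<forall>b\<in>Basis. q \<bullet> b \<in> \<int>}"

definition lattice_periodic :: "('a::euclidean_space \<Rightarrow> 'b) \<Rightarrow> bool" where
  "lattice_periodic f \<longleftrightarrow> (\<forall>x. \<forall>q\<in>lattice. f (x + q) = f x)"

lemma lattice_periodicD: "lattice_periodic f \<Longrightarrow> q \<in> lattice \<Longrightarrow> f (x + q) = f x"
  by (simp add: lattice_periodic_def)

lemma Basis_in_lattice: "b \<in> Basis \<Longrightarrow> b \<in> lattice"
  by (auto simp: lattice_def inner_Basis)

lemma uminus_in_lattice: "q \<in> lattice \<Longrightarrow> - q \<in> lattice"
  by (auto simp: lattice_def)

lemma lattice_representative:
  obtains y where "y \<in> cbox 0 (One :: 'a::euclidean_space)" "x - y \<in> lattice"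
proof
  let ?q = "\<Sum>b\<in>Basis. of_int \<lfloor>x \<bullet> b\<rfloor> *\<^sub>R b :: 'a"
  have q: "?q \<bullet> b = of_int \<lfloor>x \<bullet> b\<rfloor>" if "b \<in> Basis" for b
    using that by (simp add: inner_sum_left inner_Basis if_distrib cong: if_cong)
  show "x - (x - ?q) \<in> lattice" using q by (auto simp: lattice_def)
  show "x - ?q \<in> cbox 0 One"
    using q by (auto simp: mem_box inner_diff_left intro: less_imp_le) linarith+
qed

lemma lattice_periodic_representative:
  assumes "lattice_periodic f"
  obtains y where "y \<in> cbox 0 (One :: 'a::euclidean_space)" "f x = f y"
proof -
  obtain y where y: "y \<in> cbox 0 One" "x - y \<in> lattice" by (rule lattice_representative)
  have "f (y + (x - y)) = f y" using assms y(2) by (rule lattice_periodicD)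
  then show ?thesis using that y(1) by simp
qed

text \<open>The shifted unit cube differs from the unit cube by a slab that periodicity moves from one side to the
other.\<close>

lemma integral_periodic_shift:
  fixes f :: "'a::euclidean_space \<Rightarrow> 'b::euclidean_space"
  assumes cont: "continuous_on UNIV f" and per: "lattice_periodic f" and b: "b \<in> Basis"
    and s: "0 \<le> s" "s \<le> 1"
  shows "integral (cbox 0 One) (\<lambda>x. f (x + s *\<^sub>R b)) = integral (cbox 0 One) f"
proof -
  let ?c = "s *\<^sub>R b"
  have int: "f integrable_on cbox u v" for u v
    by (intro integrable_continuous continuous_on_subset[OF cont]) auto
  have ib: "b' \<bullet> b = (if b' = b then 1 else 0)" "b \<bullet> b' = (if b' = b then 1 else 0)" if "b' \<in> Basis" for b'
    using that b by (auto simp: inner_Basis)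
  have "integral (cbox 0 One) (\<lambda>x. f (x + ?c)) = integral (cbox ?c (One + ?c)) f"
    using integral_shift_cbox[of ?c ?c "One + ?c" f] by simp
  also have "\<dots> = integral (cbox ?c (One + ?c) \<inter> {x. x \<bullet> b \<le> 1}) f + integral (cbox ?c (One + ?c) \<inter> {x. x \<bullet> b \<ge> 1}) f"
    by (rule integral_split[OF int b])
  also have "cbox ?c (One + ?c) \<inter> {x. x \<bullet> b \<le> 1} = cbox 0 One \<inter> {x. x \<bullet> b \<ge> s}"
    using b s by (auto simp: mem_box inner_add_left ib split: if_splits) (force simp: ib)+
  also have "cbox ?c (One + ?c) \<inter> {x. x \<bullet> b \<ge> 1} = cbox b (One + ?c)"
    using b s by (auto simp: mem_box inner_add_left ib split: if_splits) (force simp: ib)+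
  also have "integral (cbox b (One + ?c)) f = integral (cbox (b - b) (One + ?c - b)) (\<lambda>x. f (x + b))"
    by (rule integral_shift_cbox[symmetric])
  also have "(\<lambda>x. f (x + b)) = f"
    using lattice_periodicD[OF per Basis_in_lattice[OF b]] by auto
  also have "cbox (b - b) (One + ?c - b) = cbox 0 One \<inter> {x. x \<bullet> b \<le> s}"
    using b s by (auto simp: mem_box inner_add_left inner_diff_left ib split: if_splits) (force simp: ib)+
  also have "integral (cbox 0 One \<inter> {x. x \<bullet> b \<ge> s}) f + integral (cbox 0 One \<inter> {x. x \<bullet> b \<le> s}) f
      = integral (cbox 0 One) f"
    using integral_split[OF int b, of 0 One s] by simp
  finally show ?thesis .
qed

text \<open>A frequency assigns an integer to every basis vector; its values off the basis are ignored, and the set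
\<open>frequencies\<close> below fixes them where uniqueness matters.\<close>

definition phase :: "('a::euclidean_space \<Rightarrow> int) \<Rightarrow> 'a \<Rightarrow> real" where
  "phase \<kappa> x = (\<Sum>b\<in>Basis. of_int (\<kappa> b) * (x \<bullet> b))"

definition character :: "('a::euclidean_space \<Rightarrow> int) \<Rightarrow> 'a \<Rightarrow> complex" where
  "character \<kappa> x = cis (2 * pi * phase \<kappa> x)"

lemma phase_add: "phase \<kappa> (x + y) = phase \<kappa> x + phase \<kappa> y"
  by (simp add: phase_def inner_add_left ring_distribs sum.distrib)

lemma phase_scaleR: "phase \<kappa> (t *\<^sub>R x) = t * phase \<kappa> x"
  by (simp add: phase_def sum_distrib_left mult_ac)

lemma phase_Basis: "b \<in> Basis \<Longrightarrow> phase \<kappa> b = of_int (\<kappa> b)"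
  by (simp add: phase_def inner_Basis if_distrib cong: if_cong)

lemma continuous_on_phase [continuous_intros]:
  "continuous_on S f \<Longrightarrow> continuous_on S (\<lambda>x. phase \<kappa> (f x))"
  unfolding phase_def by (intro continuous_intros)

lemma character_add: "character \<kappa> (x + y) = character \<kappa> x * character \<kappa> y"
  by (simp add: character_def phase_add cis_mult ring_distribs)

lemma norm_character [simp]: "norm (character \<kappa> x) = 1"
  by (simp add: character_def)

lemma continuous_on_character [continuous_intros]: "continuous_on S (character \<kappa>)"
  unfolding character_def[abs_def] cis_conv_exp by (intro continuous_intros)

lemma character_mult: "character \<kappa> x * character \<kappa>' x = character (\<lambda>b. \<kappa> b + \<kappa>' b) x"
  by (simp add: character_def cis_mult phase_def sum.distrib ring_distribs)

lemma cnj_character: "cnj (character \<kappa> x) = character (\<lambda>b. - \<kappa> b) x"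
  by (simp add: character_def cis_cnj phase_def sum_negf)

lemma character_lattice:
  assumes "q \<in> lattice" shows "character \<kappa> q = 1"
proof -
  have "phase \<kappa> q \<in> \<int>" using assms by (auto simp: phase_def lattice_def intro!: Ints_sum Ints_mult)
  then obtain n where "phase \<kappa> q = of_int n" by (auto elim: Ints_cases)
  then show ?thesis using cis_multiple_2pi[of "of_int n"] by (simp add: character_def mult_ac)
qed

lemma lattice_periodic_character: "lattice_periodic (character \<kappa>)"
  by (simp add: lattice_periodic_def character_add character_lattice)

definition fourier :: "('a::euclidean_space \<Rightarrow> complex) \<Rightarrow> ('a \<Rightarrow> int) \<Rightarrow> complex" where
  "fourier f \<kappa> = integral (cbox 0 One) (\<lambda>x. f x * cnj (character \<kappa> x))"

lemma fourier_shift: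
  assumes cont: "continuous_on UNIV f" and per: "lattice_periodic f" and b: "b \<in> Basis"
    and s: "0 \<le> s" "s \<le> 1"
  shows "fourier (\<lambda>x. f (x + s *\<^sub>R b)) \<kappa> = cis (2 * pi * of_int (\<kappa> b) * s) * fourier f \<kappa>"
proof -
  let ?g = "\<lambda>x. f x * cnj (character \<kappa> x)"
  have "continuous_on UNIV ?g" by (intro continuous_intros cont)
  moreover have "lattice_periodic ?g"
    using per by (simp add: lattice_periodic_def character_add character_lattice)
  ultimately have "integral (cbox 0 One) (\<lambda>x. ?g (x + s *\<^sub>R b)) = fourier f \<kappa>"
    using integral_periodic_shift[OF _ _ b s] unfolding fourier_def by blast
  moreover have "character \<kappa> (s *\<^sub>R b) = cis (2 * pi * of_int (\<kappa> b) * s)"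
    using b by (simp add: character_def phase_scaleR phase_Basis mult_ac)
  then have eq: "f (x + s *\<^sub>R b) * cnj (character \<kappa> x)
      = cis (2 * pi * of_int (\<kappa> b) * s) * ?g (x + s *\<^sub>R b)" for x
    by (simp add: character_add cis_cnj cis_mult mult_ac)
  have "fourier (\<lambda>x. f (x + s *\<^sub>R b)) \<kappa>
      = integral (cbox 0 One) (\<lambda>x. cis (2 * pi * of_int (\<kappa> b) * s) * ?g (x + s *\<^sub>R b))"
    unfolding fourier_def eq ..
  ultimately show ?thesis by simp
qed

text \<open>A shift along \<open>b\<close> by \<open>1 / (2 * \<bar>\<kappa> b\<bar>)\<close> changes the sign of the character and keeps its integral.\<close>

lemma integral_character:
  assumes "b \<in> Basis" "\<kappa> b \<noteq> 0"
  shows "integral (cbox 0 One) (character \<kappa>) = 0"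
proof -
  define s where "s = 1 / (2 * \<bar>of_int (\<kappa> b)\<bar> :: real)"
  have "1 \<le> \<bar>of_int (\<kappa> b) :: real\<bar>" using assms(2) by linarith
  then have s: "0 \<le> s" "s \<le> 1" by (auto simp: s_def field_simps)
  have "2 * pi * (s * of_int (\<kappa> b)) = (if \<kappa> b > 0 then pi else - pi)"
    using assms(2) by (auto simp: s_def field_simps)
  then have "cis (2 * pi * (s * of_int (\<kappa> b))) = - 1" by (simp add: complex_eq_iff)
  then have "character \<kappa> (s *\<^sub>R b) = - 1"
    using assms(1) by (simp add: character_def phase_scaleR phase_Basis)
  then have "character \<kappa> (x + s *\<^sub>R b) = - character \<kappa> x" for x by (simp add: character_add)
  with integral_periodic_shift[OF continuous_on_character lattice_periodic_character assms(1) s, of \<kappa>]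
  show ?thesis by simp
qed

text \<open>Termwise integration under a summable majorant. It is needed for series indexed by multi-indices and by
frequencies, hence the unordered sums.\<close>

lemma integral_has_sum:
  fixes F :: "'j \<Rightarrow> 'a::euclidean_space \<Rightarrow> 'b::euclidean_space"
  assumes cont: "\<And>j. j \<in> J \<Longrightarrow> continuous_on (cbox a b) (F j)"
    and le: "\<And>j x. j \<in> J \<Longrightarrow> x \<in> cbox a b \<Longrightarrow> norm (F j x) \<le> m j" and m: "m summable_on J"
    and f: "\<And>x. x \<in> cbox a b \<Longrightarrow> ((\<lambda>j. F j x) has_sum f x) J"
  shows "((\<lambda>j. integral (cbox a b) (F j)) has_sum integral (cbox a b) f) J" "continuous_on (cbox a b) f"
proof -
  let ?F = "\<lambda>j. if j \<in> J then F j else (\<lambda>_. 0)"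
  have u: "uniform_limit (cbox a b) (\<lambda>X x. \<Sum>j\<in>X. F j x) f (finite_subsets_at_top J)"
    by (rule Weierstrass_m_test_general'[OF le f m])
  have ev: "\<forall>\<^sub>F X in finite_subsets_at_top J. X \<subseteq> J"
    by (rule eventually_finite_subsets_at_top_weakI) auto
  then have "\<forall>\<^sub>F X in finite_subsets_at_top J. \<forall>x\<in>cbox a b. (\<Sum>j\<in>X. F j x) = (\<Sum>j\<in>X. ?F j x)"
    by eventually_elim (auto intro!: sum.cong)
  then have u': "uniform_limit (cbox a b) (\<lambda>X x. \<Sum>j\<in>X. ?F j x) f (finite_subsets_at_top J)"
    using u uniform_limit_cong[of "cbox a b" "\<lambda>X x. \<Sum>j\<in>X. F j x" "\<lambda>X x. \<Sum>j\<in>X. ?F j x" "finite_subsets_at_top J" f f] by blast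
  have c: "continuous_on (cbox a b) (\<lambda>x. \<Sum>j\<in>X. ?F j x)" for X
    by (intro continuous_on_sum) (auto intro: cont)
  show "continuous_on (cbox a b) f"
    by (rule uniform_limit_theorem[OF _ u']) (use c in auto)
  obtain I K where IK: "\<And>X. ((\<lambda>x. \<Sum>j\<in>X. ?F j x) has_integral I X) (cbox a b)"
    "(f has_integral K) (cbox a b)" "(I \<longlongrightarrow> K) (finite_subsets_at_top J)"
    using uniform_limit_integral_cbox[OF u' c finite_subsets_at_top_neq_bot] by blast
  have "\<forall>\<^sub>F X in finite_subsets_at_top J. I X = (\<Sum>j\<in>X. integral (cbox a b) (F j))"
    using ev
  proof eventually_elim
    case (elim X)
    have "I X = integral (cbox a b) (\<lambda>x. \<Sum>j\<in>X. ?F j x)" by (rule integral_unique[OF IK(1), symmetric])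
    also have "\<dots> = (\<Sum>j\<in>X. integral (cbox a b) (?F j))"
      using elim cont by (cases "finite X") (auto intro!: integral_sum integrable_continuous)
    also have "\<dots> = (\<Sum>j\<in>X. integral (cbox a b) (F j))" using elim by (auto intro!: sum.cong)
    finally show ?case .
  qed
  with IK(3) have "((\<lambda>X. \<Sum>j\<in>X. integral (cbox a b) (F j)) \<longlongrightarrow> K) (finite_subsets_at_top J)"
    by (rule Lim_transform_eventually)
  then show "((\<lambda>j. integral (cbox a b) (F j)) has_sum integral (cbox a b) f) J"
    using IK(2) by (simp add: has_sum_def integral_unique)
qed

inductive trig_poly :: "('a::euclidean_space \<Rightarrow> complex) \<Rightarrow> bool" where
  character: "trig_poly (\<lambda>x. c * character \<kappa> x)"
| add: "trig_poly f \<Longrightarrow> trig_poly g \<Longrightarrow> trig_poly (\<lambda>x. f x + g x)"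

lemma trig_poly_const: "trig_poly (\<lambda>x. c)"
  using trig_poly.character[of c "\<lambda>_. 0"] by (simp add: character_def phase_def)

lemma trig_poly_mult:
  assumes "trig_poly f" "trig_poly g" shows "trig_poly (\<lambda>x. f x * g x)"
  using assms(1)
proof induction
  case (character c \<kappa>)
  from assms(2) show ?case
  proof induction
    case (character c' \<kappa>')
    have "(\<lambda>x. c * character \<kappa> x * (c' * character \<kappa>' x)) = (\<lambda>x. (c * c') * character (\<lambda>b. \<kappa> b + \<kappa>' b) x)"
      by (simp add: character_mult[symmetric] mult_ac)
    then show ?case by (simp only: trig_poly.character)
  next
    case (add f g)
    then show ?case by (simp only: ring_distribs trig_poly.add)
  qed
next
  case (add f g)
  then show ?case by (simp only: ring_distribs trig_poly.add)
qed

lemma trig_poly_sum: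
  assumes "finite I" "\<And>i. i \<in> I \<Longrightarrow> trig_poly (f i)"
  shows "trig_poly (\<lambda>x. \<Sum>i\<in>I. f i x)"
  using assms by (induction I rule: finite_induct) (auto intro: trig_poly_const trig_poly.add)

lemma trig_poly_cos_sin:
  fixes b :: "'a::euclidean_space"
  assumes "b \<in> Basis"
  shows "trig_poly (\<lambda>x. of_real (cos (2 * pi * (x \<bullet> b))))" "trig_poly (\<lambda>x. of_real (sin (2 * pi * (x \<bullet> b))))"
proof -
  let ?\<kappa> = "\<lambda>b'. if b' = b then 1 else 0 :: int"
  let ?\<kappa>' = "\<lambda>b'. if b' = b then - 1 else 0 :: int"
  have p: "phase ?\<kappa> x = x \<bullet> b" "phase ?\<kappa>' x = - (x \<bullet> b)" for x
    using assms by (simp_all add: phase_def if_distrib[of of_int] if_distrib[of "\<lambda>z. z * _"] cong: if_cong)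
  have e1: "(\<lambda>x. of_real (cos (2 * pi * (x \<bullet> b)))) = (\<lambda>x. 1/2 * character ?\<kappa> x + 1/2 * character ?\<kappa>' x)"
    by (auto simp: character_def p complex_eq_iff)
  have e2: "(\<lambda>x. of_real (sin (2 * pi * (x \<bullet> b)))) = (\<lambda>x. (- \<i>/2) * character ?\<kappa> x + (\<i>/2) * character ?\<kappa>' x)"
    by (auto simp: character_def p complex_eq_iff)
  show "trig_poly (\<lambda>x. of_real (cos (2 * pi * (x \<bullet> b))))" unfolding e1 by (intro trig_poly.intros)
  show "trig_poly (\<lambda>x. of_real (sin (2 * pi * (x \<bullet> b))))" unfolding e2 by (intro trig_poly.intros)
qed

lemma continuous_on_trig_poly: "trig_poly f \<Longrightarrow> continuous_on S f"
  by (induction rule: trig_poly.induct) (auto intro!: continuous_intros)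

text \<open>The product of the circles, as a subset of a Euclidean space. Continuous functions on the torus become
continuous functions on a compact set, to which the Stone-Weierstrass theorem applies, and polynomials
pull back to trigonometric polynomials.\<close>

definition torus_embedding :: "'a::euclidean_space \<Rightarrow> 'a \<times> 'a" where
  "torus_embedding x = (\<Sum>b\<in>Basis. cos (2 * pi * (x \<bullet> b)) *\<^sub>R b, \<Sum>b\<in>Basis. sin (2 * pi * (x \<bullet> b)) *\<^sub>R b)"

lemma torus_embedding_eq_imp:
  assumes "torus_embedding x = torus_embedding y" shows "x - y \<in> lattice"
proof -
  have "x \<bullet> b - y \<bullet> b \<in> \<int>" if b: "b \<in> Basis" for b
  proof -
    have c: "fst (torus_embedding x) \<bullet> b = cos (2 * pi * (x \<bullet> b))" for x
      using b by (simp add: torus_embedding_def inner_sum_left inner_Basis if_distrib cong: if_cong)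
    have s: "snd (torus_embedding x) \<bullet> b = sin (2 * pi * (x \<bullet> b))" for x
      using b by (simp add: torus_embedding_def inner_sum_left inner_Basis if_distrib cong: if_cong)
    have "sin (2 * pi * (x \<bullet> b)) = sin (2 * pi * (y \<bullet> b)) \<and> cos (2 * pi * (x \<bullet> b)) = cos (2 * pi * (y \<bullet> b))"
      using c[of x] c[of y] s[of x] s[of y] assms by simp
    then obtain n :: int where "2 * pi * (x \<bullet> b) = 2 * pi * (y \<bullet> b) + 2 * pi * of_int n"
      unfolding sin_cos_eq_iff by blast
    then have "2 * pi * (x \<bullet> b - y \<bullet> b) = 2 * pi * of_int n" by (simp add: ring_distribs)
    then have "x \<bullet> b - y \<bullet> b = of_int n" by simp
    then show ?thesis by simp
  qed
  then show ?thesis by (simp add: lattice_def inner_diff_left)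
qed

lemma trig_poly_polynomial_embedding:
  fixes p :: "'a::euclidean_space \<times> 'a \<Rightarrow> real"
  assumes "real_polynomial_function p"
  shows "trig_poly (\<lambda>x. of_real (p (torus_embedding x)))"
  using assms
proof induction
  case (linear f)
  interpret bounded_linear f by fact
  have "f (torus_embedding x) = (\<Sum>b\<in>Basis. cos (2 * pi * (x \<bullet> b)) * f (b, 0)) + (\<Sum>b\<in>Basis. sin (2 * pi * (x \<bullet> b)) * f (0, b))" for x
  proof -
    have "torus_embedding x = (\<Sum>b\<in>Basis. cos (2 * pi * (x \<bullet> b)) *\<^sub>R (b, 0)) + (\<Sum>b\<in>Basis. sin (2 * pi * (x \<bullet> b)) *\<^sub>R (0, b))"
      by (simp add: torus_embedding_def prod_eq_iff fst_sum snd_sum)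
    then show ?thesis by (simp only: add sum scaleR real_scaleR_def)
  qed
  then show ?case
    by (simp add: del: of_real_add, simp only: of_real_add of_real_sum of_real_mult)
       (intro trig_poly.add trig_poly_sum finite_Basis trig_poly_mult trig_poly_cos_sin trig_poly_const)
next
  case (const c)
  show ?case by (rule trig_poly_const)
next
  case (add f g)
  then show ?case by (simp add: trig_poly.add)
next
  case (mult f g)
  then show ?case by (simp add: trig_poly_mult)
qed

lemma continuous_on_torus_embedding: "continuous_on S torus_embedding"
  unfolding torus_embedding_def[abs_def] by (intro continuous_intros)

lemma trig_poly_approximation_real:
  fixes f :: "'a::euclidean_space \<Rightarrow> real"
  assumes cont: "continuous_on UNIV f" and per: "lattice_periodic f" and e: "0 < e"
  obtains P where "trig_poly P" "\<And>x. norm (of_real (f x) - P x) < e"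
proof -
  let ?C = "cbox 0 (One :: 'a)" and ?E = "torus_embedding :: 'a \<Rightarrow> 'a \<times> 'a"
  define g where "g z = f (SOME x. ?E x = z)" for z
  have gE: "g (?E x) = f x" for x
  proof -
    define y where "y = (SOME y. ?E y = ?E x)"
    have "?E y = ?E x" unfolding y_def by (rule someI) (rule refl)
    then have "y - x \<in> lattice" by (rule torus_embedding_eq_imp)
    from lattice_periodicD[OF per this, of x] have "f y = f x" by simp
    then show ?thesis by (simp add: g_def y_def)
  qed
  have comp: "compact (?E ` ?C)"
    by (rule compact_continuous_image[OF continuous_on_torus_embedding compact_cbox])
  have "continuous_on (?E ` ?C) g"
    unfolding continuous_on_closed_vimage[OF compact_imp_closed[OF comp]]
  proof (intro allI impI)
    fix B :: "real set" assume B: "closed B"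
    have "closed (f -` B)"
      by (rule continuous_closed_vimage[OF B]) (use cont in \<open>simp add: continuous_on_eq_continuous_at\<close>)
    then have "compact (?C \<inter> f -` B)" by (intro compact_Int_closed compact_cbox)
    then have "compact (?E ` (?C \<inter> f -` B))"
      by (intro compact_continuous_image continuous_on_torus_embedding)
    moreover have "?E ` (?C \<inter> f -` B) = g -` B \<inter> ?E ` ?C" using gE by auto
    ultimately show "closed (g -` B \<inter> ?E ` ?C)" by (simp add: compact_imp_closed)
  qed
  from Stone_Weierstrass_real_polynomial_function[OF comp this e]
  obtain p where p: "real_polynomial_function p" "\<And>z. z \<in> ?E ` ?C \<Longrightarrow> \<bar>g z - p z\<bar> < e" by blast
  have Elat: "?E (x + q) = ?E x" if "q \<in> lattice" for x q
  proof -
    have "cos (2 * pi * ((x + q) \<bullet> b)) = cos (2 * pi * (x \<bullet> b)) \<and> sin (2 * pi * ((x + q) \<bullet> b)) = sin (2 * pi * (x \<bullet> b))"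
      if "b \<in> Basis" for b
    proof -
      have "q \<bullet> b \<in> \<int>" using that \<open>q \<in> lattice\<close> by (simp add: lattice_def)
      then obtain n where "q \<bullet> b = of_int n" by (rule Ints_cases)
      then have "2 * pi * ((x + q) \<bullet> b) = 2 * pi * (x \<bullet> b) + 2 * pi * of_int n"
        by (simp add: inner_add_left ring_distribs)
      then show ?thesis using sin_cos_eq_iff[of "2 * pi * ((x + q) \<bullet> b)" "2 * pi * (x \<bullet> b)"] by blast
    qed
    then show ?thesis by (simp add: torus_embedding_def)
  qed
  show ?thesis
  proof (rule that[OF trig_poly_polynomial_embedding[OF p(1)]])
    fix x
    obtain y where y: "y \<in> ?C" "x - y \<in> lattice" by (rule lattice_representative)
    have "?E x = ?E y" using Elat[OF y(2), of y] by simp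
    then have "\<bar>f x - p (?E x)\<bar> < e" using p(2)[of "?E y"] y(1) gE[of x] by auto
    then show "norm (of_real (f x) - of_real (p (?E x)) :: complex) < e"
      by (simp flip: of_real_diff)
  qed
qed

text \<open>Completeness of the characters: \<open>f\<close> is orthogonal to all trigonometric polynomials, which approximate its
conjugate uniformly, so the integral of \<open>\<bar>f\<bar>\<^sup>2\<close> vanishes.\<close>

lemma fourier_zero_imp_zero:
  fixes f :: "'a::euclidean_space \<Rightarrow> complex"
  assumes cont: "continuous_on UNIV f" and per: "lattice_periodic f" and z: "\<And>\<kappa>. fourier f \<kappa> = 0"
  shows "f x = 0"
proof -
  let ?C = "cbox 0 (One :: 'a)"
  have int: "g integrable_on ?C" if "continuous_on UNIV g" for g :: "'a \<Rightarrow> complex"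
    using that by (intro integrable_continuous continuous_on_subset[OF that]) auto
  have orth: "integral ?C (\<lambda>x. f x * P x) = 0" if "trig_poly P" for P
    using that
  proof induction
    case (character c \<kappa>)
    have "integral ?C (\<lambda>x. f x * cnj (character (\<lambda>b. - \<kappa> b) x)) = 0"
      using z[of "\<lambda>b. - \<kappa> b"] by (simp add: fourier_def)
    then have "integral ?C (\<lambda>x. f x * character \<kappa> x) = 0" by (simp add: cnj_character)
    then have "integral ?C (\<lambda>x. c * (f x * character \<kappa> x)) = 0" by simp
    then show ?case by (simp add: mult_ac)
  next
    case (add g h)
    have "integral ?C (\<lambda>x. f x * g x + f x * h x) = integral ?C (\<lambda>x. f x * g x) + integral ?C (\<lambda>x. f x * h x)"
      by (intro integral_add int continuous_intros cont continuous_on_trig_poly add)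
    then show ?case using add by (simp add: ring_distribs)
  qed
  have "bounded (f ` ?C)"
    by (intro compact_imp_bounded compact_continuous_image continuous_on_subset[OF cont]) auto
  then obtain B where B: "\<And>x. x \<in> ?C \<Longrightarrow> norm (f x) \<le> B"
    unfolding bounded_iff by blast
  have B0: "0 \<le> B" by (rule order_trans[OF norm_ge_zero B[of 0]]) (simp add: mem_box)
  have small: "norm (integral ?C (\<lambda>x. f x * cnj (f x))) \<le> B * (2 * e)" if e: "0 < e" for e
  proof -
    have c: "continuous_on UNIV (\<lambda>x. Re (f x))" "continuous_on UNIV (\<lambda>x. - Im (f x))"
      by (intro continuous_intros cont)+
    have p: "lattice_periodic (\<lambda>x. Re (f x))" "lattice_periodic (\<lambda>x. - Im (f x))"
      using per by (auto simp: lattice_periodic_def)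
    obtain P where P: "trig_poly P" "\<And>x. norm (of_real (Re (f x)) - P x) < e"
      using trig_poly_approximation_real[OF c(1) p(1) e] by blast
    obtain Q where Q: "trig_poly Q" "\<And>x. norm (of_real (- Im (f x)) - Q x) < e"
      using trig_poly_approximation_real[OF c(2) p(2) e] by blast
    define T where "T x = P x + \<i> * Q x" for x
    have T: "trig_poly T" unfolding T_def[abs_def]
      by (intro trig_poly.add trig_poly_mult trig_poly_const P Q)
    have Te: "norm (cnj (f x) - T x) \<le> 2 * e" for x
    proof -
      have "cnj (f x) - T x = (of_real (Re (f x)) - P x) + \<i> * (of_real (- Im (f x)) - Q x)"
        by (simp add: T_def complex_eq_iff)
      also have "norm \<dots> \<le> norm (of_real (Re (f x)) - P x) + norm (of_real (- Im (f x)) - Q x)"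
        by (rule norm_triangle_le) (simp add: norm_mult)
      also have "\<dots> \<le> e + e" by (intro add_mono less_imp_le P Q)
      finally show ?thesis by simp
    qed
    have "integral ?C (\<lambda>x. f x * cnj (f x)) = integral ?C (\<lambda>x. f x * (cnj (f x) - T x))"
    proof -
      have "integral ?C (\<lambda>x. f x * cnj (f x) - f x * T x) = integral ?C (\<lambda>x. f x * cnj (f x)) - integral ?C (\<lambda>x. f x * T x)"
        by (intro integral_diff int continuous_intros cont continuous_on_trig_poly[OF T])
      then show ?thesis using orth[OF T] by (simp add: ring_distribs)
    qed
    also have "norm \<dots> \<le> (B * (2 * e)) * measure lborel ?C"
    proof (rule has_integral_bound)
      show "0 \<le> B * (2 * e)" using B0 e by simp
      show "((\<lambda>x. f x * (cnj (f x) - T x)) has_integral integral ?C (\<lambda>x. f x * (cnj (f x) - T x))) ?C"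
        by (intro integrable_integral int continuous_intros cont continuous_on_trig_poly[OF T])
      show "norm (f x * (cnj (f x) - T x)) \<le> B * (2 * e)" if "x \<in> ?C" for x
        unfolding norm_mult using B[OF that] Te[of x] B0 by (intro mult_mono) auto
    qed
    finally show ?thesis by simp
  qed
  have i0: "integral ?C (\<lambda>x. f x * cnj (f x)) = 0"
  proof (rule ccontr)
    assume nz: "integral ?C (\<lambda>x. f x * cnj (f x)) \<noteq> 0"
    define e where "e = norm (integral ?C (\<lambda>x. f x * cnj (f x))) / (4 * (B + 1))"
    have "0 < e" using nz B0 by (simp add: e_def)
    from small[OF this] have "4 * (B + 1) * e \<le> B * (2 * e)" using B0 by (simp add: e_def)
    then have "(2 * B + 4) * e \<le> 0" by (simp add: algebra_simps)
    with \<open>0 < e\<close> B0 show False by (simp add: mult_le_0_iff)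
  qed
  have "integral ?C (\<lambda>x. (norm (f x))\<^sup>2) = 0"
  proof -
    have "(\<lambda>x. f x * cnj (f x)) = (\<lambda>x. of_real ((norm (f x))\<^sup>2))" by (rule ext) (rule complex_norm_square[symmetric])
    moreover have "((\<lambda>x. (norm (f x))\<^sup>2) has_integral integral ?C (\<lambda>x. (norm (f x))\<^sup>2)) ?C"
      by (intro integrable_integral integrable_continuous continuous_intros continuous_on_subset[OF cont]) auto
    then have "((\<lambda>x. of_real ((norm (f x))\<^sup>2) :: complex) has_integral of_real (integral ?C (\<lambda>x. (norm (f x))\<^sup>2))) ?C"
      by (rule has_integral_of_real)
    ultimately show ?thesis using i0 by (simp add: integral_unique)
  qed
  then have "\<forall>x\<in>?C. (norm (f x))\<^sup>2 = 0"
    by (subst (asm) integral_cbox_eq_0_iff)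
       (auto intro!: continuous_intros continuous_on_subset[OF cont] simp: box_ne_empty)
  moreover obtain y where "y \<in> ?C" "f x = f y" using lattice_periodic_representative[OF per] .
  ultimately show ?thesis by simp
qed

section \<open>Exponential decay of the Fourier coefficients\<close>

lemma ps_bound_translate:
  assumes "ps_bound p r f M" "\<And>z. z \<in> cube r \<Longrightarrow> f (p + z) = g (q + z)"
  shows "ps_bound q r g M"
proof -
  have "((\<lambda>\<alpha>. mpow z \<alpha> *\<^sub>R a \<alpha>) has_sum f (p + z)) multi_indices
      \<longleftrightarrow> ((\<lambda>\<alpha>. mpow z \<alpha> *\<^sub>R a \<alpha>) has_sum g (q + z)) multi_indices" if "z \<in> cube r" for a z
    using assms(2)[OF that] by simp
  with assms(1) show ?thesis by (simp add: ps_bound_def cong: ball_cong)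
qed

text \<open>Compactness of the torus makes the radius of analyticity and the bound independent of the point.\<close>

lemma lattice_periodic_uniform_ps_bound:
  fixes f :: "'a::euclidean_space \<times> 'w::euclidean_space \<Rightarrow> 'b::banach"
  assumes f: "real_analytic_on f (UNIV \<times> {w0})" and per: "\<And>w. lattice_periodic (\<lambda>x. f (x, w))"
  obtains r M where "0 < r" "r \<le> 1" "\<And>x. ps_bound (x, w0) r f M"
proof -
  let ?C = "cbox 0 (One :: 'a)"
  have "\<forall>x. \<exists>rM. 0 < fst rM \<and> ps_bound (x, w0) (fst rM) f (snd rM)"
  proof
    fix x
    obtain r M where "0 < r" "ps_bound (x, w0) r f M"
      using real_analytic_onE[OF f, of "(x, w0)"] by auto
    then show "\<exists>rM. 0 < fst rM \<and> ps_bound (x, w0) (fst rM) f (snd rM)" by (intro exI[of _ "(r, M)"]) simp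
  qed
  from choice[OF this] obtain rM where rM: "\<forall>x. 0 < fst (rM x) \<and> ps_bound (x, w0) (fst (rM x)) f (snd (rM x))" ..
  define R N where "R x = fst (rM x)" and "N x = snd (rM x)" for x
  have R: "0 < R x" "ps_bound (x, w0) (R x) f (N x)" for x using rM by (auto simp: R_def N_def)
  have "?C \<subseteq> (\<Union>x\<in>?C. ball x (R x / 2))" using R(1) by force
  then obtain D where D: "D \<subseteq> ?C" "finite D" "?C \<subseteq> (\<Union>x\<in>D. ball x (R x / 2))"
    using compactE_image[OF compact_cbox, of ?C "\<lambda>x. ball x (R x / 2)" 0 One] by auto
  have "0 \<in> ?C" by (simp add: mem_box)
  then have Dne: "D \<noteq> {}" using D(3) by auto
  define r where "r = min 1 (Min (R ` D) / 2)"
  define M where "M = Max (N ` D)"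
  have r: "0 < r" "r \<le> 1" using D(2) Dne R(1) by (auto simp: r_def)
  have "ps_bound (x, w0) r f M" for x
  proof -
    obtain y where y: "y \<in> ?C" "x - y \<in> lattice" by (rule lattice_representative)
    from D(3) y(1) obtain z where z: "z \<in> D" "y \<in> ball z (R z / 2)" by auto
    have "(y, w0) - (z, w0) \<in> cube (R z / 2)"
      using z(2) by (intro norm_imp_cube) (simp add: dist_norm norm_Pair norm_minus_commute)
    from ps_bound_nearby[OF _ R(2) this] R(1)[of z] have 1: "ps_bound (y, w0) (R z / 2) f (N z)" by simp
    have "Min (R ` D) \<le> R z" "N z \<le> M" using D(2) z(1) by (auto simp: M_def)
    then have "ps_bound (y, w0) r f M"
      using r by (intro ps_bound_mono[OF ps_bound_shrink[OF 1]]) (auto simp: r_def)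
    then show ?thesis
    proof (rule ps_bound_translate)
      fix u :: "'a \<times> 'w"
      have "f (y + fst u + (x - y), w0 + snd u) = f (y + fst u, w0 + snd u)"
        using per y(2) by (rule lattice_periodicD)
      then show "f ((y, w0) + u) = f ((x, w0) + u)" by (cases u) (simp add: add_ac)
    qed
  qed
  with r show ?thesis by (rule that)
qed

lemma fourier_shift_symmetric:
  assumes cont: "continuous_on UNIV f" and per: "lattice_periodic f" and b: "b \<in> Basis"
    and s: "\<bar>s\<bar> \<le> 1"
  shows "fourier (\<lambda>x. f (x + s *\<^sub>R b)) \<kappa> = cis (2 * pi * of_int (\<kappa> b) * s) * fourier f \<kappa>"
proof (cases "0 \<le> s")
  case True
  then show ?thesis using fourier_shift[OF cont per b] s by auto
next
  case False
  let ?f = "\<lambda>x. f (x + s *\<^sub>R b)"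
  have "continuous_on UNIV ?f" by (intro continuous_on_compose2[OF cont] continuous_intros) auto
  moreover have "lattice_periodic ?f"
    using per by (simp add: lattice_periodic_def) (metis add.assoc add.commute)
  ultimately have "fourier (\<lambda>x. ?f (x + (- s) *\<^sub>R b)) \<kappa> = cis (2 * pi * of_int (\<kappa> b) * (- s)) * fourier ?f \<kappa>"
    using False s by (intro fourier_shift b) auto
  then have "fourier f \<kappa> = cis (- (2 * pi * of_int (\<kappa> b) * s)) * fourier ?f \<kappa>"
    by (simp add: algebra_simps)
  then have "cis (2 * pi * of_int (\<kappa> b) * s) * fourier f \<kappa> =
      cis (2 * pi * of_int (\<kappa> b) * s) * (cis (- (2 * pi * of_int (\<kappa> b) * s)) * fourier ?f \<kappa>)" by simp
  also have "\<dots> = fourier ?f \<kappa>" by (simp only: mult.assoc[symmetric] cis_mult) simp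
  finally show ?thesis by simp
qed

lemma norm_fourier_le:
  assumes "continuous_on UNIV f" "\<And>x. norm (f x) \<le> B" shows "norm (fourier f \<kappa>) \<le> B"
proof -
  have "0 \<le> B" by (rule order_trans[OF norm_ge_zero assms(2)])
  then have "norm (fourier f \<kappa>) \<le> B * measure lborel (cbox 0 (One :: 'a))"
    unfolding fourier_def
  proof (rule has_integral_bound[OF _ integrable_integral])
    show "(\<lambda>x. f x * cnj (character \<kappa> x)) integrable_on cbox 0 One"
      by (intro integrable_continuous continuous_intros continuous_on_subset[OF assms(1)]) auto
  qed (use assms(2) in \<open>auto simp: norm_mult\<close>)
  then show ?thesis by simp
qed

lemma real_analytic_on_UNIV_ps_boundI:
  assumes "0 < r" "\<And>x. ps_bound x r f M" shows "real_analytic_on f UNIV"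
  using assms by (intro real_analytic_onI) blast

text \<open>Analyticity in a strip gives exponential decay of the coefficients. A proof that stays on the real
line: let \<open>a\<close> be the coefficient of \<open>k\<close> and \<open>th = 2 * pi * \<kappa> b\<close>. The translate \<open>k (x + s *\<^sub>R b)\<close> has the
coefficient \<open>cis (th * s) * a\<close>. Expanding it in powers of \<open>s\<close>, with coefficient functions bounded by
\<open>M / \<rho> ^ n\<close>, and comparing the powers of \<open>s\<close> gives \<open>\<bar>th\<bar> ^ n / fact n * norm a \<le> M / \<rho> ^ n\<close>. Weighting by
\<open>(\<rho> / 2) ^ n\<close> and summing over \<open>n\<close> yields \<open>norm a * exp (\<bar>th\<bar> * \<rho> / 2) \<le> 2 * M\<close>.\<close>

lemma fourier_decay_coordinate:
  fixes k :: "'a::euclidean_space \<Rightarrow> real"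
  assumes r: "0 < r" "r \<le> 1" and k: "\<And>x. ps_bound x r k M" and per: "lattice_periodic k"
    and b: "b \<in> Basis"
  shows "norm (fourier (\<lambda>x. of_real (k x)) \<kappa>) \<le> 2 * M * exp (- (pi * r / 2) * \<bar>of_int (\<kappa> b)\<bar>)"
proof -
  define \<rho> where "\<rho> = r / 2"
  have \<rho>: "0 < \<rho>" "\<rho> \<le> 1" using r by (auto simp: \<rho>_def)
  let ?F = "\<lambda>(x, s). k (x + s *\<^sub>R b)"
  have M0: "0 \<le> M" using k[of 0] r by (auto intro: ps_bound_nonneg)
  have F: "ps_bound (x, 0) \<rho> ?F M" for x
  proof -
    have "ps_bound (x, 0) \<rho> (\<lambda>z. k (fst z + snd z *\<^sub>R b)) M"
    proof (rule ps_bound_compose[OF _ _ k[of x]])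
      fix b' :: 'a assume b': "b' \<in> Basis"
      have "(b', 0) \<in> Basis" "(0 :: 'a, 1 :: real) \<in> Basis" using b' by (auto simp: Basis_prod_def image_iff)
      then have "ps_bound (x, 0) \<rho> (\<lambda>z. (z - (x, 0 :: real)) \<bullet> (b', 0) + (z - (x, 0 :: real)) \<bullet> (0, 1) * (b \<bullet> b')) (\<rho> + \<rho> * norm (b \<bullet> b'))"
        using \<rho> by (intro ps_bound_add ps_bound_mult ps_bound_coordinate ps_bound_const) auto
      moreover have "\<rho> + \<rho> * norm (b \<bullet> b') \<le> r" using b b' r by (simp add: \<rho>_def inner_Basis)
      ultimately have "ps_bound (x, 0) \<rho> (\<lambda>z. (z - (x, 0 :: real)) \<bullet> (b', 0) + (z - (x, 0 :: real)) \<bullet> (0, 1) * (b \<bullet> b')) r"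
        by (rule ps_bound_mono)
      moreover have "(\<lambda>z. (z - (x, 0 :: real)) \<bullet> (b', 0) + (z - (x, 0 :: real)) \<bullet> (0, 1) * (b \<bullet> b')) = (\<lambda>z. (fst z + snd z *\<^sub>R b - x) \<bullet> b')"
        by (auto simp: inner_simps)
      ultimately show "ps_bound (x, 0) \<rho> (\<lambda>z. (fst z + snd z *\<^sub>R b - x) \<bullet> b') r" by simp
    qed (use r \<rho> in auto)
    then show ?thesis by (simp add: case_prod_unfold)
  qed
  obtain g where g: "\<And>\<beta> x. \<beta> \<in> multi_indices \<Longrightarrow> ps_bound x \<rho> (g \<beta>) (M / \<rho> ^ mdeg \<beta>)"
    "\<And>x s. s \<in> cube \<rho> \<Longrightarrow> ((\<lambda>\<beta>. mpow s \<beta> * g \<beta> x) has_sum ?F (x, 0 + s)) multi_indices"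
    by (rule global_slices[OF \<rho>(1) F]) blast
  \<comment> \<open>multi-indices over the one-dimensional space of the shifts are natural numbers\<close>
  define ix where "ix n = restrict (\<lambda>_. n) (Basis :: real set)" for n :: nat
  have ix: "ix n \<in> multi_indices" for n by (simp add: ix_def)
  have bij: "bij_betw ix UNIV (multi_indices :: (real \<Rightarrow> nat) set)"
    by (rule bij_betwI[where g = "\<lambda>\<beta>. \<beta> 1"]) (auto simp: ix_def fun_eq_iff PiE_iff extensional_def)
  have ixp: "mpow s (ix n) = s ^ n" "mdeg (ix n) = n" for s n by (simp_all add: ix_def mpow_def mdeg_def)
  define G where "G n x = (of_real (g (ix n) x) :: complex)" for n x
  have "continuous_on UNIV (g (ix n))" for n
    by (intro real_analytic_on_continuous_on real_analytic_on_UNIV_ps_boundI[OF \<rho>(1) g(1)[OF ix]])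
  then have Gc: "continuous_on UNIV (G n)" for n unfolding G_def[abs_def] by (intro continuous_intros)
  have Gn: "norm (G n x) \<le> M / \<rho> ^ n" for n x
  proof -
    have "ps_bound x \<rho> (g (ix n)) (M / \<rho> ^ mdeg (ix n))" by (rule g(1)[OF ix])
    from ps_bound_normE[OF this, of 0] \<rho> show ?thesis by (simp add: G_def ixp)
  qed
  have Gs: "((\<lambda>n. of_real s ^ n * G n x) has_sum of_real (k (x + s *\<^sub>R b))) UNIV" if "\<bar>s\<bar> \<le> \<rho>" for s x
  proof -
    have "s \<in> cube \<rho>" using that by (simp add: cube_def)
    from g(2)[OF this, of x] have "((\<lambda>\<beta>. mpow s \<beta> * g \<beta> x) has_sum k (x + s *\<^sub>R b)) multi_indices" by simp
    then have "((\<lambda>n. mpow s (ix n) * g (ix n) x) has_sum k (x + s *\<^sub>R b)) UNIV"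
      by (subst has_sum_reindex_bij_betw[OF bij])
    then have "((\<lambda>n. of_real (s ^ n * g (ix n) x) :: complex) has_sum of_real (k (x + s *\<^sub>R b))) UNIV"
      by (simp only: ixp has_sum_of_real_iff)
    then show ?thesis by (simp add: G_def)
  qed
  have kc: "continuous_on UNIV (\<lambda>x. of_real (k x) :: complex)"
    by (intro continuous_on_of_real real_analytic_on_continuous_on real_analytic_on_UNIV_ps_boundI[OF r(1) k])
  have kp: "lattice_periodic (\<lambda>x. of_real (k x) :: complex)" using per by (simp add: lattice_periodic_def)
  define c where "c n = fourier (G n) \<kappa>" for n
  define a where "a = fourier (\<lambda>x. of_real (k x)) \<kappa>"
  define th where "th = 2 * pi * of_int (\<kappa> b)"
  have cn: "norm (c n) \<le> M / \<rho> ^ n" for n unfolding c_def by (rule norm_fourier_le[OF Gc Gn])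
  \<comment> \<open>the expansion of the translate in powers of \<open>s\<close>, integrated termwise\<close>
  have cs: "((\<lambda>n. of_real s ^ n * c n) has_sum cis (th * s) * a) UNIV" if s: "\<bar>s\<bar> \<le> \<rho> / 2" for s
  proof -
    have "((\<lambda>n. integral (cbox 0 One) (\<lambda>x. (of_real s ^ n * G n x) * cnj (character \<kappa> x))) has_sum
        integral (cbox 0 One) (\<lambda>x. of_real (k (x + s *\<^sub>R b)) * cnj (character \<kappa> x))) UNIV"
    proof (rule integral_has_sum(1)[where m = "\<lambda>n. M * (1/2) ^ n"])
      show "continuous_on (cbox 0 One) (\<lambda>x. (of_real s ^ n * G n x) * cnj (character \<kappa> x))" for n
        by (intro continuous_intros continuous_on_subset[OF Gc]) auto
      show "norm ((of_real s ^ n * G n x) * cnj (character \<kappa> x)) \<le> M * (1/2) ^ n" for n x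
      proof -
        have "\<bar>s\<bar> ^ n * norm (G n x) \<le> (\<rho> / 2) ^ n * (M / \<rho> ^ n)"
          using s Gn \<rho> by (intro mult_mono power_mono) auto
        then show ?thesis using \<rho> by (simp add: norm_mult norm_power power_divide field_simps)
      qed
      have "(\<lambda>n. (1/2 :: real) ^ n) summable_on UNIV"
        by (subst summable_on_UNIV_nonneg_real_iff) (auto intro: summable_geometric)
      then show "(\<lambda>n. M * (1/2) ^ n) summable_on UNIV" by (rule summable_on_cmult_right)
      show "((\<lambda>n. (of_real s ^ n * G n x) * cnj (character \<kappa> x)) has_sum
          of_real (k (x + s *\<^sub>R b)) * cnj (character \<kappa> x)) UNIV" for x
        using s \<rho> by (intro has_sum_cmult_left Gs) auto
    qed
    moreover have "integral (cbox 0 One) (\<lambda>x. (of_real s ^ n * G n x) * cnj (character \<kappa> x)) = of_real s ^ n * c n" for n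
      unfolding c_def fourier_def by (simp only: mult.assoc integral_mult_right)
    moreover have "integral (cbox 0 One) (\<lambda>x. of_real (k (x + s *\<^sub>R b)) * cnj (character \<kappa> x)) = cis (th * s) * a"
      using fourier_shift_symmetric[OF kc kp b, of s \<kappa>] s \<rho>
      by (simp add: fourier_def a_def th_def)
    ultimately show ?thesis by simp
  qed
  \<comment> \<open>the expansion of the same function of \<open>s\<close> as an exponential series\<close>
  have es: "((\<lambda>n. of_real s ^ n * ((\<i> * of_real th) ^ n / fact n * a)) has_sum cis (th * s) * a) UNIV" for s
  proof -
    let ?z = "\<i> * of_real th * of_real s :: complex"
    have "((\<lambda>n. ?z ^ n /\<^sub>R fact n) has_sum exp ?z) UNIV"
      by (rule norm_summable_imp_has_sum[OF summable_norm_exp exp_converges])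
    from has_sum_cmult_left[OF this, of a]
    have "((\<lambda>n. (?z ^ n /\<^sub>R fact n) * a) has_sum cis (th * s) * a) UNIV"
      by (simp add: cis_conv_exp mult_ac)
    moreover have "(?z ^ n /\<^sub>R fact n) * a = of_real s ^ n * ((\<i> * of_real th) ^ n / fact n * a)" for n
      by (simp add: scaleR_conv_of_real power_mult_distrib field_simps)
    ultimately show ?thesis by simp
  qed
  define d where "d n = (\<i> * of_real th) ^ n / fact n * a - c n" for n
  have ds: "((\<lambda>n. of_real (s ^ n) * d n) has_sum 0) UNIV" if "\<bar>s\<bar> \<le> \<rho> / 2" for s
    using has_sum_minus[OF es[of s] cs[OF that]] by (simp add: d_def ring_distribs)
  have "Re (d n) = 0" for n
  proof (rule power_series_coefficients_zero[where r = "\<rho> / 2"])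
    show "((\<lambda>n. t ^ n * Re (d n)) has_sum 0) UNIV" if "\<bar>t\<bar> \<le> \<rho> / 2" for t
      using has_sum_Re[OF ds[OF that]] by (simp only: Re_complex_of_real Im_complex_of_real times_complex.sel) simp
  qed (use \<rho> in auto)
  moreover have "Im (d n) = 0" for n
  proof (rule power_series_coefficients_zero[where r = "\<rho> / 2"])
    show "((\<lambda>n. t ^ n * Im (d n)) has_sum 0) UNIV" if "\<bar>t\<bar> \<le> \<rho> / 2" for t
      using has_sum_Im[OF ds[OF that]] by (simp only: Re_complex_of_real Im_complex_of_real times_complex.sel) simp
  qed (use \<rho> in auto)
  ultimately have d0: "d n = 0" for n by (simp add: complex_eq_iff)
  have le: "norm a * ((\<bar>th\<bar> * \<rho> / 2) ^ n /\<^sub>R fact n) \<le> M * (1/2) ^ n" for n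
  proof -
    have "c n = (\<i> * of_real th) ^ n / fact n * a" using d0[of n] by (simp add: d_def)
    then have "norm (c n) = \<bar>th\<bar> ^ n / fact n * norm a"
      by (simp add: norm_mult norm_divide norm_power)
    then have "\<bar>th\<bar> ^ n / fact n * norm a \<le> M / \<rho> ^ n" using cn[of n] by simp
    from mult_right_mono[OF this, of "(\<rho> / 2) ^ n"] \<rho>
    show ?thesis by (simp add: power_mult_distrib power_divide field_simps)
  qed
  have s1: "(\<lambda>n. norm a * ((\<bar>th\<bar> * \<rho> / 2) ^ n /\<^sub>R fact n)) sums (norm a * exp (\<bar>th\<bar> * \<rho> / 2))"
    by (intro sums_mult exp_converges)
  have "(\<lambda>n. M * (1/2 :: real) ^ n) sums (M * (1 / (1 - 1/2)))"
    by (intro sums_mult geometric_sums) auto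
  then have s2: "(\<lambda>n. M * (1/2 :: real) ^ n) sums (2 * M)" by (simp add: mult.commute)
  have "norm a * exp (\<bar>th\<bar> * \<rho> / 2) \<le> 2 * M"
    by (rule sums_le[OF le s1 s2])
  then have "norm a \<le> 2 * M * exp (- (\<bar>th\<bar> * \<rho> / 2))"
    by (simp add: exp_minus field_simps)
  moreover have "\<bar>th\<bar> * \<rho> / 2 = pi * r / 2 * \<bar>of_int (\<kappa> b)\<bar>"
    by (simp add: th_def \<rho>_def abs_mult)
  ultimately show ?thesis by (simp add: a_def)
qed

definition freq_norm :: "('a::euclidean_space \<Rightarrow> int) \<Rightarrow> real" where
  "freq_norm \<kappa> = (\<Sum>b\<in>Basis. \<bar>of_int (\<kappa> b)\<bar>)"

lemma freq_norm_nonneg [simp]: "0 \<le> freq_norm \<kappa>"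
  by (simp add: freq_norm_def sum_nonneg)

text \<open>The coordinate of largest absolute frequency carries at least the share \<open>1 / DIM('a)\<close> of the norm.\<close>

lemma fourier_decay:
  fixes k :: "'a::euclidean_space \<Rightarrow> real"
  assumes r: "0 < r" "r \<le> 1" and k: "\<And>x. ps_bound x r k M" and per: "lattice_periodic k"
  shows "norm (fourier (\<lambda>x. of_real (k x)) \<kappa>) \<le> 2 * M * exp (- (pi * r / (2 * DIM('a))) * freq_norm \<kappa>)"
proof -
  let ?m = "Max ((\<lambda>b. \<bar>of_int (\<kappa> b)\<bar> :: real) ` Basis)"
  have "?m \<in> (\<lambda>b. \<bar>of_int (\<kappa> b)\<bar>) ` Basis" by (rule Max_in) auto
  then obtain b where b: "b \<in> Basis" "?m = \<bar>of_int (\<kappa> b)\<bar>" by blast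
  have "freq_norm \<kappa> \<le> (\<Sum>b'\<in>(Basis :: 'a set). \<bar>of_int (\<kappa> b)\<bar>)"
    unfolding freq_norm_def by (intro sum_mono) (auto simp: b(2)[symmetric])
  then have *: "freq_norm \<kappa> \<le> DIM('a) * \<bar>of_int (\<kappa> b)\<bar>" by simp
  have "pi * r / (2 * DIM('a)) * freq_norm \<kappa> \<le> pi * r / (2 * DIM('a)) * (DIM('a) * \<bar>of_int (\<kappa> b)\<bar>)"
    using * r by (intro mult_left_mono) auto
  also have "\<dots> = pi * r / 2 * \<bar>of_int (\<kappa> b)\<bar>" by simp
  finally have "exp (- (pi * r / 2) * \<bar>of_int (\<kappa> b)\<bar>) \<le> exp (- (pi * r / (2 * DIM('a))) * freq_norm \<kappa>)" by simp
  moreover have "0 \<le> M" using k[of 0] r by (auto intro: ps_bound_nonneg)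
  ultimately have "2 * M * exp (- (pi * r / 2) * \<bar>of_int (\<kappa> b)\<bar>) \<le> 2 * M * exp (- (pi * r / (2 * DIM('a))) * freq_norm \<kappa>)"
    by (intro mult_left_mono) auto
  with fourier_decay_coordinate[OF r k per b(1), of \<kappa>] show ?thesis by linarith
qed

section \<open>Dense lines on the torus and Fourier inversion\<close>

definition nonresonant :: "'a::euclidean_space \<Rightarrow> bool" where
  "nonresonant v \<longleftrightarrow> (\<forall>\<kappa>. (\<exists>b\<in>Basis. \<kappa> b \<noteq> 0) \<longrightarrow> phase \<kappa> v \<noteq> 0)"

text \<open>The line through \<open>v\<close> is dense in the torus, by Kronecker's theorem. The theorem asks for distinct
coordinates that are linearly independent over the integers, and both are instances of nonresonance.\<close>

lemma nonresonant_line_dense: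
  fixes v x :: "'a::euclidean_space"
  assumes v: "nonresonant v" and e: "0 < e"
  obtains t q where "q \<in> lattice" "t *\<^sub>R v - q - x \<in> cube e"
proof -
  obtain h where h: "bij_betw h {..<DIM('a)} (Basis :: 'a set)"
    using ex_bij_betw_nat_finite[of "Basis :: 'a set"] by (auto simp: atLeast0LessThan)
  define th where "th i = v \<bullet> h i" for i
  have inj: "inj_on (\<lambda>b. v \<bullet> b) Basis"
  proof (rule inj_onI, rule ccontr)
    fix b c :: 'a assume bc: "b \<in> Basis" "c \<in> Basis" "v \<bullet> b = v \<bullet> c" "b \<noteq> c"
    let ?\<kappa> = "\<lambda>i. (if i = b then 1 else 0) - (if i = c then 1 else 0 :: int)"
    have "phase ?\<kappa> v = v \<bullet> b - v \<bullet> c"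
      using bc(1,2) by (simp add: phase_def left_diff_distrib sum_subtractf if_distrib[of of_int] if_distrib[of "\<lambda>z. z * _"] cong: if_cong)
    moreover have "\<exists>i\<in>Basis. ?\<kappa> i \<noteq> 0" using bc(1,4) by (intro bexI[of _ b]) auto
    then have "phase ?\<kappa> v \<noteq> 0" using v unfolding nonresonant_def by (elim allE impE)
    ultimately show False using bc(3) by simp
  qed
  have "inj_on ((\<lambda>b. v \<bullet> b) \<circ> h) {..<DIM('a)}"
    using h inj by (intro comp_inj_on) (auto simp: bij_betw_def)
  then have injth: "inj_on th {..<DIM('a)}" by (simp add: th_def[abs_def] o_def)
  interpret M: Modules.module "\<lambda>r. (*) (real_of_int r)"
    by (simp add: Modules.module.intro distrib_left mult.commute)
  have img: "th ` {..<DIM('a)} = (\<lambda>b. v \<bullet> b) ` Basis"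
    using h by (force simp: th_def bij_betw_def)
  have indep: "module.independent (\<lambda>r. (*) (real_of_int r)) (th ` {..<DIM('a)})"
    unfolding img M.independent_explicit_module
  proof (intro allI impI)
    fix T :: "real set" and u :: "real \<Rightarrow> int" and w
    assume T: "finite T" "T \<subseteq> (\<lambda>b. v \<bullet> b) ` Basis" "(\<Sum>w\<in>T. of_int (u w) * w) = 0" "w \<in> T"
    define \<kappa> where "\<kappa> b = (if v \<bullet> b \<in> T then u (v \<bullet> b) else 0)" for b
    have "phase \<kappa> v = (\<Sum>b\<in>Basis \<inter> {b. v \<bullet> b \<in> T}. of_int (u (v \<bullet> b)) * (v \<bullet> b))"
      unfolding phase_def by (rule sum.mono_neutral_cong_right) (auto simp: \<kappa>_def)
    also have "\<dots> = (\<Sum>w\<in>(\<lambda>b. v \<bullet> b) ` (Basis \<inter> {b. v \<bullet> b \<in> T}). of_int (u w) * w)"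
      by (subst sum.reindex) (auto intro: inj_on_subset[OF inj])
    also have "(\<lambda>b. v \<bullet> b) ` (Basis \<inter> {b. v \<bullet> b \<in> T}) = T" using T(2) by auto
    finally have "phase \<kappa> v = 0" using T(3) by simp
    then have z: "\<And>b. b \<in> Basis \<Longrightarrow> \<kappa> b = 0" using v by (auto simp: nonresonant_def)
    obtain b where "b \<in> Basis" "w = v \<bullet> b" using T by auto
    with z[of b] T(4) show "u w = 0" by (simp add: \<kappa>_def)
  qed
  obtain t m where tm: "\<And>i. i < DIM('a) \<Longrightarrow> \<bar>t * th i - of_int (m i) - x \<bullet> h i\<bar> < e"
    using Kronecker_thm_1[OF indep injth e, of "\<lambda>i. x \<bullet> h i"] by blast
  define q where "q = (\<Sum>i<DIM('a). of_int (m i) *\<^sub>R h i)"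
  have hB: "h i \<in> Basis" if "i < DIM('a)" for i using h that by (auto simp: bij_betw_def)
  have qh: "q \<bullet> h j = of_int (m j)" if j: "j < DIM('a)" for j
  proof -
    have "q \<bullet> h j = (\<Sum>i<DIM('a). of_int (m i) * (if i = j then 1 else 0))"
      unfolding q_def inner_sum_left
    proof (rule sum.cong)
      fix i assume "i \<in> {..<DIM('a)}"
      then show "of_int (m i) *\<^sub>R h i \<bullet> h j = of_int (m i) * (if i = j then 1 else 0)"
        using hB[of i] hB[OF j] h j by (auto simp: inner_Basis bij_betw_def inj_on_def)
    qed simp
    then show ?thesis using j by (simp add: if_distrib cong: if_cong)
  qed
  have cov: "\<exists>j<DIM('a). b = h j" if "b \<in> Basis" for b
    using h that by (force simp: bij_betw_def)
  show ?thesis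
  proof (rule that)
    have "q \<bullet> b \<in> \<int>" if b: "b \<in> Basis" for b
    proof -
      obtain j where "j < DIM('a)" "b = h j" using cov[OF b] by blast
      then show ?thesis using qh[of j] by simp
    qed
    then show "q \<in> lattice" by (simp add: lattice_def)
    have "\<bar>(t *\<^sub>R v - q - x) \<bullet> b\<bar> \<le> e" if b: "b \<in> Basis" for b
    proof -
      obtain j where j: "j < DIM('a)" "b = h j" using cov[OF b] by blast
      show ?thesis using tm[OF j(1)] qh[OF j(1)] by (simp add: j(2) inner_diff_left th_def)
    qed
    then show "t *\<^sub>R v - q - x \<in> cube e" by (simp add: cube_def)
  qed
qed

text \<open>This is why a hull is determined by its quasiperiodic function, and why the solutions of the small
divisors equation are unique.\<close>

lemma periodic_zero_on_line_imp_zero: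
  fixes f :: "'a::euclidean_space \<Rightarrow> 'b::real_normed_vector"
  assumes v: "nonresonant v" and cont: "continuous_on UNIV f" and per: "lattice_periodic f"
    and z: "\<And>t. f (t *\<^sub>R v) = 0"
  shows "f x = 0"
proof (rule ccontr)
  assume nz: "f x \<noteq> 0"
  have "isCont f x" using cont by (simp add: continuous_on_eq_continuous_at)
  then obtain d where d: "d > 0" "\<And>y. dist y x < d \<Longrightarrow> dist (f y) (f x) < norm (f x)"
    using nz unfolding continuous_at_eps_delta by (elim allE[of _ "norm (f x)"]) auto
  define e where "e = d / (2 * DIM('a))"
  have e: "0 < e" using d(1) by (simp add: e_def)
  obtain t q where tq: "q \<in> lattice" "t *\<^sub>R v - q - x \<in> cube e" using nonresonant_line_dense[OF v e] .
  let ?y = "t *\<^sub>R v + - q"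
  have "f ?y = 0" using lattice_periodicD[OF per uminus_in_lattice[OF tq(1)], of "t *\<^sub>R v"] z by simp
  moreover have "dist ?y x < d"
  proof -
    have "norm (t *\<^sub>R v - q - x) \<le> d / 2" using norm_le_cube[OF tq(2)] by (simp add: e_def)
    then show ?thesis using d(1) by (simp add: dist_norm)
  qed
  ultimately show False using d(2)[of ?y] by simp
qed

lemma summable_on_exp_abs_int:
  assumes "0 < a" shows "(\<lambda>j::int. exp (- a * \<bar>of_int j\<bar>) :: real) summable_on UNIV"
proof -
  have "summable (\<lambda>n. exp (- a) ^ n)" using assms by (intro summable_geometric) auto
  then have *: "(\<lambda>n::nat. exp (- a * real n)) summable_on UNIV"
    by (simp add: summable_on_UNIV_nonneg_real_iff exp_of_nat_mult[symmetric] mult.commute)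
  have "(\<lambda>j::int. exp (- a * \<bar>of_int j\<bar>) :: real) summable_on range int"
    by (subst summable_on_reindex) (auto simp: o_def inj_on_def intro: *[simplified])
  moreover have "(\<lambda>j::int. exp (- a * \<bar>of_int j\<bar>) :: real) summable_on range (\<lambda>n. - int n)"
    by (subst summable_on_reindex) (auto simp: o_def inj_on_def intro: *[simplified])
  ultimately have "(\<lambda>j::int. exp (- a * \<bar>of_int j\<bar>) :: real) summable_on range int \<union> range (\<lambda>n. - int n)"
    by (rule summable_on_union)
  moreover have "range int \<union> range (\<lambda>n. - int n) = UNIV"
  proof -
    have "j \<in> range int \<union> range (\<lambda>n. - int n)" for j
      using int_cases2[of j "j \<in> range int \<union> range (\<lambda>n. - int n)"] by blast
    then show ?thesis by auto
  qed
  ultimately show ?thesis by simp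
qed

abbreviation frequencies :: "('a::euclidean_space \<Rightarrow> int) set" where
  "frequencies \<equiv> Basis \<rightarrow>\<^sub>E UNIV"

lemma summable_on_exp_freq_norm:
  assumes "0 < a" shows "(\<lambda>\<kappa>. exp (- a * freq_norm \<kappa>)) summable_on (frequencies :: ('a::euclidean_space \<Rightarrow> int) set)"
proof -
  have "(\<lambda>\<kappa>::'a \<Rightarrow> int. \<Prod>b\<in>Basis. exp (- a * \<bar>of_int (\<kappa> b)\<bar>)) summable_on frequencies"
    by (rule summable_on_prod_PiE) (auto intro: summable_on_exp_abs_int[OF assms, simplified])
  then show ?thesis by (simp add: freq_norm_def exp_sum[symmetric] sum_distrib_left)
qed

lemma powr_le_exp:
  fixes a t :: real
  assumes a: "0 < a" obtains C where "0 < C" "\<And>y. 1 \<le> y \<Longrightarrow> y powr t \<le> C * exp (a * y)"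
proof -
  obtain m :: nat where m: "t \<le> real m" using real_arch_simple by blast
  define n where "n = Suc m"
  have n: "0 < n" "t \<le> real n" using m by (auto simp: n_def)
  show ?thesis
  proof (rule that[of "(real n / a) ^ n"])
    show "0 < (real n / a) ^ n" using n a by simp
    fix y :: real assume y: "1 \<le> y"
    have "y powr t \<le> y powr real n" using n y by (intro powr_mono) auto
    also have "\<dots> = (real n / a) ^ n * (a * y / real n) ^ n"
      using y n a by (simp add: powr_realpow power_mult_distrib[symmetric])
    also have "\<dots> \<le> (real n / a) ^ n * exp (a * y / real n) ^ n"
    proof (intro mult_left_mono power_mono)
      show "a * y / real n \<le> exp (a * y / real n)" using exp_ge_add_one_self[of "a * y / real n"] by linarith
    qed (use a n y in auto)
    also have "exp (a * y / real n) ^ n = exp (a * y)" using n by (simp add: exp_of_nat_mult[symmetric])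
    finally show "y powr t \<le> (real n / a) ^ n * exp (a * y)" .
  qed
qed

text \<open>The exponential series in the algebra of absolutely convergent power series.\<close>

lemma ps_bound_exp_linear:
  fixes L :: "'a::euclidean_space \<Rightarrow> complex"
  assumes r: "0 \<le> r" and L: "ps_bound p r L M"
  shows "ps_bound p r (\<lambda>x. exp (L x)) (exp M)"
proof (rule ps_bound_sum[OF r, where F = "\<lambda>n x. (1 / fact n) *\<^sub>R L x ^ n" and m = "\<lambda>n. 1 / fact n * M ^ n" and J = UNIV])
  show "ps_bound p r (\<lambda>x. (1 / fact n) *\<^sub>R L x ^ n) (1 / fact n * M ^ n)" for n
    using ps_bound_scaleR[OF r ps_bound_const[OF r, of p "1 / fact n :: real"] ps_bound_power[OF r L, of n]]
    by simp
  have M: "0 \<le> M" using L r by (rule ps_bound_nonneg)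
  have "(\<lambda>n. 1 / fact n * M ^ n) sums exp M"
    using exp_converges[of M] by (simp add: divide_inverse scaleR_conv_of_real mult_ac)
  then have hs: "((\<lambda>n. 1 / fact n * M ^ n) has_sum exp M) UNIV"
    by (rule sums_nonneg_imp_has_sum) (use M in auto)
  show "(\<lambda>n. 1 / fact n * M ^ n) summable_on UNIV" using hs by (rule has_sum_imp_summable)
  show "(\<Sum>\<^sub>\<infinity>n. 1 / fact n * M ^ n) \<le> exp M" using hs by (simp add: infsumI)
  fix y :: 'a
  have "((\<lambda>n. L (p + y) ^ n /\<^sub>R fact n) has_sum exp (L (p + y))) UNIV"
    by (rule norm_summable_imp_has_sum[OF summable_norm_exp exp_converges])
  then show "((\<lambda>n. (1 / fact n) *\<^sub>R L (p + y) ^ n) has_sum exp (L (p + y))) UNIV"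
    by (simp add: divide_inverse)
qed

text \<open>A character is large on a complex polydisc, but only exponentially in the frequency, with a rate
proportional to \<open>r\<close>; a small \<open>r\<close> is then outweighed by the decay of the Fourier coefficients.\<close>

lemma ps_bound_character:
  assumes r: "0 \<le> r"
  shows "ps_bound p r (character \<kappa>) (exp (2 * pi * r * freq_norm \<kappa>))"
proof -
  let ?L = "\<lambda>x. \<Sum>b\<in>Basis. ((x - p) \<bullet> b) *\<^sub>R (\<i> * of_real (2 * pi * of_int (\<kappa> b)))"
  have "ps_bound p r ?L (\<Sum>b\<in>Basis. r * norm (\<i> * of_real (2 * pi * of_int (\<kappa> b))))"
    by (intro ps_bound_finite_sum ps_bound_scaleR ps_bound_coordinate ps_bound_const r finite_Basis)
  also have "(\<Sum>b\<in>Basis. r * norm (\<i> * of_real (2 * pi * of_int (\<kappa> b)))) = 2 * pi * r * freq_norm \<kappa>"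
    by (simp add: freq_norm_def sum_distrib_left norm_mult abs_mult mult_ac)
  finally have "ps_bound p r (\<lambda>x. exp (?L x)) (exp (2 * pi * r * freq_norm \<kappa>))"
    by (rule ps_bound_exp_linear[OF r])
  from ps_bound_mult[OF r ps_bound_const[OF r, of p "character \<kappa> p"] this]
  have "ps_bound p r (\<lambda>x. character \<kappa> p * exp (?L x)) (exp (2 * pi * r * freq_norm \<kappa>))" by simp
  moreover have "(\<lambda>x. character \<kappa> p * exp (?L x)) = character \<kappa>"
  proof
    fix x
    have "?L x = \<i> * of_real (2 * pi * phase \<kappa> (x - p))"
      by (simp add: phase_def sum_distrib_left scaleR_conv_of_real mult_ac)
    then have "exp (?L x) = character \<kappa> (x - p)" by (simp add: character_def cis_conv_exp)
    then show "character \<kappa> p * exp (?L x) = character \<kappa> x" by (simp add: character_add[symmetric])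
  qed
  ultimately show ?thesis by simp
qed

lemma fourier_restrict: "fourier f (restrict \<kappa> Basis) = fourier f \<kappa>"
  by (simp add: fourier_def character_def phase_def)

text \<open>The series converges to a continuous periodic function with the same coefficients as \<open>f\<close>, so the two
agree by completeness.\<close>

lemma fourier_inversion:
  fixes f :: "'a::euclidean_space \<Rightarrow> complex"
  assumes cont: "continuous_on UNIV f" and per: "lattice_periodic f"
    and sm: "(\<lambda>\<kappa>. norm (fourier f \<kappa>)) summable_on frequencies"
  shows "((\<lambda>\<kappa>. fourier f \<kappa> * character \<kappa> x) has_sum f x) frequencies"
proof -
  define S where "S x = (\<Sum>\<^sub>\<infinity>\<kappa>\<in>frequencies. fourier f \<kappa> * character \<kappa> x)" for x
  have S: "((\<lambda>\<kappa>. fourier f \<kappa> * character \<kappa> x) has_sum S x) frequencies" for x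
  proof -
    have "(\<lambda>\<kappa>. norm (fourier f \<kappa> * character \<kappa> x)) summable_on frequencies"
      using sm by (simp add: norm_mult)
    from abs_summable_summable[OF this] show ?thesis by (simp add: S_def)
  qed
  have Sp: "lattice_periodic S"
    by (simp add: lattice_periodic_def S_def character_add character_lattice)
  have Sc: "continuous_on (cbox a b) S" for a b
    by (rule integral_has_sum(2)[OF _ _ sm S]) (auto simp: norm_mult intro!: continuous_intros)
  have ScU: "continuous_on UNIV S"
  proof (rule continuous_at_imp_continuous_on, rule ballI)
    fix x :: 'a
    have "x \<in> box (x - One) (x + One)" by (auto simp: mem_box inner_simps)
    then show "isCont S x"
      using continuous_on_interior[OF Sc[of "x - One" "x + One"]] by (simp add: interior_cbox)
  qed
  have Sf: "fourier S \<kappa>' = fourier f \<kappa>'" for \<kappa>'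
  proof -
    have "((\<lambda>\<kappa>. integral (cbox 0 One) (\<lambda>x. fourier f \<kappa> * character \<kappa> x * cnj (character \<kappa>' x)))
        has_sum fourier S \<kappa>') frequencies"
      unfolding fourier_def[of S]
    proof (rule integral_has_sum(1)[OF _ _ sm])
      show "continuous_on (cbox 0 One) (\<lambda>x. fourier f \<kappa> * character \<kappa> x * cnj (character \<kappa>' x))" for \<kappa>
        by (intro continuous_intros)
      show "((\<lambda>\<kappa>. fourier f \<kappa> * character \<kappa> x * cnj (character \<kappa>' x)) has_sum S x * cnj (character \<kappa>' x)) frequencies" for x
        by (intro has_sum_cmult_left S)
    qed (simp add: norm_mult)
    moreover have "integral (cbox 0 One) (\<lambda>x. fourier f \<kappa> * character \<kappa> x * cnj (character \<kappa>' x))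
        = (if \<kappa> = restrict \<kappa>' Basis then fourier f \<kappa>' else 0)" if k: "\<kappa> \<in> frequencies" for \<kappa>
    proof (cases "\<kappa> = restrict \<kappa>' Basis")
      case True
      then have "character \<kappa> x * cnj (character \<kappa>' x) = 1" for x
        by (simp add: character_def phase_def cis_cnj cis_mult)
      then show ?thesis using True by (simp add: mult.assoc fourier_restrict)
    next
      case False
      have eq: "character \<kappa> x * cnj (character \<kappa>' x) = character (\<lambda>b. \<kappa> b + - \<kappa>' b) x" for x
        unfolding cnj_character by (rule character_mult)
      have "\<exists>b\<in>Basis. \<kappa> b \<noteq> \<kappa>' b"
      proof (rule ccontr)
        assume "\<not> ?thesis"
        then have "\<kappa> b = restrict \<kappa>' Basis b" if "b \<in> Basis" for b using that by simp
        with k have "\<kappa> = restrict \<kappa>' Basis" by (intro PiE_ext[of \<kappa> Basis "\<lambda>_. UNIV"]) auto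
        with False show False ..
      qed
      then obtain b where b: "b \<in> Basis" "\<kappa> b \<noteq> \<kappa>' b" by blast
      have "integral (cbox 0 One) (character (\<lambda>b. \<kappa> b + - \<kappa>' b)) = 0"
        using b by (intro integral_character[of b]) auto
      then show ?thesis using False by (simp add: mult.assoc eq)
    qed
    ultimately have "((\<lambda>\<kappa>. if \<kappa> = restrict \<kappa>' Basis then fourier f \<kappa>' else 0) has_sum fourier S \<kappa>') frequencies"
      by (subst (asm) has_sum_cong) auto
    moreover have "((\<lambda>\<kappa>. if \<kappa> = restrict \<kappa>' Basis then fourier f \<kappa>' else 0) has_sum
        (if restrict \<kappa>' Basis = restrict \<kappa>' Basis then fourier f \<kappa>' else 0)) frequencies"
      by (rule has_sum_single) auto
    ultimately have "fourier S \<kappa>' = (if restrict \<kappa>' Basis = restrict \<kappa>' Basis then fourier f \<kappa>' else 0)"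
      by (rule has_sum_unique)
    then show ?thesis by simp
  qed
  have "f x - S x = 0"
  proof (rule fourier_zero_imp_zero[of "\<lambda>x. f x - S x"])
    show "continuous_on UNIV (\<lambda>x. f x - S x)" by (intro continuous_intros cont ScU)
    show "lattice_periodic (\<lambda>x. f x - S x)" using per Sp by (simp add: lattice_periodic_def)
    show "fourier (\<lambda>x. f x - S x) \<kappa> = 0" for \<kappa>
    proof -
      have "fourier (\<lambda>x. f x - S x) \<kappa> = fourier f \<kappa> - fourier S \<kappa>"
        unfolding fourier_def left_diff_distrib
        by (intro integral_diff integrable_continuous continuous_intros continuous_on_subset[OF cont] continuous_on_subset[OF ScU]) auto
      then show ?thesis by (simp add: Sf)
    qed
  qed
  then show ?thesis using S[of x] by simp
qed

section \<open>The small divisors equation\<close>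

lemma norm_cis_taylor: "norm (cis y - 1 - \<i> * of_real y) \<le> y\<^sup>2"
proof -
  have c1: "norm (cis y - 1) \<le> \<bar>y\<bar>" for y
  proof -
    have "norm (cis y - 1) = 2 * \<bar>sin (y / 2)\<bar>" using dist_exp_i_1[of y] by (simp add: cis_conv_exp)
    also have "\<dots> \<le> 2 * \<bar>y / 2\<bar>" by (intro mult_left_mono abs_sin_x_le_abs_x) auto
    finally show ?thesis by simp
  qed
  let ?g = "\<lambda>y. cis y - 1 - \<i> * of_real y"
  have "norm (?g y - ?g 0) \<le> \<bar>y\<bar> * norm (y - 0)"
  proof (rule differentiable_bound[of "closed_segment 0 y" ?g "\<lambda>x t. t *\<^sub>R (\<i> * (cis x - 1))"])
    fix x assume x: "x \<in> closed_segment 0 y"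
    show "(?g has_derivative (\<lambda>t. t *\<^sub>R (\<i> * (cis x - 1)))) (at x within closed_segment 0 y)"
      by (auto intro!: derivative_eq_intros simp: scaleR_conv_of_real algebra_simps)
    have "\<bar>x\<bar> \<le> \<bar>y\<bar>" using x by (auto simp: closed_segment_eq_real_ivl split: if_splits)
    then show "onorm (\<lambda>t. t *\<^sub>R (\<i> * (cis x - 1))) \<le> \<bar>y\<bar>"
      using c1[of x] by (intro onorm_le) (auto simp: norm_mult mult.commute intro!: mult_left_mono)
  qed auto
  then show ?thesis by (simp add: power2_eq_square)
qed

lemma abs_phase_le: "\<bar>phase \<kappa> v\<bar> \<le> freq_norm \<kappa> * norm v"
proof -
  have "\<bar>phase \<kappa> v\<bar> \<le> (\<Sum>b\<in>Basis. \<bar>of_int (\<kappa> b)\<bar> * \<bar>v \<bullet> b\<bar>)"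
    unfolding phase_def by (rule order_trans[OF sum_abs]) (simp add: abs_mult)
  also have "\<dots> \<le> (\<Sum>b\<in>Basis. \<bar>of_int (\<kappa> b)\<bar> * norm v)"
    by (intro sum_mono mult_left_mono Basis_le_norm) auto
  finally show ?thesis by (simp add: freq_norm_def sum_distrib_right)
qed

lemma freq_norm_ge_1:
  assumes "b \<in> Basis" "\<kappa> b \<noteq> 0" shows "1 \<le> freq_norm \<kappa>"
proof -
  have "1 \<le> \<bar>of_int (\<kappa> b) :: real\<bar>" using assms(2) by linarith
  also have "\<dots> \<le> freq_norm \<kappa>" unfolding freq_norm_def using assms(1) by (intro member_le_sum) auto
  finally show ?thesis .
qed

definition fourier_at :: "('a::euclidean_space \<times> 'p \<Rightarrow> real) \<Rightarrow> ('a \<Rightarrow> int) \<Rightarrow> 'p \<Rightarrow> complex" where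
  "fourier_at h \<kappa> l = fourier (\<lambda>x. of_real (h (x, l))) \<kappa>"

text \<open>The coefficients are analytic in the parameters on a cube that does not depend on the frequency, with
exponentially decaying bounds: expand \<open>h\<close> in powers of the parameters, with coefficient functions that are
periodic analytic in the angles by uniqueness of the expansion, and apply the decay to each of them.\<close>

lemma ps_bound_fourier_at:
  fixes h :: "'a::euclidean_space \<times> 'p::euclidean_space \<Rightarrow> real"
  assumes h: "real_analytic_on h (UNIV \<times> {l0})" and per: "\<And>l. lattice_periodic (\<lambda>x. h (x, l))"
  obtains r a N where "0 < r" "0 < a" "\<And>\<kappa>. ps_bound l0 r (fourier_at h \<kappa>) (N * exp (- a * freq_norm \<kappa>))"
proof -
  obtain R M where R: "0 < R" "R \<le> 1" "\<And>x. ps_bound (x, l0) R h M"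
    by (rule lattice_periodic_uniform_ps_bound[OF h per]) blast
  have M0: "0 \<le> M" using R(3)[of 0] R(1) by (auto intro: ps_bound_nonneg)
  obtain g where g: "\<And>\<beta> x. \<beta> \<in> multi_indices \<Longrightarrow> ps_bound x R (g \<beta>) (M / R ^ mdeg \<beta>)"
    and gs: "\<And>x l. l \<in> cube R \<Longrightarrow> ((\<lambda>\<beta>. mpow l \<beta> * g \<beta> x) has_sum h (x, l0 + l)) multi_indices"
    by (rule global_slices[OF R(1,3)]) blast
  have gp: "lattice_periodic (g \<beta>)" if \<beta>: "\<beta> \<in> multi_indices" for \<beta>
    unfolding lattice_periodic_def
  proof (intro allI ballI)
    fix x q :: 'a assume q: "q \<in> lattice"
    show "g \<beta> (x + q) = g \<beta> x"
    proof (rule ps_coefficients_unique[OF R(1) _ _ \<beta>, of "\<lambda>\<beta>. g \<beta> (x + q)" "\<lambda>l. h (x, l0 + l)" "\<lambda>\<beta>. g \<beta> x"])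
      fix l :: 'p assume l: "l \<in> cube R"
      show "((\<lambda>\<beta>. mpow l \<beta> * g \<beta> x) has_sum h (x, l0 + l)) multi_indices" by (rule gs[OF l])
      show "((\<lambda>\<beta>. mpow l \<beta> * g \<beta> (x + q)) has_sum h (x, l0 + l)) multi_indices"
        using gs[OF l, of "x + q"] lattice_periodicD[OF per q, of x "l0 + l"] by simp
    qed
  qed
  define a where "a = pi * R / (2 * DIM('a))"
  have a: "0 < a" using R(1) by (simp add: a_def)
  define c where "c \<kappa> \<beta> = fourier (\<lambda>x. of_real (g \<beta> x)) \<kappa>" for \<kappa> \<beta>
  have cle: "norm (c \<kappa> \<beta>) \<le> 2 * (M / R ^ mdeg \<beta>) * exp (- a * freq_norm \<kappa>)" if "\<beta> \<in> multi_indices" for \<kappa> \<beta>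
    unfolding c_def a_def by (rule fourier_decay[OF R(1,2) g[OF that] gp[OF that]])
  have gc: "continuous_on S (g \<beta>)" if "\<beta> \<in> multi_indices" for \<beta> S
  proof -
    have "continuous_on UNIV (g \<beta>)"
      by (intro real_analytic_on_continuous_on real_analytic_on_UNIV_ps_boundI[OF R(1) g[OF that]])
    then show ?thesis by (rule continuous_on_subset) simp
  qed
  have geo: "(\<lambda>\<beta>::'p \<Rightarrow> nat. K * (1/2) ^ mdeg \<beta>) summable_on multi_indices" for K :: real
    by (intro summable_on_cmult_right summable_on_geometric_mdeg) auto
  define G where "G = (\<Sum>\<^sub>\<infinity>\<beta>\<in>(multi_indices :: ('p \<Rightarrow> nat) set). (1/2 :: real) ^ mdeg \<beta>)"
  have half: "mpow l \<beta> * K \<le> (R/2) ^ mdeg \<beta> * K" "\<bar>mpow l \<beta>\<bar> * K \<le> (R/2) ^ mdeg \<beta> * K"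
    if "l \<in> cube (R/2)" "0 \<le> K" for l :: 'p and \<beta> K
    using abs_mpow_le[OF that(1), of \<beta>] that(2) by (auto intro!: mult_right_mono)
  have hs: "((\<lambda>\<beta>. of_real (mpow l \<beta>) * c \<kappa> \<beta>) has_sum fourier_at h \<kappa> (l0 + l)) multi_indices"
    if l: "l \<in> cube (R / 2)" for l \<kappa>
  proof -
    have lR: "l \<in> cube R" using l cube_mono[of "R / 2" R] R(1) by auto
    have "((\<lambda>\<beta>. integral (cbox 0 One) (\<lambda>x. (of_real (mpow l \<beta>) * of_real (g \<beta> x)) * cnj (character \<kappa> x))) has_sum
        integral (cbox 0 One) (\<lambda>x. of_real (h (x, l0 + l)) * cnj (character \<kappa> x))) multi_indices"
    proof (rule integral_has_sum(1)[where m = "\<lambda>\<beta>. M * (1/2) ^ mdeg \<beta>"])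
      show "(\<lambda>\<beta>::'p \<Rightarrow> nat. M * (1/2) ^ mdeg \<beta>) summable_on multi_indices" by (rule geo)
      show "continuous_on (cbox 0 One) (\<lambda>x. (of_real (mpow l \<beta>) * of_real (g \<beta> x)) * cnj (character \<kappa> x))"
        if "\<beta> \<in> multi_indices" for \<beta>
        by (intro continuous_intros gc that)
      show "norm ((of_real (mpow l \<beta>) * of_real (g \<beta> x)) * cnj (character \<kappa> x)) \<le> M * (1/2) ^ mdeg \<beta>"
        if "\<beta> \<in> multi_indices" for \<beta> x
      proof -
        have "norm (g \<beta> x) \<le> M / R ^ mdeg \<beta>" using ps_bound_normE[OF g[OF that], of 0] R(1) by simp
        then have "\<bar>mpow l \<beta>\<bar> * norm (g \<beta> x) \<le> (R/2) ^ mdeg \<beta> * (M / R ^ mdeg \<beta>)"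
          using abs_mpow_le[OF l, of \<beta>] R(1) by (intro mult_mono) auto
        then show ?thesis using R(1) by (simp add: norm_mult power_divide field_simps)
      qed
      show "((\<lambda>\<beta>. (of_real (mpow l \<beta>) * of_real (g \<beta> x)) * cnj (character \<kappa> x)) has_sum
          of_real (h (x, l0 + l)) * cnj (character \<kappa> x)) multi_indices" for x
      proof (rule has_sum_cmult_left)
        have "((\<lambda>\<beta>. of_real (mpow l \<beta> * g \<beta> x) :: complex) has_sum of_real (h (x, l0 + l))) multi_indices"
          using gs[OF lR, of x] by (simp only: has_sum_of_real_iff)
        then show "((\<lambda>\<beta>. of_real (mpow l \<beta>) * of_real (g \<beta> x) :: complex) has_sum of_real (h (x, l0 + l))) multi_indices" by simp
      qed
    qed
    moreover have "integral (cbox 0 One) (\<lambda>x. (of_real (mpow l \<beta>) * of_real (g \<beta> x)) * cnj (character \<kappa> x)) = of_real (mpow l \<beta>) * c \<kappa> \<beta>" for \<beta>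
      unfolding c_def fourier_def by (simp only: mult.assoc integral_mult_right)
    ultimately show ?thesis by (simp add: fourier_at_def fourier_def)
  qed
  have "ps_bound l0 (R / 2) (fourier_at h \<kappa>) (2 * M * G * exp (- a * freq_norm \<kappa>))" for \<kappa>
  proof (rule ps_bound_sum[where F = "\<lambda>\<beta> l. mpow (l - l0) \<beta> *\<^sub>R c \<kappa> \<beta>" and J = multi_indices
        and m = "\<lambda>\<beta>. (2 * M * exp (- a * freq_norm \<kappa>)) * (1/2) ^ mdeg \<beta>"])
    show "(\<lambda>\<beta>::'p \<Rightarrow> nat. (2 * M * exp (- a * freq_norm \<kappa>)) * (1/2) ^ mdeg \<beta>) summable_on multi_indices" by (rule geo)
    show "(\<Sum>\<^sub>\<infinity>\<beta>\<in>(multi_indices :: ('p \<Rightarrow> nat) set). (2 * M * exp (- a * freq_norm \<kappa>)) * (1/2) ^ mdeg \<beta>) \<le> 2 * M * G * exp (- a * freq_norm \<kappa>)"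
      unfolding G_def by (subst infsum_cmult_right') simp
    show "ps_bound l0 (R / 2) (\<lambda>l. mpow (l - l0) \<beta> *\<^sub>R c \<kappa> \<beta>) ((2 * M * exp (- a * freq_norm \<kappa>)) * (1/2) ^ mdeg \<beta>)"
      if "\<beta> \<in> multi_indices" for \<beta>
    proof (rule ps_bound_mono[OF ps_bound_monomial])
      have "norm (c \<kappa> \<beta>) * (R/2) ^ mdeg \<beta> \<le> (2 * (M / R ^ mdeg \<beta>) * exp (- a * freq_norm \<kappa>)) * (R/2) ^ mdeg \<beta>"
        using R(1) by (intro mult_right_mono cle that) auto
      then show "norm (c \<kappa> \<beta>) * (R/2) ^ mdeg \<beta> \<le> (2 * M * exp (- a * freq_norm \<kappa>)) * (1/2) ^ mdeg \<beta>"
        using R(1) by (simp add: power_divide field_simps)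
    qed (use R(1) in simp)
    show "((\<lambda>\<beta>. mpow (l0 + l - l0) \<beta> *\<^sub>R c \<kappa> \<beta>) has_sum fourier_at h \<kappa> (l0 + l)) multi_indices"
      if "l \<in> cube (R / 2)" for l
      using hs[OF that] by (simp add: scaleR_conv_of_real)
  qed (use R(1) in simp)
  with R(1) a show ?thesis by (intro that[of "R / 2" a "2 * M * G"]) auto
qed

lemma fourier_zero_freq:
  fixes f :: "'a::euclidean_space \<Rightarrow> real"
  assumes "continuous_on UNIV f" "\<And>b. b \<in> Basis \<Longrightarrow> \<kappa> b = 0"
  shows "fourier (\<lambda>x. of_real (f x)) \<kappa> = of_real (integral (cbox 0 One) f)"
proof -
  have "character \<kappa> x = 1" for x using assms(2) by (simp add: character_def phase_def)
  moreover have "(f has_integral integral (cbox 0 One) f) (cbox 0 One)"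
    by (intro integrable_integral integrable_continuous continuous_on_subset[OF assms(1)]) auto
  from has_integral_of_real[OF this, where ?'b = complex]
  have "integral (cbox 0 One) (\<lambda>x. of_real (f x) :: complex) = of_real (integral (cbox 0 One) f)"
    by (rule integral_unique)
  ultimately show ?thesis by (simp add: fourier_def)
qed

lemma real_analytic_on_slice:
  fixes h :: "'a::euclidean_space \<times> 'p::euclidean_space \<Rightarrow> 'b::banach"
  assumes "real_analytic_on h (UNIV \<times> {l})" shows "real_analytic_on (\<lambda>x. h (x, l)) UNIV"
  by (rule real_analytic_on_compose[OF assms]) (auto intro!: real_analytic_intros)

lemma real_analytic_on_integral:
  fixes h :: "'a::euclidean_space \<times> 'p::euclidean_space \<Rightarrow> real"
  assumes h: "real_analytic_on h (UNIV \<times> S)" and per: "\<And>l. lattice_periodic (\<lambda>x. h (x, l))"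
  shows "real_analytic_on (\<lambda>l. Re (fourier_at h (\<lambda>_. 0) l)) S"
proof (rule real_analytic_on_bounded_linear[OF bounded_linear_Re], rule real_analytic_onI)
  fix l0 assume "l0 \<in> S"
  then have "real_analytic_on h (UNIV \<times> {l0})" by (intro real_analytic_on_subset[OF h]) auto
  then obtain r a N where "0 < r" "\<And>\<kappa>. ps_bound l0 r (fourier_at h \<kappa>) (N * exp (- a * freq_norm \<kappa>))"
    by (rule ps_bound_fourier_at[OF _ per]) blast
  then show "\<exists>r>0. \<exists>M. ps_bound l0 r (fourier_at h (\<lambda>_. 0)) M" by blast
qed

text \<open>The Diophantine condition for an abstract basis, with an arbitrary exponent: the exponential decay of the
Fourier coefficients absorbs every power of the frequency.\<close>

definition diophantine_vector :: "'a::euclidean_space \<Rightarrow> bool" where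
  "diophantine_vector v \<longleftrightarrow> (\<exists>C>0. \<exists>t. \<forall>\<kappa>. (\<exists>b\<in>Basis. \<kappa> b \<noteq> 0) \<longrightarrow> C * freq_norm \<kappa> powr (- t) \<le> \<bar>phase \<kappa> v\<bar>)"

lemma diophantine_vector_nonresonant: "diophantine_vector v \<Longrightarrow> nonresonant v"
  unfolding diophantine_vector_def nonresonant_def
proof (elim exE conjE, intro allI impI notI)
  fix C t \<kappa> assume C: "0 < C" and *: "\<forall>\<kappa>. (\<exists>b\<in>Basis. \<kappa> b \<noteq> 0) \<longrightarrow> C * freq_norm \<kappa> powr (- t) \<le> \<bar>phase \<kappa> v\<bar>"
    and ex: "\<exists>b\<in>Basis. \<kappa> b \<noteq> 0" and z: "phase \<kappa> v = 0"
  have "1 \<le> freq_norm \<kappa>" using ex freq_norm_ge_1 by blast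
  then have "0 < C * freq_norm \<kappa> powr (- t)" using C by simp
  with * ex z show False by force
qed

text \<open>The solution has the Fourier coefficients of \<open>h\<close> divided by \<open>\<i> * th \<kappa>\<close>. By the Diophantine condition
the division costs a power of the frequency, which is absorbed by a part of the exponential decay; another
part absorbs the growth of the characters on the polydisc, and the rest makes the series of bounds
converge. Hence the sum is analytic jointly in the angles and the parameters.\<close>

lemma small_divisor_equation_real:
  fixes h :: "'a::euclidean_space \<times> 'p::euclidean_space \<Rightarrow> real" and v :: 'a
  assumes h: "real_analytic_on h (UNIV \<times> S)" and per: "\<And>l. lattice_periodic (\<lambda>x. h (x, l))"
    and v: "diophantine_vector v" and avg: "\<And>l. l \<in> S \<Longrightarrow> integral (cbox 0 One) (\<lambda>x. h (x, l)) = 0"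
  obtains \<phi> where "real_analytic_on \<phi> (UNIV \<times> S)" "\<And>l. lattice_periodic (\<lambda>x. \<phi> (x, l))"
    "\<And>l. l \<in> S \<Longrightarrow> integral (cbox 0 One) (\<lambda>x. \<phi> (x, l)) = 0"
    "\<And>l x. l \<in> S \<Longrightarrow> ((\<lambda>t. \<phi> (x + t *\<^sub>R v, l)) has_vector_derivative h (x, l)) (at 0)"
proof -
  \<comment> \<open>the zero frequency is left out: there the divisor vanishes, and so does the coefficient of \<open>h\<close>\<close>
  let ?K = "{\<kappa> \<in> frequencies. \<exists>b\<in>Basis. \<kappa> b \<noteq> 0} :: ('a \<Rightarrow> int) set"
  define th where "th \<kappa> = 2 * pi * phase \<kappa> v" for \<kappa>
  define \<psi> where "\<psi> = (\<lambda>(x, l). \<Sum>\<^sub>\<infinity>\<kappa>\<in>?K. fourier_at h \<kappa> l / (\<i> * of_real (th \<kappa>)) * character \<kappa> x)"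
  define \<phi> where "\<phi> z = Re (\<psi> z)" for z
  obtain C t where C: "0 < C" and dio: "\<And>\<kappa>. \<exists>b\<in>Basis. \<kappa> b \<noteq> 0 \<Longrightarrow> C * freq_norm \<kappa> powr (- t) \<le> \<bar>phase \<kappa> v\<bar>"
    using v unfolding diophantine_vector_def by blast
  have th0: "th \<kappa> \<noteq> 0" if "\<kappa> \<in> ?K" for \<kappa>
    using diophantine_vector_nonresonant[OF v] that by (auto simp: th_def nonresonant_def)
  have inv_th: "1 / \<bar>th \<kappa>\<bar> \<le> freq_norm \<kappa> powr t / C" if k: "\<kappa> \<in> ?K" for \<kappa>
  proof -
    have f1: "1 \<le> freq_norm \<kappa>" using k freq_norm_ge_1 by blast
    have "C * freq_norm \<kappa> powr (- t) \<le> \<bar>phase \<kappa> v\<bar>" using k by (intro dio) blast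
    also have "\<dots> \<le> \<bar>th \<kappa>\<bar>" using pi_gt3 mult_right_mono[of 1 "2 * pi" "\<bar>phase \<kappa> v\<bar>"] by (simp add: th_def abs_mult)
    finally have le: "C * freq_norm \<kappa> powr (- t) \<le> \<bar>th \<kappa>\<bar>" .
    have "0 < C * freq_norm \<kappa> powr (- t)" using C f1 by simp
    from divide_left_mono[OF le, of 1] this have "1 / \<bar>th \<kappa>\<bar> \<le> 1 / (C * freq_norm \<kappa> powr (- t))"
      using th0[OF k] by (simp add: mult_pos_pos)
    then show ?thesis using f1 by (simp add: powr_minus field_simps)
  qed
  have local: "\<exists>\<rho>>0. \<exists>a>0. \<exists>N\<ge>0. \<forall>x. \<forall>\<kappa>\<in>?K.
      ps_bound (x, l0) \<rho> (\<lambda>(x, l). fourier_at h \<kappa> l / (\<i> * of_real (th \<kappa>)) * character \<kappa> x) (N * exp (- a * freq_norm \<kappa>))"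
    and local2: "\<exists>a>0. \<exists>N\<ge>0. \<forall>\<kappa>. norm (fourier_at h \<kappa> l0) \<le> N * exp (- a * freq_norm \<kappa>)" if l0: "l0 \<in> S" for l0
  proof -
    have "real_analytic_on h (UNIV \<times> {l0})" using l0 by (intro real_analytic_on_subset[OF h]) auto
    then obtain r a N where r: "0 < r" and a: "0 < a"
      and F: "\<And>\<kappa>. ps_bound l0 r (fourier_at h \<kappa>) (N * exp (- a * freq_norm \<kappa>))"
      by (rule ps_bound_fourier_at[OF _ per]) blast
    have N: "0 \<le> N"
      using ps_bound_nonneg[OF F[of "\<lambda>_. 0"]] r by (simp add: zero_le_mult_iff)
    have "norm (fourier_at h \<kappa> l0) \<le> N * exp (- a * freq_norm \<kappa>)" for \<kappa>
      using ps_bound_normE[OF F, of 0] r by simp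
    with a N show "\<exists>a>0. \<exists>N\<ge>0. \<forall>\<kappa>. norm (fourier_at h \<kappa> l0) \<le> N * exp (- a * freq_norm \<kappa>)" by blast
    \<comment> \<open>the decay rate \<open>a\<close> is split: a quarter for the characters, a quarter for the divisors, half for convergence\<close>
    define \<rho> where "\<rho> = min r (a / (8 * pi))"
    have \<rho>: "0 < \<rho>" "\<rho> \<le> r" "2 * pi * \<rho> \<le> a / 4" using r a by (auto simp: \<rho>_def min_def field_simps)
    obtain D where D: "0 < D" "\<And>y. 1 \<le> y \<Longrightarrow> y powr t \<le> D * exp (a / 4 * y)" using powr_le_exp[of "a / 4"] a by auto
    have "ps_bound (x, l0) \<rho> (\<lambda>(x, l). fourier_at h \<kappa> l / (\<i> * of_real (th \<kappa>)) * character \<kappa> x) (N * D / C * exp (- (a / 2) * freq_norm \<kappa>))"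
      if k: "\<kappa> \<in> ?K" for x \<kappa>
    proof -
      have f1: "1 \<le> freq_norm \<kappa>" using k freq_norm_ge_1 by blast
      have F': "ps_bound (x, l0) \<rho> (\<lambda>z. fourier_at h \<kappa> (snd z)) (N * exp (- a * freq_norm \<kappa>))"
      proof (rule ps_bound_compose[OF _ _ ps_bound_shrink[OF F, of \<rho>]])
        fix b :: 'p assume "b \<in> Basis"
        then have "(0 :: 'a, b) \<in> Basis" by (simp add: Basis_prod_def)
        from ps_bound_coordinate[OF _ this, of \<rho> "(x, l0)"] \<rho>
        show "ps_bound (x, l0) \<rho> (\<lambda>z. (snd z - l0) \<bullet> b) \<rho>" by (simp add: inner_prod_def)
      qed (use \<rho> in auto)
      have ch: "ps_bound (x, l0) \<rho> (\<lambda>z. character \<kappa> (fst z)) (exp (2 * pi * \<rho> * freq_norm \<kappa>))"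
      proof (rule ps_bound_compose[OF _ _ ps_bound_character[of \<rho> x]])
        fix b :: 'a assume "b \<in> Basis"
        then have "(b, 0 :: 'p) \<in> Basis" by (simp add: Basis_prod_def)
        from ps_bound_coordinate[OF _ this, of \<rho> "(x, l0)"] \<rho>
        show "ps_bound (x, l0) \<rho> (\<lambda>z. (fst z - x) \<bullet> b) \<rho>" by (simp add: inner_prod_def)
      qed (use \<rho> in auto)
      let ?B = "(N * exp (- a * freq_norm \<kappa>)) * norm (1 / (\<i> * of_real (th \<kappa>)) :: complex) * exp (2 * pi * \<rho> * freq_norm \<kappa>)"
      have "ps_bound (x, l0) \<rho> (\<lambda>z. fourier_at h \<kappa> (snd z) * (1 / (\<i> * of_real (th \<kappa>))) * character \<kappa> (fst z)) ?B"
        using \<rho> by (intro ps_bound_mult F' ch ps_bound_const) auto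
      then have 1: "ps_bound (x, l0) \<rho> (\<lambda>(x, l). fourier_at h \<kappa> l / (\<i> * of_real (th \<kappa>)) * character \<kappa> x) ?B"
        by (simp add: case_prod_unfold)
      have "?B = N * exp (- a * freq_norm \<kappa>) * exp (2 * pi * \<rho> * freq_norm \<kappa>) * (1 / \<bar>th \<kappa>\<bar>)"
        by (simp add: norm_divide norm_mult)
      also have "\<dots> \<le> N * exp (- a * freq_norm \<kappa>) * exp (a / 4 * freq_norm \<kappa>) * (D * exp (a / 4 * freq_norm \<kappa>) / C)"
      proof (rule mult_mono)
        have "2 * pi * \<rho> * freq_norm \<kappa> \<le> a / 4 * freq_norm \<kappa>" using \<rho>(3) f1 by (intro mult_right_mono) auto
        then show "N * exp (- a * freq_norm \<kappa>) * exp (2 * pi * \<rho> * freq_norm \<kappa>) \<le> N * exp (- a * freq_norm \<kappa>) * exp (a / 4 * freq_norm \<kappa>)"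
          using N by (intro mult_left_mono) auto
        have "freq_norm \<kappa> powr t / C \<le> D * exp (a / 4 * freq_norm \<kappa>) / C"
          using D(2)[OF f1] C by (intro divide_right_mono) auto
        with inv_th[OF k] show "1 / \<bar>th \<kappa>\<bar> \<le> D * exp (a / 4 * freq_norm \<kappa>) / C" by linarith
      qed (use N in auto)
      also have "\<dots> = N * D / C * (exp (- a * freq_norm \<kappa>) * exp (a / 4 * freq_norm \<kappa>) * exp (a / 4 * freq_norm \<kappa>))"
        by (simp add: field_simps)
      also have "exp (- a * freq_norm \<kappa>) * exp (a / 4 * freq_norm \<kappa>) * exp (a / 4 * freq_norm \<kappa>) = exp (- (a / 2) * freq_norm \<kappa>)"
        unfolding exp_add[symmetric] by (rule arg_cong[where f = exp]) (simp add: field_simps)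
      finally show ?thesis by (rule ps_bound_mono[OF 1])
    qed
    moreover have "0 \<le> N * D / C" using N D(1) C by simp
    ultimately show "\<exists>\<rho>>0. \<exists>a>0. \<exists>N\<ge>0. \<forall>x. \<forall>\<kappa>\<in>?K.
      ps_bound (x, l0) \<rho> (\<lambda>(x, l). fourier_at h \<kappa> l / (\<i> * of_real (th \<kappa>)) * character \<kappa> x) (N * exp (- a * freq_norm \<kappa>))"
      using \<rho>(1) a by (intro exI[of _ \<rho>] conjI exI[of _ "a / 2"] exI[of _ "N * D / C"] allI ballI) auto
  qed
  have smK: "(\<lambda>\<kappa>. N * exp (- a * freq_norm \<kappa>)) summable_on ?K" if "0 < a" for N a
    by (rule summable_on_subset_banach[OF summable_on_cmult_right[OF summable_on_exp_freq_norm[OF that]]]) auto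
  have an: "real_analytic_on \<psi> (UNIV \<times> S)"
  proof (rule real_analytic_onI)
    fix p assume "p \<in> (UNIV :: 'a set) \<times> S"
    then obtain x0 l0 where p: "p = (x0, l0)" and l0: "l0 \<in> S" by auto
    from local[OF l0] obtain \<rho> a N where \<rho>: "0 < \<rho>" and a: "0 < a"
      and B': "\<forall>x. \<forall>\<kappa>\<in>?K. ps_bound (x, l0) \<rho> (\<lambda>(x, l). fourier_at h \<kappa> l / (\<i> * of_real (th \<kappa>)) * character \<kappa> x) (N * exp (- a * freq_norm \<kappa>))"
      by (elim exE conjE) (rule that)
    have B: "ps_bound p \<rho> (\<lambda>(x, l). fourier_at h \<kappa> l / (\<i> * of_real (th \<kappa>)) * character \<kappa> x) (N * exp (- a * freq_norm \<kappa>))"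
      if "\<kappa> \<in> ?K" for \<kappa>
      unfolding p by (rule B'[THEN spec, THEN bspec, OF that])
    have "ps_bound p \<rho> \<psi> (\<Sum>\<^sub>\<infinity>\<kappa>\<in>?K. N * exp (- a * freq_norm \<kappa>))"
    proof (rule ps_bound_sum[OF _ B smK[OF a] order_refl])
      fix y :: "'a \<times> 'p" assume y: "y \<in> cube \<rho>"
      have "(\<lambda>\<kappa>. norm ((\<lambda>(x, l). fourier_at h \<kappa> l / (\<i> * of_real (th \<kappa>)) * character \<kappa> x) (p + y))) summable_on ?K"
        by (rule Infinite_Sum.abs_summable_on_comparison_test'[OF smK[OF a]])
           (rule ps_bound_normE[OF B _ y], use \<rho> in auto)
      from abs_summable_summable[OF this]
      show "((\<lambda>\<kappa>. (\<lambda>(x, l). fourier_at h \<kappa> l / (\<i> * of_real (th \<kappa>)) * character \<kappa> x) (p + y)) has_sum \<psi> (p + y)) ?K"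
        unfolding \<psi>_def by (cases "p + y") simp
    qed (use \<rho> in auto)
    with \<rho> show "\<exists>r>0. \<exists>M. ps_bound p r \<psi> M" by blast
  qed
  have psi_sum: "((\<lambda>\<kappa>. fourier_at h \<kappa> l / (\<i> * of_real (th \<kappa>)) * character \<kappa> x) has_sum \<psi> (x, l)) ?K"
    and psi_abs: "\<exists>m. m summable_on ?K \<and> (\<forall>\<kappa>\<in>?K. \<forall>x. norm (fourier_at h \<kappa> l / (\<i> * of_real (th \<kappa>)) * character \<kappa> x) \<le> m \<kappa>)"
    if l: "l \<in> S" for l x
  proof -
    from local[OF l] obtain \<rho> a N where \<rho>: "0 < \<rho>" and a: "0 < a"
      and B': "\<forall>x. \<forall>\<kappa>\<in>?K. ps_bound (x, l) \<rho> (\<lambda>(x, l). fourier_at h \<kappa> l / (\<i> * of_real (th \<kappa>)) * character \<kappa> x) (N * exp (- a * freq_norm \<kappa>))"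
      by (elim exE conjE) (rule that)
    have B: "ps_bound (x, l) \<rho> (\<lambda>(x, l). fourier_at h \<kappa> l / (\<i> * of_real (th \<kappa>)) * character \<kappa> x) (N * exp (- a * freq_norm \<kappa>))"
      if "\<kappa> \<in> ?K" for \<kappa> x
      by (rule B'[THEN spec, THEN bspec, OF that])
    have le: "norm (fourier_at h \<kappa> l / (\<i> * of_real (th \<kappa>)) * character \<kappa> x) \<le> N * exp (- a * freq_norm \<kappa>)" if "\<kappa> \<in> ?K" for \<kappa> x
      using ps_bound_normE[OF B[OF that], of 0 x] \<rho> by simp
    then show "\<exists>m. m summable_on ?K \<and> (\<forall>\<kappa>\<in>?K. \<forall>x. norm (fourier_at h \<kappa> l / (\<i> * of_real (th \<kappa>)) * character \<kappa> x) \<le> m \<kappa>)"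
      by (intro exI[of _ "\<lambda>\<kappa>. N * exp (- a * freq_norm \<kappa>)"] conjI smK[OF a] ballI allI le)
    have "(\<lambda>\<kappa>. norm (fourier_at h \<kappa> l / (\<i> * of_real (th \<kappa>)) * character \<kappa> x)) summable_on ?K"
      by (rule Infinite_Sum.abs_summable_on_comparison_test'[OF smK[OF a] le])
    from abs_summable_summable[OF this]
    show "((\<lambda>\<kappa>. fourier_at h \<kappa> l / (\<i> * of_real (th \<kappa>)) * character \<kappa> x) has_sum \<psi> (x, l)) ?K"
      unfolding \<psi>_def by simp
  qed
  have psi_per: "lattice_periodic (\<lambda>x. \<psi> (x, l))" for l
    by (simp add: lattice_periodic_def \<psi>_def character_add character_lattice)
  have psi_avg: "integral (cbox 0 One) (\<lambda>x. \<psi> (x, l)) = 0" if l: "l \<in> S" for l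
  proof -
    from psi_abs[OF l] obtain m where m: "m summable_on ?K" and
      m2: "\<forall>\<kappa>\<in>?K. \<forall>x. norm (fourier_at h \<kappa> l / (\<i> * of_real (th \<kappa>)) * character \<kappa> x) \<le> m \<kappa>"
      by (elim exE conjE) (rule that)
    have "((\<lambda>\<kappa>. integral (cbox 0 One) (\<lambda>x. fourier_at h \<kappa> l / (\<i> * of_real (th \<kappa>)) * character \<kappa> x)) has_sum integral (cbox 0 One) (\<lambda>x. \<psi> (x, l))) ?K"
      by (rule integral_has_sum(1)[OF _ m2[THEN bspec, THEN spec] m psi_sum[OF l]]) (intro continuous_intros)
    moreover have "integral (cbox 0 One) (\<lambda>x. fourier_at h \<kappa> l / (\<i> * of_real (th \<kappa>)) * character \<kappa> x) = 0" if "\<kappa> \<in> ?K" for \<kappa>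
    proof -
      obtain b where "b \<in> Basis" "\<kappa> b \<noteq> 0" using \<open>\<kappa> \<in> ?K\<close> by blast
      from integral_character[of b \<kappa>, OF this] show ?thesis by simp
    qed
    ultimately have "((\<lambda>\<kappa>. 0) has_sum integral (cbox 0 One) (\<lambda>x. \<psi> (x, l))) ?K"
      by (subst (asm) has_sum_cong) auto
    then show ?thesis using has_sum_unique has_sum_0_simp by blast
  qed
  have h_sum: "((\<lambda>\<kappa>. fourier_at h \<kappa> l * character \<kappa> x) has_sum of_real (h (x, l))) ?K" if l: "l \<in> S" for l x
  proof -
    obtain a N where a: "0 < a" and N: "\<And>\<kappa>. norm (fourier_at h \<kappa> l) \<le> N * exp (- a * freq_norm \<kappa>)"
      using local2[OF l] by (elim exE conjE) (rule that, auto)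
    have hl: "real_analytic_on h (UNIV \<times> {l})" using l by (intro real_analytic_on_subset[OF h]) auto
    then have hc: "continuous_on UNIV (\<lambda>x. h (x, l))" by (intro real_analytic_on_continuous_on real_analytic_on_slice)
    have "((\<lambda>\<kappa>. fourier (\<lambda>x. of_real (h (x, l))) \<kappa> * character \<kappa> x) has_sum of_real (h (x, l))) frequencies"
    proof (rule fourier_inversion)
      show "continuous_on UNIV (\<lambda>x. of_real (h (x, l)) :: complex)" by (intro continuous_intros hc)
      show "lattice_periodic (\<lambda>x. of_real (h (x, l)) :: complex)" using per[of l] by (simp add: lattice_periodic_def)
      show "(\<lambda>\<kappa>. norm (fourier (\<lambda>x. of_real (h (x, l))) \<kappa>)) summable_on (frequencies :: ('a \<Rightarrow> int) set)"
        by (rule Infinite_Sum.abs_summable_on_comparison_test'[OF summable_on_cmult_right[OF summable_on_exp_freq_norm[OF a]]])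
           (use N in \<open>auto simp: fourier_at_def\<close>)
    qed
    then have hs: "((\<lambda>\<kappa>. fourier_at h \<kappa> l * character \<kappa> x) has_sum of_real (h (x, l))) frequencies"
      by (simp add: fourier_at_def)
    have "((\<lambda>\<kappa>. fourier_at h \<kappa> l * character \<kappa> x) has_sum of_real (h (x, l))) frequencies \<longleftrightarrow>
        ((\<lambda>\<kappa>. fourier_at h \<kappa> l * character \<kappa> x) has_sum of_real (h (x, l))) ?K"
    proof (rule has_sum_cong_neutral)
      fix \<kappa> :: "'a \<Rightarrow> int" assume "\<kappa> \<in> frequencies - ?K"
      then have "\<And>b. b \<in> Basis \<Longrightarrow> \<kappa> b = 0" by auto
      from fourier_zero_freq[of "\<lambda>x. h (x, l)" \<kappa>, OF hc this] avg[OF l]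
      show "fourier_at h \<kappa> l * character \<kappa> x = 0" by (simp add: fourier_at_def)
    qed auto
    with hs show ?thesis by blast
  qed
  have psi_deriv: "((\<lambda>s. \<psi> (x + s *\<^sub>R v, l)) has_vector_derivative of_real (h (x, l))) (at 0)" if l: "l \<in> S" for l x
  proof -
    obtain a N where a: "0 < a" and N: "\<And>\<kappa>. norm (fourier_at h \<kappa> l) \<le> N * exp (- a * freq_norm \<kappa>)" and N0: "0 \<le> N"
      using local2[OF l] by (elim exE conjE) (rule that, auto)
    obtain D where D: "0 < D" "\<And>y. 1 \<le> y \<Longrightarrow> y powr 1 \<le> D * exp (a / 2 * y)"
      using powr_le_exp[OF half_gt_zero[OF a], of 1] by blast
    define m where "m \<kappa> = (2 * pi * norm v * N * D) * exp (- (a / 2) * freq_norm \<kappa>)" for \<kappa> :: "'a \<Rightarrow> int"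
    have msm: "m summable_on ?K" unfolding m_def using a by (intro smK) auto
    have bnd: "norm (fourier_at h \<kappa> l) * \<bar>th \<kappa>\<bar> \<le> m \<kappa>" if k: "\<kappa> \<in> ?K" for \<kappa>
    proof -
      have f1: "1 \<le> freq_norm \<kappa>" using k freq_norm_ge_1 by blast
      have "\<bar>th \<kappa>\<bar> \<le> 2 * pi * (freq_norm \<kappa> * norm v)" using abs_phase_le[of \<kappa> v] by (simp add: th_def abs_mult)
      also have "\<dots> \<le> 2 * pi * ((D * exp (a / 2 * freq_norm \<kappa>)) * norm v)"
        using D(2)[OF f1] f1 by (intro mult_left_mono mult_right_mono) auto
      finally have "norm (fourier_at h \<kappa> l) * \<bar>th \<kappa>\<bar> \<le> (N * exp (- a * freq_norm \<kappa>)) * (2 * pi * ((D * exp (a / 2 * freq_norm \<kappa>)) * norm v))"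
        using N N0 by (intro mult_mono) auto
      also have "\<dots> = (2 * pi * norm v * N * D) * (exp (- a * freq_norm \<kappa>) * exp (a / 2 * freq_norm \<kappa>))" by (simp add: mult_ac)
      also have "exp (- a * freq_norm \<kappa>) * exp (a / 2 * freq_norm \<kappa>) = exp (- (a / 2) * freq_norm \<kappa>)"
        unfolding exp_add[symmetric] by (rule arg_cong[where f = exp]) (simp add: field_simps)
      finally show ?thesis by (simp add: m_def)
    qed
    let ?A = "infsum m ?K"
    \<comment> \<open>termwise Taylor expansion: \<open>cis y - 1 - \<i> * y\<close> is at most \<open>y\<^sup>2\<close>, and one factor \<open>th \<kappa>\<close> cancels the divisor\<close>
    have le: "norm (\<psi> (x + s *\<^sub>R v, l) - \<psi> (x, l) - s *\<^sub>R of_real (h (x, l))) \<le> s\<^sup>2 * ?A" for s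
    proof (rule norm_infsum_le)
      show "((\<lambda>\<kappa>. fourier_at h \<kappa> l / (\<i> * of_real (th \<kappa>)) * character \<kappa> (x + s *\<^sub>R v)
          - fourier_at h \<kappa> l / (\<i> * of_real (th \<kappa>)) * character \<kappa> x - s *\<^sub>R (fourier_at h \<kappa> l * character \<kappa> x))
          has_sum \<psi> (x + s *\<^sub>R v, l) - \<psi> (x, l) - s *\<^sub>R of_real (h (x, l))) ?K"
        by (intro has_sum_minus has_sum_scaleR psi_sum h_sum l)
      show "((\<lambda>\<kappa>. s\<^sup>2 * m \<kappa>) has_sum s\<^sup>2 * ?A) ?K" by (intro has_sum_cmult_right has_sum_infsum msm)
      fix \<kappa> assume k: "\<kappa> \<in> ?K"
      have "character \<kappa> (s *\<^sub>R v) = cis (th \<kappa> * s)" by (simp add: character_def phase_scaleR th_def mult_ac)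
      then have "fourier_at h \<kappa> l / (\<i> * of_real (th \<kappa>)) * character \<kappa> (x + s *\<^sub>R v)
          - fourier_at h \<kappa> l / (\<i> * of_real (th \<kappa>)) * character \<kappa> x - s *\<^sub>R (fourier_at h \<kappa> l * character \<kappa> x)
          = fourier_at h \<kappa> l * character \<kappa> x * (cis (th \<kappa> * s) - 1 - \<i> * of_real (th \<kappa> * s)) / (\<i> * of_real (th \<kappa>))"
        using th0[OF k] by (simp add: character_add scaleR_conv_of_real field_simps)
      then have "norm (fourier_at h \<kappa> l / (\<i> * of_real (th \<kappa>)) * character \<kappa> (x + s *\<^sub>R v)
          - fourier_at h \<kappa> l / (\<i> * of_real (th \<kappa>)) * character \<kappa> x - s *\<^sub>R (fourier_at h \<kappa> l * character \<kappa> x))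
          = norm (fourier_at h \<kappa> l) * norm (cis (th \<kappa> * s) - 1 - \<i> * of_real (th \<kappa> * s)) / \<bar>th \<kappa>\<bar>"
        by (simp add: norm_mult norm_divide)
      also have "\<dots> \<le> norm (fourier_at h \<kappa> l) * (th \<kappa> * s)\<^sup>2 / \<bar>th \<kappa>\<bar>"
        by (intro divide_right_mono mult_left_mono norm_cis_taylor) auto
      also have "(th \<kappa> * s)\<^sup>2 = s\<^sup>2 * \<bar>th \<kappa>\<bar> * \<bar>th \<kappa>\<bar>" by (simp add: power_mult_distrib power2_eq_square)
      also have "norm (fourier_at h \<kappa> l) * (s\<^sup>2 * \<bar>th \<kappa>\<bar> * \<bar>th \<kappa>\<bar>) / \<bar>th \<kappa>\<bar> = s\<^sup>2 * (norm (fourier_at h \<kappa> l) * \<bar>th \<kappa>\<bar>)"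
        using th0[OF k] by simp
      also have "\<dots> \<le> s\<^sup>2 * m \<kappa>" by (intro mult_left_mono bnd k) auto
      finally show "norm (fourier_at h \<kappa> l / (\<i> * of_real (th \<kappa>)) * character \<kappa> (x + s *\<^sub>R v)
          - fourier_at h \<kappa> l / (\<i> * of_real (th \<kappa>)) * character \<kappa> x - s *\<^sub>R (fourier_at h \<kappa> l * character \<kappa> x)) \<le> s\<^sup>2 * m \<kappa>" .
    qed
    show ?thesis
      unfolding has_vector_derivative_def has_derivative_iff_norm
    proof
      show "bounded_linear (\<lambda>s. s *\<^sub>R of_real (h (x, l)) :: complex)" by (rule bounded_linear_scaleR_left)
      have "((\<lambda>s::real. \<bar>s\<bar> * ?A) \<longlongrightarrow> \<bar>0\<bar> * ?A) (at 0)" by (intro tendsto_mult_right tendsto_rabs tendsto_ident_at)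
      then have lim: "((\<lambda>s::real. \<bar>s\<bar> * ?A) \<longlongrightarrow> 0) (at 0)" by simp
      show "((\<lambda>s. norm (\<psi> (x + s *\<^sub>R v, l) - \<psi> (x + 0 *\<^sub>R v, l) - (s - 0) *\<^sub>R of_real (h (x, l))) / norm (s - 0)) \<longlongrightarrow> 0) (at 0)"
      proof (rule Lim_null_comparison[OF _ lim], rule always_eventually, rule allI)
        fix s :: real
        show "norm (norm (\<psi> (x + s *\<^sub>R v, l) - \<psi> (x + 0 *\<^sub>R v, l) - (s - 0) *\<^sub>R of_real (h (x, l))) / norm (s - 0)) \<le> \<bar>s\<bar> * ?A"
        proof (cases "s = 0")
          case False
          then show ?thesis using le[of s] by (simp add: divide_le_eq power2_eq_square mult_ac)
        qed simp
      qed
    qed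
  qed
  show ?thesis
  proof (rule that[of \<phi>])
    show "real_analytic_on \<phi> (UNIV \<times> S)" unfolding \<phi>_def[abs_def]
      by (rule real_analytic_on_bounded_linear[OF bounded_linear_Re an])
    show "lattice_periodic (\<lambda>x. \<phi> (x, l))" for l using psi_per[of l] by (simp add: \<phi>_def lattice_periodic_def)
    show "((\<lambda>s. \<phi> (x + s *\<^sub>R v, l)) has_vector_derivative h (x, l)) (at 0)" if "l \<in> S" for l x
      using bounded_linear.has_vector_derivative[OF bounded_linear_Re psi_deriv[OF that]] by (simp add: \<phi>_def)
    show "integral (cbox 0 One) (\<lambda>x. \<phi> (x, l)) = 0" if l: "l \<in> S" for l
    proof -
      have "real_analytic_on \<psi> (UNIV \<times> {l})" using l by (intro real_analytic_on_subset[OF an]) auto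
      then have "continuous_on UNIV (\<lambda>x. \<psi> (x, l))" by (intro real_analytic_on_continuous_on real_analytic_on_slice)
      then have "(\<lambda>x. \<psi> (x, l)) integrable_on cbox 0 One"
        by (intro integrable_continuous) (rule continuous_on_subset, auto)
      from has_integral_Re[OF integrable_integral[OF this]] psi_avg[OF l] show ?thesis
        by (simp add: \<phi>_def integral_unique)
    qed
  qed
qed

text \<open>The average over the torus, written as a zeroth Fourier coefficient so that it is analytic in the
parameters by what is known of these coefficients.\<close>

definition mean :: "('a::euclidean_space \<times> 'p \<Rightarrow> 'b::euclidean_space) \<Rightarrow> 'p \<Rightarrow> 'b" where
  "mean h l = (\<Sum>b\<in>Basis. Re (fourier_at (\<lambda>z. h z \<bullet> b) (\<lambda>_. 0) l) *\<^sub>R b)"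

definition periodic_analytic :: "'p::euclidean_space set \<Rightarrow> ('a::euclidean_space \<times> 'p \<Rightarrow> 'b::euclidean_space) \<Rightarrow> bool" where
  "periodic_analytic S h \<longleftrightarrow> real_analytic_on h (UNIV \<times> S) \<and> (\<forall>l. lattice_periodic (\<lambda>x. h (x, l)))"

lemma real_analytic_on_inner_left:
  fixes f :: "'a::euclidean_space \<Rightarrow> 'b::euclidean_space"
  shows "real_analytic_on f S \<Longrightarrow> real_analytic_on (\<lambda>x. f x \<bullet> b) S"
  by (rule real_analytic_on_bounded_linear[OF bounded_linear_inner_left])

lemma periodic_analyticD:
  assumes "periodic_analytic S h"
  shows "real_analytic_on h (UNIV \<times> S)" "lattice_periodic (\<lambda>x. h (x, l))"
  using assms by (simp_all add: periodic_analytic_def)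

lemma periodic_analytic_inner: "periodic_analytic S h \<Longrightarrow> periodic_analytic S (\<lambda>z. h z \<bullet> b)"
  by (simp add: periodic_analytic_def lattice_periodic_def real_analytic_on_inner_left)

lemma periodic_analytic_continuous:
  assumes "periodic_analytic S h" "l \<in> S" shows "continuous_on T (\<lambda>x. h (x, l))"
proof -
  have "real_analytic_on h (UNIV \<times> {l})"
    by (rule real_analytic_on_subset[OF periodic_analyticD(1)[OF assms(1)]]) (use assms(2) in auto)
  then have "continuous_on UNIV (\<lambda>x. h (x, l))"
    by (intro real_analytic_on_continuous_on real_analytic_on_slice)
  then show ?thesis by (rule continuous_on_subset) simp
qed

lemma integral_inner_left:
  fixes f :: "'a::euclidean_space \<Rightarrow> 'b::euclidean_space"
  assumes "continuous_on (cbox u v) f"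
  shows "integral (cbox u v) (\<lambda>x. f x \<bullet> b) = integral (cbox u v) f \<bullet> b"
  using has_integral_linear[OF integrable_integral[OF integrable_continuous[OF assms]] bounded_linear_inner_left[of b]]
  by (simp add: o_def integral_unique)

lemma mean_eq_integral:
  assumes h: "periodic_analytic S h" and l: "l \<in> S"
  shows "mean h l = integral (cbox 0 One) (\<lambda>x. h (x, l))"
proof -
  have "Re (fourier_at (\<lambda>z. h z \<bullet> b) (\<lambda>_. 0) l) = integral (cbox 0 One) (\<lambda>x. h (x, l)) \<bullet> b" for b
  proof -
    have "continuous_on UNIV (\<lambda>x. h (x, l) \<bullet> b)"
      by (rule periodic_analytic_continuous[OF periodic_analytic_inner[OF h] l])
    then have "fourier_at (\<lambda>z. h z \<bullet> b) (\<lambda>_. 0) l = of_real (integral (cbox 0 One) (\<lambda>x. h (x, l) \<bullet> b))"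
      unfolding fourier_at_def by (intro fourier_zero_freq) auto
    then show ?thesis using integral_inner_left[OF periodic_analytic_continuous[OF h l]] by simp
  qed
  then show ?thesis by (simp add: mean_def euclidean_representation)
qed

lemma real_analytic_on_mean:
  assumes h: "periodic_analytic S h" shows "real_analytic_on (mean h) S"
  unfolding mean_def[abs_def]
proof (intro real_analytic_on_sum real_analytic_on_scaleR real_analytic_on_const)
  fix b
  have "periodic_analytic S (\<lambda>z. h z \<bullet> b)" by (rule periodic_analytic_inner[OF h])
  from periodic_analyticD[OF this]
  show "real_analytic_on (\<lambda>l. Re (fourier_at (\<lambda>z. h z \<bullet> b) (\<lambda>_. 0) l)) S"
    by (rule real_analytic_on_integral)
qed

lemma periodic_analytic_param:
  assumes "real_analytic_on g S"
  shows "periodic_analytic S (\<lambda>z. g (snd z) :: 'b::euclidean_space)"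
proof -
  have "real_analytic_on (\<lambda>z. g (snd z)) (UNIV \<times> S)"
    by (rule real_analytic_on_compose[OF assms]) (auto intro!: real_analytic_intros)
  then show ?thesis by (simp add: periodic_analytic_def lattice_periodic_def)
qed

lemma periodic_analytic_add:
  "periodic_analytic S f \<Longrightarrow> periodic_analytic S g \<Longrightarrow> periodic_analytic S (\<lambda>z. f z + g z)"
  by (simp add: periodic_analytic_def lattice_periodic_def real_analytic_on_add)

lemma periodic_analytic_diff:
  "periodic_analytic S f \<Longrightarrow> periodic_analytic S g \<Longrightarrow> periodic_analytic S (\<lambda>z. f z - g z)"
  by (simp add: periodic_analytic_def lattice_periodic_def real_analytic_on_diff)

lemma periodic_analytic_scaleR:
  "periodic_analytic S f \<Longrightarrow> periodic_analytic S g \<Longrightarrow> periodic_analytic S (\<lambda>z. f z *\<^sub>R g z)"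
  by (simp add: periodic_analytic_def lattice_periodic_def real_analytic_on_scaleR)

lemma mean_minus_param:
  fixes h :: "'a::euclidean_space \<times> 'p::euclidean_space \<Rightarrow> 'b::euclidean_space"
  assumes h: "periodic_analytic S h" and l: "l \<in> S"
  shows "integral (cbox 0 One) (\<lambda>x. h (x, l) - g l) = mean h l - g l"
proof -
  have "integral (cbox 0 One) (\<lambda>x. h (x, l) - g l) = integral (cbox 0 One) (\<lambda>x. h (x, l)) - integral (cbox 0 One) (\<lambda>x::'a. g l)"
    by (intro integral_diff integrable_continuous periodic_analytic_continuous[OF h l] continuous_on_const)
  then show ?thesis by (simp add: mean_eq_integral[OF h l])
qed

text \<open>The small divisors equation \<open>\<partial>\<^sub>v \<phi> = w\<close>, normalized by a zero average. For \<open>v = (\<omega>, \<nu>)\<close> the function \<open>\<phi>\<close> is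
\<open>\<S>\<D>(w)\<close> in terms of hulls.\<close>

definition osc_primitive ::
    "'a::euclidean_space \<Rightarrow> 'p::euclidean_space set \<Rightarrow> ('a \<times> 'p \<Rightarrow> 'b::euclidean_space) \<Rightarrow> ('a \<times> 'p \<Rightarrow> 'b) \<Rightarrow> bool" where
  "osc_primitive v S \<phi> w \<longleftrightarrow> periodic_analytic S \<phi> \<and> periodic_analytic S w \<and>
     (\<forall>l\<in>S. integral (cbox 0 One) (\<lambda>x. \<phi> (x, l)) = 0 \<and>
        (\<forall>x. ((\<lambda>t. \<phi> (x + t *\<^sub>R v, l)) has_vector_derivative w (x, l)) (at 0)))"

lemma small_divisor_equation:
  fixes w :: "'a::euclidean_space \<times> 'p::euclidean_space \<Rightarrow> 'b::euclidean_space"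
  assumes w: "periodic_analytic S w" and v: "diophantine_vector v"
    and avg: "\<And>l. l \<in> S \<Longrightarrow> mean w l = 0"
  obtains \<phi> where "osc_primitive v S \<phi> w"
proof -
  have "\<forall>b\<in>Basis. \<exists>\<phi>. osc_primitive v S \<phi> (\<lambda>z. w z \<bullet> b)"
  proof
    fix b :: 'b
    have wb: "periodic_analytic S (\<lambda>z. w z \<bullet> b)" by (rule periodic_analytic_inner[OF w])
    have i0: "integral (cbox 0 One) (\<lambda>x. w (x, l) \<bullet> b) = 0" if "l \<in> S" for l
      using integral_inner_left[OF periodic_analytic_continuous[OF w that]] avg[OF that]
        mean_eq_integral[OF w that] by simp
    have a: "real_analytic_on (\<lambda>z. w z \<bullet> b) (UNIV \<times> S)" "\<And>l. lattice_periodic (\<lambda>x. w (x, l) \<bullet> b)"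
      using periodic_analyticD[OF wb] by simp_all
    show "\<exists>\<phi>. osc_primitive v S \<phi> (\<lambda>z. w z \<bullet> b)"
    proof (rule small_divisor_equation_real[OF a v i0])
      fix \<phi> :: "'a \<times> 'p \<Rightarrow> real"
      assume "real_analytic_on \<phi> (UNIV \<times> S)" "\<And>l. lattice_periodic (\<lambda>x. \<phi> (x, l))"
        "\<And>l. l \<in> S \<Longrightarrow> integral (cbox 0 One) (\<lambda>x. \<phi> (x, l)) = 0"
        "\<And>l x. l \<in> S \<Longrightarrow> ((\<lambda>t. \<phi> (x + t *\<^sub>R v, l)) has_vector_derivative w (x, l) \<bullet> b) (at 0)"
      with wb show ?thesis by (intro exI[of _ \<phi>]) (simp add: osc_primitive_def periodic_analytic_def)
    qed
  qed
  from bchoice[OF this] obtain \<phi> where \<phi>: "\<forall>b\<in>Basis. osc_primitive v S (\<phi> b) (\<lambda>z. w z \<bullet> b)" ..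
  then have pa: "\<And>b. b \<in> Basis \<Longrightarrow> periodic_analytic S (\<phi> b)"
    and pi: "\<And>b l. b \<in> Basis \<Longrightarrow> l \<in> S \<Longrightarrow> integral (cbox 0 One) (\<lambda>x. \<phi> b (x, l)) = 0"
    and pd: "\<And>b l x. b \<in> Basis \<Longrightarrow> l \<in> S \<Longrightarrow> ((\<lambda>t. \<phi> b (x + t *\<^sub>R v, l)) has_vector_derivative w (x, l) \<bullet> b) (at 0)"
    by (simp_all add: osc_primitive_def)
  let ?f = "\<lambda>z. \<Sum>b\<in>Basis. \<phi> b z *\<^sub>R b"
  have "real_analytic_on ?f (UNIV \<times> S)"
    by (intro real_analytic_on_sum real_analytic_on_scaleR real_analytic_on_const periodic_analyticD(1)[OF pa])
  moreover have "lattice_periodic (\<lambda>x. ?f (x, l))" for l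
    unfolding lattice_periodic_def
    using lattice_periodicD[OF periodic_analyticD(2)[OF pa]] by (intro allI ballI sum.cong) auto
  moreover have "integral (cbox 0 One) (\<lambda>x. ?f (x, l)) = 0" if l: "l \<in> S" for l
  proof -
    have "integral (cbox 0 One) (\<lambda>x. ?f (x, l)) = (\<Sum>b\<in>Basis. integral (cbox 0 One) (\<lambda>x. \<phi> b (x, l) *\<^sub>R b))"
      by (intro integral_sum integrable_continuous continuous_intros periodic_analytic_continuous[OF pa l]) auto
    also have "\<dots> = (\<Sum>b\<in>Basis. integral (cbox 0 One) (\<lambda>x. \<phi> b (x, l)) *\<^sub>R b)"
    proof (intro sum.cong refl)
      fix b :: 'b assume b: "b \<in> Basis"
      have "(\<lambda>x. \<phi> b (x, l)) integrable_on cbox 0 One"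
        by (intro integrable_continuous periodic_analytic_continuous[OF pa[OF b] l])
      from has_integral_scaleR_left[OF integrable_integral[OF this], of b]
      show "integral (cbox 0 One) (\<lambda>x. \<phi> b (x, l) *\<^sub>R b) = integral (cbox 0 One) (\<lambda>x. \<phi> b (x, l)) *\<^sub>R b"
        by (rule integral_unique)
    qed
    also have "\<dots> = 0" using pi l by simp
    finally show ?thesis .
  qed
  moreover have "((\<lambda>t. ?f (x + t *\<^sub>R v, l)) has_vector_derivative w (x, l)) (at 0)" if l: "l \<in> S" for l x
  proof -
    have "((\<lambda>t. ?f (x + t *\<^sub>R v, l)) has_vector_derivative (\<Sum>b\<in>Basis. (w (x, l) \<bullet> b) *\<^sub>R b)) (at 0)"
    proof (rule has_vector_derivative_sum)
      fix b :: 'b assume b: "b \<in> Basis"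
      show "((\<lambda>t. \<phi> b (x + t *\<^sub>R v, l) *\<^sub>R b) has_vector_derivative (w (x, l) \<bullet> b) *\<^sub>R b) (at 0)"
        by (rule bounded_linear.has_vector_derivative[OF bounded_linear_scaleR_left pd[OF b l]])
    qed
    then show ?thesis by (simp add: euclidean_representation)
  qed
  ultimately show ?thesis using w by (intro that[of ?f]) (simp add: osc_primitive_def periodic_analytic_def)
qed

lemma osc_primitive_zero: "osc_primitive v S (\<lambda>_. 0) (\<lambda>_. 0)"
  by (simp add: osc_primitive_def periodic_analytic_def lattice_periodic_def)

section \<open>Expansions at \<open>u = 0\<close>\<close>

lemma real_analytic_on_difference_quotient_iter:
  "real_analytic_on f ({0} \<times> Z) \<Longrightarrow> real_analytic_on ((difference_quotient ^^ n) f) ({0} \<times> Z)"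
  by (induction n) (auto intro: real_analytic_on_difference_quotient)

lemma difference_quotient_taylor:
  "f (u, z) = (\<Sum>j<n. u ^ j *\<^sub>R (difference_quotient ^^ j) f (0, z)) + u ^ n *\<^sub>R (difference_quotient ^^ n) f (u, z)"
proof (induction n)
  case (Suc n)
  have "(difference_quotient ^^ n) f (u, z) = (difference_quotient ^^ n) f (0, z) + u *\<^sub>R (difference_quotient ^^ Suc n) f (u, z)"
    using difference_quotient_identity[of "(difference_quotient ^^ n) f" u z] by simp
  with Suc show ?case by (simp add: scaleR_right_distrib mult.commute)
qed simp

text \<open>A one-sided bound on a segment suffices to make the Taylor coefficients vanish, since they exist by
analyticity.\<close>

lemma difference_quotient_coefficient_zero:
  fixes f :: "real \<times> 'z::euclidean_space \<Rightarrow> 'b::banach"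
  assumes "real_analytic_on f ({0} \<times> Z)" "z \<in> Z" "0 < \<delta>"
    and "\<And>u. 0 < u \<Longrightarrow> u < \<delta> \<Longrightarrow> norm (f (u, z)) \<le> C * u ^ n" and "j < n"
  shows "(difference_quotient ^^ j) f (0, z) = 0"
  using assms(1,4,5)
proof (induction n arbitrary: f j)
  case (Suc n)
  have "isCont f (0, z)" using Suc.prems(1) assms(2) by (intro real_analytic_on_isCont) auto
  then have "(f \<longlongrightarrow> f (0, z)) (nhds (0, z))" by (simp add: isCont_def tendsto_at_iff_tendsto_nhds)
  moreover have "filterlim (\<lambda>u. (u, z)) (nhds (0, z)) (at_right (0::real))"
    by (intro tendsto_Pair tendsto_ident_at tendsto_const)
  ultimately have 1: "((\<lambda>u. f (u, z)) \<longlongrightarrow> f (0, z)) (at_right 0)" by (rule filterlim_compose)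
  have "((\<lambda>u::real. C * u ^ Suc n) \<longlongrightarrow> C * 0 ^ Suc n) (at_right 0)" by (intro tendsto_intros)
  then have 2: "((\<lambda>u::real. C * u ^ Suc n) \<longlongrightarrow> 0) (at_right 0)" by simp
  have "\<forall>\<^sub>F u in at_right 0. norm (f (u, z)) \<le> C * u ^ Suc n"
    unfolding eventually_at_right_field using assms(3) Suc.prems(2) by (intro exI[of _ \<delta>]) auto
  from Lim_null_comparison[OF this 2] have "((\<lambda>u. f (u, z)) \<longlongrightarrow> 0) (at_right 0)" .
  with 1 have f0: "f (0, z) = 0" using tendsto_unique[OF trivial_limit_at_right_real] by blast
  show ?case
  proof (cases j)
    case 0
    then show ?thesis by (simp add: f0)
  next
    case (Suc i)
    have "(difference_quotient ^^ i) (difference_quotient f) (0, z) = 0"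
    proof (rule Suc.IH)
      show "real_analytic_on (difference_quotient f) ({0} \<times> Z)"
        by (rule real_analytic_on_difference_quotient[OF Suc.prems(1)])
      fix u assume u: "0 < u" "u < \<delta>"
      have "norm (difference_quotient f (u, z)) = norm (f (u, z)) / u"
        using u by (simp add: difference_quotient_def f0 divide_inverse mult.commute)
      also have "\<dots> \<le> C * u ^ Suc n / u" using Suc.prems(2)[OF u] u by (intro divide_right_mono) auto
      finally show "norm (difference_quotient f (u, z)) \<le> C * u ^ n" using u by simp
    qed (use Suc.prems(3) Suc in simp)
    then show ?thesis by (simp add: Suc funpow_swap1)
  qed
qed simp

text \<open>Functions of \<open>u\<close>, the angles and the parameters that are expanded in powers of \<open>u\<close>. Analyticity is
asked at the points with \<open>u = 0\<close>; the radius in \<open>u\<close> may depend on the parameters.\<close>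

definition germ :: "'p::euclidean_space set \<Rightarrow> (real \<times> ('a::euclidean_space \<times> 'p) \<Rightarrow> 'b::euclidean_space) \<Rightarrow> bool" where
  "germ S f \<longleftrightarrow> real_analytic_on f ({0} \<times> (UNIV \<times> S)) \<and> (\<forall>u l. lattice_periodic (\<lambda>x. f (u, (x, l))))"

text \<open>\<open>f = O(u ^ n)\<close> in the analytic sense, by a factorization instead of a bound: the quotient is available for
the next step of the construction.\<close>

definition flat :: "'p::euclidean_space set \<Rightarrow> nat \<Rightarrow> (real \<times> ('a::euclidean_space \<times> 'p) \<Rightarrow> 'b::euclidean_space) \<Rightarrow> bool" where
  "flat S n f \<longleftrightarrow> (\<exists>r. germ S r \<and> (\<forall>u x. \<forall>l\<in>S. f (u, (x, l)) = u ^ n *\<^sub>R r (u, (x, l))))"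

lemma germI:
  "real_analytic_on f ({0} \<times> (UNIV \<times> S)) \<Longrightarrow> (\<And>u l. lattice_periodic (\<lambda>x. f (u, (x, l)))) \<Longrightarrow> germ S f"
  by (simp add: germ_def)

lemma germD:
  assumes "germ S f"
  shows "real_analytic_on f ({0} \<times> (UNIV \<times> S))" "lattice_periodic (\<lambda>x. f (u, (x, l)))"
  using assms by (simp_all add: germ_def)

lemma germ_add: "germ S f \<Longrightarrow> germ S g \<Longrightarrow> germ S (\<lambda>z. f z + g z)"
  by (simp add: germ_def lattice_periodic_def real_analytic_on_add)

lemma germ_diff: "germ S f \<Longrightarrow> germ S g \<Longrightarrow> germ S (\<lambda>z. f z - g z)"
  by (simp add: germ_def lattice_periodic_def real_analytic_on_diff)

lemma germ_scaleR: "germ S f \<Longrightarrow> germ S g \<Longrightarrow> germ S (\<lambda>z. f z *\<^sub>R g z)"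
  by (simp add: germ_def lattice_periodic_def real_analytic_on_scaleR)

lemma germ_Pair: "germ S f \<Longrightarrow> germ S g \<Longrightarrow> germ S (\<lambda>z. (f z, g z))"
  by (simp add: germ_def lattice_periodic_def real_analytic_on_Pair)

lemma germ_const: "germ S (\<lambda>_. c)"
  by (simp add: germ_def lattice_periodic_def)

lemma germ_u_power: "germ S (\<lambda>z. fst z ^ n)"
  by (simp add: germ_def lattice_periodic_def) (intro real_analytic_intros)

lemma germ_sum: "(\<And>i. i \<in> I \<Longrightarrow> germ S (f i)) \<Longrightarrow> germ S (\<lambda>z. \<Sum>i\<in>I. f i z)"
  by (induction I rule: infinite_finite_induct) (auto intro: germ_add germ_const)

lemma germ_coefficient:
  assumes "periodic_analytic S f" shows "germ S (\<lambda>z. f (snd z))"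
proof -
  have "real_analytic_on (\<lambda>z::real \<times> _. f (snd z)) ({0} \<times> (UNIV \<times> S))"
    by (rule real_analytic_on_compose[where T = "UNIV \<times> S"])
       (intro periodic_analyticD(1)[OF assms] real_analytic_intros | auto)+
  then show ?thesis using assms by (simp add: germ_def periodic_analytic_def)
qed

lemma germ_param:
  fixes g :: "'p::euclidean_space \<Rightarrow> 'b::euclidean_space"
  assumes "real_analytic_on g S" shows "germ S (\<lambda>z. g (snd (snd z)))"
  by (rule germ_coefficient[OF periodic_analytic_param[OF assms]])

lemma germ_initial:
  assumes "germ S f" shows "periodic_analytic S (\<lambda>z. f (0, z))"
proof -
  have "real_analytic_on (\<lambda>z. f (0, z)) (UNIV \<times> S)"
    by (rule real_analytic_on_compose[where T = "{0} \<times> (UNIV \<times> S)"])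
       (intro germD(1)[OF assms] real_analytic_intros | auto)+
  then show ?thesis using assms by (simp add: germ_def periodic_analytic_def)
qed

lemma germ_difference_quotient:
  assumes "germ S f" shows "germ S (difference_quotient f)"
proof (rule germI)
  show "real_analytic_on (difference_quotient f) ({0} \<times> (UNIV \<times> S))"
    by (rule real_analytic_on_difference_quotient[OF germD(1)[OF assms]])
  show "lattice_periodic (\<lambda>x. difference_quotient f (u, (x, l)))" for u l
    using lattice_periodicD[OF germD(2)[OF assms]] by (simp add: lattice_periodic_def difference_quotient_def)
qed

lemma flat_Suc:
  assumes "germ S r" "\<And>u x l. l \<in> S \<Longrightarrow> f (u, (x, l)) = u ^ n *\<^sub>R r (u, (x, l))"
    and "\<And>x l. l \<in> S \<Longrightarrow> r (0, (x, l)) = 0"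
  shows "flat S (Suc n) f"
  unfolding flat_def
proof (intro exI conjI allI ballI)
  show "germ S (difference_quotient r)" by (rule germ_difference_quotient[OF assms(1)])
  fix u x l assume l: "l \<in> S"
  have "r (u, (x, l)) = u *\<^sub>R difference_quotient r (u, (x, l))"
    using difference_quotient_identity[of r u "(x, l)"] assms(3)[OF l, of x] by simp
  then show "f (u, (x, l)) = u ^ Suc n *\<^sub>R difference_quotient r (u, (x, l))"
    using assms(2)[OF l, of u x] by (simp add: mult.commute)
qed

lemma difference_quotient_cong:
  "(\<And>s. f (s, z') = f (s, z)) \<Longrightarrow> difference_quotient f (u, z') = difference_quotient f (u, z)"
  by (simp add: difference_quotient_def)

text \<open>First-order expansion of \<open>\<Phi>\<close> around the profile \<open>Q\<close> in the direction \<open>R\<close>, with an exact analytic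
remainder. The quotient is taken with respect to an independent variable \<open>s\<close>, for which \<open>u ^ n\<close> is
substituted; as \<open>n\<close> is positive, only the derivative of \<open>\<Phi>\<close> at \<open>u = 0\<close> enters at order \<open>n\<close>.\<close>

lemma germ_perturbation:
  fixes \<Phi> :: "real \<times> ('q::euclidean_space \<times> ('a::euclidean_space \<times> 'p::euclidean_space)) \<Rightarrow> 'b::euclidean_space"
  assumes an: "real_analytic_on \<Phi> ({0} \<times> (UNIV \<times> (UNIV \<times> S)))"
    and per: "\<And>u q l. lattice_periodic (\<lambda>x. \<Phi> (u, (q, (x, l))))"
    and Q: "germ S Q" and R: "germ S R" and n: "1 \<le> n"
  obtains \<Psi> where "germ S \<Psi>"
    "\<And>u z. \<Phi> (u, (Q (u, z) + u ^ n *\<^sub>R R (u, z), z)) = \<Phi> (u, (Q (u, z), z)) + u ^ n *\<^sub>R \<Psi> (u, z)"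
    "\<And>z. \<Psi> (0, z) = vector_derivative (\<lambda>s. \<Phi> (0, (Q (0, z) + s *\<^sub>R R (0, z), z))) (at 0)"
proof -
  define f where "f w = \<Phi> (fst (snd w), (Q (snd w) + fst w *\<^sub>R R (snd w), snd (snd w)))"
    for w :: "real \<times> (real \<times> ('a \<times> 'p))"
  let ?g = "difference_quotient f"
  let ?Z = "{0} \<times> (UNIV \<times> S) :: (real \<times> ('a \<times> 'p)) set"
  have Qa: "real_analytic_on Q ?Z" and Ra: "real_analytic_on R ?Z" using germD(1)[OF Q] germD(1)[OF R] by blast+
  have snd: "real_analytic_on (\<lambda>w. F (snd w)) ({0} \<times> ?Z)" if "real_analytic_on F ?Z" for F :: "_ \<Rightarrow> 'q"
    by (rule real_analytic_on_compose[OF that]) (auto intro!: real_analytic_intros)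
  have "real_analytic_on f ({0} \<times> ?Z)" unfolding f_def[abs_def]
    by (rule real_analytic_on_compose[OF an]) (auto intro!: real_analytic_intros snd Qa Ra)
  then have g: "real_analytic_on ?g ({0} \<times> ?Z)" by (rule real_analytic_on_difference_quotient)
  define \<Psi> where "\<Psi> z = ?g (fst z ^ n, z)" for z
  have fper: "f (s, (u, (x + q, l))) = f (s, (u, (x, l)))" if q: "q \<in> lattice" for s u x l q
    using lattice_periodicD[OF germD(2)[OF Q] q] lattice_periodicD[OF germD(2)[OF R] q]
      lattice_periodicD[OF per q] by (simp add: f_def)
  show ?thesis
  proof (rule that[of \<Psi>])
    have "real_analytic_on \<Psi> ?Z" unfolding \<Psi>_def
      by (rule real_analytic_on_compose[OF g]) (use n in \<open>auto intro!: real_analytic_intros\<close>)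
    moreover have "lattice_periodic (\<lambda>x. \<Psi> (u, (x, l)))" for u l
      unfolding lattice_periodic_def
    proof (intro allI ballI)
      fix x q :: 'a assume q: "q \<in> lattice"
      show "\<Psi> (u, (x + q, l)) = \<Psi> (u, (x, l))"
        unfolding \<Psi>_def fst_conv by (rule difference_quotient_cong) (rule fper[OF q])
    qed
    ultimately show "germ S \<Psi>" by (simp add: germ_def)
    show "\<Phi> (u, (Q (u, z) + u ^ n *\<^sub>R R (u, z), z)) = \<Phi> (u, (Q (u, z), z)) + u ^ n *\<^sub>R \<Psi> (u, z)" for u z
      using difference_quotient_identity[of f "u ^ n" "(u, z)"] by (simp add: \<Psi>_def f_def)
    show "\<Psi> (0, z) = vector_derivative (\<lambda>s. \<Phi> (0, (Q (0, z) + s *\<^sub>R R (0, z), z))) (at 0)" for z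
      using n by (simp add: \<Psi>_def difference_quotient_def f_def)
  qed
qed

lemma mean_add:
  assumes "periodic_analytic S f" "periodic_analytic S g" "l \<in> S"
  shows "mean (\<lambda>z. f z + g z) l = mean f l + mean g l"
  unfolding mean_eq_integral[OF periodic_analytic_add[OF assms(1,2)] assms(3)]
    mean_eq_integral[OF assms(1,3)] mean_eq_integral[OF assms(2,3)]
  by (intro integral_add integrable_continuous periodic_analytic_continuous[OF assms(1,3)]
      periodic_analytic_continuous[OF assms(2,3)])

lemma mean_scaleR_param:
  assumes g: "real_analytic_on g S" and f: "periodic_analytic S f" and l: "l \<in> S"
  shows "mean (\<lambda>z. g (snd z) *\<^sub>R f z) l = g l *\<^sub>R mean f l"
  unfolding mean_eq_integral[OF periodic_analytic_scaleR[OF periodic_analytic_param[OF g] f] l]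
    mean_eq_integral[OF f l] by simp

lemma mean_diff_param:
  fixes f :: "'a::euclidean_space \<times> 'p::euclidean_space \<Rightarrow> 'b::euclidean_space"
  assumes g: "real_analytic_on g S" and f: "periodic_analytic S f" and l: "l \<in> S"
  shows "mean (\<lambda>z. f z - g (snd z)) l = mean f l - g l"
  using mean_eq_integral[OF periodic_analytic_diff[OF f periodic_analytic_param[OF g]] l] mean_minus_param[OF f l]
  by simp

text \<open>A truncated expansion in powers of \<open>u\<close>: averaged coefficients \<open>s\<close> and oscillatory coefficients \<open>s'\<close>, the
latter multiplied by a further \<open>u ^ (k - 1)\<close>. The weights \<open>c\<close> are \<open>1\<close> for the expansion itself; with \<open>e + i\<close> in
place of \<open>1\<close> it represents \<open>u ^ (1 - e)\<close> times the derivative of \<open>u ^ e\<close> times the expansion.\<close>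

definition trunc :: "(nat \<Rightarrow> real) \<Rightarrow> nat \<Rightarrow> nat \<Rightarrow> (nat \<Rightarrow> 'p \<Rightarrow> 'b::euclidean_space) \<Rightarrow> (nat \<Rightarrow> 'a \<times> 'p \<Rightarrow> 'b)
    \<Rightarrow> real \<times> ('a::euclidean_space \<times> 'p::euclidean_space) \<Rightarrow> 'b" where
  "trunc c k N s s' z = (\<Sum>i<N. (c i * fst z ^ i) *\<^sub>R s i (snd (snd z)))
     + (\<Sum>i<N. (c (i + k - 1) * fst z ^ (i + k - 1)) *\<^sub>R s' i (snd z))"

lemma germ_mult_real:
  fixes f g :: "real \<times> ('a::euclidean_space \<times> 'p::euclidean_space) \<Rightarrow> real"
  shows "germ S f \<Longrightarrow> germ S g \<Longrightarrow> germ S (\<lambda>z. f z * g z)"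
  using germ_scaleR[of S f g] by simp

lemma germ_trunc:
  assumes "\<And>i. real_analytic_on (s i) S" "\<And>i. periodic_analytic S (s' i)"
  shows "germ S (trunc c k N s s')"
  unfolding trunc_def[abs_def]
  by (intro germ_add germ_sum germ_scaleR germ_mult_real germ_const germ_u_power germ_param assms germ_coefficient)

lemma trunc_Suc:
  assumes "1 \<le> k"
  shows "trunc c k (Suc N) (s(N := a)) (s'(N := b)) z = trunc c k N s s' z
    + fst z ^ N *\<^sub>R (c N *\<^sub>R a (snd (snd z)) + (c (N + k - 1) * fst z ^ (k - 1)) *\<^sub>R b (snd z))"
proof -
  have "fst z ^ (N + k - 1) = fst z ^ N * fst z ^ (k - 1)"
    using assms by (simp flip: power_add)
  then show ?thesis by (simp add: trunc_def algebra_simps)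
qed

lemma trunc_zero:
  assumes "2 \<le> k" "1 \<le> N" shows "trunc c k N s s' (0, z) = c 0 *\<^sub>R s 0 (snd z)"
proof -
  obtain n where N: "N = Suc n" using assms(2) by (cases N) auto
  have "(\<Sum>i<N. (c i * 0 ^ i) *\<^sub>R s i (snd z)) = c 0 *\<^sub>R s 0 (snd z)"
    unfolding N by (subst sum.lessThan_Suc_shift) simp
  moreover have "(\<Sum>i<N. (c (i + k - 1) * 0 ^ (i + k - 1)) *\<^sub>R s' i z) = 0"
    using assms(1) by (intro sum.neutral) auto
  ultimately show ?thesis by (simp add: trunc_def)
qed

text \<open>One component of the error, divided by its leading power of \<open>u\<close>. The vector field on the line is
\<open>u ^ k * (y0 + y1 * u ^ (k - 1))\<close>, and \<open>w\<close> collects the derivatives of the oscillatory coefficients along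
\<open>(\<omega>, \<nu>)\<close>. The flow on the line is slower than the one on the torus by \<open>u ^ (k - 1)\<close>; that is the extra
power in \<open>trunc\<close>, and the reason why \<open>s'\<close> appears here through \<open>w\<close> with the power \<open>u ^ i\<close>.\<close>

definition defect ::
    "(real \<times> ('q \<times> ('a \<times> 'p)) \<Rightarrow> 'b) \<Rightarrow> (real \<times> ('a \<times> 'p) \<Rightarrow> 'q) \<Rightarrow> ('p \<Rightarrow> real) \<Rightarrow> ('p \<Rightarrow> real)
      \<Rightarrow> nat \<Rightarrow> nat \<Rightarrow> nat \<Rightarrow> (nat \<Rightarrow> 'p \<Rightarrow> 'b) \<Rightarrow> (nat \<Rightarrow> 'a \<times> 'p \<Rightarrow> 'b) \<Rightarrow> (nat \<Rightarrow> 'a \<times> 'p \<Rightarrow> 'b)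
      \<Rightarrow> real \<times> ('a::euclidean_space \<times> 'p::euclidean_space) \<Rightarrow> 'b::euclidean_space" where
  "defect \<Phi> Q y0 y1 e k N s s' w z =
     \<Phi> (fst z, (Q z, snd z))
     - (y0 (snd (snd z)) + y1 (snd (snd z)) * fst z ^ (k - 1)) *\<^sub>R trunc (\<lambda>i. real (e + i)) k N s s' z
     - (\<Sum>i<N. fst z ^ i *\<^sub>R w i (snd z))"

lemma germ_compose_profile:
  fixes \<Phi> :: "real \<times> ('q::euclidean_space \<times> ('a::euclidean_space \<times> 'p::euclidean_space)) \<Rightarrow> 'b::euclidean_space"
  assumes an: "real_analytic_on \<Phi> ({0} \<times> (UNIV \<times> (UNIV \<times> S)))"
    and per: "\<And>u q l. lattice_periodic (\<lambda>x. \<Phi> (u, (q, (x, l))))" and Q: "germ S Q"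
  shows "germ S (\<lambda>z. \<Phi> (fst z, (Q z, snd z)))"
proof (rule germI)
  show "real_analytic_on (\<lambda>z. \<Phi> (fst z, (Q z, snd z))) ({0} \<times> (UNIV \<times> S))"
    by (rule real_analytic_on_compose[OF an]) (intro real_analytic_intros germD(1)[OF Q] | auto)+
  show "lattice_periodic (\<lambda>x. \<Phi> (fst (u, x, l), Q (u, x, l), snd (u, x, l)))" for u l
    using lattice_periodicD[OF germD(2)[OF Q]] lattice_periodicD[OF per] by (simp add: lattice_periodic_def)
qed

lemma germ_defect:
  fixes \<Phi> :: "real \<times> ('q::euclidean_space \<times> ('a::euclidean_space \<times> 'p::euclidean_space)) \<Rightarrow> 'b::euclidean_space"
  assumes "real_analytic_on \<Phi> ({0} \<times> (UNIV \<times> (UNIV \<times> S)))"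
    and "\<And>u q l. lattice_periodic (\<lambda>x. \<Phi> (u, (q, (x, l))))" "germ S Q"
    and "real_analytic_on y0 S" "real_analytic_on y1 S"
    and "\<And>i. real_analytic_on (s i) S" "\<And>i. periodic_analytic S (s' i)" "\<And>i. periodic_analytic S (w i)"
  shows "germ S (defect \<Phi> Q y0 y1 e k N s s' w)"
  unfolding defect_def[abs_def]
  by (intro germ_diff germ_compose_profile germ_scaleR germ_add germ_mult_real germ_param germ_u_power germ_trunc
      germ_sum germ_coefficient assms)

text \<open>One step of the construction. Adding coefficients of index \<open>N\<close> changes the defect at order \<open>N\<close> by the
linearized equation in the hypothesis \<open>zero\<close>; if it holds, the defect gains a power of \<open>u\<close>. A correction
\<open>d\<close> of the vector field on the line acts at order \<open>k - 1\<close>, and so helps only for \<open>N = k - 1\<close>.\<close>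

lemma defect_step:
  fixes \<Phi> :: "real \<times> ('q::euclidean_space \<times> ('a::euclidean_space \<times> 'p::euclidean_space)) \<Rightarrow> 'b::euclidean_space"
  assumes an: "real_analytic_on \<Phi> ({0} \<times> (UNIV \<times> (UNIV \<times> S)))"
    and per: "\<And>u q l. lattice_periodic (\<lambda>x. \<Phi> (u, (q, (x, l))))"
    and Q: "germ S Q" and R: "germ S R" and N: "1 \<le> N" and k: "2 \<le> k"
    and y: "real_analytic_on y0 S" "real_analytic_on y1 S" "real_analytic_on d S"
    and s: "\<And>i. real_analytic_on (s i) S" "real_analytic_on sN S"
    and s': "\<And>i. periodic_analytic S (s' i)" "periodic_analytic S s'N" and wN: "periodic_analytic S wN"
    and r: "germ S r" and old: "\<And>u x l. l \<in> S \<Longrightarrow> defect \<Phi> Q y0 y1 e k N s s' w (u, (x, l)) = u ^ N *\<^sub>R r (u, (x, l))"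
    and d: "N \<noteq> k - 1 \<Longrightarrow> d = (\<lambda>_. 0)"
    and zero: "\<And>x l. l \<in> S \<Longrightarrow> r (0, (x, l))
        + vector_derivative (\<lambda>t. \<Phi> (0, (Q (0, (x, l)) + t *\<^sub>R R (0, (x, l)), (x, l)))) (at 0)
        - (y0 l * real (e + N)) *\<^sub>R sN l - (d l * real e) *\<^sub>R s 0 l - wN (x, l) = 0"
  shows "flat S (Suc N) (defect \<Phi> (\<lambda>z. Q z + fst z ^ N *\<^sub>R R z) y0 (\<lambda>l. y1 l + d l) e k (Suc N) (s(N := sN)) (s'(N := s'N)) (w(N := wN)))"
proof -
  obtain \<Psi> where \<Psi>: "germ S \<Psi>"
    "\<And>u z. \<Phi> (u, (Q (u, z) + u ^ N *\<^sub>R R (u, z), z)) = \<Phi> (u, (Q (u, z), z)) + u ^ N *\<^sub>R \<Psi> (u, z)"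
    "\<And>z. \<Psi> (0, z) = vector_derivative (\<lambda>t. \<Phi> (0, (Q (0, z) + t *\<^sub>R R (0, z), z))) (at 0)"
    using germ_perturbation[OF an per Q R N] by blast
  let ?c = "\<lambda>i. real (e + i)"
  let ?P = "trunc ?c k (Suc N) (s(N := sN)) (s'(N := s'N))"
  define B where "B z = ?c N *\<^sub>R sN (snd (snd z)) + (?c (N + k - 1) * fst z ^ (k - 1)) *\<^sub>R s'N (snd z)"
    for z :: "real \<times> ('a \<times> 'p)"
  define r' where "r' z = r z + \<Psi> z - (y0 (snd (snd z)) + y1 (snd (snd z)) * fst z ^ (k - 1)) *\<^sub>R B z
     - d (snd (snd z)) *\<^sub>R ?P z - wN (snd z)" for z
  have Bg: "germ S B" unfolding B_def[abs_def]
    by (intro germ_add germ_scaleR germ_const germ_param s germ_mult_real germ_u_power germ_coefficient s')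
  have Pg: "germ S ?P" using s s' by (intro germ_trunc) auto
  show ?thesis
  proof (rule flat_Suc[where r = r'])
    show "germ S r'" unfolding r'_def[abs_def]
      by (intro germ_diff germ_add r \<Psi> germ_scaleR germ_mult_real germ_param germ_u_power y Bg Pg germ_coefficient wN)
    fix u :: real and x :: 'a and l :: 'p assume l: "l \<in> S"
    let ?z = "(u, (x, l))"
    have P: "?P ?z = trunc ?c k N s s' ?z + u ^ N *\<^sub>R B ?z"
      using trunc_Suc[of k ?c N s sN s' s'N ?z] k by (simp add: B_def)
    have du: "d l * u ^ (k - 1) = u ^ N * d l" using d by (cases "N = k - 1") auto
    have W: "(\<Sum>i<Suc N. u ^ i *\<^sub>R (w(N := wN)) i (x, l)) = (\<Sum>i<N. u ^ i *\<^sub>R w i (x, l)) + u ^ N *\<^sub>R wN (x, l)"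
      by simp
    have o: "\<Phi> (u, (Q ?z, (x, l))) - (y0 l + y1 l * u ^ (k - 1)) *\<^sub>R trunc ?c k N s s' ?z - (\<Sum>i<N. u ^ i *\<^sub>R w i (x, l)) = u ^ N *\<^sub>R r ?z"
      using old[OF l, of u x] by (simp add: defect_def)
    have "defect \<Phi> (\<lambda>z. Q z + fst z ^ N *\<^sub>R R z) y0 (\<lambda>l. y1 l + d l) e k (Suc N) (s(N := sN)) (s'(N := s'N)) (w(N := wN)) ?z
      = \<Phi> (u, (Q ?z, (x, l))) + u ^ N *\<^sub>R \<Psi> ?z - ((y0 l + y1 l * u ^ (k - 1)) *\<^sub>R (trunc ?c k N s s' ?z + u ^ N *\<^sub>R B ?z)
          + (d l * u ^ (k - 1)) *\<^sub>R ?P ?z) - ((\<Sum>i<N. u ^ i *\<^sub>R w i (x, l)) + u ^ N *\<^sub>R wN (x, l))"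
      unfolding defect_def fst_conv snd_conv \<Psi>(2) W P[symmetric] by (simp add: algebra_simps)
    also have "\<dots> = (\<Phi> (u, (Q ?z, (x, l))) - (y0 l + y1 l * u ^ (k - 1)) *\<^sub>R trunc ?c k N s s' ?z - (\<Sum>i<N. u ^ i *\<^sub>R w i (x, l)))
        + u ^ N *\<^sub>R (\<Psi> ?z - (y0 l + y1 l * u ^ (k - 1)) *\<^sub>R B ?z - d l *\<^sub>R ?P ?z - wN (x, l))"
      unfolding du by (simp add: algebra_simps)
    also have "\<dots> = u ^ N *\<^sub>R r' ?z" unfolding o by (simp add: r'_def algebra_simps)
    finally show "defect \<Phi> (\<lambda>z. Q z + fst z ^ N *\<^sub>R R z) y0 (\<lambda>l. y1 l + d l) e k (Suc N) (s(N := sN)) (s'(N := s'N)) (w(N := wN)) ?z = u ^ N *\<^sub>R r' ?z" .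
  next
    fix x l assume l: "l \<in> S"
    have P0: "?P (0, (x, l)) = real e *\<^sub>R s 0 l"
      using trunc_zero[OF k, of "Suc N" ?c "s(N := sN)" "s'(N := s'N)" "(x, l)"] N by simp
    have B0: "B (0, (x, l)) = ?c N *\<^sub>R sN l" using k by (simp add: B_def)
    show "r' (0, (x, l)) = 0" using zero[OF l, of x] k unfolding r'_def fst_conv snd_conv P0 B0 \<Psi>(3)
      by (simp add: power_0_left)
  qed
qed

section \<open>The rescaled invariance equation\<close>

text \<open>The invariance equation after the substitution \<open>x = u\<^sup>2 * \<xi>\<close>, \<open>y = u ^ (k + 1) * \<eta>\<close> and
\<open>\<theta> \<mapsto> \<theta> + u ^ m *\<^sub>R \<vartheta>\<close>, on hulls; the exponent \<open>m\<close> is \<open>2 * p - k + 1\<close> when the problem comes from \<open>X\<close>. The functions \<open>FA\<close> and \<open>FB\<close> are the rescaled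
remainders \<open>A\<close> and \<open>B\<close>, which are of higher order than the leading terms by a factor \<open>u\<close>. The
sign \<open>\<sigma>\<close> selects one of the two branches.\<close>

locale rescaled_problem =
  fixes v :: "'q::euclidean_space \<times> 'r::euclidean_space" and S :: "'p::euclidean_space set"
    and k m p :: nat and C a :: "('q \<times> 'r) \<times> 'p \<Rightarrow> real" and D :: "('q \<times> 'r) \<times> 'p \<Rightarrow> 'q"
    and FA :: "real \<times> ((real \<times> real) \<times> (('q \<times> 'r) \<times> 'p)) \<Rightarrow> real"
    and FB :: "real \<times> ((real \<times> real) \<times> (('q \<times> 'r) \<times> 'p)) \<Rightarrow> 'q" and \<sigma> :: real
  assumes k: "2 \<le> k" and m: "1 \<le> m" and v: "diophantine_vector v"
    and C: "periodic_analytic S C" and a: "periodic_analytic S a" and D: "periodic_analytic S D"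
    and FA: "real_analytic_on FA ({0} \<times> (UNIV \<times> (UNIV \<times> S)))" "\<And>u q l. lattice_periodic (\<lambda>x. FA (u, (q, (x, l))))"
    and FB: "real_analytic_on FB ({0} \<times> (UNIV \<times> (UNIV \<times> S)))" "\<And>u q l. lattice_periodic (\<lambda>x. FB (u, (q, (x, l))))"
    and C_pos: "\<And>l. l \<in> S \<Longrightarrow> 0 < mean C l" and a_pos: "\<And>l. l \<in> S \<Longrightarrow> 0 < mean a l"
    and \<sigma>: "\<sigma> = 1 \<or> \<sigma> = - 1"
begin

definition y0 :: "'p \<Rightarrow> real" where
  "y0 l = \<sigma> * sqrt (mean C l * mean a l / (2 * (real k + 1)))"

definition \<eta>0 :: "'p \<Rightarrow> real" where
  "\<eta>0 l = \<sigma> * sqrt (2 * mean a l / (mean C l * (real k + 1)))"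

definition \<theta>0 :: "'p \<Rightarrow> 'q" where
  "\<theta>0 l = (\<sigma> / real m * sqrt (2 * (real k + 1) / (mean C l * mean a l))) *\<^sub>R mean D l"

lemma \<sigma>_square: "\<sigma> * \<sigma> = 1" using \<sigma> by auto

text \<open>At \<open>u = 0\<close> the averaged equations are \<open>c \<eta> = 2 y\<close>, \<open>a = (k + 1) \<eta> y\<close> and \<open>d = m y \<vartheta>\<close>. Eliminating
\<open>\<eta>\<close> leaves \<open>y\<^sup>2 = c a / (2 (k + 1))\<close>, which has the two real solutions because \<open>c\<close> and \<open>a\<close> are positive.\<close>

lemma leading_relations:
  assumes l: "l \<in> S"
  shows "y0 l \<noteq> 0" "y0 l * y0 l = mean C l * mean a l / (2 * (real k + 1))" "mean C l * \<eta>0 l = 2 * y0 l"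
    "mean a l = (real k + 1) * \<eta>0 l * y0 l" "mean D l = (real m * y0 l) *\<^sub>R \<theta>0 l"
proof -
  let ?c = "mean C l" and ?a = "mean a l" and ?k = "real k + 1"
  have c: "0 < ?c" and a: "0 < ?a" using C_pos a_pos l by auto
  define R where "R = sqrt (?c * ?a / (2 * ?k))"
  have R: "0 < R" "R * R = ?c * ?a / (2 * ?k)" using c a by (auto simp: R_def)
  have y: "y0 l = \<sigma> * R" by (simp add: y0_def R_def)
  show "y0 l \<noteq> 0" using R \<sigma> by (auto simp: y)
  have "y0 l * y0 l = (\<sigma> * \<sigma>) * (R * R)" by (simp add: y)
  then show "y0 l * y0 l = ?c * ?a / (2 * ?k)" by (simp add: \<sigma>_square R)
  have e: "\<eta>0 l = \<sigma> * (2 * R / ?c)"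
  proof -
    have four: "4 * (?c * ?a / (2 * K)) / (?c * ?c) = 2 * ?a / (?c * K)" if "0 < K" for K
      using c that by (simp add: field_simps)
    have "2 * ?a / (?c * ?k) = (2 * R / ?c) * (2 * R / ?c)"
    proof -
      have "(2 * R / ?c) * (2 * R / ?c) = 4 * (R * R) / (?c * ?c)" by (simp add: field_simps)
      also have "\<dots> = 2 * ?a / (?c * ?k)" unfolding R(2) using c four[of ?k] by simp
      finally show ?thesis ..
    qed
    then have "sqrt (2 * ?a / (?c * ?k)) = \<bar>2 * R / ?c\<bar>" by (simp only: real_sqrt_abs2)
    then have "sqrt (2 * ?a / (?c * ?k)) = 2 * R / ?c" using R c by simp
    then show ?thesis by (simp add: \<eta>0_def)
  qed
  show "?c * \<eta>0 l = 2 * y0 l" using c by (simp add: e y)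
  have two: "2 * K * (?c * ?a / (2 * K)) / ?c = ?a" if "0 < K" for K using c that by simp
  have "?k * \<eta>0 l * y0 l = (\<sigma> * \<sigma>) * (2 * ?k * (R * R) / ?c)" by (simp add: e y)
  also have "\<dots> = ?a" unfolding \<sigma>_square R(2) using two[of ?k] by simp
  finally show "?a = ?k * \<eta>0 l * y0 l" ..
  have "sqrt (2 * ?k / (?c * ?a)) = 1 / R"
  proof -
    have "2 * ?k / (?c * ?a) = 1 / (R * R)" unfolding R(2) using c a by (simp add: field_simps)
    also have "\<dots> = (1 / R) * (1 / R)" by simp
    finally have "sqrt (2 * ?k / (?c * ?a)) = \<bar>1 / R\<bar>" by (simp only: real_sqrt_abs2)
    then show ?thesis using R by simp
  qed
  then have "\<theta>0 l = (\<sigma> / real m * (1 / R)) *\<^sub>R mean D l" by (simp add: \<theta>0_def)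
  then have "(real m * y0 l) *\<^sub>R \<theta>0 l = (real m * (\<sigma> * R) * (\<sigma> / real m * (1 / R))) *\<^sub>R mean D l" by (simp add: y)
  also have "real m * (\<sigma> * R) * (\<sigma> / real m * (1 / R)) = \<sigma> * \<sigma>" using m R by simp
  finally show "mean D l = (real m * y0 l) *\<^sub>R \<theta>0 l" by (simp add: \<sigma>_square)
qed

lemma leading_analytic:
  "real_analytic_on (mean C) S" "real_analytic_on (mean a) S" "real_analytic_on (mean D) S"
  "real_analytic_on y0 S" "real_analytic_on \<eta>0 S" "real_analytic_on \<theta>0 S"
proof -
  show c: "real_analytic_on (mean C) S" and aa: "real_analytic_on (mean a) S" and dd: "real_analytic_on (mean D) S"
    by (intro real_analytic_on_mean C a D)+
  have pos: "0 < mean C l * mean a l" "0 < mean C l" "0 < mean a l" if "l \<in> S" for l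
    using C_pos[OF that] a_pos[OF that] by auto
  show "real_analytic_on y0 S" unfolding y0_def[abs_def]
    by (intro real_analytic_on_mult real_analytic_on_const real_analytic_on_sqrt real_analytic_on_divide c aa)
       (auto intro!: divide_pos_pos pos)
  show "real_analytic_on \<eta>0 S" unfolding \<eta>0_def[abs_def]
    by (intro real_analytic_on_mult real_analytic_on_const real_analytic_on_sqrt real_analytic_on_divide c aa)
       (auto dest: pos intro!: divide_pos_pos mult_pos_pos)
  show "real_analytic_on \<theta>0 S" unfolding \<theta>0_def[abs_def]
    by (intro real_analytic_on_scaleR real_analytic_on_mult real_analytic_on_const real_analytic_on_sqrt real_analytic_on_divide c aa dd)
       (auto dest: pos intro!: divide_pos_pos mult_pos_pos)
qed

definition shift :: "real \<Rightarrow> 'q \<Rightarrow> ('q \<times> 'r) \<times> 'p \<Rightarrow> ('q \<times> 'r) \<times> 'p" where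
  "shift u \<theta> z = (fst z + (u ^ m *\<^sub>R \<theta>, 0), snd z)"

text \<open>The components of the vector field in the rescaled variables, divided by \<open>u ^ (k + 1)\<close>, \<open>u ^ (2 * k)\<close>
and \<open>u ^ (2 * p)\<close>; in the last one the constant \<open>\<omega>\<close> is subtracted.\<close>

definition \<Phi>X :: "real \<times> (((real \<times> real) \<times> 'q) \<times> (('q \<times> 'r) \<times> 'p)) \<Rightarrow> real" where
  "\<Phi>X = (\<lambda>(u, (((\<xi>, \<eta>), \<theta>), z)). C (shift u \<theta> z) * \<eta>)"

definition \<Phi>Y :: "real \<times> (((real \<times> real) \<times> 'q) \<times> (('q \<times> 'r) \<times> 'p)) \<Rightarrow> real" where
  "\<Phi>Y = (\<lambda>(u, (((\<xi>, \<eta>), \<theta>), z)). a (shift u \<theta> z) * \<xi> ^ k + u * FA (u, ((\<xi>, \<eta>), shift u \<theta> z)))"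

definition \<Phi>T :: "real \<times> (((real \<times> real) \<times> 'q) \<times> (('q \<times> 'r) \<times> 'p)) \<Rightarrow> 'q" where
  "\<Phi>T = (\<lambda>(u, (((\<xi>, \<eta>), \<theta>), z)). \<xi> ^ p *\<^sub>R D (shift u \<theta> z) + u *\<^sub>R FB (u, ((\<xi>, \<eta>), shift u \<theta> z)))"

abbreviation dom :: "(real \<times> (((real \<times> real) \<times> 'q) \<times> (('q \<times> 'r) \<times> 'p))) set" where
  "dom \<equiv> {0} \<times> (UNIV \<times> (UNIV \<times> S))"

lemma real_analytic_on_shift:
  "real_analytic_on (\<lambda>w. shift (fst w) (snd (fst (snd w))) (snd (snd w))) dom"
  unfolding shift_def by (intro real_analytic_intros)

lemma compose_shift:
  fixes G :: "('q \<times> 'r) \<times> 'p \<Rightarrow> 'b::banach"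
  assumes "real_analytic_on G (UNIV \<times> S)"
  shows "real_analytic_on (\<lambda>w. G (shift (fst w) (snd (fst (snd w))) (snd (snd w)))) dom"
  by (rule real_analytic_on_compose[OF assms real_analytic_on_shift]) (auto simp: shift_def)

lemma compose_shift_F:
  fixes G :: "real \<times> ((real \<times> real) \<times> (('q \<times> 'r) \<times> 'p)) \<Rightarrow> 'b::banach"
  assumes "real_analytic_on G ({0} \<times> (UNIV \<times> (UNIV \<times> S)))"
  shows "real_analytic_on (\<lambda>w. G (fst w, (fst (fst (snd w)), shift (fst w) (snd (fst (snd w))) (snd (snd w))))) dom"
  by (rule real_analytic_on_compose[OF assms], intro real_analytic_intros real_analytic_on_shift)
     (auto simp: shift_def)

lemma \<Phi>_analytic:
  "real_analytic_on \<Phi>X dom" "real_analytic_on \<Phi>Y dom" "real_analytic_on \<Phi>T dom"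
proof -
  note an = compose_shift[OF periodic_analyticD(1)[OF C]] compose_shift[OF periodic_analyticD(1)[OF a]]
    compose_shift[OF periodic_analyticD(1)[OF D]] compose_shift_F[OF FA(1)] compose_shift_F[OF FB(1)]
  have "real_analytic_on (\<lambda>w. C (shift (fst w) (snd (fst (snd w))) (snd (snd w))) * snd (fst (fst (snd w)))) dom"
    by (intro real_analytic_on_mult an real_analytic_on_fst real_analytic_on_snd real_analytic_on_ident)
  then show "real_analytic_on \<Phi>X dom" by (simp add: \<Phi>X_def case_prod_unfold)
  have "real_analytic_on (\<lambda>w. a (shift (fst w) (snd (fst (snd w))) (snd (snd w))) * fst (fst (fst (snd w))) ^ k
      + fst w * FA (fst w, (fst (fst (snd w)), shift (fst w) (snd (fst (snd w))) (snd (snd w))))) dom"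
    by (intro real_analytic_on_mult real_analytic_on_add real_analytic_on_power an real_analytic_on_fst real_analytic_on_snd real_analytic_on_ident)
  then show "real_analytic_on \<Phi>Y dom" by (simp add: \<Phi>Y_def case_prod_unfold)
  have "real_analytic_on (\<lambda>w. fst (fst (fst (snd w))) ^ p *\<^sub>R D (shift (fst w) (snd (fst (snd w))) (snd (snd w)))
      + fst w *\<^sub>R FB (fst w, (fst (fst (snd w)), shift (fst w) (snd (fst (snd w))) (snd (snd w))))) dom"
    by (intro real_analytic_on_scaleR real_analytic_on_add real_analytic_on_power an real_analytic_on_fst real_analytic_on_snd real_analytic_on_ident)
  then show "real_analytic_on \<Phi>T dom" by (simp add: \<Phi>T_def case_prod_unfold)
qed

lemma shift_lattice: "shift u \<theta> (x + q, l) = (fst (shift u \<theta> (x, l)) + q, l)"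
  by (simp add: shift_def)

lemma \<Phi>_periodic:
  "lattice_periodic (\<lambda>x. \<Phi>X (u, (w, (x, l))))" "lattice_periodic (\<lambda>x. \<Phi>Y (u, (w, (x, l))))"
  "lattice_periodic (\<lambda>x. \<Phi>T (u, (w, (x, l))))"
proof -
  have s: "shift u \<theta> (x, l) = (fst (shift u \<theta> (x, l)), l)" for x \<theta> by (simp add: shift_def)
  have G: "G (shift u \<theta> (x + q, l)) = G (shift u \<theta> (x, l))" if "\<And>l. lattice_periodic (\<lambda>x. G (x, l))" "q \<in> lattice"
    for G :: "('q \<times> 'r) \<times> 'p \<Rightarrow> 'b" and \<theta> x q
    using lattice_periodicD[OF that(1) that(2), of "fst (shift u \<theta> (x, l))" l] s[of \<theta> x] by (simp add: shift_lattice)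
  have per: "C (shift u \<theta> (x + q, l)) = C (shift u \<theta> (x, l))" "a (shift u \<theta> (x + q, l)) = a (shift u \<theta> (x, l))"
    "D (shift u \<theta> (x + q, l)) = D (shift u \<theta> (x, l))" "FA (u, b, shift u \<theta> (x + q, l)) = FA (u, b, shift u \<theta> (x, l))"
    "FB (u, b, shift u \<theta> (x + q, l)) = FB (u, b, shift u \<theta> (x, l))" if q: "q \<in> lattice" for \<theta> x q b
    by (rule G[of C, OF periodic_analyticD(2)[OF C] q] G[of a, OF periodic_analyticD(2)[OF a] q]
      G[of D, OF periodic_analyticD(2)[OF D] q] G[of "\<lambda>z. FA (u, b, z)", OF FA(2) q] G[of "\<lambda>z. FB (u, b, z)", OF FB(2) q])+
  show "lattice_periodic (\<lambda>x. \<Phi>X (u, (w, (x, l))))" "lattice_periodic (\<lambda>x. \<Phi>Y (u, (w, (x, l))))"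
    "lattice_periodic (\<lambda>x. \<Phi>T (u, (w, (x, l))))"
    by (simp_all add: lattice_periodic_def \<Phi>X_def \<Phi>Y_def \<Phi>T_def case_prod_unfold per)
qed

lemma shift_zero: "shift 0 \<theta> z = z"
  using m by (simp add: shift_def prod_eq_iff power_0_left)

lemma \<Phi>_derivative:
  "vector_derivative (\<lambda>t. \<Phi>X (0, (((1, e), h) + t *\<^sub>R ((\<xi>, \<eta>), \<theta>), z))) (at 0) = C z * \<eta>"
  "vector_derivative (\<lambda>t. \<Phi>Y (0, (((1, e), h) + t *\<^sub>R ((\<xi>, \<eta>), \<theta>), z))) (at 0) = a z * (real k * \<xi>)"
  "vector_derivative (\<lambda>t. \<Phi>T (0, (((1, e), h) + t *\<^sub>R ((\<xi>, \<eta>), \<theta>), z))) (at 0) = (real p * \<xi>) *\<^sub>R D z"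
proof -
  have pw: "((\<lambda>t. (1 + t * \<xi>) ^ n) has_real_derivative real n * \<xi>) (at 0)" for n
    by (auto intro!: derivative_eq_intros)
  have "((\<lambda>t. C z * (e + t * \<eta>)) has_vector_derivative C z * \<eta>) (at 0)"
    by (subst has_real_derivative_iff_has_vector_derivative[symmetric]) (auto intro!: derivative_eq_intros)
  then show "vector_derivative (\<lambda>t. \<Phi>X (0, (((1, e), h) + t *\<^sub>R ((\<xi>, \<eta>), \<theta>), z))) (at 0) = C z * \<eta>"
    by (simp only: \<Phi>X_def prod.case add_Pair scaleR_Pair shift_zero real_scaleR_def mult_zero_left add_0_right scaleR_zero_left vector_derivative_at)
  have "((\<lambda>t. a z * (1 + t * \<xi>) ^ k) has_vector_derivative a z * (real k * \<xi>)) (at 0)"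
    by (subst has_real_derivative_iff_has_vector_derivative[symmetric]) (rule DERIV_cmult[OF pw])
  then show "vector_derivative (\<lambda>t. \<Phi>Y (0, (((1, e), h) + t *\<^sub>R ((\<xi>, \<eta>), \<theta>), z))) (at 0) = a z * (real k * \<xi>)"
    by (simp only: \<Phi>Y_def prod.case add_Pair scaleR_Pair shift_zero real_scaleR_def mult_zero_left add_0_right scaleR_zero_left vector_derivative_at)
  have "((\<lambda>t. (1 + t * \<xi>) ^ p *\<^sub>R D z) has_vector_derivative (real p * \<xi>) *\<^sub>R D z) (at 0)"
    by (rule bounded_linear.has_vector_derivative[OF bounded_linear_scaleR_left])
       (rule pw[unfolded has_real_derivative_iff_has_vector_derivative])
  then show "vector_derivative (\<lambda>t. \<Phi>T (0, (((1, e), h) + t *\<^sub>R ((\<xi>, \<eta>), \<theta>), z))) (at 0) = (real p * \<xi>) *\<^sub>R D z"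
    by (simp only: \<Phi>T_def prod.case add_Pair scaleR_Pair shift_zero real_scaleR_def mult_zero_left add_0_right scaleR_zero_left vector_derivative_at)
qed

definition profile where
  "profile N X X' Y Y' T T' z =
     ((trunc (\<lambda>_. 1) k N X X' z, trunc (\<lambda>_. 1) k N Y Y' z), trunc (\<lambda>_. 1) k N T T' z)"

text \<open>Coefficients for which the error is flat to order \<open>N\<close>. The coefficients of index zero are prescribed, and
the correction \<open>y1\<close> of the vector field appears only after the resonant order \<open>k - 1\<close> has been passed.\<close>

definition solution ::
    "nat \<Rightarrow> (nat \<Rightarrow> 'p \<Rightarrow> real) \<Rightarrow> (nat \<Rightarrow> ('q \<times> 'r) \<times> 'p \<Rightarrow> real) \<Rightarrow> (nat \<Rightarrow> ('q \<times> 'r) \<times> 'p \<Rightarrow> real)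
      \<Rightarrow> (nat \<Rightarrow> 'p \<Rightarrow> real) \<Rightarrow> (nat \<Rightarrow> ('q \<times> 'r) \<times> 'p \<Rightarrow> real) \<Rightarrow> (nat \<Rightarrow> ('q \<times> 'r) \<times> 'p \<Rightarrow> real)
      \<Rightarrow> (nat \<Rightarrow> 'p \<Rightarrow> 'q) \<Rightarrow> (nat \<Rightarrow> ('q \<times> 'r) \<times> 'p \<Rightarrow> 'q) \<Rightarrow> (nat \<Rightarrow> ('q \<times> 'r) \<times> 'p \<Rightarrow> 'q)
      \<Rightarrow> ('p \<Rightarrow> real) \<Rightarrow> bool" where
  "solution N X X' wX Y Y' wY T T' wT y1 \<longleftrightarrow>
     (\<forall>i. real_analytic_on (X i) S \<and> real_analytic_on (Y i) S \<and> real_analytic_on (T i) S) \<and> real_analytic_on y1 S \<and>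
     (\<forall>i. osc_primitive v S (X' i) (wX i) \<and> osc_primitive v S (Y' i) (wY i) \<and> osc_primitive v S (T' i) (wT i)) \<and>
     X 0 = (\<lambda>_. 1) \<and> Y 0 = \<eta>0 \<and> T 0 = \<theta>0 \<and>
     (\<forall>x l. wX 0 (x, l) = \<eta>0 l * (C (x, l) - mean C l) \<and> wY 0 (x, l) = a (x, l) - mean a l \<and>
        wT 0 (x, l) = D (x, l) - mean D l) \<and>
     (N < k \<longrightarrow> y1 = (\<lambda>_. 0)) \<and>
     flat S N (defect \<Phi>X (profile N X X' Y Y' T T') y0 y1 2 k N X X' wX) \<and>
     flat S N (defect \<Phi>Y (profile N X X' Y Y' T T') y0 y1 (k + 1) k N Y Y' wY) \<and>
     flat S N (defect \<Phi>T (profile N X X' Y Y' T T') y0 y1 m k N T T' wT)"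

text \<open>The averaged equations at order \<open>N\<close> for the coefficients of \<open>\<xi>\<close> and \<open>\<eta>\<close>. With the value of \<open>y0\<^sup>2\<close> their
determinant is \<open>c a / (2 (k + 1))\<close> times \<open>(2 + N) (k + 1 + N) - 2 k (k + 1)\<close>, which vanishes only for
\<open>N = k - 1\<close>. In this resonant case the system is solved by means of \<open>d\<close>, the new coefficient of the vector
field on the line, whereas the coefficient of \<open>\<xi>\<close> is free and set to zero.\<close>

lemma linear_system:
  assumes rx: "real_analytic_on \<rho>x S" and ry: "real_analytic_on \<rho>y S" and N: "1 \<le> N"
  obtains XN YN d where "real_analytic_on XN S" "real_analytic_on YN S" "real_analytic_on d S"
    "N \<noteq> k - 1 \<Longrightarrow> d = (\<lambda>_. 0)"
    "\<And>l. l \<in> S \<Longrightarrow> \<rho>x l + mean C l * YN l - real (2 + N) * y0 l * XN l - 2 * d l = 0"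
    "\<And>l. l \<in> S \<Longrightarrow> \<rho>y l + mean a l * real k * XN l - real (k + 1 + N) * y0 l * YN l - real (k + 1) * \<eta>0 l * d l = 0"
proof -
  note an = rx ry leading_analytic
  have cpos: "mean C l \<noteq> 0" "mean a l \<noteq> 0" if "l \<in> S" for l using C_pos[OF that] a_pos[OF that] by auto
  show ?thesis
  proof (cases "N = k - 1")
    case True
    have kN: "k = N + 1" using True N by simp
    define d where "d l = (mean C l * \<rho>y l + 2 * real k * y0 l * \<rho>x l) / ((6 * real k + 2) * y0 l)" for l
    define YN where "YN l = (2 * d l - \<rho>x l) / mean C l" for l
    have da: "real_analytic_on d S" unfolding d_def[abs_def]
      by (intro real_analytic_on_divide real_analytic_on_add real_analytic_on_mult real_analytic_on_const an)
         (use leading_relations(1) in auto)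
    have Ya: "real_analytic_on YN S" unfolding YN_def[abs_def]
      by (intro real_analytic_on_divide real_analytic_on_diff real_analytic_on_mult real_analytic_on_const an da cpos)
    show ?thesis
    proof (rule that[of "\<lambda>_. 0" YN d])
      fix l assume l: "l \<in> S"
      have cY: "mean C l * YN l = 2 * d l - \<rho>x l" using cpos[OF l] by (simp add: YN_def)
      then show "\<rho>x l + mean C l * YN l - real (2 + N) * y0 l * 0 - 2 * d l = 0" by simp
      have dd: "(6 * real k + 2) * y0 l * d l = mean C l * \<rho>y l + 2 * real k * y0 l * \<rho>x l"
        using leading_relations(1)[OF l] by (simp add: d_def)
      have "mean C l * (\<rho>y l - 2 * real k * y0 l * YN l - (real k + 1) * \<eta>0 l * d l)
         = mean C l * \<rho>y l - 2 * real k * y0 l * (mean C l * YN l) - (real k + 1) * (mean C l * \<eta>0 l) * d l"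
        by (simp add: algebra_simps)
      also have "\<dots> = mean C l * \<rho>y l + 2 * real k * y0 l * \<rho>x l - (6 * real k + 2) * y0 l * d l"
        unfolding cY leading_relations(3)[OF l] by (simp add: algebra_simps)
      also have "\<dots> = 0" unfolding dd by simp
      finally have "\<rho>y l - 2 * real k * y0 l * YN l - (real k + 1) * \<eta>0 l * d l = 0" using cpos[OF l] by simp
      moreover have kk: "real (k + 1 + N) = 2 * real k" "real (k + 1) = real k + 1" using kN by auto
      ultimately show "\<rho>y l + mean a l * real k * 0 - real (k + 1 + N) * y0 l * YN l - real (k + 1) * \<eta>0 l * d l = 0"
        unfolding kk by simp
    qed (use da Ya True in auto)
  next
    case False
    define \<Delta> where "\<Delta> l = real (2 + N) * real (k + 1 + N) * (y0 l * y0 l) - real k * (mean C l * mean a l)" for l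
    have D0: "\<Delta> l \<noteq> 0" if l: "l \<in> S" for l
    proof -
      have "(2 + N) * (k + 1 + N) \<noteq> 2 * k * (k + 1)"
      proof (cases "N < k - 1")
        case True
        have "(2 + N) * (k + 1 + N) < (k + 1) * (2 * k)"
          using True by (intro mult_strict_mono) auto
        then show ?thesis by (simp add: mult_ac)
      next
        case False
        then have "k - 1 < N" using \<open>N \<noteq> k - 1\<close> by simp
        then have "(k + 1) * (2 * k) < (2 + N) * (k + 1 + N)"
          by (intro mult_strict_mono) auto
        then show ?thesis by (simp add: mult_ac)
      qed
      then have ne: "real (2 + N) * real (k + 1 + N) \<noteq> 2 * real k * (real k + 1)"
        by (metis (no_types, lifting) of_nat_1 of_nat_add of_nat_eq_iff of_nat_mult of_nat_numeral)
      have gen: "P * (ca / (2 * K)) - kk * ca = ca * (P - 2 * kk * K) / (2 * K)" if "0 < K" for P ca K kk :: real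
        using that by (simp add: field_simps)
      have "\<Delta> l = mean C l * mean a l * (real (2 + N) * real (k + 1 + N) - 2 * real k * (real k + 1)) / (2 * (real k + 1))"
        unfolding \<Delta>_def leading_relations(2)[OF l] by (rule gen) simp
      then show ?thesis using ne cpos[OF l] by simp
    qed
    define XN where "XN l = (mean C l * \<rho>y l + real (k + 1 + N) * y0 l * \<rho>x l) / \<Delta> l" for l
    define YN where "YN l = (real (2 + N) * y0 l * XN l - \<rho>x l) / mean C l" for l
    have Da: "real_analytic_on \<Delta> S" unfolding \<Delta>_def[abs_def]
      by (intro real_analytic_on_diff real_analytic_on_mult real_analytic_on_const an)
    have Xa: "real_analytic_on XN S" unfolding XN_def[abs_def]
      by (intro real_analytic_on_divide real_analytic_on_add real_analytic_on_mult real_analytic_on_const an Da D0)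
    have Ya: "real_analytic_on YN S" unfolding YN_def[abs_def]
      by (intro real_analytic_on_divide real_analytic_on_diff real_analytic_on_mult real_analytic_on_const an Xa cpos)
    show ?thesis
    proof (rule that[of XN YN "\<lambda>_. 0"])
      fix l assume l: "l \<in> S"
      have cY: "mean C l * YN l = real (2 + N) * y0 l * XN l - \<rho>x l" using cpos[OF l] by (simp add: YN_def)
      then show "\<rho>x l + mean C l * YN l - real (2 + N) * y0 l * XN l - 2 * 0 = 0" by simp
      have DX: "\<Delta> l * XN l = mean C l * \<rho>y l + real (k + 1 + N) * y0 l * \<rho>x l" using D0[OF l] by (simp add: XN_def)
      have "mean C l * (\<rho>y l + mean a l * real k * XN l - real (k + 1 + N) * y0 l * YN l)
        = mean C l * \<rho>y l + mean C l * mean a l * real k * XN l - real (k + 1 + N) * y0 l * (mean C l * YN l)"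
        by (simp add: algebra_simps)
      also have "\<dots> = mean C l * \<rho>y l + real (k + 1 + N) * y0 l * \<rho>x l - \<Delta> l * XN l"
        unfolding cY \<Delta>_def by (simp add: algebra_simps)
      also have "\<dots> = 0" unfolding DX by simp
      finally have "\<rho>y l + mean a l * real k * XN l - real (k + 1 + N) * y0 l * YN l = 0" using cpos[OF l] by simp
      then show "\<rho>y l + mean a l * real k * XN l - real (k + 1 + N) * y0 l * YN l - real (k + 1) * \<eta>0 l * 0 = 0" by simp
    qed (use Xa Ya in auto)
  qed
qed

text \<open>Once the averages are balanced by \<open>eq\<close>, what remains of the equation at order \<open>N\<close> has zero average and is
removed by an oscillatory coefficient.\<close>

lemma oscillation:
  fixes f :: "('q \<times> 'r) \<times> 'p \<Rightarrow> 'b::euclidean_space"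
  assumes r: "germ S r" and h: "real_analytic_on h S" and f: "periodic_analytic S f" and g: "real_analytic_on g S"
    and eq: "\<And>l. l \<in> S \<Longrightarrow> mean (\<lambda>z. r (0, z)) l + h l *\<^sub>R mean f l - g l = 0"
  obtains \<phi> where "osc_primitive v S \<phi> (\<lambda>z. r (0, z) + h (snd z) *\<^sub>R f z - g (snd z))"
proof (rule small_divisor_equation[OF _ v])
  have hf: "periodic_analytic S (\<lambda>z. h (snd z) *\<^sub>R f z)"
    by (intro periodic_analytic_scaleR periodic_analytic_param h f)
  have sum: "periodic_analytic S (\<lambda>z. r (0, z) + h (snd z) *\<^sub>R f z)"
    by (intro periodic_analytic_add germ_initial r hf)
  show "periodic_analytic S (\<lambda>z. r (0, z) + h (snd z) *\<^sub>R f z - g (snd z))"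
    by (intro periodic_analytic_diff sum periodic_analytic_param g)
  show "mean (\<lambda>z. r (0, z) + h (snd z) *\<^sub>R f z - g (snd z)) l = 0" if l: "l \<in> S" for l
    using eq[OF l] mean_diff_param[OF g sum l] mean_add[OF germ_initial[OF r] hf l] mean_scaleR_param[OF h f l] by simp
qed (use that in blast)

text \<open>The averaged part of the equation at order \<open>N\<close> determines the averaged coefficients: \<open>\<xi>\<close> and \<open>\<eta>\<close> by the
linear system, \<open>\<vartheta>\<close> afterwards by a division. The oscillatory coefficients then solve small divisors
equations.\<close>

lemma solution_step:
  assumes sol: "solution N X X' wX Y Y' wY T T' wT y1" and N: "1 \<le> N"
  shows "\<exists>X X' wX Y Y' wY T T' wT y1. solution (Suc N) X X' wX Y Y' wY T T' wT y1"
proof -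
  have an: "\<And>i. real_analytic_on (X i) S" "\<And>i. real_analytic_on (Y i) S" "\<And>i. real_analytic_on (T i) S"
    "real_analytic_on y1 S"
    and osc: "\<And>i. osc_primitive v S (X' i) (wX i)" "\<And>i. osc_primitive v S (Y' i) (wY i)" "\<And>i. osc_primitive v S (T' i) (wT i)"
    and init: "X 0 = (\<lambda>_. 1)" "Y 0 = \<eta>0" "T 0 = \<theta>0"
    and w0: "\<And>x l. wX 0 (x, l) = \<eta>0 l * (C (x, l) - mean C l)" "\<And>x l. wY 0 (x, l) = a (x, l) - mean a l"
      "\<And>x l. wT 0 (x, l) = D (x, l) - mean D l"
    and y1: "N < k \<Longrightarrow> y1 = (\<lambda>_. 0)"
    and fl: "flat S N (defect \<Phi>X (profile N X X' Y Y' T T') y0 y1 2 k N X X' wX)"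
      "flat S N (defect \<Phi>Y (profile N X X' Y Y' T T') y0 y1 (k + 1) k N Y Y' wY)"
      "flat S N (defect \<Phi>T (profile N X X' Y Y' T T') y0 y1 m k N T T' wT)"
    using sol unfolding solution_def by (simp_all del: split_paired_All)
  have pa: "\<And>i. periodic_analytic S (X' i)" "\<And>i. periodic_analytic S (Y' i)" "\<And>i. periodic_analytic S (T' i)"
    "\<And>i. periodic_analytic S (wX i)" "\<And>i. periodic_analytic S (wY i)" "\<And>i. periodic_analytic S (wT i)"
    using osc by (simp_all add: osc_primitive_def)
  let ?Q = "profile N X X' Y Y' T T'"
  have Q: "germ S ?Q" unfolding profile_def[abs_def] by (intro germ_Pair germ_trunc an pa)
  obtain rx where rx: "germ S rx" "\<And>u x l. l \<in> S \<Longrightarrow> defect \<Phi>X ?Q y0 y1 2 k N X X' wX (u, (x, l)) = u ^ N *\<^sub>R rx (u, (x, l))"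
    using fl(1) unfolding flat_def by blast
  obtain ry where ry: "germ S ry" "\<And>u x l. l \<in> S \<Longrightarrow> defect \<Phi>Y ?Q y0 y1 (k + 1) k N Y Y' wY (u, (x, l)) = u ^ N *\<^sub>R ry (u, (x, l))"
    using fl(2) unfolding flat_def by blast
  obtain rt where rt: "germ S rt" "\<And>u x l. l \<in> S \<Longrightarrow> defect \<Phi>T ?Q y0 y1 m k N T T' wT (u, (x, l)) = u ^ N *\<^sub>R rt (u, (x, l))"
    using fl(3) unfolding flat_def by blast
  define \<rho>x where "\<rho>x = mean (\<lambda>z. rx (0, z))"
  define \<rho>y where "\<rho>y = mean (\<lambda>z. ry (0, z))"
  define \<rho>t where "\<rho>t = mean (\<lambda>z. rt (0, z))"
  have ra: "real_analytic_on \<rho>x S" "real_analytic_on \<rho>y S" "real_analytic_on \<rho>t S"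
    unfolding \<rho>x_def \<rho>y_def \<rho>t_def by (intro real_analytic_on_mean germ_initial rx ry rt)+
  obtain XN YN d where lin: "real_analytic_on XN S" "real_analytic_on YN S" "real_analytic_on d S"
    "N \<noteq> k - 1 \<Longrightarrow> d = (\<lambda>_. 0)"
    and eqx: "\<And>l. l \<in> S \<Longrightarrow> \<rho>x l + mean C l * YN l - real (2 + N) * y0 l * XN l - 2 * d l = 0"
    and eqy: "\<And>l. l \<in> S \<Longrightarrow> \<rho>y l + mean a l * real k * XN l - real (k + 1 + N) * y0 l * YN l - real (k + 1) * \<eta>0 l * d l = 0"
    using linear_system[OF ra(1,2) N] by blast
  define TN where "TN l = (1 / (real (m + N) * y0 l)) *\<^sub>R (\<rho>t l + (real p * XN l) *\<^sub>R mean D l - (real m * d l) *\<^sub>R \<theta>0 l)" for l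
  have Ta: "real_analytic_on TN S" unfolding TN_def[abs_def]
    by (intro real_analytic_on_scaleR real_analytic_on_divide real_analytic_on_const real_analytic_on_mult
        real_analytic_on_diff real_analytic_on_add ra lin leading_analytic) (use leading_relations(1) N in auto)
  have eqt: "\<rho>t l + (real p * XN l) *\<^sub>R mean D l - ((y0 l * real (m + N)) *\<^sub>R TN l + (d l * real m) *\<^sub>R \<theta>0 l) = 0"
    if l: "l \<in> S" for l
    using leading_relations(1)[OF l] N by (simp add: TN_def mult_ac)
  \<comment> \<open>the averaged terms that each of the three right-hand sides has to balance\<close>
  define gx where "gx l = y0 l * real (2 + N) * XN l + d l * real 2" for l
  define gy where "gy l = y0 l * real (k + 1 + N) * YN l + d l * real (k + 1) * \<eta>0 l" for l
  define gt where "gt l = (y0 l * real (m + N)) *\<^sub>R TN l + (d l * real m) *\<^sub>R \<theta>0 l" for l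
  have ga: "real_analytic_on gx S" "real_analytic_on gy S" "real_analytic_on gt S"
    unfolding gx_def[abs_def] gy_def[abs_def] gt_def[abs_def]
    by (intro real_analytic_on_add real_analytic_on_mult real_analytic_on_scaleR real_analytic_on_const lin leading_analytic Ta)+
  define wXN where "wXN = (\<lambda>z. rx (0, z) + YN (snd z) *\<^sub>R C z - gx (snd z))"
  define wYN where "wYN = (\<lambda>z. ry (0, z) + (real k * XN (snd z)) *\<^sub>R a z - gy (snd z))"
  define wTN where "wTN = (\<lambda>z. rt (0, z) + (real p * XN (snd z)) *\<^sub>R D z - gt (snd z))"
  have XNk: "real_analytic_on (\<lambda>l. real n * XN l) S" for n
    by (intro real_analytic_on_mult real_analytic_on_const lin)
  obtain X'N where X'N: "osc_primitive v S X'N wXN"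
    unfolding wXN_def
    by (rule oscillation[OF rx(1) lin(2) C ga(1)]) (use eqx in \<open>auto simp: \<rho>x_def gx_def algebra_simps\<close>)
  obtain Y'N where Y'N: "osc_primitive v S Y'N wYN"
    unfolding wYN_def
    by (rule oscillation[OF ry(1) XNk a ga(2)]) (use eqy in \<open>auto simp: \<rho>y_def gy_def algebra_simps\<close>)
  obtain T'N where T'N: "osc_primitive v S T'N wTN"
    unfolding wTN_def
    by (rule oscillation[OF rt(1) XNk D ga(3)]) (use eqt in \<open>auto simp: \<rho>t_def gt_def\<close>)
  have paN: "periodic_analytic S X'N" "periodic_analytic S Y'N" "periodic_analytic S T'N"
    "periodic_analytic S wXN" "periodic_analytic S wYN" "periodic_analytic S wTN"
    using X'N Y'N T'N by (simp_all add: osc_primitive_def)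
  define R where "R z = ((XN (snd (snd z)) + fst z ^ (k - 1) * X'N (snd z), YN (snd (snd z)) + fst z ^ (k - 1) * Y'N (snd z)),
      TN (snd (snd z)) + fst z ^ (k - 1) *\<^sub>R T'N (snd z))" for z :: "real \<times> (('q \<times> 'r) \<times> 'p)"
  have R: "germ S R" unfolding R_def[abs_def]
    by (intro germ_Pair germ_add germ_mult_real germ_scaleR germ_param germ_u_power germ_coefficient lin Ta paN)
  have k1: "1 \<le> k" using k by simp
  have Qs: "(\<lambda>z. ?Q z + fst z ^ N *\<^sub>R R z) = profile (Suc N) (X(N := XN)) (X'(N := X'N)) (Y(N := YN)) (Y'(N := Y'N)) (T(N := TN)) (T'(N := T'N))"
    by (simp add: fun_eq_iff profile_def trunc_Suc[OF k1] R_def)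
  have Q0: "?Q (0, (x, l)) = ((1, \<eta>0 l), \<theta>0 l)" for x l
    by (simp add: profile_def trunc_zero[OF k N] init)
  have R0: "R (0, (x, l)) = ((XN l, YN l), TN l)" for x l
    using k by (simp add: R_def power_0_left)
  note step = defect_step[OF _ _ Q R N k leading_analytic(4) an(4) lin(3)]
  have stX: "flat S (Suc N) (defect \<Phi>X (\<lambda>z. ?Q z + fst z ^ N *\<^sub>R R z) y0 (\<lambda>l. y1 l + d l) 2 k (Suc N) (X(N := XN)) (X'(N := X'N)) (wX(N := wXN)))"
  proof (rule step[OF \<Phi>_analytic(1) \<Phi>_periodic(1) an(1) lin(1) pa(1) paN(1,4) rx(1,2) lin(4)])
    fix x l assume l: "l \<in> S"
    show "rx (0, (x, l)) + vector_derivative (\<lambda>t. \<Phi>X (0, (?Q (0, (x, l)) + t *\<^sub>R R (0, (x, l)), (x, l)))) (at 0)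
        - (y0 l * real (2 + N)) *\<^sub>R XN l - (d l * real 2) *\<^sub>R X 0 l - wXN (x, l) = 0"
      unfolding Q0 R0 \<Phi>_derivative by (simp add: wXN_def gx_def init algebra_simps)
  qed
  have stY: "flat S (Suc N) (defect \<Phi>Y (\<lambda>z. ?Q z + fst z ^ N *\<^sub>R R z) y0 (\<lambda>l. y1 l + d l) (k + 1) k (Suc N) (Y(N := YN)) (Y'(N := Y'N)) (wY(N := wYN)))"
  proof (rule step[OF \<Phi>_analytic(2) \<Phi>_periodic(2) an(2) lin(2) pa(2) paN(2,5) ry(1,2) lin(4)])
    fix x l assume l: "l \<in> S"
    show "ry (0, (x, l)) + vector_derivative (\<lambda>t. \<Phi>Y (0, (?Q (0, (x, l)) + t *\<^sub>R R (0, (x, l)), (x, l)))) (at 0)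
        - (y0 l * real (k + 1 + N)) *\<^sub>R YN l - (d l * real (k + 1)) *\<^sub>R Y 0 l - wYN (x, l) = 0"
      unfolding Q0 R0 \<Phi>_derivative by (simp add: wYN_def gy_def init algebra_simps)
  qed
  have stT: "flat S (Suc N) (defect \<Phi>T (\<lambda>z. ?Q z + fst z ^ N *\<^sub>R R z) y0 (\<lambda>l. y1 l + d l) m k (Suc N) (T(N := TN)) (T'(N := T'N)) (wT(N := wTN)))"
  proof (rule step[OF \<Phi>_analytic(3) \<Phi>_periodic(3) an(3) Ta pa(3) paN(3,6) rt(1,2) lin(4)])
    fix x l assume l: "l \<in> S"
    show "rt (0, (x, l)) + vector_derivative (\<lambda>t. \<Phi>T (0, (?Q (0, (x, l)) + t *\<^sub>R R (0, (x, l)), (x, l)))) (at 0)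
        - (y0 l * real (m + N)) *\<^sub>R TN l - (d l * real m) *\<^sub>R T 0 l - wTN (x, l) = 0"
      unfolding Q0 R0 \<Phi>_derivative by (simp add: wTN_def gt_def init)
  qed
  have y1': "(\<lambda>l. y1 l + d l) = (\<lambda>_. 0)" if "Suc N < k"
    using y1 lin(4) that by auto
  have "solution (Suc N) (X(N := XN)) (X'(N := X'N)) (wX(N := wXN)) (Y(N := YN)) (Y'(N := Y'N)) (wY(N := wYN))
      (T(N := TN)) (T'(N := T'N)) (wT(N := wTN)) (\<lambda>l. y1 l + d l)"
    unfolding solution_def Qs[symmetric]
    using an lin(1,2) Ta real_analytic_on_add[OF an(4) lin(3)] osc X'N Y'N T'N init w0 N y1' stX stY stT by (simp del: split_paired_All)
  then show ?thesis by blast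
qed

text \<open>At order zero the averages balance by the relations between the leading coefficients, and the
oscillatory parts of \<open>c\<close>, \<open>a\<close> and \<open>d\<close> are removed by the first oscillatory coefficients.\<close>

lemma solution_base: "\<exists>X X' wX Y Y' wY T T' wT y1. solution 1 X X' wX Y Y' wY T T' wT y1"
proof -
  note an = leading_analytic
  have Co: "periodic_analytic S (\<lambda>z. C z - mean C (snd z))" and ao: "periodic_analytic S (\<lambda>z. a z - mean a (snd z))"
    and Do: "periodic_analytic S (\<lambda>z. D z - mean D (snd z))"
    by (intro periodic_analytic_diff C a D periodic_analytic_param an)+
  have "mean (\<lambda>z. \<eta>0 (snd z) *\<^sub>R (C z - mean C (snd z))) l = 0" if "l \<in> S" for l
    using mean_scaleR_param[OF an(5) Co that] mean_diff_param[OF an(1) C that] by simp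
  from small_divisor_equation[OF periodic_analytic_scaleR[OF periodic_analytic_param[OF an(5)] Co] v this]
  obtain x1 where x1: "osc_primitive v S x1 (\<lambda>z. \<eta>0 (snd z) *\<^sub>R (C z - mean C (snd z)))" by blast
  have "mean (\<lambda>z. a z - mean a (snd z)) l = 0" if "l \<in> S" for l using mean_diff_param[OF an(2) a that] by simp
  from small_divisor_equation[OF ao v this]
  obtain a1 where a1: "osc_primitive v S a1 (\<lambda>z. a z - mean a (snd z))" by blast
  have "mean (\<lambda>z. D z - mean D (snd z)) l = 0" if "l \<in> S" for l using mean_diff_param[OF an(3) D that] by simp
  from small_divisor_equation[OF Do v this]
  obtain d1 where d1: "osc_primitive v S d1 (\<lambda>z. D z - mean D (snd z))" by blast
  define X where "X = (\<lambda>i::nat. if i = 0 then (\<lambda>_::'p. 1::real) else (\<lambda>_. 0))"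
  define X' where "X' = (\<lambda>i::nat. if i = 0 then x1 else (\<lambda>_. 0))"
  define wX where "wX = (\<lambda>i::nat. if i = 0 then (\<lambda>z. \<eta>0 (snd z) *\<^sub>R (C z - mean C (snd z))) else (\<lambda>_. 0))"
  define Y where "Y = (\<lambda>i::nat. if i = 0 then \<eta>0 else (\<lambda>_. 0))"
  define Y' where "Y' = (\<lambda>i::nat. if i = 0 then a1 else (\<lambda>_. 0))"
  define wY where "wY = (\<lambda>i::nat. if i = 0 then (\<lambda>z. a z - mean a (snd z)) else (\<lambda>_. 0))"
  define T where "T = (\<lambda>i::nat. if i = 0 then \<theta>0 else (\<lambda>_. 0))"
  define T' where "T' = (\<lambda>i::nat. if i = 0 then d1 else (\<lambda>_. 0))"
  define wT where "wT = (\<lambda>i::nat. if i = 0 then (\<lambda>z. D z - mean D (snd z)) else (\<lambda>_. 0))"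
  let ?Q = "profile 1 X X' Y Y' T T'"
  have anl: "real_analytic_on (X i) S" "real_analytic_on (Y i) S" "real_analytic_on (T i) S" for i
    using an by (simp_all add: X_def Y_def T_def)
  have osc: "osc_primitive v S (X' i) (wX i)" "osc_primitive v S (Y' i) (wY i)" "osc_primitive v S (T' i) (wT i)" for i
    using x1 a1 d1 by (simp_all add: X'_def wX_def Y'_def wY_def T'_def wT_def osc_primitive_zero)
  have pa: "periodic_analytic S (X' i)" "periodic_analytic S (Y' i)" "periodic_analytic S (T' i)"
    "periodic_analytic S (wX i)" "periodic_analytic S (wY i)" "periodic_analytic S (wT i)" for i
    using osc by (simp_all add: osc_primitive_def)
  have Q: "germ S ?Q" unfolding profile_def[abs_def] by (intro germ_Pair germ_trunc anl pa)
  have Q0: "?Q (0, z) = ((1, \<eta>0 (snd z)), \<theta>0 (snd z))" for z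
    by (simp add: profile_def trunc_zero[OF k] X_def Y_def T_def)
  have z: "(0::real) ^ (k - 1) = 0" using k by simp
  have flX: "flat S (Suc 0) (defect \<Phi>X ?Q y0 (\<lambda>_. 0) 2 k 1 X X' wX)"
  proof (rule flat_Suc[OF germ_defect[OF \<Phi>_analytic(1) \<Phi>_periodic(1) Q an(4) real_analytic_on_const anl(1) pa(1,4)]])
    fix x l assume l: "l \<in> S"
    show "defect \<Phi>X ?Q y0 (\<lambda>_. 0) 2 k 1 X X' wX (0, (x, l)) = 0"
      unfolding defect_def fst_conv snd_conv Q0 using leading_relations(3)[OF l]
      by (simp add: trunc_zero[OF k] \<Phi>X_def shift_zero wX_def X_def algebra_simps)
  qed simp
  have flY: "flat S (Suc 0) (defect \<Phi>Y ?Q y0 (\<lambda>_. 0) (k + 1) k 1 Y Y' wY)"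
  proof (rule flat_Suc[OF germ_defect[OF \<Phi>_analytic(2) \<Phi>_periodic(2) Q an(4) real_analytic_on_const anl(2) pa(2,5)]])
    fix x l assume l: "l \<in> S"
    show "defect \<Phi>Y ?Q y0 (\<lambda>_. 0) (k + 1) k 1 Y Y' wY (0, (x, l)) = 0"
      unfolding defect_def fst_conv snd_conv Q0 using leading_relations(4)[OF l]
      by (simp add: trunc_zero[OF k] \<Phi>Y_def shift_zero wY_def Y_def algebra_simps)
  qed simp
  have flT: "flat S (Suc 0) (defect \<Phi>T ?Q y0 (\<lambda>_. 0) m k 1 T T' wT)"
  proof (rule flat_Suc[OF germ_defect[OF \<Phi>_analytic(3) \<Phi>_periodic(3) Q an(4) real_analytic_on_const anl(3) pa(3,6)]])
    fix x l assume l: "l \<in> S"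
    show "defect \<Phi>T ?Q y0 (\<lambda>_. 0) m k 1 T T' wT (0, (x, l)) = 0"
      unfolding defect_def fst_conv snd_conv Q0 using leading_relations(5)[OF l]
      by (simp add: trunc_zero[OF k] \<Phi>T_def shift_zero wT_def T_def mult_ac)
  qed simp
  have "solution 1 X X' wX Y Y' wY T T' wT (\<lambda>_. 0)"
    unfolding solution_def using anl osc flX flY flT
    by (simp add: X_def Y_def T_def wX_def wY_def wT_def)
  then show ?thesis by blast
qed

theorem solution_exists: "1 \<le> N \<Longrightarrow> \<exists>X X' wX Y Y' wY T T' wT y1. solution N X X' wX Y Y' wY T T' wT y1"
proof (induction N rule: nat_induct_at_least)
  case base
  show ?case by (rule solution_base)
next
  case (Suc N)
  from Suc.IH show ?case by (elim exE) (rule solution_step[OF _ Suc.hyps])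
qed

end

section \<open>Hulls, averages and the small divisors operator\<close>

lemma Basis_vec_real: "(Basis :: (real^'n) set) = range (\<lambda>i. axis i 1)"
  by (auto simp: Basis_vec_def)

lemma sum_Basis_vec:
  "(\<Sum>b\<in>(Basis :: (real^'n) set). f b) = (\<Sum>i\<in>UNIV. f (axis i 1))"
  unfolding Basis_vec_real by (subst sum.reindex) (auto simp: inj_on_def axis_eq_axis)

lemma sum_Basis_prod:
  "(\<Sum>b\<in>(Basis :: ('a::euclidean_space \<times> 'b::euclidean_space) set). f b) = (\<Sum>b\<in>Basis. f (b, 0)) + (\<Sum>b\<in>Basis. f (0, b))"
proof -
  have disj: "(\<lambda>u::'a. (u, 0::'b)) ` Basis \<inter> (\<lambda>v::'b. (0::'a, v)) ` Basis = {}" by auto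
  show ?thesis unfolding Basis_prod_def
    by (subst sum.union_disjoint) (auto simp: disj sum.reindex inj_on_def)
qed

lemma lattice_vec: "q \<in> lattice \<longleftrightarrow> (\<forall>i. (q :: real^'n) $ i \<in> \<int>)"
  by (auto simp: lattice_def Basis_vec_real inner_axis)

lemma lattice_prod: "(q, r) \<in> lattice \<longleftrightarrow> q \<in> lattice \<and> r \<in> lattice"
  by (simp add: lattice_def Basis_prod_def ball_Un)

lemma torus_periodic_iff: "torus_periodic H \<longleftrightarrow> lattice_periodic (\<lambda>x. H (fst x) (snd x))"
proof
  assume H: "torus_periodic H"
  have "H (\<theta> + q) (\<tau> + r) = H \<theta> \<tau>" if "(q, r) \<in> lattice" for \<theta> \<tau> q r
    using H that unfolding torus_periodic_def lattice_prod lattice_vec by blast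
  then show "lattice_periodic (\<lambda>x. H (fst x) (snd x))"
    by (simp add: lattice_periodic_def)
next
  assume "lattice_periodic (\<lambda>x. H (fst x) (snd x))"
  from lattice_periodicD[OF this, of "(q, r)" "(\<theta>, \<tau>)" for q r \<theta> \<tau>]
  show "torus_periodic H" by (simp add: torus_periodic_def lattice_prod lattice_vec)
qed

lemma diophantine_join_vec:
  assumes "diophantine (join_vec \<omega> \<nu>)" shows "diophantine_vector (\<omega> :: real^'d, \<nu> :: real^'e)"
proof -
  obtain C t where C: "C > 0" and dio: "\<And>q::int^('d+'e). q \<noteq> 0 \<Longrightarrow>
        \<bar>\<Sum>i\<in>UNIV. join_vec \<omega> \<nu> $ i * of_int (q $ i)\<bar> \<ge> C * (\<Sum>i\<in>UNIV. \<bar>of_int (q $ i)\<bar>) powr (- t)"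
    using assms unfolding diophantine_def by blast
  have "C * freq_norm \<kappa> powr (- t) \<le> \<bar>phase \<kappa> (\<omega>, \<nu>)\<bar>" if ex: "\<exists>b\<in>Basis. \<kappa> b \<noteq> 0" for \<kappa> :: "(real^'d) \<times> (real^'e) \<Rightarrow> int"
  proof -
    define q :: "int^('d+'e)" where "q = (\<chi> i. case i of Inl j \<Rightarrow> \<kappa> (axis j 1, 0) | Inr j \<Rightarrow> \<kappa> (0, axis j 1))"
    have S: "(\<Sum>i\<in>(UNIV :: ('d + 'e) set). f i) = (\<Sum>i\<in>UNIV. f (Inl i)) + (\<Sum>i\<in>UNIV. f (Inr i))" for f :: "_ \<Rightarrow> real"
      unfolding UNIV_Plus_UNIV[symmetric] by (subst sum.Plus) (auto simp: o_def)
    have fn: "(\<Sum>i\<in>UNIV. \<bar>of_int (q $ i)\<bar>) = freq_norm \<kappa>"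
      unfolding S by (simp add: q_def freq_norm_def sum_Basis_prod sum_Basis_vec)
    have ph: "(\<Sum>i\<in>UNIV. join_vec \<omega> \<nu> $ i * of_int (q $ i)) = phase \<kappa> (\<omega>, \<nu>)"
      unfolding S by (simp add: q_def phase_def sum_Basis_prod sum_Basis_vec join_vec_def inner_axis mult.commute)
    have "q \<noteq> 0"
    proof
      assume q: "q = 0"
      have "freq_norm \<kappa> = 0" unfolding fn[symmetric] q by simp
      moreover have "1 \<le> freq_norm \<kappa>" using ex freq_norm_ge_1 by blast
      ultimately show False by simp
    qed
    from dio[OF this] show ?thesis by (simp only: fn ph)
  qed
  then show ?thesis unfolding diophantine_vector_def using C by blast
qed

lemma nonresonant_snd:
  assumes "nonresonant (\<omega> :: 'a::euclidean_space, \<nu> :: 'b::euclidean_space)" shows "nonresonant \<nu>"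
  unfolding nonresonant_def
proof (intro allI impI)
  fix \<kappa> :: "'b \<Rightarrow> int" assume ex: "\<exists>b\<in>Basis. \<kappa> b \<noteq> 0"
  define \<kappa>' :: "'a \<times> 'b \<Rightarrow> int" where "\<kappa>' z = (if fst z = 0 then \<kappa> (snd z) else 0)" for z
  obtain b where b: "b \<in> Basis" "\<kappa> b \<noteq> 0" using ex by blast
  have "\<exists>z\<in>Basis. \<kappa>' z \<noteq> 0" using b by (intro bexI[of _ "(0, b)"]) (auto simp: \<kappa>'_def Basis_prod_def)
  then have "phase \<kappa>' (\<omega>, \<nu>) \<noteq> 0" using assms unfolding nonresonant_def by (elim allE impE)
  moreover have "phase \<kappa>' (\<omega>, \<nu>) = phase \<kappa> \<nu>"
  proof -
    have "(\<Sum>b\<in>Basis. of_int (\<kappa>' (b, 0)) * (\<omega> \<bullet> b)) = 0"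
      by (intro sum.neutral) (auto simp: \<kappa>'_def)
    then show ?thesis by (simp add: phase_def sum_Basis_prod) (simp add: \<kappa>'_def)
  qed
  ultimately show "phase \<kappa> \<nu> \<noteq> 0" by simp
qed

text \<open>Two hulls agree on the line \<open>{\<theta>} \<times> \<real> \<nu>\<close>, which is dense in the torus \<open>{\<theta>} \<times> \<T>\<^sup>d\<^sup>'\<close>.\<close>

lemma analytic_hull_unique:
  fixes H1 H2 :: "real^'d \<Rightarrow> real^'e \<Rightarrow> 'b::euclidean_space"
  assumes nu: "nonresonant \<nu>" and H: "analytic_hull \<nu> h H1" "analytic_hull \<nu> h H2"
  shows "H1 = H2"
proof (intro ext)
  fix \<theta> \<tau>
  have cont: "continuous_on UNIV (\<lambda>\<tau>. H \<theta> \<tau>)" if "analytic_hull \<nu> h H" for H :: "real^'d \<Rightarrow> real^'e \<Rightarrow> 'b"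
  proof -
    have "real_analytic_on (\<lambda>(\<theta>, \<tau>). H \<theta> \<tau>) UNIV" using that by (simp add: analytic_hull_def)
    from continuous_on_compose2[OF real_analytic_on_continuous_on[OF this], of UNIV "\<lambda>\<tau>. (\<theta>, \<tau>)"]
    show ?thesis by (simp add: continuous_on_Pair continuous_on_const continuous_on_id)
  qed
  have per: "H \<theta> (\<tau> + q) = H \<theta> \<tau>" if "analytic_hull \<nu> h H" "q \<in> lattice" for H :: "real^'d \<Rightarrow> real^'e \<Rightarrow> 'b" and \<tau> q
  proof -
    have "lattice_periodic (\<lambda>x. H (fst x) (snd x))"
      using that by (simp add: analytic_hull_def torus_periodic_iff)
    moreover have "(0, q) \<in> lattice" using that(2) by (simp add: lattice_prod) (simp add: lattice_def)
    ultimately show ?thesis using lattice_periodicD[of "\<lambda>x. H (fst x) (snd x)" "(0, q)" "(\<theta>, \<tau>)"] by simp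
  qed
  have "H1 \<theta> \<tau> - H2 \<theta> \<tau> = 0"
  proof (rule periodic_zero_on_line_imp_zero[OF nu, of "\<lambda>\<tau>. H1 \<theta> \<tau> - H2 \<theta> \<tau>"])
    show "continuous_on UNIV (\<lambda>\<tau>. H1 \<theta> \<tau> - H2 \<theta> \<tau>)" by (intro continuous_on_diff cont H)
    show "lattice_periodic (\<lambda>\<tau>. H1 \<theta> \<tau> - H2 \<theta> \<tau>)" using per[OF H(1)] per[OF H(2)] by (simp add: lattice_periodic_def)
    show "H1 \<theta> (t *\<^sub>R \<nu>) - H2 \<theta> (t *\<^sub>R \<nu>) = 0" for t
    proof -
      have "h \<theta> t = H1 \<theta> (t *\<^sub>R \<nu>)" "h \<theta> t = H2 \<theta> (t *\<^sub>R \<nu>)" using H by (simp_all add: analytic_hull_def)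
      then show ?thesis by simp
    qed
  qed
  then show "H1 \<theta> \<tau> = H2 \<theta> \<tau>" by simp
qed

lemma average_eq:
  fixes H :: "real^'d \<Rightarrow> real^'e \<Rightarrow> 'b::euclidean_space"
  assumes "nonresonant \<nu>" "analytic_hull \<nu> h H"
  shows "average \<nu> h = integral (cbox 0 One) (\<lambda>x. H (fst x) (snd x))"
proof -
  have "(THE H. analytic_hull \<nu> h H) = H"
    using assms analytic_hull_unique[OF assms(1)] by (intro the_equality) auto
  then show ?thesis by (simp add: average_def case_prod_unfold)
qed

lemma periodic_analytic_hull:
  fixes G :: "((real^'d) \<times> (real^'e)) \<times> 'p::euclidean_space \<Rightarrow> 'b::euclidean_space"
  assumes G: "periodic_analytic S G" and l: "l \<in> S" and h: "\<And>\<theta> t. h \<theta> t = G ((\<theta>, t *\<^sub>R \<nu>), l)"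
  shows "analytic_hull \<nu> h (\<lambda>\<theta> \<tau>. G ((\<theta>, \<tau>), l))"
proof -
  have "real_analytic_on G (UNIV \<times> {l})"
    by (rule real_analytic_on_subset[OF periodic_analyticD(1)[OF G]]) (use l in auto)
  from real_analytic_on_slice[OF this] have "real_analytic_on (\<lambda>(\<theta>, \<tau>). G ((\<theta>, \<tau>), l)) UNIV"
    by (simp add: case_prod_unfold)
  moreover have "torus_periodic (\<lambda>\<theta> \<tau>. G ((\<theta>, \<tau>), l))"
    unfolding torus_periodic_iff using periodic_analyticD(2)[OF G] by simp
  ultimately show ?thesis using h by (simp add: analytic_hull_def)
qed

lemma average_eq_mean:
  fixes G :: "((real^'d) \<times> (real^'e)) \<times> 'p::euclidean_space \<Rightarrow> 'b::euclidean_space"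
  assumes "nonresonant \<nu>" "periodic_analytic S G" "l \<in> S" "\<And>\<theta> t. h \<theta> t = G ((\<theta>, t *\<^sub>R \<nu>), l)"
  shows "average \<nu> h = mean G l"
  using average_eq[OF assms(1) periodic_analytic_hull[OF assms(2-4)]] mean_eq_integral[OF assms(2,3)] by simp

text \<open>The angles and the hull variables are paired, so that they form a single torus.\<close>

lemma quasiperiodic_on_iff:
  fixes h :: "real^'d \<Rightarrow> real \<Rightarrow> 'p::euclidean_space \<Rightarrow> 'b::euclidean_space" and \<nu> :: "real^'e"
  shows "quasiperiodic_on \<nu> S h \<longleftrightarrow>
    (\<exists>G. periodic_analytic S G \<and> (\<forall>p\<in>S. \<forall>\<theta> t. h \<theta> t p = G ((\<theta>, t *\<^sub>R \<nu>), p)))"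
proof
  assume "quasiperiodic_on \<nu> S h"
  then obtain H where H: "\<And>p. torus_periodic (\<lambda>\<theta> \<tau>. H \<theta> \<tau> p)" "\<forall>p\<in>S. \<forall>\<theta> t. h \<theta> t p = H \<theta> (t *\<^sub>R \<nu>) p"
    "real_analytic_on (\<lambda>(\<theta>, \<tau>, p). H \<theta> \<tau> p) (UNIV \<times> UNIV \<times> S)"
    unfolding quasiperiodic_on_def by blast
  have "real_analytic_on (\<lambda>z. (\<lambda>(\<theta>, \<tau>, p). H \<theta> \<tau> p) (fst (fst z), snd (fst z), snd z)) (UNIV \<times> S)"
    by (rule real_analytic_on_compose[OF H(3)], intro real_analytic_intros) auto
  then have "periodic_analytic S (\<lambda>z. H (fst (fst z)) (snd (fst z)) (snd z))"
    using H(1) by (simp add: periodic_analytic_def torus_periodic_iff)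
  then show "\<exists>G. periodic_analytic S G \<and> (\<forall>p\<in>S. \<forall>\<theta> t. h \<theta> t p = G ((\<theta>, t *\<^sub>R \<nu>), p))"
    using H(2) by (intro exI[of _ "\<lambda>z. H (fst (fst z)) (snd (fst z)) (snd z)"]) simp
next
  assume "\<exists>G. periodic_analytic S G \<and> (\<forall>p\<in>S. \<forall>\<theta> t. h \<theta> t p = G ((\<theta>, t *\<^sub>R \<nu>), p))"
  then obtain G where G: "periodic_analytic S G" "\<forall>p\<in>S. \<forall>\<theta> t. h \<theta> t p = G ((\<theta>, t *\<^sub>R \<nu>), p)" by blast
  have "real_analytic_on (\<lambda>z. G ((fst z, fst (snd z)), snd (snd z))) (UNIV \<times> UNIV \<times> S)"
    by (rule real_analytic_on_compose[OF periodic_analyticD(1)[OF G(1)]], intro real_analytic_intros) auto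
  then have "real_analytic_on (\<lambda>(\<theta>, \<tau>, p). G ((\<theta>, \<tau>), p)) (UNIV \<times> UNIV \<times> S)" by (simp add: case_prod_unfold)
  moreover have "torus_periodic (\<lambda>\<theta> \<tau>. G ((\<theta>, \<tau>), p))" for p
    unfolding torus_periodic_iff using periodic_analyticD(2)[OF G(1)] by simp
  ultimately show "quasiperiodic_on \<nu> S h" unfolding quasiperiodic_on_def
    using G(2) by (intro exI[of _ "\<lambda>\<theta> \<tau> p. G ((\<theta>, \<tau>), p)"]) simp
qed

text \<open>The derivative along the vector field plus the time derivative is the derivative of the hull along one
curve, by the chain rule.\<close>

lemma frechet_plus_time_derivative:
  fixes F :: "'u::euclidean_space \<times> ('a::euclidean_space \<times> 'e::euclidean_space) \<Rightarrow> 'b::euclidean_space"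
  assumes "F differentiable (at (u, (\<theta>, t *\<^sub>R \<nu>)))"
    and D: "((\<lambda>s. F (u + s *\<^sub>R h, (\<theta> + s *\<^sub>R \<omega>, t *\<^sub>R \<nu> + s *\<^sub>R \<nu>))) has_vector_derivative D) (at 0)"
  shows "frechet_derivative (\<lambda>(u, \<theta>). F (u, (\<theta>, t *\<^sub>R \<nu>))) (at (u, \<theta>)) (h, \<omega>)
    + vector_derivative (\<lambda>t. F (u, (\<theta>, t *\<^sub>R \<nu>))) (at t) = D"
proof -
  obtain F' where F': "(F has_derivative F') (at (u, (\<theta>, t *\<^sub>R \<nu>)))" using assms(1) by (auto simp: differentiable_def)
  then interpret bounded_linear F' by (rule has_derivative_bounded_linear)
  have "((\<lambda>z. F (fst z, (snd z, t *\<^sub>R \<nu>))) has_derivative (\<lambda>z. F' (fst z, (snd z, 0)))) (at (u, \<theta>))"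
    by (rule has_derivative_compose[where f = "\<lambda>z. (fst z, (snd z, t *\<^sub>R \<nu>))" and g = F and g' = F'])
       (use F' in \<open>auto intro!: derivative_eq_intros\<close>)
  then have "frechet_derivative (\<lambda>(u, \<theta>). F (u, (\<theta>, t *\<^sub>R \<nu>))) (at (u, \<theta>)) = (\<lambda>z. F' (fst z, (snd z, 0)))"
    by (intro frechet_derivative_at[symmetric]) (simp add: case_prod_unfold)
  moreover have "((\<lambda>t. F (u, (\<theta>, t *\<^sub>R \<nu>))) has_vector_derivative F' (0, (0, \<nu>))) (at t)"
  proof -
    have "((\<lambda>t. F (u, (\<theta>, t *\<^sub>R \<nu>))) has_derivative (\<lambda>s. F' (0, (0, s *\<^sub>R \<nu>)))) (at t)"
      by (rule has_derivative_compose[where f = "\<lambda>t. (u, (\<theta>, t *\<^sub>R \<nu>))" and g = F, OF _ F'])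
         (auto intro!: derivative_eq_intros)
    moreover have "F' (0, (0, s *\<^sub>R \<nu>)) = s *\<^sub>R F' (0, (0, \<nu>))" for s
      using scaleR[of s "(0, (0, \<nu>))"] by simp
    ultimately show ?thesis by (simp add: has_vector_derivative_def)
  qed
  then have "vector_derivative (\<lambda>t. F (u, (\<theta>, t *\<^sub>R \<nu>))) (at t) = F' (0, (0, \<nu>))" by (rule vector_derivative_at)
  moreover have "((\<lambda>s. F (u + s *\<^sub>R h, (\<theta> + s *\<^sub>R \<omega>, t *\<^sub>R \<nu> + s *\<^sub>R \<nu>))) has_vector_derivative F' (h, (\<omega>, \<nu>))) (at 0)"
  proof -
    have "((\<lambda>s. F (u + s *\<^sub>R h, (\<theta> + s *\<^sub>R \<omega>, t *\<^sub>R \<nu> + s *\<^sub>R \<nu>))) has_derivative (\<lambda>s. F' (s *\<^sub>R h, (s *\<^sub>R \<omega>, s *\<^sub>R \<nu>)))) (at 0)"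
      by (rule has_derivative_compose[where f = "\<lambda>s. (u + s *\<^sub>R h, (\<theta> + s *\<^sub>R \<omega>, t *\<^sub>R \<nu> + s *\<^sub>R \<nu>))" and g = F and g' = F'])
         (use F' in \<open>auto intro!: derivative_eq_intros\<close>)
    moreover have "F' (s *\<^sub>R h, (s *\<^sub>R \<omega>, s *\<^sub>R \<nu>)) = s *\<^sub>R F' (h, (\<omega>, \<nu>))" for s
      using scaleR[of s "(h, (\<omega>, \<nu>))"] by simp
    ultimately show ?thesis by (simp add: has_vector_derivative_def)
  qed
  then have "D = F' (h, (\<omega>, \<nu>))" using D by (rule vector_derivative_unique_at[rotated])
  moreover have "F' (h, (\<omega>, 0)) + F' (0, (0, \<nu>)) = F' (h, (\<omega>, \<nu>))"
    using add[of "(h, (\<omega>, 0))" "(0, (0, \<nu>))"] by simp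
  ultimately show ?thesis by simp
qed

lemma frechet_plus_time_derivative_torus:
  fixes F :: "'a::euclidean_space \<times> 'e::euclidean_space \<Rightarrow> 'b::euclidean_space"
  assumes F: "F differentiable (at (\<theta>, t *\<^sub>R \<nu>))"
  shows "((\<lambda>s. F ((\<theta>, t *\<^sub>R \<nu>) + s *\<^sub>R (\<omega>, \<nu>))) has_vector_derivative
     (frechet_derivative (\<lambda>\<theta>. F (\<theta>, t *\<^sub>R \<nu>)) (at \<theta>) \<omega> + vector_derivative (\<lambda>t. F (\<theta>, t *\<^sub>R \<nu>)) (at t))) (at 0)"
proof -
  obtain F' where F': "(F has_derivative F') (at (\<theta>, t *\<^sub>R \<nu>))" using F by (auto simp: differentiable_def)
  then interpret bounded_linear F' by (rule has_derivative_bounded_linear)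
  have "((\<lambda>\<theta>. F (\<theta>, t *\<^sub>R \<nu>)) has_derivative (\<lambda>h. F' (h, 0))) (at \<theta>)"
    by (rule has_derivative_compose[where f = "\<lambda>\<theta>. (\<theta>, t *\<^sub>R \<nu>)" and g = F, OF _ F']) (auto intro!: derivative_eq_intros)
  then have 1: "frechet_derivative (\<lambda>\<theta>. F (\<theta>, t *\<^sub>R \<nu>)) (at \<theta>) = (\<lambda>h. F' (h, 0))"
    by (rule frechet_derivative_at[symmetric])
  have "((\<lambda>t. F (\<theta>, t *\<^sub>R \<nu>)) has_derivative (\<lambda>s. F' (0, s *\<^sub>R \<nu>))) (at t)"
    by (rule has_derivative_compose[where f = "\<lambda>t. (\<theta>, t *\<^sub>R \<nu>)" and g = F, OF _ F']) (auto intro!: derivative_eq_intros)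
  moreover have "F' (0, s *\<^sub>R \<nu>) = s *\<^sub>R F' (0, \<nu>)" for s using scaleR[of s "(0, \<nu>)"] by simp
  ultimately have 2: "vector_derivative (\<lambda>t. F (\<theta>, t *\<^sub>R \<nu>)) (at t) = F' (0, \<nu>)"
    by (intro vector_derivative_at) (simp add: has_vector_derivative_def)
  have "((\<lambda>s. F ((\<theta>, t *\<^sub>R \<nu>) + s *\<^sub>R (\<omega>, \<nu>))) has_derivative (\<lambda>s. F' (s *\<^sub>R (\<omega>, \<nu>)))) (at 0)"
    by (rule has_derivative_compose[where f = "\<lambda>s. (\<theta>, t *\<^sub>R \<nu>) + s *\<^sub>R (\<omega>, \<nu>)" and g = F and g' = F'])
       (use F' in \<open>auto intro!: derivative_eq_intros simp: zero_prod_def[symmetric]\<close>)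
  then have "((\<lambda>s. F ((\<theta>, t *\<^sub>R \<nu>) + s *\<^sub>R (\<omega>, \<nu>))) has_vector_derivative F' (\<omega>, \<nu>)) (at 0)"
    by (simp only: has_vector_derivative_def scaleR)
  moreover have "F' (\<omega>, 0) + F' (0, \<nu>) = F' (\<omega>, \<nu>)" using add[of "(\<omega>, 0)" "(0, \<nu>)"] by simp
  ultimately show ?thesis unfolding 1 2 by simp
qed

lemma has_vector_derivative_shift_zero:
  assumes "((\<lambda>s. f (t + s)) has_vector_derivative D) (at 0)"
  shows "(f has_vector_derivative D) (at t)"
proof -
  have "((\<lambda>s. f (t + s)) has_derivative (\<lambda>s. s *\<^sub>R D)) (at (t - t))" using assms by (simp add: has_vector_derivative_def)
  then have "((\<lambda>s. f (t + (s - t))) has_derivative (\<lambda>s. s *\<^sub>R D)) (at t)"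
    by (intro has_derivative_compose[where f = "\<lambda>s. s - t" and g = "\<lambda>s. f (t + s)" and g' = "\<lambda>s. s *\<^sub>R D" and f' = "\<lambda>s. s"])
       (auto intro!: derivative_eq_intros)
  then show ?thesis by (simp add: has_vector_derivative_def)
qed

text \<open>Uniqueness: the difference of two solutions is constant along the line in the direction \<open>(\<omega>, \<nu>)\<close>, hence
constant on the torus by density, and zero by the normalization of the average.\<close>

lemma SD_eq:
  fixes \<phi> w :: "((real^'d) \<times> (real^'e)) \<times> 'p::euclidean_space \<Rightarrow> 'b::euclidean_space"
  assumes v: "nonresonant (\<omega>, \<nu>)" and osc: "osc_primitive (\<omega>, \<nu>) S \<phi> w" and l: "l \<in> S"
    and h: "\<And>\<theta> t. h \<theta> t = w ((\<theta>, t *\<^sub>R \<nu>), l)"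
  shows "SD \<omega> \<nu> h \<theta> t = \<phi> ((\<theta>, t *\<^sub>R \<nu>), l)"
proof -
  have nu: "nonresonant \<nu>" by (rule nonresonant_snd[OF v])
  have pa: "periodic_analytic S \<phi>" and i0: "integral (cbox 0 One) (\<lambda>x. \<phi> (x, l)) = 0"
    and der: "\<And>x. ((\<lambda>t. \<phi> (x + t *\<^sub>R (\<omega>, \<nu>), l)) has_vector_derivative w (x, l)) (at 0)"
    using osc l by (simp_all add: osc_primitive_def del: split_paired_All)
  let ?f = "\<lambda>\<theta> t. \<phi> ((\<theta>, t *\<^sub>R \<nu>), l)"
  have hull: "analytic_hull \<nu> ?f (\<lambda>\<theta> \<tau>. \<phi> ((\<theta>, \<tau>), l))" by (rule periodic_analytic_hull[OF pa l]) simp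
  have dif: "(\<lambda>x. \<phi> (x, l)) differentiable (at x)" for x
  proof -
    have "real_analytic_on \<phi> (UNIV \<times> {l})"
      by (rule real_analytic_on_subset[OF periodic_analyticD(1)[OF pa]]) (use l in auto)
    from real_analytic_on_differentiable[OF real_analytic_on_slice[OF this]] show ?thesis by simp
  qed
  have "SD \<omega> \<nu> h = ?f"
    unfolding SD_def
  proof (rule the_equality)
    have "average \<nu> ?f = 0" using average_eq[OF nu hull] i0 by simp
    moreover have "frechet_derivative (\<lambda>\<theta>. ?f \<theta> t) (at \<theta>) \<omega> + vector_derivative (\<lambda>t. ?f \<theta> t) (at t) = h \<theta> t" for \<theta> t
      using vector_derivative_unique_at[OF frechet_plus_time_derivative_torus[OF dif, of \<theta> t \<nu> \<omega>] der[of "(\<theta>, t *\<^sub>R \<nu>)"]]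
      by (simp add: h)
    ultimately show "(\<exists>H. analytic_hull \<nu> ?f H) \<and> average \<nu> ?f = 0 \<and>
      (\<forall>\<theta> t. frechet_derivative (\<lambda>\<theta>. ?f \<theta> t) (at \<theta>) \<omega> + vector_derivative (\<lambda>t. ?f \<theta> t) (at t) = h \<theta> t)"
      using hull by blast
  next
    fix f assume f: "(\<exists>H. analytic_hull \<nu> f H) \<and> average \<nu> f = 0 \<and>
      (\<forall>\<theta> t. frechet_derivative (\<lambda>\<theta>. f \<theta> t) (at \<theta>) \<omega> + vector_derivative (\<lambda>t. f \<theta> t) (at t) = h \<theta> t)"
    then obtain H where H: "analytic_hull \<nu> f H" by blast
    let ?H = "\<lambda>x. H (fst x) (snd x)"
    have fH: "f \<theta> t = ?H (\<theta>, t *\<^sub>R \<nu>)" for \<theta> t using H by (simp add: analytic_hull_def)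
    have Ha: "real_analytic_on ?H UNIV" using H by (simp add: analytic_hull_def case_prod_unfold)
    have Hd: "?H differentiable (at x)" for x by (rule real_analytic_on_differentiable[OF Ha]) simp
    define g where "g x = ?H x - \<phi> (x, l)" for x
    have gc: "continuous_on UNIV g" unfolding g_def[abs_def]
      by (intro continuous_on_diff real_analytic_on_continuous_on[OF Ha] periodic_analytic_continuous[OF pa l])
    have gp: "lattice_periodic g"
      using H periodic_analyticD(2)[OF pa] by (simp add: g_def lattice_periodic_def analytic_hull_def torus_periodic_iff)
    have "((\<lambda>s. g (s *\<^sub>R (\<omega>, \<nu>))) has_vector_derivative 0) (at s within UNIV)" for s
    proof -
      have "((\<lambda>r. ?H ((s *\<^sub>R \<omega>, s *\<^sub>R \<nu>) + r *\<^sub>R (\<omega>, \<nu>))) has_vector_derivative h (s *\<^sub>R \<omega>) s) (at 0)"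
        using frechet_plus_time_derivative_torus[OF Hd, of "s *\<^sub>R \<omega>" s \<nu> \<omega>] f by (simp add: fH)
      from has_vector_derivative_diff[OF this der[of "(s *\<^sub>R \<omega>, s *\<^sub>R \<nu>)"]]
      have "((\<lambda>r. g ((s *\<^sub>R \<omega>, s *\<^sub>R \<nu>) + r *\<^sub>R (\<omega>, \<nu>))) has_vector_derivative 0) (at 0)"
        by (simp add: g_def h)
      then have "((\<lambda>r. g ((s + r) *\<^sub>R (\<omega>, \<nu>))) has_vector_derivative 0) (at 0)" by (simp add: scaleR_left_distrib)
      then show ?thesis by (rule has_vector_derivative_shift_zero)
    qed
    then obtain c where c: "\<And>s. g (s *\<^sub>R (\<omega>, \<nu>)) = c"
      using has_vector_derivative_zero_constant[of UNIV "\<lambda>s. g (s *\<^sub>R (\<omega>, \<nu>))"] by auto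
    have gconst: "g x = c" for x
    proof -
      have "g x - c = 0"
        by (rule periodic_zero_on_line_imp_zero[OF v, of "\<lambda>x. g x - c"])
           (use gc gp c in \<open>auto intro!: continuous_intros simp: lattice_periodic_def\<close>)
      then show ?thesis by simp
    qed
    have "c = integral (cbox 0 One) g"
    proof -
      have "g = (\<lambda>_. c)" using gconst by auto
      then show ?thesis by simp
    qed
    also have "\<dots> = integral (cbox 0 One) ?H - integral (cbox 0 One) (\<lambda>x. \<phi> (x, l))"
      unfolding g_def[abs_def]
      by (intro integral_diff integrable_continuous periodic_analytic_continuous[OF pa l] continuous_on_subset[OF real_analytic_on_continuous_on[OF Ha]]) auto
    also have "\<dots> = 0" using average_eq[OF nu H] f i0 by simp
    finally have "c = 0" .
    show "f = ?f"
    proof (intro ext)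
      fix \<theta> t
      show "f \<theta> t = ?f \<theta> t" using gconst[of "(\<theta>, t *\<^sub>R \<nu>)"] fH[of \<theta> t] by (simp add: g_def \<open>c = 0\<close>)
    qed
  qed
  then show ?thesis by simp
qed

section \<open>Rescaling of the remainders and differentiation along curves\<close>

text \<open>On the curve \<open>(u\<^sup>2 \<xi>, u ^ (k + 1) \<eta>)\<close> the norm is \<open>O(u\<^sup>2)\<close>, so the two terms of the remainder are
\<open>O(u ^ (k + 1 + 2 (j - 1)))\<close> and \<open>O(u ^ (2 (j + 1)))\<close>; both are \<open>O(u ^ (2 * j + 1))\<close> as \<open>k \<ge> 2\<close>. The
origin is excluded, because the asymptotic bounds say nothing about it.\<close>

lemma remainder_form_weighted_bound:
  fixes G :: "real \<Rightarrow> real \<Rightarrow> 'b::real_normed_vector"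
  assumes G: "remainder_form U j G" and U: "(0, 0) \<in> interior U" and k: "2 \<le> k" and j: "1 \<le> j"
    and nz: "(\<xi>, \<eta>) \<noteq> (0, 0)"
  obtains C \<delta> where "0 < \<delta>" "\<And>u. 0 < u \<Longrightarrow> u < \<delta> \<Longrightarrow> norm (G (u ^ 2 * \<xi>) (u ^ (k + 1) * \<eta>)) \<le> C * u ^ (2 * j + 1)"
proof -
  obtain F1 F2 where F': "\<forall>(x, y)\<in>U. G x y = y *\<^sub>R F1 (x, y) + F2 (x, y)"
    and F1: "(\<lambda>z. norm (F1 z)) \<in> O[at (0, 0)](\<lambda>z. norm z ^ (j - 1))"
    and F2: "(\<lambda>z. norm (F2 z)) \<in> O[at (0, 0)](\<lambda>z. norm z ^ (j + 1))"
    using G unfolding remainder_form_def by blast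
  have F: "G x y = y *\<^sub>R F1 (x, y) + F2 (x, y)" if "(x, y) \<in> U" for x y
    using bspec[OF F' that] by simp
  obtain c1 where c1: "c1 > 0" "\<forall>\<^sub>F z in at (0, 0). norm (norm (F1 z)) \<le> c1 * norm (norm z ^ (j - 1))"
    using landau_o.bigE[OF F1] by blast
  obtain c2 where c2: "c2 > 0" "\<forall>\<^sub>F z in at (0, 0). norm (norm (F2 z)) \<le> c2 * norm (norm z ^ (j + 1))"
    using landau_o.bigE[OF F2] by blast
  obtain d1 where d1: "d1 > 0" "\<And>z. z \<noteq> (0, 0) \<Longrightarrow> dist z (0, 0) < d1 \<Longrightarrow> norm (F1 z) \<le> c1 * norm z ^ (j - 1)"
    using c1(2) unfolding eventually_at by auto
  obtain d2 where d2: "d2 > 0" "\<And>z. z \<noteq> (0, 0) \<Longrightarrow> dist z (0, 0) < d2 \<Longrightarrow> norm (F2 z) \<le> c2 * norm z ^ (j + 1)"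
    using c2(2) unfolding eventually_at by auto
  obtain d3 where d3: "d3 > 0" "ball (0, 0) d3 \<subseteq> U" using U by (meson mem_interior)
  define K where "K = \<bar>\<xi>\<bar> + \<bar>\<eta>\<bar>"
  have K0: "0 \<le> K" by (simp add: K_def)
  define d where "d = min d1 (min d2 d3)"
  have d: "0 < d" using d1 d2 d3 by (simp add: d_def)
  define \<delta> where "\<delta> = min 1 (d / (K + 1))"
  have \<delta>: "0 < \<delta>" "\<delta> \<le> 1" using d K0 by (auto simp: \<delta>_def)
  show ?thesis
  proof (rule that[OF \<delta>(1), of "\<bar>\<eta>\<bar> * c1 * K ^ (j - 1) + c2 * K ^ (j + 1)"])
    fix u assume u: "0 < u" "u < \<delta>"
    then have u1: "u \<le> 1" using \<delta> by simp
    let ?z = "(u ^ 2 * \<xi>, u ^ (k + 1) * \<eta>)"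
    have zn: "?z \<noteq> (0, 0)" using nz u by auto
    have "u ^ (k + 1) \<le> u ^ 2" using k u u1 by (intro power_decreasing) auto
    then have "norm ?z \<le> u ^ 2 * \<bar>\<xi>\<bar> + u ^ 2 * \<bar>\<eta>\<bar>"
      using u by (intro order_trans[OF norm_Pair_le]) (auto simp: abs_mult intro!: add_mono mult_right_mono)
    then have zK: "norm ?z \<le> u ^ 2 * K" by (simp add: K_def ring_distribs)
    also have "\<dots> \<le> u * K" using u u1 K0 by (intro mult_right_mono) (auto simp: power2_eq_square)
    also have "\<dots> \<le> u * (K + 1)" using u by simp
    also have "\<dots> < d"
    proof -
      have "u < d / (K + 1)" using u(2) by (simp add: \<delta>_def)
      then show ?thesis using K0 by (simp add: field_simps)
    qed
    finally have "dist ?z (0, 0) < d" by (simp add: dist_norm flip: zero_prod_def)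
    then have z: "dist ?z (0, 0) < d1" "dist ?z (0, 0) < d2" "?z \<in> U"
      using d3(2) by (auto simp: d_def dist_commute)
    have b1: "norm (F1 ?z) \<le> c1 * (u ^ 2 * K) ^ (j - 1)"
      using d1(2)[OF zn z(1)] c1(1) zK by (elim order_trans) (intro mult_left_mono power_mono, auto)
    have b2: "norm (F2 ?z) \<le> c2 * (u ^ 2 * K) ^ (j + 1)"
      using d2(2)[OF zn z(2)] c2(1) zK by (elim order_trans) (intro mult_left_mono power_mono, auto)
    have e1: "u ^ (k + 1) * (u ^ 2) ^ (j - 1) \<le> u ^ (2 * j + 1)"
    proof -
      have "u ^ (k + 1) * (u ^ 2) ^ (j - 1) = u ^ (k + 1 + 2 * (j - 1))" by (simp flip: power_mult add: power_add)
      also have "\<dots> \<le> u ^ (2 * j + 1)" using k j u u1 by (intro power_decreasing) auto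
      finally show ?thesis .
    qed
    have e2: "(u ^ 2) ^ (j + 1) \<le> u ^ (2 * j + 1)"
      unfolding power_mult[symmetric] using u u1 by (intro power_decreasing) auto
    have "norm (G (u ^ 2 * \<xi>) (u ^ (k + 1) * \<eta>)) \<le> norm ((u ^ (k + 1) * \<eta>) *\<^sub>R F1 ?z) + norm (F2 ?z)"
      unfolding F[OF z(3)] by (rule norm_triangle_ineq)
    also have "norm ((u ^ (k + 1) * \<eta>) *\<^sub>R F1 ?z) = u ^ (k + 1) * \<bar>\<eta>\<bar> * norm (F1 ?z)"
      using u by (simp add: abs_mult)
    also have "\<dots> \<le> u ^ (k + 1) * \<bar>\<eta>\<bar> * (c1 * (u ^ 2 * K) ^ (j - 1))"
      using b1 u by (intro mult_left_mono) auto
    also have "\<dots> = (\<bar>\<eta>\<bar> * c1 * K ^ (j - 1)) * (u ^ (k + 1) * (u ^ 2) ^ (j - 1))" by (simp add: power_mult_distrib mult_ac)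
    also have "\<dots> \<le> (\<bar>\<eta>\<bar> * c1 * K ^ (j - 1)) * u ^ (2 * j + 1)"
      using c1(1) K0 e1 by (intro mult_left_mono) auto
    finally have "norm (G (u ^ 2 * \<xi>) (u ^ (k + 1) * \<eta>)) \<le> (\<bar>\<eta>\<bar> * c1 * K ^ (j - 1)) * u ^ (2 * j + 1) + norm (F2 ?z)" by simp
    also have "norm (F2 ?z) \<le> (c2 * K ^ (j + 1)) * (u ^ 2) ^ (j + 1)"
      using b2 by (simp add: power_mult_distrib mult_ac)
    also have "\<dots> \<le> (c2 * K ^ (j + 1)) * u ^ (2 * j + 1)"
      using c2(1) K0 e2 by (intro mult_left_mono) auto
    finally show "norm (G (u ^ 2 * \<xi>) (u ^ (k + 1) * \<eta>)) \<le> (\<bar>\<eta>\<bar> * c1 * K ^ (j - 1) + c2 * K ^ (j + 1)) * u ^ (2 * j + 1)"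
      by (simp add: ring_distribs)
  qed
qed

lemma difference_quotient_iter_cong:
  assumes "\<And>s. f (s, z') = f (s, z)"
  shows "(difference_quotient ^^ n) f (s, z') = (difference_quotient ^^ n) f (s, z)"
proof (induction n arbitrary: s)
  case (Suc n)
  then show ?case using difference_quotient_cong[of "(difference_quotient ^^ n) f" z' z s] by simp
qed (simp add: assms)

lemma continuous_zero_at_zero:
  fixes f :: "real \<Rightarrow> 'b::real_normed_vector"
  assumes "continuous_on UNIV f" "\<And>s. s \<noteq> 0 \<Longrightarrow> f s = 0" shows "f 0 = 0"
proof -
  have "(f \<longlongrightarrow> f 0) (at 0)" using assms(1) by (simp add: continuous_on_def)
  moreover have "(f \<longlongrightarrow> 0) (at 0)"
    by (rule tendsto_eventually) (auto simp: eventually_at_filter assms(2))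
  ultimately show ?thesis by (rule LIM_unique)
qed

text \<open>The bounds on the remainder hold for each \<open>\<theta>\<close>, \<open>t\<close> and parameter separately, with constants that may
depend on them, and only for points of the hull of the form \<open>(\<theta>, t *\<^sub>R \<nu>)\<close>. They still force the Taylor
coefficients in \<open>u\<close> below \<open>2 * j + 1\<close> to vanish at these points; by density of the line and by continuity the
coefficients vanish everywhere, and the iterated difference quotient is the sought factor.\<close>

lemma weighted_remainder:
  fixes G :: "('a::euclidean_space \<times> 'e::euclidean_space) \<times> ((real \<times> real) \<times> 'p::euclidean_space) \<Rightarrow> 'b::euclidean_space"
  assumes G: "periodic_analytic (U \<times> S) G" and U: "(0, 0) \<in> interior U" and k: "2 \<le> k" and j: "1 \<le> j"
    and nu: "nonresonant \<nu>"
    and rem: "\<And>\<theta> t l. l \<in> S \<Longrightarrow> remainder_form U j (\<lambda>x y. G ((\<theta>, t *\<^sub>R \<nu>), ((x, y), l)))"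
  obtains F where "real_analytic_on F ({0} \<times> (UNIV \<times> (UNIV \<times> S)))"
    "\<And>u q l. lattice_periodic (\<lambda>x. F (u, (q, (x, l))))"
    "\<And>u \<xi> \<eta> x l. l \<in> S \<Longrightarrow> G (x, ((u ^ 2 * \<xi>, u ^ (k + 1) * \<eta>), l)) = u ^ (2 * j + 1) *\<^sub>R F (u, ((\<xi>, \<eta>), (x, l)))"
proof -
  let ?D = "{0} \<times> (UNIV \<times> (UNIV \<times> S)) :: (real \<times> ((real \<times> real) \<times> (('a \<times> 'e) \<times> 'p))) set"
  define f where "f w = G (fst (snd (snd w)), ((fst w ^ 2 * fst (fst (snd w)), fst w ^ (k + 1) * snd (fst (snd w))), snd (snd (snd w))))"
    for w :: "real \<times> ((real \<times> real) \<times> (('a \<times> 'e) \<times> 'p))"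
  have U0: "(0, 0) \<in> U" using U interior_subset by blast
  have fa: "real_analytic_on f ?D" unfolding f_def[abs_def]
    by (rule real_analytic_on_compose[OF periodic_analyticD(1)[OF G]], intro real_analytic_intros)
       (auto simp: U0)
  have fper: "f (s, (q, (x + y, l))) = f (s, (q, (x, l)))" if "y \<in> lattice" for s q x y l
    using lattice_periodicD[OF periodic_analyticD(2)[OF G] that] by (simp add: f_def)
  let ?q = "\<lambda>i. (difference_quotient ^^ i) f"
  have qa: "real_analytic_on (?q i) ?D" for i by (rule real_analytic_on_difference_quotient_iter[OF fa])
  have qper: "lattice_periodic (\<lambda>x. ?q i (s, (q, (x, l))))" for i s q l
    unfolding lattice_periodic_def by (intro allI ballI difference_quotient_iter_cong fper)
  have qc: "continuous_on UNIV (\<lambda>y. ?q i (0, c y))" if "continuous_on UNIV c" "\<And>y. c y \<in> UNIV \<times> (UNIV \<times> S)" for i and c :: "'y::topological_space \<Rightarrow> _"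
  proof (rule continuous_on_compose2[OF real_analytic_on_continuous_on[OF qa]])
    show "continuous_on UNIV (\<lambda>y. (0, c y))" by (intro continuous_intros that)
    show "range (\<lambda>y. (0, c y)) \<subseteq> ?D" using that(2) by blast
  qed
  have z1: "?q i (0, (q, ((\<theta>, t *\<^sub>R \<nu>), l))) = 0" if l: "l \<in> S" and i: "i < 2 * j + 1" and q: "q \<noteq> (0, 0)" for i q \<theta> t l
  proof -
    obtain \<xi> \<eta> where qq: "q = (\<xi>, \<eta>)" by force
    obtain C \<delta> where "0 < \<delta>"
      "\<And>u. 0 < u \<Longrightarrow> u < \<delta> \<Longrightarrow> norm (G ((\<theta>, t *\<^sub>R \<nu>), ((u ^ 2 * \<xi>, u ^ (k + 1) * \<eta>), l))) \<le> C * u ^ (2 * j + 1)"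
      using remainder_form_weighted_bound[OF rem[OF l] U k j, of \<xi> \<eta>] q qq by blast
    then show ?thesis
      by (intro difference_quotient_coefficient_zero[OF fa _ _ _ i]) (auto simp: l qq f_def)
  qed
  \<comment> \<open>from the line to the whole torus, by density\<close>
  have z2: "?q i (0, (q, ((\<theta>, \<tau>), l))) = 0" if l: "l \<in> S" and i: "i < 2 * j + 1" and q: "q \<noteq> (0, 0)" for i q \<theta> \<tau> l
  proof (rule periodic_zero_on_line_imp_zero[OF nu, of "\<lambda>\<tau>. ?q i (0, (q, ((\<theta>, \<tau>), l)))"])
    show "continuous_on UNIV (\<lambda>\<tau>. ?q i (0, (q, ((\<theta>, \<tau>), l))))" by (rule qc) (auto intro!: continuous_intros simp: l)
    show "?q i (0, (q, ((\<theta>, t *\<^sub>R \<nu>), l))) = 0" for t by (rule z1[OF l i q])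
    have "(0 :: 'a, r) \<in> lattice" if "r \<in> lattice" for r :: 'e using that by (simp add: lattice_prod) (simp add: lattice_def)
    from lattice_periodicD[OF qper this, of _ i 0 q "(\<theta>, y)" l for y]
    show "lattice_periodic (\<lambda>\<tau>. ?q i (0, (q, ((\<theta>, \<tau>), l))))" by (simp add: lattice_periodic_def)
  qed
  \<comment> \<open>the excluded point \<open>(0, 0)\<close>, by continuity\<close>
  have z3: "?q i (0, (q, (x, l))) = 0" if l: "l \<in> S" and i: "i < 2 * j + 1" for i q x l
  proof (cases "q = (0, 0)")
    case False
    then show ?thesis using z2[OF l i, of q "fst x" "snd x"] by simp
  next
    case True
    have "?q i (0, ((0, 0), (x, l))) = 0"
    proof (rule continuous_zero_at_zero[of "\<lambda>s. ?q i (0, ((s, 0), (x, l)))"])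
      show "continuous_on UNIV (\<lambda>s. ?q i (0, ((s, 0), (x, l))))" by (rule qc) (auto intro!: continuous_intros simp: l)
      show "?q i (0, ((s, 0), (x, l))) = 0" if "s \<noteq> 0" for s using z2[OF l i, of "(s, 0)" "fst x" "snd x"] that by simp
    qed
    with True show ?thesis by simp
  qed
  show ?thesis
  proof (rule that[of "?q (2 * j + 1)"])
    show "real_analytic_on (?q (2 * j + 1)) ?D" by (rule qa)
    show "lattice_periodic (\<lambda>x. ?q (2 * j + 1) (u, (q, (x, l))))" for u q l by (rule qper)
    fix u \<xi> \<eta> x l assume l: "l \<in> S"
    have "f (u, ((\<xi>, \<eta>), (x, l))) = u ^ (2 * j + 1) *\<^sub>R ?q (2 * j + 1) (u, ((\<xi>, \<eta>), (x, l)))"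
      using difference_quotient_taylor[of f u "((\<xi>, \<eta>), (x, l))" "2 * j + 1"] z3[OF l] by simp
    then show "G (x, ((u ^ 2 * \<xi>, u ^ (k + 1) * \<eta>), l)) = u ^ (2 * j + 1) *\<^sub>R ?q (2 * j + 1) (u, ((\<xi>, \<eta>), (x, l)))"
      by (simp add: f_def)
  qed
qed

text \<open>Uniformity over the angles and over a compact set of parameters comes from the compactness of the torus.\<close>

lemma germ_locally_bounded:
  fixes f :: "real \<times> ('a::euclidean_space \<times> 'p::euclidean_space) \<Rightarrow> 'b::euclidean_space"
  assumes f: "germ S f" and L: "compact L" "L \<subseteq> S"
  obtains C \<delta> where "0 < \<delta>" "\<And>u x l. l \<in> L \<Longrightarrow> \<bar>u\<bar> < \<delta> \<Longrightarrow> norm (f (u, (x, l))) \<le> C"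
proof -
  let ?K = "cbox 0 (One :: 'a) \<times> L"
  have "\<forall>z\<in>?K. \<exists>rM. 0 < fst rM \<and> ps_bound (0, z) (fst rM) f (snd rM)"
  proof
    fix z assume "z \<in> ?K"
    then have "(0, z) \<in> {0} \<times> (UNIV \<times> S)" using L(2) by auto
    then obtain r M where "0 < r" "ps_bound (0, z) r f M" using real_analytic_onE[OF germD(1)[OF f]] by blast
    then show "\<exists>rM. 0 < fst rM \<and> ps_bound (0, z) (fst rM) f (snd rM)" by (intro exI[of _ "(r, M)"]) simp
  qed
  from bchoice[OF this] obtain rM where rM: "\<forall>z\<in>?K. 0 < fst (rM z) \<and> ps_bound (0, z) (fst (rM z)) f (snd (rM z))" ..
  have "compact ?K" by (intro compact_Times compact_cbox L)
  moreover have "\<And>z. z \<in> ?K \<Longrightarrow> open (ball z (fst (rM z)))" by simp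
  moreover have "?K \<subseteq> (\<Union>z\<in>?K. ball z (fst (rM z)))" using rM by force
  ultimately obtain D where D: "D \<subseteq> ?K" "finite D" "?K \<subseteq> (\<Union>z\<in>D. ball z (fst (rM z)))"
    by (rule compactE_image)
  define \<delta> where "\<delta> = Min (insert 1 ((\<lambda>z. fst (rM z)) ` D))"
  define C where "C = Max (insert 0 ((\<lambda>z. snd (rM z)) ` D))"
  have \<delta>: "0 < \<delta>" using D(1,2) rM by (auto simp: \<delta>_def)
  show ?thesis
  proof (rule that[OF \<delta>, of C])
    fix u :: real and x l assume l: "l \<in> L" and u: "\<bar>u\<bar> < \<delta>"
    obtain y where y: "y \<in> cbox 0 One" "f (u, (x, l)) = f (u, (y, l))"
      by (rule lattice_periodic_representative[OF germD(2)[OF f, of u l], of x]) blast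
    obtain z where z: "z \<in> D" "(y, l) \<in> ball z (fst (rM z))" using D(3) y(1) l by blast
    have zK: "z \<in> ?K" using D(1) z(1) by blast
    have "\<delta> \<le> fst (rM z)" "snd (rM z) \<le> C" using D(2) z(1) by (auto simp: \<delta>_def C_def)
    have "(y, l) - z \<in> cube (fst (rM z))"
      using z(2) by (intro norm_imp_cube) (simp add: dist_norm norm_minus_commute)
    then have "(u, (y, l) - z) \<in> cube (fst (rM z))"
      using u \<open>\<delta> \<le> fst (rM z)\<close> by (simp add: cube_def Basis_prod_def[where 'a = real] ball_Un)
    from ps_bound_normE[OF _ _ this, of "(0, z)" f "snd (rM z)"] rM[rule_format, OF zK]
    have "norm (f (u, (y, l))) \<le> snd (rM z)" by simp
    then show "norm (f (u, (x, l))) \<le> C" using y(2) \<open>snd (rM z) \<le> C\<close> by simp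
  qed
qed

text \<open>The derivative of one component of the parameterization along the flow of the vector field on the line
and on the torus, after taking out \<open>u ^ (e + k - 1)\<close>: the bracket is what \<open>defect\<close> subtracts.\<close>

lemma component_curve_derivative:
  fixes s :: "nat \<Rightarrow> 'p::euclidean_space \<Rightarrow> 'b::euclidean_space" and s' w :: "nat \<Rightarrow> 'a::euclidean_space \<times> 'p \<Rightarrow> 'b"
  assumes e: "1 \<le> e" and k: "1 \<le> k" and osc: "\<And>i. osc_primitive v S (s' i) (w i)" and l: "l \<in> S"
    and h: "h = u ^ k * c"
  shows "((\<lambda>r. (u + r * h) ^ e *\<^sub>R trunc (\<lambda>_. 1) k N s s' (u + r * h, (x + r *\<^sub>R v, l))) has_vector_derivative
     u ^ (e + k - 1) *\<^sub>R (c *\<^sub>R trunc (\<lambda>i. real (e + i)) k N s s' (u, (x, l)) + (\<Sum>i<N. u ^ i *\<^sub>R w i (x, l)))) (at 0)"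
proof -
  have pw: "((\<lambda>r. (u + r * h) ^ n) has_real_derivative real n * (c * u ^ (n + k - 1))) (at 0)" if n: "1 \<le> n" for n
  proof -
    have "((\<lambda>r. (u + r * h) ^ n) has_real_derivative real n * h * u ^ (n - 1)) (at 0)"
      by (auto intro!: derivative_eq_intros)
    moreover have "u ^ k * u ^ (n - 1) = u ^ (n + k - 1)" using n by (simp flip: power_add add: add.commute)
    ultimately show ?thesis by (simp add: h mult_ac)
  qed
  have der: "((\<lambda>r. s' i (x + r *\<^sub>R v, l)) has_vector_derivative w i (x, l)) (at 0)" for i
    using osc[of i] l by (simp add: osc_primitive_def)
  have 1: "((\<lambda>r. (u + r * h) ^ (e + i) *\<^sub>R s i l) has_vector_derivative (real (e + i) * (c * u ^ (e + i + k - 1))) *\<^sub>R s i l) (at 0)" for i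
    using e by (intro bounded_linear.has_vector_derivative[OF bounded_linear_scaleR_left])
      (simp only: has_real_derivative_iff_has_vector_derivative[symmetric], intro pw, simp)
  have 2: "((\<lambda>r. (u + r * h) ^ (e + (i + k - 1)) *\<^sub>R s' i (x + r *\<^sub>R v, l)) has_vector_derivative
      u ^ (e + (i + k - 1)) *\<^sub>R w i (x, l) + (real (e + (i + k - 1)) * (c * u ^ (e + (i + k - 1) + k - 1))) *\<^sub>R s' i (x, l)) (at 0)" for i
  proof -
    have "((\<lambda>r. (u + r * h) ^ (e + (i + k - 1))) has_real_derivative real (e + (i + k - 1)) * (c * u ^ (e + (i + k - 1) + k - 1))) (at 0)"
      using e by (intro pw) simp
    from has_vector_derivative_scaleR[OF this der[of i]] show ?thesis by simp
  qed
  let ?A = "\<lambda>r. (\<Sum>i<N. (u + r * h) ^ (e + i) *\<^sub>R s i l) + (\<Sum>i<N. (u + r * h) ^ (e + (i + k - 1)) *\<^sub>R s' i (x + r *\<^sub>R v, l))"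
  have "(?A has_vector_derivative ((\<Sum>i<N. (real (e + i) * (c * u ^ (e + i + k - 1))) *\<^sub>R s i l)
     + (\<Sum>i<N. u ^ (e + (i + k - 1)) *\<^sub>R w i (x, l) + (real (e + (i + k - 1)) * (c * u ^ (e + (i + k - 1) + k - 1))) *\<^sub>R s' i (x, l)))) (at 0)"
    by (intro has_vector_derivative_add has_vector_derivative_sum 1 2)
  moreover have "?A = (\<lambda>r. (u + r * h) ^ e *\<^sub>R trunc (\<lambda>_. 1) k N s s' (u + r * h, (x + r *\<^sub>R v, l)))"
    by (simp add: trunc_def scaleR_right_distrib scaleR_sum_right power_add)
  moreover have "(\<Sum>i<N. (real (e + i) * (c * u ^ (e + i + k - 1))) *\<^sub>R s i l)
     + (\<Sum>i<N. u ^ (e + (i + k - 1)) *\<^sub>R w i (x, l) + (real (e + (i + k - 1)) * (c * u ^ (e + (i + k - 1) + k - 1))) *\<^sub>R s' i (x, l))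
    = u ^ (e + k - 1) *\<^sub>R (c *\<^sub>R trunc (\<lambda>i. real (e + i)) k N s s' (u, (x, l)) + (\<Sum>i<N. u ^ i *\<^sub>R w i (x, l)))"
  proof -
    have p1: "u ^ (e + i + k - 1) = u ^ (e + k - 1) * u ^ i" for i using k by (simp flip: power_add add: add_ac)
    have p2: "u ^ (e + (i + k - 1)) = u ^ (e + k - 1) * u ^ i" for i using k by (simp flip: power_add add: add_ac)
    have p3: "u ^ (e + (i + k - 1) + k - 1) = u ^ (e + k - 1) * u ^ (i + k - 1)" for i using k by (simp flip: power_add add: add_ac)
    show ?thesis unfolding p1 p2 p3 trunc_def
      by (simp add: scaleR_right_distrib scaleR_sum_right sum.distrib mult_ac add_ac)
  qed
  ultimately show ?thesis by simp
qed

lemma trunc_differentiable: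
  fixes s :: "nat \<Rightarrow> 'p::euclidean_space \<Rightarrow> 'b::euclidean_space" and s' :: "nat \<Rightarrow> 'a::euclidean_space \<times> 'p \<Rightarrow> 'b"
  assumes pa: "\<And>i. periodic_analytic S (s' i)" and l: "l \<in> S"
  shows "(\<lambda>z. fst z ^ e *\<^sub>R trunc c k N s s' (fst z, (snd z, l))) differentiable (at (u, x))"
proof -
  have dif: "(\<lambda>z::real \<times> 'a. s' i (snd z, l)) differentiable (at (u, x))" for i
  proof -
    have "real_analytic_on (s' i) (UNIV \<times> {l})"
      by (rule real_analytic_on_subset[OF periodic_analyticD(1)[OF pa]]) (use l in auto)
    from real_analytic_on_differentiable[OF real_analytic_on_slice[OF this]]
    have "(\<lambda>x. s' i (x, l)) differentiable (at (snd (u, x)))" by simp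
    from differentiable_compose[where f = "\<lambda>x. s' i (x, l)" and g = snd and x = "(u, x)" and s = UNIV, OF this]
    show ?thesis by (simp add: bounded_linear_imp_differentiable[OF bounded_linear_snd])
  qed
  have pw: "(\<lambda>z::real \<times> 'a. fst z ^ n) differentiable (at (u, x))" for n
    by (intro differentiable_power bounded_linear_imp_differentiable[OF bounded_linear_fst])
  show ?thesis unfolding trunc_def fst_conv snd_conv
    by (intro differentiable_scaleR differentiable_add differentiable_sum differentiable_mult differentiable_const pw dif finite_lessThan ballI)
qed

lemma sum_shift_range:
  fixes f :: "nat \<Rightarrow> 'b::comm_monoid_add"
  assumes "1 \<le> N" "b = a + N - 1" shows "(\<Sum>i=a..b. f i) = (\<Sum>i<N. f (a + i))"
proof -
  have "{a..b} = {0 + a..<N + a}" using assms by auto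
  then show ?thesis by (simp only: sum.shift_bounds_nat_ivl atLeast0LessThan add.commute)
qed

section \<open>The parameterization in the original variables\<close>

text \<open>The rescaled problem for given coefficient functions of \<open>(\<theta>, t, \<mu>)\<close> and hulls of them. The relation with
\<open>FA\<close> and \<open>FB\<close> is required only for points in \<open>U\<close>, where \<open>A\<close> and \<open>B\<close> are meaningful.\<close>

locale hull_problem = rescaled_problem "(\<omega>, \<nu>)" \<Lambda> k m p C a D FA FB \<sigma>
  for \<omega> :: "real^'d" and \<nu> :: "real^'e" and \<Lambda> :: "(real^'m) set" and k m p :: nat
    and C a :: "((real^'d) \<times> (real^'e)) \<times> (real^'m) \<Rightarrow> real" and D :: "((real^'d) \<times> (real^'e)) \<times> (real^'m) \<Rightarrow> real^'d"
    and FA :: "real \<times> ((real \<times> real) \<times> (((real^'d) \<times> (real^'e)) \<times> (real^'m))) \<Rightarrow> real"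
    and FB :: "real \<times> ((real \<times> real) \<times> (((real^'d) \<times> (real^'e)) \<times> (real^'m))) \<Rightarrow> real^'d" and \<sigma> :: real +
  fixes U :: "(real \<times> real) set"
    and ct aa :: "real^'d \<Rightarrow> real \<Rightarrow> real^'m \<Rightarrow> real" and dt :: "real^'d \<Rightarrow> real \<Rightarrow> real^'m \<Rightarrow> real^'d"
    and At :: "real \<Rightarrow> real \<Rightarrow> real^'d \<Rightarrow> real \<Rightarrow> real^'m \<Rightarrow> real"
    and Bt :: "real \<Rightarrow> real \<Rightarrow> real^'d \<Rightarrow> real \<Rightarrow> real^'m \<Rightarrow> real^'d"
  assumes m_eq: "m + k = 2 * p + 1"
    and ct: "\<And>\<mu> \<theta> t. \<mu> \<in> \<Lambda> \<Longrightarrow> ct \<theta> t \<mu> = C ((\<theta>, t *\<^sub>R \<nu>), \<mu>)"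
    and aa: "\<And>\<mu> \<theta> t. \<mu> \<in> \<Lambda> \<Longrightarrow> aa \<theta> t \<mu> = a ((\<theta>, t *\<^sub>R \<nu>), \<mu>)"
    and dt: "\<And>\<mu> \<theta> t. \<mu> \<in> \<Lambda> \<Longrightarrow> dt \<theta> t \<mu> = D ((\<theta>, t *\<^sub>R \<nu>), \<mu>)"
    and At: "\<And>u \<xi> \<eta> \<mu> \<theta> t. \<mu> \<in> \<Lambda> \<Longrightarrow> (u ^ 2 * \<xi>, u ^ (k + 1) * \<eta>) \<in> U \<Longrightarrow>
      At (u ^ 2 * \<xi>) (u ^ (k + 1) * \<eta>) \<theta> t \<mu> = u ^ (2 * k + 1) * FA (u, ((\<xi>, \<eta>), ((\<theta>, t *\<^sub>R \<nu>), \<mu>)))"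
    and Bt: "\<And>u \<xi> \<eta> \<mu> \<theta> t. \<mu> \<in> \<Lambda> \<Longrightarrow> (u ^ 2 * \<xi>, u ^ (k + 1) * \<eta>) \<in> U \<Longrightarrow>
      Bt (u ^ 2 * \<xi>) (u ^ (k + 1) * \<eta>) \<theta> t \<mu> = u ^ (2 * p + 1) *\<^sub>R FB (u, ((\<xi>, \<eta>), ((\<theta>, t *\<^sub>R \<nu>), \<mu>)))"
begin

text \<open>The index shifts undo the substitution: \<open>K_map\<close> counts powers of \<open>u\<close>, whereas the coefficients of the
rescaled problem start at zero.\<close>

definition K_of where
  "K_of n X X' Y Y' T T' = K_map k p n (\<lambda>i. X (i - 2)) (\<lambda>i \<theta> t \<mu>. X' (i - (k + 1)) ((\<theta>, t *\<^sub>R \<nu>), \<mu>))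
     (\<lambda>i. Y (i - (k + 1))) (\<lambda>i \<theta> t \<mu>. Y' (i - 2 * k) ((\<theta>, t *\<^sub>R \<nu>), \<mu>))
     (\<lambda>i. T (i - m)) (\<lambda>i \<theta> t \<mu>. T' (i - 2 * p) ((\<theta>, t *\<^sub>R \<nu>), \<mu>))"

definition Y_of :: "(real^'m \<Rightarrow> real) \<Rightarrow> nat \<Rightarrow> real^'m \<Rightarrow> real" where
  "Y_of y1 i = (if i = k then y0 else if i = 2 * k - 1 then y1 else (\<lambda>_. 0))"

lemma K_of_eq:
  assumes N: "n = N + 1" "1 \<le> N" and X0: "X 0 = (\<lambda>_. 1)"
  shows "K_of n X X' Y Y' T T' u \<theta> t \<mu> =
    (u ^ 2 * trunc (\<lambda>_. 1) k N X X' (u, ((\<theta>, t *\<^sub>R \<nu>), \<mu>)),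
     u ^ (k + 1) * trunc (\<lambda>_. 1) k N Y Y' (u, ((\<theta>, t *\<^sub>R \<nu>), \<mu>)),
     \<theta> + u ^ m *\<^sub>R trunc (\<lambda>_. 1) k N T T' (u, ((\<theta>, t *\<^sub>R \<nu>), \<mu>)))"
proof -
  let ?z = "((\<theta>, t *\<^sub>R \<nu>), \<mu>)"
  have "(\<Sum>i=3..n. X (i - 2) \<mu> * u ^ i) + u\<^sup>2 = (\<Sum>i=2..n. X (i - 2) \<mu> * u ^ i)"
    using N X0 by (subst sum.atLeast_Suc_atMost[of 2 n]) auto
  also have "\<dots> = (\<Sum>i<N. X (2 + i - 2) \<mu> * u ^ (2 + i))" by (rule sum_shift_range) (use N in auto)
  also have "\<dots> = (\<Sum>i<N. u ^ 2 * (u ^ i * X i \<mu>))" by (intro sum.cong refl) (simp add: power_add power2_eq_square mult_ac)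
  finally have x1: "u\<^sup>2 + (\<Sum>i=3..n. X (i - 2) \<mu> * u ^ i) = (\<Sum>i<N. u ^ 2 * (u ^ i * X i \<mu>))" by (simp add: add.commute)
  have "(\<Sum>i=k+1..n+k-1. X' (i - (k + 1)) ?z * u ^ i) = (\<Sum>i<N. X' (k + 1 + i - (k + 1)) ?z * u ^ (k + 1 + i))"
    by (rule sum_shift_range) (use N in auto)
  also have "\<dots> = (\<Sum>i<N. u ^ 2 * (u ^ (i + k - 1) * X' i ?z))"
  proof (intro sum.cong refl)
    fix i
    have "k + 1 + i = 2 + (i + k - 1)" using k by simp
    then have "u ^ (k + 1 + i) = u ^ 2 * u ^ (i + k - 1)" by (simp only: power_add[symmetric])
    then show "X' (k + 1 + i - (k + 1)) ?z * u ^ (k + 1 + i) = u ^ 2 * (u ^ (i + k - 1) * X' i ?z)" by simp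
  qed
  finally have x2: "(\<Sum>i=k+1..n+k-1. X' (i - (k + 1)) ?z * u ^ i) = (\<Sum>i<N. u ^ 2 * (u ^ (i + k - 1) * X' i ?z))" .
  have "(\<Sum>i=k+1..n+k-1. Y (i - (k + 1)) \<mu> * u ^ i) = (\<Sum>i<N. Y (k + 1 + i - (k + 1)) \<mu> * u ^ (k + 1 + i))"
    by (rule sum_shift_range) (use N in auto)
  also have "\<dots> = (\<Sum>i<N. u ^ (k + 1) * (u ^ i * Y i \<mu>))" by (intro sum.cong) (auto simp: power_add mult_ac)
  finally have y1: "(\<Sum>i=k+1..n+k-1. Y (i - (k + 1)) \<mu> * u ^ i) = (\<Sum>i<N. u ^ (k + 1) * (u ^ i * Y i \<mu>))" .
  have "(\<Sum>i=2*k..n+2*k-2. Y' (i - 2 * k) ?z * u ^ i) = (\<Sum>i<N. Y' (2 * k + i - 2 * k) ?z * u ^ (2 * k + i))"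
    by (rule sum_shift_range) (use N k in auto)
  also have "\<dots> = (\<Sum>i<N. u ^ (k + 1) * (u ^ (i + k - 1) * Y' i ?z))"
  proof (intro sum.cong refl)
    fix i
    have "(k + 1) + (i + k - 1) = 2 * k + i" using k by simp
    then have "u ^ (2 * k + i) = u ^ (k + 1) * u ^ (i + k - 1)" by (simp only: power_add[symmetric])
    then show "Y' (2 * k + i - 2 * k) ?z * u ^ (2 * k + i) = u ^ (k + 1) * (u ^ (i + k - 1) * Y' i ?z)" by simp
  qed
  finally have y2: "(\<Sum>i=2*k..n+2*k-2. Y' (i - 2 * k) ?z * u ^ i) = (\<Sum>i<N. u ^ (k + 1) * (u ^ (i + k - 1) * Y' i ?z))" .
  have mm: "2 * p + 1 - k = m" "n + 2 * p - k - 1 = m + N - 1" using m_eq N by auto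
  have "(\<Sum>i=m..m+N-1. u ^ i *\<^sub>R T (i - m) \<mu>) = (\<Sum>i<N. u ^ (m + i) *\<^sub>R T (m + i - m) \<mu>)"
    by (rule sum_shift_range) (use N in auto)
  also have "\<dots> = (\<Sum>i<N. u ^ m *\<^sub>R (u ^ i *\<^sub>R T i \<mu>))" by (intro sum.cong) (auto simp: power_add)
  finally have t1: "(\<Sum>i=2*p+1-k..n+2*p-k-1. u ^ i *\<^sub>R T (i - m) \<mu>) = (\<Sum>i<N. u ^ m *\<^sub>R (u ^ i *\<^sub>R T i \<mu>))" unfolding mm .
  have "(\<Sum>i=2*p..n+2*p-2. u ^ i *\<^sub>R T' (i - 2 * p) ?z) = (\<Sum>i<N. u ^ (2 * p + i) *\<^sub>R T' (2 * p + i - 2 * p) ?z)"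
    by (rule sum_shift_range) (use N m_eq k in auto)
  also have "\<dots> = (\<Sum>i<N. u ^ m *\<^sub>R (u ^ (i + k - 1) *\<^sub>R T' i ?z))"
  proof (intro sum.cong refl)
    fix i
    have "2 * p + i = m + (i + k - 1)" using m_eq k by simp
    then have "u ^ (2 * p + i) = u ^ m * u ^ (i + k - 1)" by (simp only: power_add)
    then show "u ^ (2 * p + i) *\<^sub>R T' (2 * p + i - 2 * p) ?z = u ^ m *\<^sub>R (u ^ (i + k - 1) *\<^sub>R T' i ?z)" by simp
  qed
  finally have t2: "(\<Sum>i=2*p..n+2*p-2. u ^ i *\<^sub>R T' (i - 2 * p) ?z) = (\<Sum>i<N. u ^ m *\<^sub>R (u ^ (i + k - 1) *\<^sub>R T' i ?z))" .
  show ?thesis unfolding K_of_def K_map_def x1 x2 y1 y2 t1 t2 sum_distrib_left[symmetric] scaleR_sum_right[symmetric]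
    by (simp add: trunc_def ring_distribs scaleR_right_distrib add.assoc)
qed

lemma Y_field_eq:
  assumes "n = N + 1" "N < k \<longrightarrow> y1 = (\<lambda>_. 0)"
  shows "Y_field k n \<omega> (Y_of y1) u \<mu> = (u ^ k * (y0 \<mu> + y1 \<mu> * u ^ (k - 1)), \<omega>)"
proof -
  have "u ^ (2 * k - 1) = u ^ k * u ^ (k - 1)" using k by (simp flip: power_add add: mult_2)
  moreover have "2 * k - 1 \<noteq> k" using k by simp
  ultimately show ?thesis using assms by (auto simp: Y_field_def Y_of_def algebra_simps)
qed

text \<open>The three components of the error are the defects times the powers of \<open>u\<close> that were divided out. The
formula holds as long as the point lies in \<open>U\<close>.\<close>

lemma invariance_error_eq:
  assumes sol: "solution N X X' wX Y Y' wY T T' wT y1" and N: "1 \<le> N" "n = N + 1" and \<mu>: "\<mu> \<in> \<Lambda>"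
    and U: "(u ^ 2 * trunc (\<lambda>_. 1) k N X X' (u, ((\<theta>, t *\<^sub>R \<nu>), \<mu>)), u ^ (k + 1) * trunc (\<lambda>_. 1) k N Y Y' (u, ((\<theta>, t *\<^sub>R \<nu>), \<mu>))) \<in> U"
  shows "invariance_error (X_field k p \<omega> ct aa dt At Bt) (K_of n X X' Y Y' T T') (Y_field k n \<omega> (Y_of y1)) u \<theta> t \<mu> =
    (u ^ (k + 1) * defect \<Phi>X (profile N X X' Y Y' T T') y0 y1 2 k N X X' wX (u, ((\<theta>, t *\<^sub>R \<nu>), \<mu>)),
     u ^ (2 * k) * defect \<Phi>Y (profile N X X' Y Y' T T') y0 y1 (k + 1) k N Y Y' wY (u, ((\<theta>, t *\<^sub>R \<nu>), \<mu>)),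
     u ^ (2 * p) *\<^sub>R defect \<Phi>T (profile N X X' Y Y' T T') y0 y1 m k N T T' wT (u, ((\<theta>, t *\<^sub>R \<nu>), \<mu>)))"
proof -
  let ?x = "(\<theta>, t *\<^sub>R \<nu>)"
  let ?z = "(u, (?x, \<mu>))"
  have osc: "\<And>i. osc_primitive (\<omega>, \<nu>) \<Lambda> (X' i) (wX i)" "\<And>i. osc_primitive (\<omega>, \<nu>) \<Lambda> (Y' i) (wY i)" "\<And>i. osc_primitive (\<omega>, \<nu>) \<Lambda> (T' i) (wT i)"
    and X0: "X 0 = (\<lambda>_. 1)" and y1: "N < k \<longrightarrow> y1 = (\<lambda>_. 0)"
    using sol unfolding solution_def by (simp_all del: split_paired_All)
  have pa: "\<And>i. periodic_analytic \<Lambda> (X' i)" "\<And>i. periodic_analytic \<Lambda> (Y' i)" "\<And>i. periodic_analytic \<Lambda> (T' i)"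
    using osc by (simp_all add: osc_primitive_def)
  define c where "c = y0 \<mu> + y1 \<mu> * u ^ (k - 1)"
  define h where "h = u ^ k * c"
  let ?vx = "trunc (\<lambda>_. 1) k N X X'" and ?vy = "trunc (\<lambda>_. 1) k N Y Y'" and ?vt = "trunc (\<lambda>_. 1) k N T T'"
  \<comment> \<open>the parameterization on hulls, as a function of \<open>u\<close> and of the point \<open>(\<theta>, \<tau>)\<close> of the torus\<close>
  define F where "F = (\<lambda>z :: real \<times> ((real^'d) \<times> (real^'e)). (fst z ^ 2 * ?vx (fst z, (snd z, \<mu>)),
      fst z ^ (k + 1) * ?vy (fst z, (snd z, \<mu>)), fst (snd z) + fst z ^ m *\<^sub>R ?vt (fst z, (snd z, \<mu>))))"
  have KF: "K_of n X X' Y Y' T T' u \<theta> t \<mu> = F (u, (\<theta>, t *\<^sub>R \<nu>))" for u \<theta> t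
    unfolding F_def fst_conv snd_conv by (rule K_of_eq[where X = X, OF N(2,1) X0])
  have Fd: "F differentiable (at (u, ?x))"
    unfolding F_def
  proof (intro differentiable_Pair differentiable_add)
    show "(\<lambda>z. fst z ^ 2 * ?vx (fst z, (snd z, \<mu>))) differentiable (at (u, ?x))"
      using trunc_differentiable[where s' = X' and s = X and e = 2 and u = u and x = ?x, OF pa(1) \<mu>] by simp
    show "(\<lambda>z. fst z ^ (k + 1) * ?vy (fst z, (snd z, \<mu>))) differentiable (at (u, ?x))"
      using trunc_differentiable[where s' = Y' and s = Y and e = "k + 1" and u = u and x = ?x, OF pa(2) \<mu>] by simp
    show "(\<lambda>z. fst z ^ m *\<^sub>R ?vt (fst z, (snd z, \<mu>))) differentiable (at (u, ?x))"
      by (rule trunc_differentiable[OF pa(3) \<mu>])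
    show "(\<lambda>z. fst (snd z)) differentiable (at (u, ?x))"
      by (intro bounded_linear_imp_differentiable bounded_linear_intros)
  qed
  define dx where "dx = u ^ (2 + k - 1) *\<^sub>R (c *\<^sub>R trunc (\<lambda>i. real (2 + i)) k N X X' ?z + (\<Sum>i<N. u ^ i *\<^sub>R wX i (?x, \<mu>)))"
  define dy where "dy = u ^ (k + 1 + k - 1) *\<^sub>R (c *\<^sub>R trunc (\<lambda>i. real (k + 1 + i)) k N Y Y' ?z + (\<Sum>i<N. u ^ i *\<^sub>R wY i (?x, \<mu>)))"
  define dth where "dth = \<omega> + u ^ (m + k - 1) *\<^sub>R (c *\<^sub>R trunc (\<lambda>i. real (m + i)) k N T T' ?z + (\<Sum>i<N. u ^ i *\<^sub>R wT i (?x, \<mu>)))"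
  have k1: "1 \<le> k" using k by simp
  have curve: "((\<lambda>s. F (u + s *\<^sub>R h, (\<theta> + s *\<^sub>R \<omega>, t *\<^sub>R \<nu> + s *\<^sub>R \<nu>))) has_vector_derivative (dx, dy, dth)) (at 0)"
  proof -
    have e: "(\<theta> + s *\<^sub>R \<omega>, t *\<^sub>R \<nu> + s *\<^sub>R \<nu>) = ?x + s *\<^sub>R (\<omega>, \<nu>)" for s by simp
    have 1: "((\<lambda>s. (u + s * h) ^ 2 *\<^sub>R ?vx (u + s * h, (?x + s *\<^sub>R (\<omega>, \<nu>), \<mu>))) has_vector_derivative dx) (at 0)"
      unfolding dx_def by (rule component_curve_derivative[OF _ k1 osc(1) \<mu> h_def]) simp
    have 2: "((\<lambda>s. (u + s * h) ^ (k + 1) *\<^sub>R ?vy (u + s * h, (?x + s *\<^sub>R (\<omega>, \<nu>), \<mu>))) has_vector_derivative dy) (at 0)"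
      unfolding dy_def by (rule component_curve_derivative[OF _ k1 osc(2) \<mu> h_def]) simp
    have 3: "((\<lambda>s. (u + s * h) ^ m *\<^sub>R ?vt (u + s * h, (?x + s *\<^sub>R (\<omega>, \<nu>), \<mu>))) has_vector_derivative
        u ^ (m + k - 1) *\<^sub>R (c *\<^sub>R trunc (\<lambda>i. real (m + i)) k N T T' ?z + (\<Sum>i<N. u ^ i *\<^sub>R wT i (?x, \<mu>)))) (at 0)"
      by (rule component_curve_derivative[OF m k1 osc(3) \<mu> h_def])
    have "((\<lambda>s. \<theta> + s *\<^sub>R \<omega>) has_vector_derivative \<omega>) (at 0)"
      by (auto intro!: derivative_eq_intros)
    from has_vector_derivative_add[OF this 3]
    have 4: "((\<lambda>s. (\<theta> + s *\<^sub>R \<omega>) + (u + s * h) ^ m *\<^sub>R ?vt (u + s * h, (?x + s *\<^sub>R (\<omega>, \<nu>), \<mu>))) has_vector_derivative dth) (at 0)"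
      by (simp add: dth_def)
    from has_vector_derivative_Pair[OF 1 has_vector_derivative_Pair[OF 2 4]]
    show ?thesis unfolding F_def fst_conv snd_conv e by simp
  qed
  have tot: "frechet_derivative (\<lambda>(u, \<theta>). K_of n X X' Y Y' T T' u \<theta> t \<mu>) (at (u, \<theta>)) (Y_field k n \<omega> (Y_of y1) u \<mu>)
      + vector_derivative (\<lambda>t. K_of n X X' Y Y' T T' u \<theta> t \<mu>) (at t) = (dx, dy, dth)"
    using frechet_plus_time_derivative[OF Fd curve] unfolding KF Y_field_eq[OF N(2) y1] by (simp add: h_def c_def)
  have P: "profile N X X' Y Y' T T' ?z = ((?vx ?z, ?vy ?z), ?vt ?z)" by (simp add: profile_def)
  have sh: "shift u (?vt ?z) (?x, \<mu>) = ((\<theta> + u ^ m *\<^sub>R ?vt ?z, t *\<^sub>R \<nu>), \<mu>)" by (simp add: shift_def)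
  define \<theta>' where "\<theta>' = \<theta> + u ^ m *\<^sub>R ?vt ?z"
  have XF: "X_field k p \<omega> ct aa dt At Bt (K_of n X X' Y Y' T T' u \<theta> t \<mu>) t \<mu> =
     (u ^ (k + 1) * \<Phi>X (u, (profile N X X' Y Y' T T' ?z, (?x, \<mu>))),
      u ^ (2 * k) * \<Phi>Y (u, (profile N X X' Y Y' T T' ?z, (?x, \<mu>))),
      \<omega> + u ^ (2 * p) *\<^sub>R \<Phi>T (u, (profile N X X' Y Y' T T' ?z, (?x, \<mu>))))"
  proof -
    have "At (u ^ 2 * ?vx ?z) (u ^ (k + 1) * ?vy ?z) \<theta>' t \<mu> = u ^ (2 * k + 1) * FA (u, ((?vx ?z, ?vy ?z), ((\<theta>', t *\<^sub>R \<nu>), \<mu>)))"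
      by (rule At[OF \<mu> U])
    moreover have "Bt (u ^ 2 * ?vx ?z) (u ^ (k + 1) * ?vy ?z) \<theta>' t \<mu> = u ^ (2 * p + 1) *\<^sub>R FB (u, ((?vx ?z, ?vy ?z), ((\<theta>', t *\<^sub>R \<nu>), \<mu>)))"
      by (rule Bt[OF \<mu> U])
    moreover have "(u ^ 2 * ?vx ?z) ^ q = u ^ (2 * q) * ?vx ?z ^ q" for q by (simp add: power_mult_distrib power_mult)
    ultimately show ?thesis
      unfolding K_of_eq[where X = X, OF N(2,1) X0] P \<Phi>X_def \<Phi>Y_def \<Phi>T_def X_field_def prod.case sh \<theta>'_def[symmetric] ct[OF \<mu>] aa[OF \<mu>] dt[OF \<mu>]
      by (simp add: algebra_simps scaleR_right_distrib)
  qed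
  have px: "2 + k - 1 = k + 1" "k + 1 + k - 1 = 2 * k" "m + k - 1 = 2 * p" using k m_eq by auto
  have "invariance_error (X_field k p \<omega> ct aa dt At Bt) (K_of n X X' Y Y' T T') (Y_field k n \<omega> (Y_of y1)) u \<theta> t \<mu>
    = X_field k p \<omega> ct aa dt At Bt (K_of n X X' Y Y' T T' u \<theta> t \<mu>) t \<mu> - (dx, dy, dth)"
    unfolding invariance_error_def tot[symmetric] by simp
  then show ?thesis
    unfolding XF dx_def dy_def dth_def defect_def c_def px fst_conv snd_conv by (simp add: algebra_simps scaleR_right_distrib)
qed

text \<open>Both components have a factor \<open>u\<close> and are otherwise bounded, so they stay near the origin.\<close>

lemma profile_small:
  assumes sol: "solution N X X' wX Y Y' wY T T' wT y1" and L: "compact L" "L \<subseteq> \<Lambda>" and U: "(0, 0) \<in> interior U"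
  obtains \<delta> where "0 < \<delta>" "\<And>u x \<mu>. \<mu> \<in> L \<Longrightarrow> 0 \<le> u \<Longrightarrow> u < \<delta> \<Longrightarrow>
    (u ^ 2 * trunc (\<lambda>_. 1) k N X X' (u, (x, \<mu>)), u ^ (k + 1) * trunc (\<lambda>_. 1) k N Y Y' (u, (x, \<mu>))) \<in> U"
proof -
  have an: "\<And>i. real_analytic_on (X i) \<Lambda>" "\<And>i. real_analytic_on (Y i) \<Lambda>"
    and osc: "\<And>i. osc_primitive (\<omega>, \<nu>) \<Lambda> (X' i) (wX i)" "\<And>i. osc_primitive (\<omega>, \<nu>) \<Lambda> (Y' i) (wY i)"
    using sol unfolding solution_def by (simp_all del: split_paired_All)
  have pa: "\<And>i. periodic_analytic \<Lambda> (X' i)" "\<And>i. periodic_analytic \<Lambda> (Y' i)"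
    using osc by (simp_all add: osc_primitive_def)
  let ?g = "\<lambda>z. (fst z ^ 1 * trunc (\<lambda>_. 1) k N X X' z, fst z ^ k * trunc (\<lambda>_. 1) k N Y Y' z)"
  have "germ \<Lambda> ?g" by (intro germ_Pair germ_mult_real germ_u_power germ_trunc an pa)
  note gb = germ_locally_bounded[OF this L]
  obtain B \<delta> where B: "0 < \<delta>" "\<And>u x \<mu>. \<mu> \<in> L \<Longrightarrow> \<bar>u\<bar> < \<delta> \<Longrightarrow> norm (?g (u, (x, \<mu>))) \<le> B"
    by (rule gb) (rule that)
  obtain r where r: "r > 0" "ball (0, 0) r \<subseteq> U" using U by (meson mem_interior)
  define B' where "B' = \<bar>B\<bar> + 1"
  have B': "0 < B'" "B < B'" by (auto simp: B'_def)
  show ?thesis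
  proof (rule that[of "min \<delta> (r / B')"])
    show "0 < min \<delta> (r / B')" using B(1) r(1) B' by simp
    fix u x \<mu> assume \<mu>: "\<mu> \<in> L" and u: "0 \<le> u" "u < min \<delta> (r / B')"
    let ?p = "(u ^ 2 * trunc (\<lambda>_. 1) k N X X' (u, (x, \<mu>)), u ^ (k + 1) * trunc (\<lambda>_. 1) k N Y Y' (u, (x, \<mu>)))"
    have "?p = u *\<^sub>R ?g (u, (x, \<mu>))" by (simp add: power2_eq_square mult_ac)
    then have "norm ?p = u * norm (?g (u, (x, \<mu>)))" using u(1) by (simp only: norm_scaleR abs_of_nonneg)
    also have "\<dots> \<le> u * B" using B(2)[OF \<mu>, of u x] u by (intro mult_left_mono) auto
    also have "\<dots> \<le> u * B'" using u B' by (intro mult_left_mono) auto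
    also have "\<dots> < r" using u(2) B' by (simp add: field_simps)
    finally have "dist (0, 0) ?p < r" by (simp only: dist_norm zero_prod_def[symmetric] diff_0 norm_minus_cancel)
    then show "?p \<in> U" using r(2) by auto
  qed
qed

lemma bigO_zero_flat:
  fixes f :: "real \<times> (((real^'d) \<times> (real^'e)) \<times> (real^'m)) \<Rightarrow> 'b::euclidean_space"
  assumes f: "flat \<Lambda> N f" and L: "compact L" "L \<subseteq> \<Lambda>" and q: "q = M + N"
    and \<delta>: "0 < \<delta>" and g: "\<And>u \<theta> t \<mu>. \<mu> \<in> L \<Longrightarrow> 0 \<le> u \<Longrightarrow> u < \<delta> \<Longrightarrow> g u \<theta> t \<mu> = u ^ M *\<^sub>R f (u, ((\<theta>, t *\<^sub>R \<nu>), \<mu>))"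
  shows "\<exists>B. \<exists>\<delta>>0. \<forall>\<mu>\<in>L. \<forall>\<theta> t u. 0 \<le> u \<longrightarrow> u < \<delta> \<longrightarrow> norm (g u \<theta> t \<mu>) \<le> B * u ^ q"
proof -
  obtain r where r: "germ \<Lambda> r" "\<And>u x \<mu>. \<mu> \<in> \<Lambda> \<Longrightarrow> f (u, (x, \<mu>)) = u ^ N *\<^sub>R r (u, (x, \<mu>))"
    using f unfolding flat_def by blast
  obtain B \<delta>' where B: "0 < \<delta>'" "\<And>u x \<mu>. \<mu> \<in> L \<Longrightarrow> \<bar>u\<bar> < \<delta>' \<Longrightarrow> norm (r (u, (x, \<mu>))) \<le> B"
    by (rule germ_locally_bounded[OF r(1) L]) (rule that)
  have "norm (g u \<theta> t \<mu>) \<le> B * u ^ q" if "\<mu> \<in> L" "0 \<le> u" "u < min \<delta> \<delta>'" for u \<theta> t \<mu>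
  proof -
    have "\<mu> \<in> \<Lambda>" using L(2) that(1) by blast
    then have "g u \<theta> t \<mu> = u ^ q *\<^sub>R r (u, ((\<theta>, t *\<^sub>R \<nu>), \<mu>))" using g[of \<mu> u \<theta> t] that by (simp add: r(2) q power_add)
    then have "norm (g u \<theta> t \<mu>) = u ^ q * norm (r (u, ((\<theta>, t *\<^sub>R \<nu>), \<mu>)))" using that(2) by simp
    also have "\<dots> \<le> u ^ q * B" using B(2)[OF that(1), of u] that by (intro mult_left_mono) auto
    finally show ?thesis by (simp add: mult.commute)
  qed
  then show ?thesis using B(1) \<delta> by (intro exI[of _ B] exI[of _ "min \<delta> \<delta>'"] conjI ballI allI impI) simp_all
qed

lemma error_bigO:
  assumes sol: "solution N X X' wX Y Y' wY T T' wT y1" and N: "1 \<le> N" "n = N + 1" and U: "(0, 0) \<in> interior U"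
  shows "let G = invariance_error (X_field k p \<omega> ct aa dt At Bt) (K_of n X X' Y Y' T T') (Y_field k n \<omega> (Y_of y1))
     in bigO_zero \<Lambda> (n + k) (\<lambda>u \<theta> t \<mu>. fst (G u \<theta> t \<mu>)) \<and>
        bigO_zero \<Lambda> (n + 2*k - 1) (\<lambda>u \<theta> t \<mu>. fst (snd (G u \<theta> t \<mu>))) \<and>
        bigO_zero \<Lambda> (n + 2*p - 1) (\<lambda>u \<theta> t \<mu>. snd (snd (G u \<theta> t \<mu>)))"
proof -
  have fl: "flat \<Lambda> N (defect \<Phi>X (profile N X X' Y Y' T T') y0 y1 2 k N X X' wX)"
      "flat \<Lambda> N (defect \<Phi>Y (profile N X X' Y Y' T T') y0 y1 (k + 1) k N Y Y' wY)"
      "flat \<Lambda> N (defect \<Phi>T (profile N X X' Y Y' T T') y0 y1 m k N T T' wT)"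
    using sol unfolding solution_def by (simp_all del: split_paired_All)
  define G where "G = invariance_error (X_field k p \<omega> ct aa dt At Bt) (K_of n X X' Y Y' T T') (Y_field k n \<omega> (Y_of y1))"
  define W where "W u \<theta> t \<mu> = (u ^ (k + 1) * defect \<Phi>X (profile N X X' Y Y' T T') y0 y1 2 k N X X' wX (u, ((\<theta>, t *\<^sub>R \<nu>), \<mu>)),
     u ^ (2 * k) * defect \<Phi>Y (profile N X X' Y Y' T T') y0 y1 (k + 1) k N Y Y' wY (u, ((\<theta>, t *\<^sub>R \<nu>), \<mu>)),
     u ^ (2 * p) *\<^sub>R defect \<Phi>T (profile N X X' Y Y' T T') y0 y1 m k N T T' wT (u, ((\<theta>, t *\<^sub>R \<nu>), \<mu>)))"
    for u :: real and \<theta> t \<mu>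
  have main: "\<exists>\<delta>>0. \<forall>\<mu>\<in>L. \<forall>\<theta> t u. 0 \<le> u \<longrightarrow> u < \<delta> \<longrightarrow> G u \<theta> t \<mu> = W u \<theta> t \<mu>"
    if L: "compact L" "L \<subseteq> \<Lambda>" for L
  proof -
    obtain \<delta> where \<delta>: "0 < \<delta>" "\<And>u x \<mu>. \<mu> \<in> L \<Longrightarrow> 0 \<le> u \<Longrightarrow> u < \<delta> \<Longrightarrow>
      (u ^ 2 * trunc (\<lambda>_. 1) k N X X' (u, (x, \<mu>)), u ^ (k + 1) * trunc (\<lambda>_. 1) k N Y Y' (u, (x, \<mu>))) \<in> U"
      by (rule profile_small[OF sol L U]) (rule that)
    show ?thesis unfolding G_def W_def
      by (intro exI[of _ \<delta>] conjI \<delta>(1) ballI allI impI invariance_error_eq[OF sol N] \<delta>(2)) (use L(2) in auto)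
  qed
  have q: "n + k = (k + 1) + N" "n + 2*k - 1 = 2 * k + N" "n + 2*p - 1 = 2 * p + N" using N by auto
  have "(\<exists>C. \<exists>\<delta>>0. \<forall>\<mu>\<in>L. \<forall>\<theta> t u. 0 \<le> u \<longrightarrow> u < \<delta> \<longrightarrow> norm (fst (G u \<theta> t \<mu>)) \<le> C * u ^ (n + k)) \<and>
      (\<exists>C. \<exists>\<delta>>0. \<forall>\<mu>\<in>L. \<forall>\<theta> t u. 0 \<le> u \<longrightarrow> u < \<delta> \<longrightarrow> norm (fst (snd (G u \<theta> t \<mu>))) \<le> C * u ^ (n + 2*k - 1)) \<and>
      (\<exists>C. \<exists>\<delta>>0. \<forall>\<mu>\<in>L. \<forall>\<theta> t u. 0 \<le> u \<longrightarrow> u < \<delta> \<longrightarrow> norm (snd (snd (G u \<theta> t \<mu>))) \<le> C * u ^ (n + 2*p - 1))"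
    if L: "compact L" "L \<subseteq> \<Lambda>" for L
  proof (intro conjI)
    from main[OF L] obtain \<delta> where \<delta>: "0 < \<delta>" and E: "\<And>u \<theta> t \<mu>. \<mu> \<in> L \<Longrightarrow> 0 \<le> u \<Longrightarrow> u < \<delta> \<Longrightarrow> G u \<theta> t \<mu> = W u \<theta> t \<mu>"
      by blast
    show "\<exists>C. \<exists>\<delta>>0. \<forall>\<mu>\<in>L. \<forall>\<theta> t u. 0 \<le> u \<longrightarrow> u < \<delta> \<longrightarrow> norm (fst (G u \<theta> t \<mu>)) \<le> C * u ^ (n + k)"
      by (rule bigO_zero_flat[OF fl(1) L q(1) \<delta>]) (simp add: E W_def)
    show "\<exists>C. \<exists>\<delta>>0. \<forall>\<mu>\<in>L. \<forall>\<theta> t u. 0 \<le> u \<longrightarrow> u < \<delta> \<longrightarrow> norm (fst (snd (G u \<theta> t \<mu>))) \<le> C * u ^ (n + 2*k - 1)"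
      by (rule bigO_zero_flat[OF fl(2) L q(2) \<delta>]) (simp add: E W_def)
    show "\<exists>C. \<exists>\<delta>>0. \<forall>\<mu>\<in>L. \<forall>\<theta> t u. 0 \<le> u \<longrightarrow> u < \<delta> \<longrightarrow> norm (snd (snd (G u \<theta> t \<mu>))) \<le> C * u ^ (n + 2*p - 1)"
      by (rule bigO_zero_flat[OF fl(3) L q(3) \<delta>]) (simp add: E W_def)
  qed
  then show ?thesis unfolding Let_def bigO_zero_def G_def[symmetric] by simp
qed

end

text \<open>Used with \<open>r = 1 / \<eta>0 \<mu>\<close>: the first oscillatory coefficient of the \<open>x\<close>-component solves the equation with
right-hand side \<open>\<eta>0 \<mu>\<close> times the oscillatory part of \<open>c\<close>.\<close>

lemma osc_primitive_scaleR:
  assumes "osc_primitive v S \<phi> w" shows "osc_primitive v S (\<lambda>z. r *\<^sub>R \<phi> z) (\<lambda>z. r *\<^sub>R w z)"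
proof -
  have pa: "periodic_analytic S \<phi>" "periodic_analytic S w"
    and i0: "\<And>l. l \<in> S \<Longrightarrow> integral (cbox 0 One) (\<lambda>x. \<phi> (x, l)) = 0"
    and der: "\<And>l x. l \<in> S \<Longrightarrow> ((\<lambda>t. \<phi> (x + t *\<^sub>R v, l)) has_vector_derivative w (x, l)) (at 0)"
    using assms by (simp_all add: osc_primitive_def del: split_paired_All)
  have "periodic_analytic S (\<lambda>z. r *\<^sub>R \<phi> z)" "periodic_analytic S (\<lambda>z. r *\<^sub>R w z)"
    by (intro periodic_analytic_scaleR[OF periodic_analytic_param[OF real_analytic_on_const]] pa)+
  moreover have "((\<lambda>t. r *\<^sub>R \<phi> (x + t *\<^sub>R v, l)) has_vector_derivative r *\<^sub>R w (x, l)) (at 0)" if "l \<in> S" for x l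
    by (rule bounded_linear.has_vector_derivative[OF bounded_linear_scaleR_right der[OF that]])
  ultimately show ?thesis using i0 by (simp add: osc_primitive_def del: split_paired_All)
qed

lemma remainder_form_cong:
  assumes "remainder_form U j F" "\<And>x y. (x, y) \<in> U \<Longrightarrow> F x y = G x y" shows "remainder_form U j G"
proof -
  obtain F1 F2 where F: "\<forall>(x, y)\<in>U. F x y = y *\<^sub>R F1 (x, y) + F2 (x, y)"
    and O: "(\<lambda>z. norm (F1 z)) \<in> O[at (0, 0)](\<lambda>z. norm z ^ (j - 1))" "(\<lambda>z. norm (F2 z)) \<in> O[at (0, 0)](\<lambda>z. norm z ^ (j + 1))"
    using assms(1) unfolding remainder_form_def by (elim exE conjE)
  have "\<forall>(x, y)\<in>U. G x y = y *\<^sub>R F1 (x, y) + F2 (x, y)" using F assms(2) by fastforce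
  with O show ?thesis unfolding remainder_form_def by (intro exI conjI)
qed

lemma quasiperiodic_weighted_remainder:
  fixes R :: "real \<Rightarrow> real \<Rightarrow> real^'d \<Rightarrow> real \<Rightarrow> 'p::euclidean_space \<Rightarrow> 'b::euclidean_space" and \<nu> :: "real^'e"
  assumes qp: "quasiperiodic_on \<nu> (U \<times> S) (\<lambda>\<theta> t ((x, y), \<mu>). R x y \<theta> t \<mu>)"
    and U: "(0, 0) \<in> interior U" and k: "2 \<le> k" and j: "1 \<le> j" and nu: "nonresonant \<nu>"
    and rem: "\<And>\<theta> t \<mu>. \<mu> \<in> S \<Longrightarrow> remainder_form U j (\<lambda>x y. R x y \<theta> t \<mu>)"
  obtains F where "real_analytic_on F ({0} \<times> (UNIV \<times> (UNIV \<times> S)))"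
    "\<And>u q l. lattice_periodic (\<lambda>x. F (u, (q, (x, l))))"
    "\<And>u \<xi> \<eta> \<mu> \<theta> t. \<mu> \<in> S \<Longrightarrow> (u ^ 2 * \<xi>, u ^ (k + 1) * \<eta>) \<in> U \<Longrightarrow>
      R (u ^ 2 * \<xi>) (u ^ (k + 1) * \<eta>) \<theta> t \<mu> = u ^ (2 * j + 1) *\<^sub>R F (u, ((\<xi>, \<eta>), ((\<theta>, t *\<^sub>R \<nu>), \<mu>)))"
proof -
  obtain G where G: "periodic_analytic (U \<times> S) G"
    "\<forall>p\<in>U \<times> S. \<forall>\<theta> t. (case p of ((x, y), \<mu>) \<Rightarrow> R x y \<theta> t \<mu>) = G ((\<theta>, t *\<^sub>R \<nu>), p)"
    using qp unfolding quasiperiodic_on_iff by (elim exE conjE) (rule that, assumption, simp add: case_prod_unfold)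
  have GR: "R x y \<theta> t \<mu> = G ((\<theta>, t *\<^sub>R \<nu>), ((x, y), \<mu>))" if "(x, y) \<in> U" "\<mu> \<in> S" for x y \<mu> \<theta> t
    using G(2)[rule_format, of "((x, y), \<mu>)" \<theta> t] that by simp
  have rG: "remainder_form U j (\<lambda>x y. G ((\<theta>, t *\<^sub>R \<nu>), ((x, y), l)))" if "l \<in> S" for \<theta> t l
    by (rule remainder_form_cong[OF rem[OF that]]) (rule GR[OF _ that])
  obtain F where F: "real_analytic_on F ({0} \<times> (UNIV \<times> (UNIV \<times> S)))"
    "\<And>u q l. lattice_periodic (\<lambda>x. F (u, (q, (x, l))))"
    "\<And>u \<xi> \<eta> x l. l \<in> S \<Longrightarrow> G (x, ((u ^ 2 * \<xi>, u ^ (k + 1) * \<eta>), l)) = u ^ (2 * j + 1) *\<^sub>R F (u, ((\<xi>, \<eta>), (x, l)))"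
    by (rule weighted_remainder[OF G(1) U k j nu rG]) (assumption, rule that)
  show ?thesis by (rule that[OF F(1,2)]) (simp only: GR F(3))
qed

theorem theorem3p6:
  fixes k p :: nat
    and U :: "(real \<times> real) set"
    and \<Lambda> :: "(real^'m) set"
    and \<omega> :: "real^'d"
    and \<nu> :: "real^'e"
    and c a :: "real^'d \<Rightarrow> real \<Rightarrow> real^'m \<Rightarrow> real"
    and d :: "real^'d \<Rightarrow> real \<Rightarrow> real^'m \<Rightarrow> real^'d"
    and A :: "real \<Rightarrow> real \<Rightarrow> real^'d \<Rightarrow> real \<Rightarrow> real^'m \<Rightarrow> real"
    and B :: "real \<Rightarrow> real \<Rightarrow> real^'d \<Rightarrow> real \<Rightarrow> real^'m \<Rightarrow> real^'d"
  assumes k: "k \<ge> 2" and p: "p \<ge> 1"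
    and U: "(0, 0) \<in> interior U"
    and c: "quasiperiodic_on \<nu> \<Lambda> c"
    and a: "quasiperiodic_on \<nu> \<Lambda> a"
    and d: "quasiperiodic_on \<nu> \<Lambda> d"
    and A: "quasiperiodic_on \<nu> (U \<times> \<Lambda>) (\<lambda>\<theta> t ((x, y), \<mu>). A x y \<theta> t \<mu>)"
    and B: "quasiperiodic_on \<nu> (U \<times> \<Lambda>) (\<lambda>\<theta> t ((x, y), \<mu>). B x y \<theta> t \<mu>)"
    and A_form: "\<And>\<theta> t \<mu>. \<mu> \<in> \<Lambda> \<Longrightarrow> remainder_form U k (\<lambda>x y. A x y \<theta> t \<mu>)"
    and B_form: "\<And>\<theta> t \<mu>. \<mu> \<in> \<Lambda> \<Longrightarrow> remainder_form U p (\<lambda>x y. B x y \<theta> t \<mu>)"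
    and c_pos: "\<And>\<mu>. \<mu> \<in> \<Lambda> \<Longrightarrow> average_at \<nu> c \<mu> > 0"
    and d_nonzero: "\<And>\<mu>. \<mu> \<in> \<Lambda> \<Longrightarrow> average_at \<nu> d \<mu> \<noteq> 0"
    and kp: "2 * p > k - 1"
    and dioph: "diophantine (join_vec \<omega> \<nu>)"
    and a_pos: "\<And>\<mu>. \<mu> \<in> \<Lambda> \<Longrightarrow> average_at \<nu> a \<mu> > 0"
  shows "\<forall>n\<ge>2. \<forall>s\<in>{1, -1}. \<exists>Kx Kx' Ky Ky' K\<theta> K\<theta>' Y.
    (\<forall>i. real_analytic_on (Kx i) \<Lambda> \<and> real_analytic_on (Ky i) \<Lambda> \<and>
         real_analytic_on (K\<theta> i) \<Lambda> \<and> real_analytic_on (Y i) \<Lambda>) \<and>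
    (\<forall>i. quasiperiodic_on \<nu> \<Lambda> (Kx' i) \<and> quasiperiodic_on \<nu> \<Lambda> (Ky' i) \<and>
         quasiperiodic_on \<nu> \<Lambda> (K\<theta>' i)) \<and>
    (\<forall>i. \<forall>\<mu>\<in>\<Lambda>. average_at \<nu> (Kx' i) \<mu> = 0 \<and>
         average_at \<nu> (Ky' i) \<mu> = 0 \<and>
         average_at \<nu> (K\<theta>' i) \<mu> = 0) \<and>
    (let G = invariance_error (X_field k p \<omega> c a d A B)
               (K_map k p n Kx Kx' Ky Ky' K\<theta> K\<theta>') (Y_field k n \<omega> Y)
     in bigO_zero \<Lambda> (n + k) (\<lambda>u \<theta> t \<mu>. fst (G u \<theta> t \<mu>)) \<and>
        bigO_zero \<Lambda> (n + 2*k - 1) (\<lambda>u \<theta> t \<mu>. fst (snd (G u \<theta> t \<mu>))) \<and>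
        bigO_zero \<Lambda> (n + 2*p - 1) (\<lambda>u \<theta> t \<mu>. snd (snd (G u \<theta> t \<mu>)))) \<and>
    (\<forall>\<mu>\<in>\<Lambda>.
       Ky (k + 1) \<mu> = s * sqrt (2 * average_at \<nu> a \<mu> / (average_at \<nu> c \<mu> * (real k + 1))) \<and>
       K\<theta> (2*p + 1 - k) \<mu> =
         (s / (2 * real p - real k + 1) *
          sqrt (2 * (real k + 1) / (average_at \<nu> c \<mu> * average_at \<nu> a \<mu>))) *\<^sub>R average_at \<nu> d \<mu> \<and>
       Y k \<mu> = s * sqrt (average_at \<nu> c \<mu> * average_at \<nu> a \<mu> / (2 * (real k + 1))) \<and>
       (\<forall>\<theta> t.
          Kx' (k + 1) \<theta> t \<mu> = SD \<omega> \<nu> (oscillatory_at \<nu> c \<mu>) \<theta> t * Ky (k + 1) \<mu> \<and>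
          Ky' (2*k) \<theta> t \<mu> = SD \<omega> \<nu> (oscillatory_at \<nu> a \<mu>) \<theta> t \<and>
          K\<theta>' (2*p) \<theta> t \<mu> = SD \<omega> \<nu> (oscillatory_at \<nu> d \<mu>) \<theta> t))"
proof (intro allI impI ballI)
  fix n :: nat and s :: real
  assume n: "2 \<le> n" and s: "s \<in> {1, - 1}"
  define N where "N = n - 1"
  define m where "m = 2 * p + 1 - k"
  have nN: "n = N + 1" "1 \<le> N" using n by (auto simp: N_def)
  have mk: "m + k = 2 * p + 1" "1 \<le> m" using kp by (auto simp: m_def)
  have v: "diophantine_vector (\<omega>, \<nu>)" by (rule diophantine_join_vec[OF dioph])
  have nr: "nonresonant (\<omega>, \<nu>)" by (rule diophantine_vector_nonresonant[OF v])
  have nu: "nonresonant \<nu>" by (rule nonresonant_snd[OF nr])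
  obtain C where hull_c: "periodic_analytic \<Lambda> C" "\<And>\<mu> \<theta> t. \<mu> \<in> \<Lambda> \<Longrightarrow> c \<theta> t \<mu> = C ((\<theta>, t *\<^sub>R \<nu>), \<mu>)"
    using c unfolding quasiperiodic_on_iff by (elim exE conjE) (rule that, simp_all)
  obtain a' where hull_a: "periodic_analytic \<Lambda> a'" "\<And>\<mu> \<theta> t. \<mu> \<in> \<Lambda> \<Longrightarrow> a \<theta> t \<mu> = a' ((\<theta>, t *\<^sub>R \<nu>), \<mu>)"
    using a unfolding quasiperiodic_on_iff by (elim exE conjE) (rule that, simp_all)
  obtain D where hull_d: "periodic_analytic \<Lambda> D" "\<And>\<mu> \<theta> t. \<mu> \<in> \<Lambda> \<Longrightarrow> d \<theta> t \<mu> = D ((\<theta>, t *\<^sub>R \<nu>), \<mu>)"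
    using d unfolding quasiperiodic_on_iff by (elim exE conjE) (rule that, simp_all)
  obtain FA where FA: "real_analytic_on FA ({0} \<times> (UNIV \<times> (UNIV \<times> \<Lambda>)))"
    "\<And>u q l. lattice_periodic (\<lambda>x. FA (u, (q, (x, l))))"
    "\<And>u \<xi> \<eta> \<mu> \<theta> t. \<mu> \<in> \<Lambda> \<Longrightarrow> (u ^ 2 * \<xi>, u ^ (k + 1) * \<eta>) \<in> U \<Longrightarrow>
      A (u ^ 2 * \<xi>) (u ^ (k + 1) * \<eta>) \<theta> t \<mu> = u ^ (2 * k + 1) *\<^sub>R FA (u, ((\<xi>, \<eta>), ((\<theta>, t *\<^sub>R \<nu>), \<mu>)))"
    by (rule quasiperiodic_weighted_remainder[OF A U k _ nu A_form]) (use k in simp, assumption, rule that)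
  obtain FB where FB: "real_analytic_on FB ({0} \<times> (UNIV \<times> (UNIV \<times> \<Lambda>)))"
    "\<And>u q l. lattice_periodic (\<lambda>x. FB (u, (q, (x, l))))"
    "\<And>u \<xi> \<eta> \<mu> \<theta> t. \<mu> \<in> \<Lambda> \<Longrightarrow> (u ^ 2 * \<xi>, u ^ (k + 1) * \<eta>) \<in> U \<Longrightarrow>
      B (u ^ 2 * \<xi>) (u ^ (k + 1) * \<eta>) \<theta> t \<mu> = u ^ (2 * p + 1) *\<^sub>R FB (u, ((\<xi>, \<eta>), ((\<theta>, t *\<^sub>R \<nu>), \<mu>)))"
    by (rule quasiperiodic_weighted_remainder[OF B U k p nu B_form]) (assumption, rule that)
  have avg: "average_at \<nu> c \<mu> = mean C \<mu>" "average_at \<nu> a \<mu> = mean a' \<mu>" "average_at \<nu> d \<mu> = mean D \<mu>"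
    if "\<mu> \<in> \<Lambda>" for \<mu>
    by (rule average_eq_mean[OF nu hull_c(1) that], rule hull_c(2)[OF that])
      (rule average_eq_mean[OF nu hull_a(1) that], rule hull_a(2)[OF that], rule average_eq_mean[OF nu hull_d(1) that], rule hull_d(2)[OF that])
  interpret hull_problem \<omega> \<nu> \<Lambda> k m p C a' D FA FB s U c a d A B
  proof
    show "0 < mean C l" "0 < mean a' l" if "l \<in> \<Lambda>" for l using c_pos a_pos avg that by simp_all
    show "s = 1 \<or> s = - 1" using s by simp
  qed (use k mk v hull_c hull_a hull_d FA FB in simp_all)
  obtain X X' wX Y Y' wY T T' wT y1 where sol: "solution N X X' wX Y Y' wY T T' wT y1"
    using solution_exists[OF nN(2)] by (elim exE)
  have an: "real_analytic_on (X i) \<Lambda>" "real_analytic_on (Y i) \<Lambda>" "real_analytic_on (T i) \<Lambda>" "real_analytic_on y1 \<Lambda>"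
    and osc: "osc_primitive (\<omega>, \<nu>) \<Lambda> (X' i) (wX i)" "osc_primitive (\<omega>, \<nu>) \<Lambda> (Y' i) (wY i)" "osc_primitive (\<omega>, \<nu>) \<Lambda> (T' i) (wT i)"
    and init: "Y 0 = \<eta>0" "T 0 = \<theta>0"
    and w0: "wX 0 (x, l) = \<eta>0 l * (C (x, l) - mean C l)" "wY 0 (x, l) = a' (x, l) - mean a' l"
      "wT 0 (x, l) = D (x, l) - mean D l" for i x l
    using sol unfolding solution_def by (simp_all del: split_paired_All)
  let ?Kx = "\<lambda>i. X (i - 2)" and ?Kx' = "\<lambda>i \<theta> t \<mu>. X' (i - (k + 1)) ((\<theta>, t *\<^sub>R \<nu>), \<mu>)"
  let ?Ky = "\<lambda>i. Y (i - (k + 1))" and ?Ky' = "\<lambda>i \<theta> t \<mu>. Y' (i - 2 * k) ((\<theta>, t *\<^sub>R \<nu>), \<mu>)"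
  let ?K\<theta> = "\<lambda>i. T (i - m)" and ?K\<theta>' = "\<lambda>i \<theta> t \<mu>. T' (i - 2 * p) ((\<theta>, t *\<^sub>R \<nu>), \<mu>)"
  let ?Y = "Y_of y1"
  have coefficients: "real_analytic_on (?Kx i) \<Lambda> \<and> real_analytic_on (?Ky i) \<Lambda> \<and> real_analytic_on (?K\<theta> i) \<Lambda> \<and> real_analytic_on (?Y i) \<Lambda>" for i
    using an leading_analytic(4) by (simp add: Y_of_def)
  have qp: "quasiperiodic_on \<nu> \<Lambda> (\<lambda>\<theta> t \<mu>. \<phi> ((\<theta>, t *\<^sub>R \<nu>), \<mu>))" if "osc_primitive (\<omega>, \<nu>) \<Lambda> \<phi> w"
    for \<phi> w :: "((real^'d) \<times> (real^'e)) \<times> (real^'m) \<Rightarrow> 'b::euclidean_space"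
    unfolding quasiperiodic_on_iff using that by (intro exI[of _ \<phi>]) (simp add: osc_primitive_def)
  have zero: "average_at \<nu> (\<lambda>\<theta> t \<mu>. \<phi> ((\<theta>, t *\<^sub>R \<nu>), \<mu>)) \<mu> = 0" if "osc_primitive (\<omega>, \<nu>) \<Lambda> \<phi> w" "\<mu> \<in> \<Lambda>"
    for \<phi> w :: "((real^'d) \<times> (real^'e)) \<times> (real^'m) \<Rightarrow> 'b::euclidean_space" and \<mu>
  proof -
    have pa: "periodic_analytic \<Lambda> \<phi>" and i0: "integral (cbox 0 One) (\<lambda>x. \<phi> (x, \<mu>)) = 0"
      using that by (simp_all add: osc_primitive_def)
    show ?thesis using average_eq_mean[OF nu pa that(2)] mean_eq_integral[OF pa that(2)] i0 by simp
  qed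
  have error: "let G = invariance_error (X_field k p \<omega> c a d A B)
        (K_map k p n ?Kx ?Kx' ?Ky ?Ky' ?K\<theta> ?K\<theta>') (Y_field k n \<omega> ?Y)
     in bigO_zero \<Lambda> (n + k) (\<lambda>u \<theta> t \<mu>. fst (G u \<theta> t \<mu>)) \<and>
        bigO_zero \<Lambda> (n + 2*k - 1) (\<lambda>u \<theta> t \<mu>. fst (snd (G u \<theta> t \<mu>))) \<and>
        bigO_zero \<Lambda> (n + 2*p - 1) (\<lambda>u \<theta> t \<mu>. snd (snd (G u \<theta> t \<mu>)))"
    using error_bigO[OF sol nN(2,1) U] unfolding K_of_def .
  have leading: "?Ky (k + 1) \<mu> = s * sqrt (2 * average_at \<nu> a \<mu> / (average_at \<nu> c \<mu> * (real k + 1)))"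
    "?K\<theta> (2*p + 1 - k) \<mu> = (s / (2 * real p - real k + 1) *
          sqrt (2 * (real k + 1) / (average_at \<nu> c \<mu> * average_at \<nu> a \<mu>))) *\<^sub>R average_at \<nu> d \<mu>"
    "?Y k \<mu> = s * sqrt (average_at \<nu> c \<mu> * average_at \<nu> a \<mu> / (2 * (real k + 1)))"
    if \<mu>: "\<mu> \<in> \<Lambda>" for \<mu>
  proof -
    have "real m + real k = 2 * real p + 1" using mk(1) by (metis of_nat_1 of_nat_add of_nat_mult of_nat_numeral)
    then have rm: "2 * real p - real k + 1 = real m" by simp
    show "?Ky (k + 1) \<mu> = s * sqrt (2 * average_at \<nu> a \<mu> / (average_at \<nu> c \<mu> * (real k + 1)))"
      by (simp add: init \<eta>0_def avg[OF \<mu>])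
    show "?K\<theta> (2*p + 1 - k) \<mu> = (s / (2 * real p - real k + 1) *
          sqrt (2 * (real k + 1) / (average_at \<nu> c \<mu> * average_at \<nu> a \<mu>))) *\<^sub>R average_at \<nu> d \<mu>"
      unfolding rm m_def[symmetric] by (simp add: init \<theta>0_def avg[OF \<mu>])
    show "?Y k \<mu> = s * sqrt (average_at \<nu> c \<mu> * average_at \<nu> a \<mu> / (2 * (real k + 1)))"
      by (simp add: Y_of_def y0_def avg[OF \<mu>])
  qed
  have divisors: "?Kx' (k + 1) \<theta> t \<mu> = SD \<omega> \<nu> (oscillatory_at \<nu> c \<mu>) \<theta> t * ?Ky (k + 1) \<mu>"
    "?Ky' (2*k) \<theta> t \<mu> = SD \<omega> \<nu> (oscillatory_at \<nu> a \<mu>) \<theta> t"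
    "?K\<theta>' (2*p) \<theta> t \<mu> = SD \<omega> \<nu> (oscillatory_at \<nu> d \<mu>) \<theta> t" if \<mu>: "\<mu> \<in> \<Lambda>" for \<mu> \<theta> t
  proof -
    have "SD \<omega> \<nu> (oscillatory_at \<nu> a \<mu>) \<theta> t = Y' 0 ((\<theta>, t *\<^sub>R \<nu>), \<mu>)"
      by (rule SD_eq[OF nr osc(2) \<mu>]) (unfold oscillatory_def, unfold avg(2)[OF \<mu>], simp add: w0 hull_a(2)[OF \<mu>])
    then show "?Ky' (2*k) \<theta> t \<mu> = SD \<omega> \<nu> (oscillatory_at \<nu> a \<mu>) \<theta> t" by simp
    have "SD \<omega> \<nu> (oscillatory_at \<nu> d \<mu>) \<theta> t = T' 0 ((\<theta>, t *\<^sub>R \<nu>), \<mu>)"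
      by (rule SD_eq[OF nr osc(3) \<mu>]) (unfold oscillatory_def, unfold avg(3)[OF \<mu>], simp add: w0 hull_d(2)[OF \<mu>])
    then show "?K\<theta>' (2*p) \<theta> t \<mu> = SD \<omega> \<nu> (oscillatory_at \<nu> d \<mu>) \<theta> t" by simp
    have \<eta>: "\<eta>0 \<mu> \<noteq> 0" using leading_relations(1,3)[OF \<mu>] by auto
    have "SD \<omega> \<nu> (oscillatory_at \<nu> c \<mu>) \<theta> t = (1 / \<eta>0 \<mu>) *\<^sub>R X' 0 ((\<theta>, t *\<^sub>R \<nu>), \<mu>)"
      by (rule SD_eq[OF nr osc_primitive_scaleR[OF osc(1)] \<mu>]) (unfold oscillatory_def, unfold avg(1)[OF \<mu>], use \<eta> in \<open>simp add: w0 hull_c(2)[OF \<mu>]\<close>)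
    then show "?Kx' (k + 1) \<theta> t \<mu> = SD \<omega> \<nu> (oscillatory_at \<nu> c \<mu>) \<theta> t * ?Ky (k + 1) \<mu>" using \<eta> by (simp add: init)
  qed
  show "\<exists>Kx Kx' Ky Ky' K\<theta> K\<theta>' Y.
    (\<forall>i. real_analytic_on (Kx i) \<Lambda> \<and> real_analytic_on (Ky i) \<Lambda> \<and>
         real_analytic_on (K\<theta> i) \<Lambda> \<and> real_analytic_on (Y i) \<Lambda>) \<and>
    (\<forall>i. quasiperiodic_on \<nu> \<Lambda> (Kx' i) \<and> quasiperiodic_on \<nu> \<Lambda> (Ky' i) \<and>
         quasiperiodic_on \<nu> \<Lambda> (K\<theta>' i)) \<and>
    (\<forall>i. \<forall>\<mu>\<in>\<Lambda>. average_at \<nu> (Kx' i) \<mu> = 0 \<and>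
         average_at \<nu> (Ky' i) \<mu> = 0 \<and>
         average_at \<nu> (K\<theta>' i) \<mu> = 0) \<and>
    (let G = invariance_error (X_field k p \<omega> c a d A B)
               (K_map k p n Kx Kx' Ky Ky' K\<theta> K\<theta>') (Y_field k n \<omega> Y)
     in bigO_zero \<Lambda> (n + k) (\<lambda>u \<theta> t \<mu>. fst (G u \<theta> t \<mu>)) \<and>
        bigO_zero \<Lambda> (n + 2*k - 1) (\<lambda>u \<theta> t \<mu>. fst (snd (G u \<theta> t \<mu>))) \<and>
        bigO_zero \<Lambda> (n + 2*p - 1) (\<lambda>u \<theta> t \<mu>. snd (snd (G u \<theta> t \<mu>)))) \<and>
    (\<forall>\<mu>\<in>\<Lambda>.
       Ky (k + 1) \<mu> = s * sqrt (2 * average_at \<nu> a \<mu> / (average_at \<nu> c \<mu> * (real k + 1))) \<and>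
       K\<theta> (2*p + 1 - k) \<mu> =
         (s / (2 * real p - real k + 1) *
          sqrt (2 * (real k + 1) / (average_at \<nu> c \<mu> * average_at \<nu> a \<mu>))) *\<^sub>R average_at \<nu> d \<mu> \<and>
       Y k \<mu> = s * sqrt (average_at \<nu> c \<mu> * average_at \<nu> a \<mu> / (2 * (real k + 1))) \<and>
       (\<forall>\<theta> t.
          Kx' (k + 1) \<theta> t \<mu> = SD \<omega> \<nu> (oscillatory_at \<nu> c \<mu>) \<theta> t * Ky (k + 1) \<mu> \<and>
          Ky' (2*k) \<theta> t \<mu> = SD \<omega> \<nu> (oscillatory_at \<nu> a \<mu>) \<theta> t \<and>
          K\<theta>' (2*p) \<theta> t \<mu> = SD \<omega> \<nu> (oscillatory_at \<nu> d \<mu>) \<theta> t))"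
    by (rule exI[of _ ?Kx], rule exI[of _ ?Kx'], rule exI[of _ ?Ky], rule exI[of _ ?Ky'], rule exI[of _ ?K\<theta>], rule exI[of _ ?K\<theta>'],
        rule exI[of _ ?Y], intro conjI allI ballI error coefficients[THEN conjunct1] coefficients[THEN conjunct2, THEN conjunct1]
        coefficients[THEN conjunct2, THEN conjunct2, THEN conjunct1] coefficients[THEN conjunct2, THEN conjunct2, THEN conjunct2]
        qp[OF osc(1)] qp[OF osc(2)] qp[OF osc(3)] zero[OF osc(1)] zero[OF osc(2)] zero[OF osc(3)] leading divisors)
qed

end
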